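(* Let $f$ be a nonzero modular form of weight $r>0$ for a finite index subgroup $\Gamma$ of $\mathrm{SL}_2(\mathbb Z)$ (setting as in the context), let $\alpha>\alpha_0$, let $x$ be a rational number, and let $\beta(x),\beta^*(x),\beta^{**}(x)$ denote the Hölder exponents at $x$ of any one of the functions $f_\alpha$, $\Re f_\alpha$, $\Im f_\alpha$. Then: (1) If $f$ is cuspidal at $x$ then $\beta(x)=2\alpha-r$; otherwise $\beta(x)=\alpha-r$. (2) If $f$ is a cusp form, $\beta^*(x)=[\alpha-r/2]+\min(1,2\{\alpha-r/2\})$. If $f$ is not a cusp form, then $\beta^*(x)=[\alpha-r]+\min(1,2\{\alpha-r\}+r)$ when $f$ is cuspidal at $x$ and $\alpha-r\notin\mathbb Z$, and $\beta^*(x)=\alpha-r$ when $f$ is not cuspidal at $x$ or $\alpha-r\in\mathbb Z$. (3) In every case $\beta^{**}(x)=\alpha-\alpha_0$. (4) Suppose $0<\alpha-\alpha_0\le1$. If $f$ is not cuspidal at $x$, then $f_\alpha$ (resp. $\Re f_\alpha$, $\Im f_\alpha$) is not differentiable at $x$. If $f$ is cuspidal at $x$, then $f_\alpha$ (resp. $\Re f_\alpha$, $\Im f_\alpha$) is differentiable at $x$ if and only if $\alpha>(r+1)/2$, and in that case $$f_\alpha'(x)=\frac{(2\pi)^\alpha}{(im)^\alpha\Gamma(\alpha)}\int_{(x)}(z-x)^{\alpha-1}f'(z)\,dz,$$ where $(x)$ denotes the vertical ray from $x$ to $i\infty$ and $m=m_\infty$.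
   Context: Let $\Gamma$ be a subgroup of finite index of $\mathrm{SL}_2(\mathbb Z)$, $r>0$ real, and $\{\mu_\gamma\}_{\gamma\in\Gamma}$ a multiplier system of unimodular complex numbers. $f$ is a nonzero modular form of weight $r$: holomorphic on $\mathbb H$, $f(\gamma z)=\mu_\gamma(cz+d)^rf(z)$ for all $\gamma=\begin{pmatrix}a&b\\c&d\end{pmatrix}\in\Gamma$ ($\gamma z=(az+b)/(cz+d)$), with at most polynomial growth as $\Im z\to0^+$. Powers and logarithms use the branch $-\pi<\arg z\le\pi$. For $\gamma\in\mathrm{GL}_2^+(\mathbb R)$, $f^\gamma(z)=(\det\gamma)^{r/2}f(\gamma z)/(cz+d)^r$. Cusps are elements of $\mathbb Q\cup\{\infty\}$; $m_{\mathfrak a}$ is the width of $\mathfrak a$ (order of the stabilizer of $\mathfrak a$ in $\mathrm{SL}_2(\mathbb Z)$ modulo $\Gamma$). A scaling matrix is $\sigma_{\mathfrak a}=\gamma\eta$ with $\gamma\in\mathrm{SL}_2(\mathbb Z)$, $\gamma(\infty)=\mathfrak a$, bottom row $(c,d)$ with $c<0$ or ($c=0,d=1$), $\eta=\mathrm{diag}(\sqrt{m_{\mathfrak a}},1/\sqrt{m_{\mathfrak a}})$; then $f^{\sigma_{\mathfrak a}}(z)=\sum_{n\ge0}a_n^{\mathfrak a}e^{2\pi i(n+\kappa_{\mathfrak a})z}$ with $0\le\kappa_{\mathfrak a}<1$, assumed rational. $f$ is cuspidal at $\mathfrak a$ if $\kappa_{\mathfrak a}>0$ or $a_0^{\mathfrak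 a}=0$; $f$ is a cusp form if cuspidal at every cusp. With $m=m_\infty$, $\kappa=\kappa_\infty$, $f(mz)=\sum_{n\ge0}a_ne^{2\pi i(n+\kappa)z}$, the fractional integral is $f_\alpha(mx)=\sum_{n+\kappa>0}a_n(n+\kappa)^{-\alpha}e^{2\pi i(n+\kappa)x}$ (a continuous function when $\alpha>\alpha_0$). $\alpha_0=r/2$ if $f$ is a cusp form and $\alpha_0=r$ otherwise. $[s]$ and $\{s\}$ denote integer and fractional parts. Hölder exponents of a continuous function $g$: for $s\ge0$, $g\in\mathcal C^s(x_0)$ if there is a polynomial $P$ of degree $<s$ with $|g(x)-P(x-x_0)|\le C|x-x_0|^s$ as $x\to x_0$; for $0\le s\le1$, $\Lambda^s(x_0)=\mathcal C^s(x_0)$ and $\Lambda^s(\Omega)$ is the set of continuous functions satisfying a uniform $s$-Hölder condition on $\Omega$; for integer $k\ge0$ and $0\le s\le1$, $g\in\mathcal C^{k,s}(x_0)$ if $g^{(k)}$ exists on an interval containing $x_0$ and $g^{(k)}\in\Lambda^s(x_0)$, and $g\in\mathcal C^{k,s}(I)$ ($I$ open) if $g^{(k)}$ exists on $I$ and lies in $\Lambda^s(K)$ for every compact $K\subset I$. Then $\beta(x_0)=\sup\{s:g\in\mathcal C^s(x_0)\}$, $\beta^*(x_0)=\sup\{k+s:g\in\mathcal C^{k,s}(x_0)\}$, and $\beta^{**}(x_0)=\lim_{I\to\{x_0\}}\sup\{k+s:g\in\mathcal C^{k,s}(I)\}$, the limit over a nested sequence of open intervals with intersection $\{x_0\}$.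 *)

theory Defs
  imports "HOL-Analysis.Analysis"
begin

text \<open>Integer 2x2 matrices (a,b,c,d) = [[a,b],[c,d]].\<close>
type_synonym imat = "int \<times> int \<times> int \<times> int"
text \<open>Real 2x2 matrices (a,b,c,d) = [[a,b],[c,d]].\<close>
type_synonym rmat = "real \<times> real \<times> real \<times> real"

definition SL2Z :: "imat set" where
  "SL2Z = {(a,b,c,d). a*d - b*c = 1}"

fun imat_mult :: "imat \<Rightarrow> imat \<Rightarrow> imat" where
  "imat_mult (a,b,c,d) (a',b',c',d') = (a*a'+b*c', a*b'+b*d', c*a'+d*c', c*b'+d*d')"

fun imat_inv :: "imat \<Rightarrow> imat" where
  "imat_inv (a,b,c,d) = (d, -b, -c, a)"

fun imat_neg :: "imat \<Rightarrow> imat" where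
  "imat_neg (a,b,c,d) = (-a, -b, -c, -d)"

definition finite_index_subgroup :: "imat set \<Rightarrow> bool" where
  "finite_index_subgroup G \<longleftrightarrow>
     G \<subseteq> SL2Z \<and> (1,0,0,1) \<in> G \<and>
     (\<forall>g\<in>G. \<forall>h\<in>G. imat_mult g h \<in> G) \<and> (\<forall>g\<in>G. imat_inv g \<in> G) \<and>
     finite ((\<lambda>g. imat_mult g ` G) ` SL2Z)"

definition multiplier_system :: "imat set \<Rightarrow> (imat \<Rightarrow> complex) \<Rightarrow> bool" where
  "multiplier_system G \<mu> \<longleftrightarrow> (\<forall>g\<in>G. norm (\<mu> g) = 1)"

fun mobius :: "imat \<Rightarrow> complex \<Rightarrow> complex" where
  "mobius (a,b,c,d) z = (of_int a * z + of_int b) / (of_int c * z + of_int d)"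

text \<open>Powers use the principal branch (Isabelle's complex powr is based on Ln,
  with argument in (-pi, pi]).\<close>
definition modular_form :: "imat set \<Rightarrow> (imat \<Rightarrow> complex) \<Rightarrow> real \<Rightarrow> (complex \<Rightarrow> complex) \<Rightarrow> bool" where
  "modular_form G \<mu> r f \<longleftrightarrow>
     f holomorphic_on {z. 0 < Im z} \<and>
     (\<forall>g\<in>G. \<forall>z. 0 < Im z \<longrightarrow>
        (case g of (a,b,c,d) \<Rightarrow>
          f (mobius g z) = \<mu> g * (of_int c * z + of_int d) powr (of_real r) * f z)) \<and>
     (\<exists>C N. \<forall>z. 0 < Im z \<and> Im z \<le> 1 \<longrightarrow> norm (f z) \<le> C * Im z powr (- N))"

fun slash :: "real \<Rightarrow> (complex \<Rightarrow> complex) \<Rightarrow> rmat \<Rightarrow> complex \<Rightarrow> complex" where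
  "slash r f (a,b,c,d) z =
     of_real ((a*d - b*c) powr (r/2)) *
     f ((of_real a * z + of_real b) / (of_real c * z + of_real d)) /
     (of_real c * z + of_real d) powr (of_real r)"

text \<open>Cusps: elements of Q \<union> {\<infinity>}, represented as rat option (None = \<infinity>).
  cusp_image g = g(\<infinity>).\<close>
fun cusp_image :: "imat \<Rightarrow> rat option" where
  "cusp_image (a,b,c,d) = (if c = 0 then None else Some (Fract a c))"

fun imat_pow_T :: "nat \<Rightarrow> imat" where
  "imat_pow_T m = (1, int m, 0, 1)"

definition cusp_width :: "imat set \<Rightarrow> imat \<Rightarrow> nat" where
  "cusp_width G g = (LEAST m. 0 < m \<and>
      (imat_mult g (imat_mult (imat_pow_T m) (imat_inv g)) \<in> G \<or>
       imat_neg (imat_mult g (imat_mult (imat_pow_T m) (imat_inv g))) \<in> G))"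

fun rmat_of :: "imat \<Rightarrow> rmat" where
  "rmat_of (a,b,c,d) = (real_of_int a, real_of_int b, real_of_int c, real_of_int d)"

fun rmat_mult :: "rmat \<Rightarrow> rmat \<Rightarrow> rmat" where
  "rmat_mult (a,b,c,d) (a',b',c',d') = (a*a'+b*c', a*b'+b*d', c*a'+d*c', c*b'+d*d')"

definition scaling_matrices :: "imat set \<Rightarrow> rat option \<Rightarrow> rmat set" where
  "scaling_matrices G cp = {rmat_mult (rmat_of g)
        (sqrt (real (cusp_width G g)), 0, 0, 1 / sqrt (real (cusp_width G g))) | g.
      g \<in> SL2Z \<and> cusp_image g = cp \<and>
      (case g of (a,b,c,d) \<Rightarrow> c < 0 \<or> (c = 0 \<and> d = 1))}"

definition fourier_exp :: "(complex \<Rightarrow> complex) \<Rightarrow> real \<Rightarrow> (nat \<Rightarrow> complex) \<Rightarrow> bool" where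
  "fourier_exp g \<kappa> a \<longleftrightarrow> 0 \<le> \<kappa> \<and> \<kappa> < 1 \<and>
     (\<forall>z. 0 < Im z \<longrightarrow>
        (\<lambda>n. a n * exp (2 * of_real pi * \<i> * (of_nat n + of_real \<kappa>) * z)) sums g z)"

definition cuspidal_at :: "imat set \<Rightarrow> real \<Rightarrow> (complex \<Rightarrow> complex) \<Rightarrow> rat option \<Rightarrow> bool" where
  "cuspidal_at G r f cp \<longleftrightarrow>
     (\<forall>\<sigma>\<in>scaling_matrices G cp. \<forall>\<kappa> a. fourier_exp (slash r f \<sigma>) \<kappa> a \<longrightarrow> (0 < \<kappa> \<or> a 0 = 0))"

definition cusp_form :: "imat set \<Rightarrow> real \<Rightarrow> (complex \<Rightarrow> complex) \<Rightarrow> bool" where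
  "cusp_form G r f \<longleftrightarrow> (\<forall>cp. cuspidal_at G r f cp)"

definition rational_kappas :: "imat set \<Rightarrow> real \<Rightarrow> (complex \<Rightarrow> complex) \<Rightarrow> bool" where
  "rational_kappas G r f \<longleftrightarrow>
     (\<forall>cp. \<forall>\<sigma>\<in>scaling_matrices G cp. \<forall>\<kappa> a. fourier_exp (slash r f \<sigma>) \<kappa> a \<longrightarrow> \<kappa> \<in> \<rat>)"

definition alpha0 :: "imat set \<Rightarrow> real \<Rightarrow> (complex \<Rightarrow> complex) \<Rightarrow> real" where
  "alpha0 G r f = (if cusp_form G r f then r / 2 else r)"

text \<open>Fractional integral: with f(mz) = \<Sum> a_n e^{2\<pi>i(n+\<kappa>)z},
  f_alpha(m x) = \<Sum>_{n+\<kappa>>0} a_n (n+\<kappa>)^{-alpha} e^{2\<pi>i(n+\<kappa>)x}, i.e.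
  f_alpha(t) is the series evaluated at t/m.\<close>
definition frac_integral :: "(nat \<Rightarrow> complex) \<Rightarrow> real \<Rightarrow> nat \<Rightarrow> real \<Rightarrow> real \<Rightarrow> complex" where
  "frac_integral a \<kappa> m \<alpha> t =
     (\<Sum>n. if 0 < real n + \<kappa>
           then a n * of_real ((real n + \<kappa>) powr (- \<alpha>)) *
                exp (2 * of_real pi * \<i> * of_real (real n + \<kappa>) * of_real (t / real m))
           else 0)"

definition holder_C :: "real \<Rightarrow> (real \<Rightarrow> 'a::real_normed_vector) \<Rightarrow> real \<Rightarrow> bool" where
  "holder_C s g x0 \<longleftrightarrow>
     (\<exists>c::nat \<Rightarrow> 'a. \<exists>C. \<exists>\<delta>>0. \<forall>x. 0 < \<bar>x - x0\<bar> \<and> \<bar>x - x0\<bar> < \<delta> \<longrightarrow>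
        norm (g x - (\<Sum>k\<in>{k. real k < s}. (x - x0) ^ k *\<^sub>R c k)) \<le> C * \<bar>x - x0\<bar> powr s)"

definition Lambda_on :: "real \<Rightarrow> (real \<Rightarrow> 'a::real_normed_vector) \<Rightarrow> real set \<Rightarrow> bool" where
  "Lambda_on s g \<Omega> \<longleftrightarrow> continuous_on \<Omega> g \<and>
     (\<exists>C. \<forall>x\<in>\<Omega>. \<forall>y\<in>\<Omega>. norm (g x - g y) \<le> C * \<bar>x - y\<bar> powr s)"

definition derivs_on :: "nat \<Rightarrow> (real \<Rightarrow> 'a::real_normed_vector) \<Rightarrow> (nat \<Rightarrow> real \<Rightarrow> 'a) \<Rightarrow> real set \<Rightarrow> bool" where
  "derivs_on k g D I \<longleftrightarrow> D 0 = g \<and>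
     (\<forall>j<k. \<forall>x\<in>I. (D j has_vector_derivative D (Suc j) x) (at x))"

definition Ck_at :: "nat \<Rightarrow> real \<Rightarrow> (real \<Rightarrow> 'a::real_normed_vector) \<Rightarrow> real \<Rightarrow> bool" where
  "Ck_at k s g x0 \<longleftrightarrow> 0 \<le> s \<and> s \<le> 1 \<and>
     (\<exists>a b D. a < x0 \<and> x0 < b \<and> derivs_on k g D {a<..<b} \<and> holder_C s (D k) x0)"

definition Ck_on :: "nat \<Rightarrow> real \<Rightarrow> (real \<Rightarrow> 'a::real_normed_vector) \<Rightarrow> real set \<Rightarrow> bool" where
  "Ck_on k s g I \<longleftrightarrow> 0 \<le> s \<and> s \<le> 1 \<and>
     (\<exists>D. derivs_on k g D I \<and> (\<forall>K. compact K \<and> K \<subseteq> I \<longrightarrow> Lambda_on s (D k) K))"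

definition holder_beta :: "(real \<Rightarrow> 'a::real_normed_vector) \<Rightarrow> real \<Rightarrow> ereal" where
  "holder_beta g x0 = Sup (ereal ` {s. 0 \<le> s \<and> holder_C s g x0})"

definition holder_beta_star :: "(real \<Rightarrow> 'a::real_normed_vector) \<Rightarrow> real \<Rightarrow> ereal" where
  "holder_beta_star g x0 = Sup {ereal (real k + s) | k s. Ck_at k s g x0}"

definition holder_reg_on :: "(real \<Rightarrow> 'a::real_normed_vector) \<Rightarrow> real set \<Rightarrow> ereal" where
  "holder_reg_on g I = Sup {ereal (real k + s) | k s. Ck_on k s g I}"

definition has_holder_beta_2star :: "(real \<Rightarrow> 'a::real_normed_vector) \<Rightarrow> real \<Rightarrow> ereal \<Rightarrow> bool" where
  "has_holder_beta_2star g x0 v \<longleftrightarrow>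
     (\<forall>a b :: nat \<Rightarrow> real.
        (\<forall>n. {a (Suc n)<..<b (Suc n)} \<subseteq> {a n<..<b n}) \<and> (\<Inter>n. {a n<..<b n}) = {x0} \<longrightarrow>
        ((\<lambda>n. holder_reg_on g {a n<..<b n}) \<longlongrightarrow> v) sequentially)"

definition holder_exponents_are :: "(real \<Rightarrow> 'a::real_normed_vector) \<Rightarrow> real \<Rightarrow> real \<Rightarrow> real \<Rightarrow> real \<Rightarrow> bool" where
  "holder_exponents_are g x0 b b1 b2 \<longleftrightarrow>
     holder_beta g x0 = ereal b \<and> holder_beta_star g x0 = ereal b1 \<and>
     has_holder_beta_2star g x0 (ereal b2)"

end

theory Submission
  imports Defs "HOL-Complex_Analysis.Complex_Analysis"
begin

text \<open>
  The Cauchy-Gamma integral over vertical rays recovers \<open>f\<close> from its fractional integral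
  \<open>f\<^sub>\<alpha>\<close> and conversely. Write \<open>y = Im z\<close>. A Peano expansion \<open>P(t) + o(\<bar>t\<bar>\<^sup>s)\<close> of \<open>f\<^sub>\<alpha>\<close> (or of its real or
  imaginary part) at \<open>x\<close> therefore forces \<open>f (x + z)\<close> to be \<open>o(\<bar>z\<bar>\<^sup>s y powr (-\<alpha>))\<close> up to smaller terms, and
  a bound \<open>\<bar>z\<bar> powr p * y powr (-q)\<close> for \<open>f (x + z)\<close> gives, by repeated integration, a Taylor expansion of order
  \<open>p + \<alpha> - q\<close> of \<open>f\<^sub>\<alpha>\<close> at \<open>x\<close>.

  The size of \<open>f\<close> near the real axis is read off the \<open>\<Gamma>\<close>-invariant function \<open>h z = y powr (r/2) * \<bar>f z\<bar>\<close>,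
  which has only finitely many translates under \<open>SL\<^sub>2(\<int>)\<close>. Upper bounds yield the regularity of
  \<open>f\<^sub>\<alpha>\<close>. It cannot be larger because \<open>f\<close> attains these bounds: on the vertical ray above a cusp where it is
  not cuspidal, on a horocycle at a cusp where it is cuspidal, and on vertical rays above a dense set of
  real points, which limits the regularity on open intervals.
\<close>

subsection \<open>Pointwise Hoelder regularity\<close>

text \<open>The growth of \<open>f\<close> controls partial sums of its coefficients rather than
  absolute sums, so continuity and derivatives of \<open>f\<^sub>\<alpha>\<close> on the axis itself
  come from summation by parts. Real and imaginary parts involve the conjugate series; it continues
  to the lower half plane, where Cauchy integrals around a point above the axis do not see it. Peano
  remainders are little-o because non-differentiability must also follow when the exponent is
  exactly 1. At a cuspidal point every \<open>q \<ge> \<alpha>0\<close> is admissible with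
  \<open>p = 2 * q - r\<close>; the resulting order \<open>q + \<alpha> - r\<close> tends to
  \<open>2 * \<alpha> - r\<close> as \<open>q\<close> tends to \<open>\<alpha>\<close>. Integral
  orders would bring in logarithms; they are avoided by a generic choice of \<open>q\<close>, which
  is harmless because exponents are suprema. Passing to \<open>h\<close> removes the multiplier and
  the branch of the power. The expansions at the cusps must then be rebuilt from a function whose
  modulus alone is known to be periodic. Their existence matters: \<open>cuspidal_at\<close>
  quantifies over all expansions and would hold vacuously without one.\<close>

lemma has_integral_Ioi_iff:
  fixes f :: "real \<Rightarrow> 'a::banach"
  shows "(f has_integral I) {a<..} \<longleftrightarrow> (f has_integral I) {a..}"
  by (rule has_integral_spike_set_eq) (auto intro: negligible_subset[of "{a}"])

text \<open>The exact value is a Beta integral times \<open>y powr (p - j)\<close>, and only the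
  power matters. Below \<open>u = y\<close> the factor \<open>y + u\<close> is replaced by
  \<open>y\<close>, above it by \<open>u\<close>, which leaves two pure powers.\<close>

lemma kernel_integral_bound:
  fixes p j y :: real
  assumes p: "0 < p" "p < j" and y: "0 < y"
  shows "(\<lambda>u. u powr (p - 1) * (y + u) powr (- j)) integrable_on {0<..}"
    and "integral {0<..} (\<lambda>u. u powr (p - 1) * (y + u) powr (- j)) \<le> (1 / p + 1 / (j - p)) * y powr (p - j)"
proof -
  define M where "M u = (if u \<le> y then y powr (- j) * u powr (p - 1) else u powr (p - 1 - j))" for u
  have 1: "((\<lambda>u. u powr (p - 1)) has_integral (y powr p / p)) {0..y}"
    using has_integral_powr_from_0[of "p - 1" y] p y by simp
  have 2: "((\<lambda>u. u powr (p - 1 - j)) has_integral (- (y powr (p - j)) / (p - j))) {y..}"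
    using has_integral_powr_to_inf[of "p - 1 - j" y] p y by (simp add: algebra_simps)
  have m1: "(M has_integral (y powr (- j) * (y powr p / p))) {0..y}"
    using has_integral_mult_right[OF 1, of "y powr (- j)"]
    by (rule has_integral_eq[rotated]) (auto simp: M_def)
  have m2: "(M has_integral (- (y powr (p - j)) / (p - j))) {y..}"
    using 2 by (rule has_integral_spike_finite[of "{y}", rotated 2]) (auto simp: M_def)
  have "(M has_integral (y powr (- j) * (y powr p / p) + - (y powr (p - j)) / (p - j))) ({0..y} \<union> {y..})"
    by (rule has_integral_Un[OF m1 m2]) (auto intro: negligible_subset[of "{y}"])
  moreover have "{0..y} \<union> {y..} = {0..}" using y by auto
  moreover have "y powr (- j) * (y powr p / p) + - (y powr (p - j)) / (p - j) = (1 / p + 1 / (j - p)) * y powr (p - j)"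
  proof -
    have a: "y powr (- j) * (y powr p / p) = y powr (p - j) / p"
      by (simp add: powr_add[symmetric])
    have b: "- (y powr (p - j)) / (p - j) = y powr (p - j) / (j - p)"
      using p by (simp add: minus_divide_left[symmetric] minus_divide_right)
    show ?thesis unfolding a b by (simp add: algebra_simps)
  qed
  ultimately have M0: "(M has_integral ((1 / p + 1 / (j - p)) * y powr (p - j))) {0..}" by simp
  then have M: "(M has_integral ((1 / p + 1 / (j - p)) * y powr (p - j))) {0<..}"
    by (simp add: has_integral_Ioi_iff)
  have le: "u powr (p - 1) * (y + u) powr (- j) \<le> M u" if "u \<in> {0<..}" for u
  proof (cases "u \<le> y")
    case True
    have "(y + u) powr (- j) \<le> y powr (- j)"
      using that y p by (intro powr_mono2') auto
    then have "u powr (p - 1) * (y + u) powr (- j) \<le> u powr (p - 1) * y powr (- j)"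
      by (intro mult_left_mono) auto
    then show ?thesis using True by (simp add: M_def mult.commute)
  next
    case False
    have "(y + u) powr (- j) \<le> u powr (- j)"
      using that y p by (intro powr_mono2') auto
    then have "u powr (p - 1) * (y + u) powr (- j) \<le> u powr (p - 1) * u powr (- j)"
      by (intro mult_left_mono) auto
    also have "\<dots> = u powr (p - 1 - j)" by (simp add: powr_add[symmetric])
    finally show ?thesis using False by (simp add: M_def)
  qed
  show int: "(\<lambda>u. u powr (p - 1) * (y + u) powr (- j)) integrable_on {0<..}"
  proof (rule measurable_bounded_by_integrable_imp_integrable_real[of _ _ M])
    show "(\<lambda>u. u powr (p - 1) * (y + u) powr (- j)) \<in> borel_measurable (lebesgue_on {0<..})"
      using y by (intro continuous_imp_measurable_on_sets_lebesgue continuous_intros) auto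
  qed (use M le in auto)
  show "integral {0<..} (\<lambda>u. u powr (p - 1) * (y + u) powr (- j)) \<le> (1 / p + 1 / (j - p)) * y powr (p - j)"
    using integral_le[OF int has_integral_integrable[OF M]] le integral_unique[OF M] by auto
qed

text \<open>The substitution \<open>t = l * u\<close> is made in the Lebesgue integral, to which the
  nonnegative integrand transfers.\<close>

lemma Gamma_integral_scaled:
  fixes p l :: real
  assumes p: "0 < p" and l: "0 < l"
  shows "((\<lambda>u. u powr (p - 1) * exp (- (l * u))) has_integral (Gamma p * l powr (- p))) {0<..}"
proof -
  define f where "f t = indicator {0<..} t *\<^sub>R (t powr (p - 1) * exp (- t))" for t :: real
  have "((\<lambda>t. t powr (p - 1) / exp t) has_integral Gamma p) {0..}"
    by (rule Gamma_integral_real[OF p])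
  then have "((\<lambda>t. t powr (p - 1) * exp (- t)) has_integral Gamma p) {0..}"
    by (simp add: exp_minus divide_inverse)
  then have hi: "((\<lambda>t. t powr (p - 1) * exp (- t)) has_integral Gamma p) {0<..}"
    by (simp add: has_integral_Ioi_iff)
  then have "set_integrable lebesgue {0<..} (\<lambda>t. t powr (p - 1) * exp (- t))"
    by (intro nonnegative_absolutely_integrable_1) auto
  moreover from this hi have "set_lebesgue_integral lebesgue {0<..} (\<lambda>t. t powr (p - 1) * exp (- t)) = Gamma p"
    by (simp add: integral_unique set_lebesgue_integral_eq_integral(2))
  ultimately have "has_bochner_integral lebesgue f (Gamma p)"
    unfolding f_def has_bochner_integral_iff set_integrable_def set_lebesgue_integral_def by simp
  moreover have fm: "f \<in> borel_measurable lborel"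
    unfolding f_def by measurable
  ultimately have "has_bochner_integral lborel f (Gamma p)"
    by (simp add: has_bochner_integral_iff integrable_completion integral_completion)
  then have "has_bochner_integral lborel (\<lambda>x. f (0 + l * x)) (Gamma p /\<^sub>R \<bar>l\<bar>)"
    using l by (subst lborel_has_bochner_integral_real_affine_iff[of l, symmetric]) auto
  then have "((\<lambda>x. f (l * x)) has_integral (Gamma p / l)) UNIV"
    using l has_integral_integral_lborel[of "\<lambda>x. f (l * x)"]
    by (simp add: has_bochner_integral_iff divide_inverse mult.commute)
  from has_integral_mult_right[OF this, of "l powr (1 - p)"]
  have "((\<lambda>x. l powr (1 - p) * f (l * x)) has_integral (l powr (1 - p) * (Gamma p / l))) UNIV" .
  moreover have "l powr (1 - p) * f (l * x) = (if x \<in> {0<..} then x powr (p - 1) * exp (- (l * x)) else 0)" for x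
    using l by (auto simp: f_def indicator_def powr_mult zero_less_mult_iff powr_add[symmetric] mult.assoc[symmetric])
  moreover have "l powr (1 - p) * (Gamma p / l) = Gamma p * l powr (- p)"
    using l by (simp add: powr_diff powr_minus divide_inverse)
  ultimately show ?thesis
    by (simp only: has_integral_restrict_UNIV)
qed

text \<open>Unlike \<open>holder_C\<close>, this demands a little-o remainder and does not restrict the degree of the polynomial.\<close>

definition peano :: "real \<Rightarrow> (real \<Rightarrow> 'a::real_normed_vector) \<Rightarrow> real \<Rightarrow> bool" where
  "peano s g x \<longleftrightarrow> (\<exists>n c. \<forall>\<epsilon>>0. \<exists>\<delta>>0. \<forall>t. 0 < \<bar>t - x\<bar> \<and> \<bar>t - x\<bar> < \<delta> \<longrightarrow>
     norm (g t - (\<Sum>k<n. (t - x) ^ k *\<^sub>R c k)) \<le> \<epsilon> * \<bar>t - x\<bar> powr s)"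

lemma Collect_real_less: "{k. real k < s} = {..<nat \<lceil>s\<rceil>}"
  by (auto simp: zless_nat_conj less_ceiling_iff) (simp_all add: less_ceiling_iff zless_nat_eq_int_zless)

lemma powr_less_eps:
  fixes d \<epsilon> :: real
  assumes "0 < d" "0 < \<epsilon>"
  shows "\<exists>\<delta>>0. \<forall>u. 0 < u \<and> u < \<delta> \<longrightarrow> u powr d \<le> \<epsilon>"
proof (intro exI[of _ "\<epsilon> powr (1 / d)"] conjI allI impI)
  show "0 < \<epsilon> powr (1 / d)" using assms by simp
  fix u assume "0 < u \<and> u < \<epsilon> powr (1 / d)"
  then have "u powr d \<le> (\<epsilon> powr (1 / d)) powr d"
    using assms by (intro powr_mono2) auto
  then show "u powr d \<le> \<epsilon>" using assms by (simp add: powr_powr)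
qed

text \<open>The spare power \<open>s' - s\<close> makes the bounded remainder a little-o. As
  exponents are suprema nothing is lost: where no Peano expansion of order \<open>s\<close> exists,
  the Hoelder exponent is at most \<open>s\<close>.\<close>

lemma holder_C_imp_peano:
  assumes h: "holder_C s' g x" and s: "s < s'"
  shows "peano s g x"
proof -
  obtain c C \<delta> where d: "0 < \<delta>" and 
    b: "\<And>t. 0 < \<bar>t - x\<bar> \<Longrightarrow> \<bar>t - x\<bar> < \<delta> \<Longrightarrow>
        norm (g t - (\<Sum>k<nat \<lceil>s'\<rceil>. (t - x) ^ k *\<^sub>R c k)) \<le> C * \<bar>t - x\<bar> powr s'"
    using h unfolding holder_C_def Collect_real_less by blast
  show ?thesis unfolding peano_def
  proof (rule exI, rule exI, intro allI impI)
    fix \<epsilon> :: real assume e: "0 < \<epsilon>"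
    obtain \<delta>' where d': "0 < \<delta>'" and b': "\<And>u. 0 < u \<Longrightarrow> u < \<delta>' \<Longrightarrow> u powr (s' - s) \<le> \<epsilon> / (\<bar>C\<bar> + 1)"
      using powr_less_eps[of "s' - s" "\<epsilon> / (\<bar>C\<bar> + 1)"] s e by auto
    have "norm (g t - (\<Sum>k<nat \<lceil>s'\<rceil>. (t - x) ^ k *\<^sub>R c k)) \<le> \<epsilon> * \<bar>t - x\<bar> powr s"
      if t: "0 < \<bar>t - x\<bar>" "\<bar>t - x\<bar> < min \<delta> \<delta>'" for t
    proof -
      have "norm (g t - (\<Sum>k<nat \<lceil>s'\<rceil>. (t - x) ^ k *\<^sub>R c k)) \<le> C * \<bar>t - x\<bar> powr s'"
        using b t by auto
      also have "\<dots> \<le> (\<bar>C\<bar> + 1) * \<bar>t - x\<bar> powr s'"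
        by (intro mult_right_mono) auto
      also have "\<dots> = ((\<bar>C\<bar> + 1) * \<bar>t - x\<bar> powr (s' - s)) * \<bar>t - x\<bar> powr s"
        by (simp add: powr_add[symmetric])
      also have "\<dots> \<le> \<epsilon> * \<bar>t - x\<bar> powr s"
        using b'[of "\<bar>t - x\<bar>"] t by (intro mult_right_mono) (auto simp: field_simps)
      finally show ?thesis .
    qed
    then show "\<exists>\<delta>>0. \<forall>t. 0 < \<bar>t - x\<bar> \<and> \<bar>t - x\<bar> < \<delta> \<longrightarrow>
       norm (g t - (\<Sum>k<nat \<lceil>s'\<rceil>. (t - x) ^ k *\<^sub>R c k)) \<le> \<epsilon> * \<bar>t - x\<bar> powr s"
      using d d' by (intro exI[of _ "min \<delta> \<delta>'"]) auto
  qed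
qed

lemma peano_mono:
  assumes h: "peano s' g x" and s: "s \<le> s'"
  shows "peano s g x"
proof -
  obtain n c where b: "\<And>\<epsilon>. 0 < \<epsilon> \<Longrightarrow> \<exists>\<delta>>0. \<forall>t. 0 < \<bar>t - x\<bar> \<and> \<bar>t - x\<bar> < \<delta> \<longrightarrow>
     norm (g t - (\<Sum>k<n. (t - x) ^ k *\<^sub>R c k)) \<le> \<epsilon> * \<bar>t - x\<bar> powr s'"
    using h unfolding peano_def by blast
  show ?thesis unfolding peano_def
  proof (rule exI, rule exI, intro allI impI)
    fix \<epsilon> :: real assume e: "0 < \<epsilon>"
    obtain \<delta> where d: "0 < \<delta>" and d2: "\<And>t. 0 < \<bar>t - x\<bar> \<Longrightarrow> \<bar>t - x\<bar> < \<delta> \<Longrightarrow>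
       norm (g t - (\<Sum>k<n. (t - x) ^ k *\<^sub>R c k)) \<le> \<epsilon> * \<bar>t - x\<bar> powr s'"
      using b[OF e] by blast
    have "norm (g t - (\<Sum>k<n. (t - x) ^ k *\<^sub>R c k)) \<le> \<epsilon> * \<bar>t - x\<bar> powr s"
      if "0 < \<bar>t - x\<bar>" "\<bar>t - x\<bar> < min \<delta> 1" for t
    proof -
      have "norm (g t - (\<Sum>k<n. (t - x) ^ k *\<^sub>R c k)) \<le> \<epsilon> * \<bar>t - x\<bar> powr s'"
        using that by (intro d2) auto
      also have "\<dots> \<le> \<epsilon> * \<bar>t - x\<bar> powr s"
        using that e s by (intro mult_left_mono powr_mono') auto
      finally show ?thesis .
    qed
    then show "\<exists>\<delta>>0. \<forall>t. 0 < \<bar>t - x\<bar> \<and> \<bar>t - x\<bar> < \<delta> \<longrightarrow>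
       norm (g t - (\<Sum>k<n. (t - x) ^ k *\<^sub>R c k)) \<le> \<epsilon> * \<bar>t - x\<bar> powr s"
      using d by (intro exI[of _ "min \<delta> 1"]) auto
  qed
qed

lemma peano_linear:
  assumes J: "bounded_linear J" and h: "peano s g x"
  shows "peano s (\<lambda>t. J (g t)) x"
proof -
  interpret J: bounded_linear J by (rule J)
  obtain n c where b: "\<And>\<epsilon>. 0 < \<epsilon> \<Longrightarrow> \<exists>\<delta>>0. \<forall>t. 0 < \<bar>t - x\<bar> \<and> \<bar>t - x\<bar> < \<delta> \<longrightarrow>
     norm (g t - (\<Sum>k<n. (t - x) ^ k *\<^sub>R c k)) \<le> \<epsilon> * \<bar>t - x\<bar> powr s"
    using h unfolding peano_def by blast
  obtain K where K: "0 < K" "\<And>v. norm (J v) \<le> norm v * K" using J.pos_bounded by blast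
  show ?thesis unfolding peano_def
  proof (intro exI[of _ n] exI[of _ "\<lambda>k. J (c k)"] allI impI)
    fix \<epsilon> :: real assume e: "0 < \<epsilon>"
    obtain \<delta> where d: "0 < \<delta>" and d2: "\<And>t. 0 < \<bar>t - x\<bar> \<Longrightarrow> \<bar>t - x\<bar> < \<delta> \<Longrightarrow>
       norm (g t - (\<Sum>k<n. (t - x) ^ k *\<^sub>R c k)) \<le> (\<epsilon> / K) * \<bar>t - x\<bar> powr s"
      using b[of "\<epsilon> / K"] e K by (meson divide_pos_pos)
    have "norm (J (g t) - (\<Sum>k<n. (t - x) ^ k *\<^sub>R J (c k))) \<le> \<epsilon> * \<bar>t - x\<bar> powr s"
      if "0 < \<bar>t - x\<bar>" "\<bar>t - x\<bar> < \<delta>" for t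
    proof -
      have "norm (J (g t) - (\<Sum>k<n. (t - x) ^ k *\<^sub>R J (c k))) = norm (J (g t - (\<Sum>k<n. (t - x) ^ k *\<^sub>R c k)))"
        by (simp add: J.diff J.sum J.scaleR)
      also have "\<dots> \<le> (\<epsilon> / K) * \<bar>t - x\<bar> powr s * K"
        by (rule order_trans[OF K(2) mult_right_mono[OF d2[OF that]]]) (use K in auto)
      finally show ?thesis using K by simp
    qed
    then show "\<exists>\<delta>>0. \<forall>t. 0 < \<bar>t - x\<bar> \<and> \<bar>t - x\<bar> < \<delta> \<longrightarrow>
       norm (J (g t) - (\<Sum>k<n. (t - x) ^ k *\<^sub>R J (c k))) \<le> \<epsilon> * \<bar>t - x\<bar> powr s"
      using d by blast
  qed
qed

lemma holder_C_linear:
  assumes J: "bounded_linear J" and h: "holder_C s g x"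
  shows "holder_C s (\<lambda>t. J (g t)) x"
proof -
  interpret J: bounded_linear J by (rule J)
  obtain c C \<delta> where d: "0 < \<delta>" and 
    b: "\<And>t. 0 < \<bar>t - x\<bar> \<Longrightarrow> \<bar>t - x\<bar> < \<delta> \<Longrightarrow>
        norm (g t - (\<Sum>k<nat \<lceil>s\<rceil>. (t - x) ^ k *\<^sub>R c k)) \<le> C * \<bar>t - x\<bar> powr s"
    using h unfolding holder_C_def Collect_real_less by blast
  obtain K where K: "0 < K" "\<And>v. norm (J v) \<le> norm v * K" using J.pos_bounded by blast
  show ?thesis unfolding holder_C_def Collect_real_less
  proof (rule exI[of _ "\<lambda>k. J (c k)"], rule exI[of _ "C * K"], rule exI[of _ \<delta>], intro conjI allI impI d)
    fix t assume t: "0 < \<bar>t - x\<bar> \<and> \<bar>t - x\<bar> < \<delta>"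
    have "norm (J (g t) - (\<Sum>k<nat \<lceil>s\<rceil>. (t - x) ^ k *\<^sub>R J (c k))) = norm (J (g t - (\<Sum>k<nat \<lceil>s\<rceil>. (t - x) ^ k *\<^sub>R c k)))"
      by (simp add: J.diff J.sum J.scaleR)
    also have "\<dots> \<le> C * \<bar>t - x\<bar> powr s * K"
      by (rule order_trans[OF K(2)]) (use b t K in \<open>auto intro: mult_right_mono\<close>)
    finally show "norm (J (g t) - (\<Sum>k<nat \<lceil>s\<rceil>. (t - x) ^ k *\<^sub>R J (c k))) \<le> C * K * \<bar>t - x\<bar> powr s"
      by (simp add: mult_ac)
  qed
qed

lemma holder_C_of_polynomial:
  fixes c :: "nat \<Rightarrow> 'a::real_normed_vector"
  assumes d: "0 < \<delta>" and s: "s \<le> s'"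
    and b: "\<And>t. 0 < \<bar>t - x\<bar> \<Longrightarrow> \<bar>t - x\<bar> < \<delta> \<Longrightarrow>
        norm (g t - (\<Sum>k<n. (t - x) ^ k *\<^sub>R c k)) \<le> C * \<bar>t - x\<bar> powr s'"
  shows "holder_C s g x"
proof -
  define N where "N = nat \<lceil>s\<rceil>"
  define c' where "c' k = (if k < n then c k else 0)" for k
  define D where "D = (\<Sum>k\<in>{N..<n}. norm (c k))"
  have ge: "s \<le> real k" if "N \<le> k" for k using that unfolding N_def by linarith
  show ?thesis unfolding holder_C_def Collect_real_less N_def[symmetric]
  proof (rule exI[of _ c'], rule exI[of _ "\<bar>C\<bar> + D"], rule exI[of _ "min \<delta> 1"], intro conjI allI impI)
    show "0 < min \<delta> 1" using d by simp
    fix t assume t: "0 < \<bar>t - x\<bar> \<and> \<bar>t - x\<bar> < min \<delta> 1"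
    have 1: "(\<Sum>k<N. (t - x) ^ k *\<^sub>R c' k) = (\<Sum>k\<in>{..<n} \<inter> {..<N}. (t - x) ^ k *\<^sub>R c k)"
      unfolding c'_def by (rule sum.mono_neutral_cong_right) auto
    have 2: "(\<Sum>k<n. (t - x) ^ k *\<^sub>R c k) =
        (\<Sum>k\<in>{..<n} \<inter> {..<N}. (t - x) ^ k *\<^sub>R c k) + (\<Sum>k\<in>{N..<n}. (t - x) ^ k *\<^sub>R c k)"
      by (subst sum.union_disjoint[symmetric]) (auto intro!: sum.cong)
    have 3: "norm (\<Sum>k\<in>{N..<n}. (t - x) ^ k *\<^sub>R c k) \<le> D * \<bar>t - x\<bar> powr s"
      unfolding D_def sum_distrib_right
    proof (rule sum_norm_le)
      fix k assume "k \<in> {N..<n}"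
      then have "\<bar>t - x\<bar> ^ k \<le> \<bar>t - x\<bar> powr s"
        using t ge[of k] by (subst powr_realpow[symmetric]) (auto intro: powr_mono')
      then show "norm ((t - x) ^ k *\<^sub>R c k) \<le> norm (c k) * \<bar>t - x\<bar> powr s"
        by (simp add: power_abs mult.commute mult_left_mono)
    qed
    have "norm (g t - (\<Sum>k<N. (t - x) ^ k *\<^sub>R c' k)) =
       norm ((g t - (\<Sum>k<n. (t - x) ^ k *\<^sub>R c k)) + (\<Sum>k\<in>{N..<n}. (t - x) ^ k *\<^sub>R c k))"
      unfolding 1 2 by (simp add: algebra_simps)
    also have "\<dots> \<le> C * \<bar>t - x\<bar> powr s' + D * \<bar>t - x\<bar> powr s"
      using b t 3 by (intro order_trans[OF norm_triangle_ineq] add_mono) auto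
    also have "\<dots> \<le> \<bar>C\<bar> * \<bar>t - x\<bar> powr s + D * \<bar>t - x\<bar> powr s"
      using t s by (intro add_mono mult_mono powr_mono' order_refl) auto
    finally show "norm (g t - (\<Sum>k<N. (t - x) ^ k *\<^sub>R c' k)) \<le> (\<bar>C\<bar> + D) * \<bar>t - x\<bar> powr s"
      by (simp add: algebra_simps)
  qed
qed

lemma has_vector_derivative_polynomial:
  fixes c :: "nat \<Rightarrow> 'a::real_normed_vector"
  shows "((\<lambda>t. a + (\<Sum>k<n. (t - x) ^ Suc k *\<^sub>R (c k /\<^sub>R real (Suc k)))) has_vector_derivative
     (\<Sum>k<n. (t - x) ^ k *\<^sub>R c k)) (at t)"
proof -
  have "((\<lambda>t. (t - x) ^ Suc k *\<^sub>R (c k /\<^sub>R real (Suc k))) has_vector_derivative (t - x) ^ k *\<^sub>R c k) (at t)" for k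
  proof -
    have "((\<lambda>t. (t - x) ^ Suc k) has_real_derivative (real (Suc k) * (t - x) ^ k)) (at t)"
      by (auto intro!: derivative_eq_intros simp del: of_nat_Suc power_Suc)
    from has_vector_derivative_scaleR[OF this has_vector_derivative_const[of "c k /\<^sub>R real (Suc k)"]]
    have "((\<lambda>t. (t - x) ^ Suc k *\<^sub>R (c k /\<^sub>R real (Suc k))) has_vector_derivative
       (real (Suc k) * (t - x) ^ k) *\<^sub>R (c k /\<^sub>R real (Suc k))) (at t)"
      by (simp del: of_nat_Suc power_Suc)
    moreover have "(real (Suc k) * (t - x) ^ k) *\<^sub>R (c k /\<^sub>R real (Suc k)) = (t - x) ^ k *\<^sub>R c k"
      by (simp del: of_nat_Suc)
    ultimately show ?thesis by (simp only:)
  qed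
  then show ?thesis
    by (intro has_vector_derivative_add[where f' = 0, simplified] has_vector_derivative_sum has_vector_derivative_const) auto
qed

text \<open>Mean value inequality for the difference of \<open>g\<close> and the integrated
  polynomial: between \<open>x\<close> and \<open>t\<close> its derivative is at most
  \<open>B * \<bar>t - x\<bar> powr s\<close>, and the length of the interval gives one more power.
  The constant \<open>B\<close> is preserved, so little-o remainders lift as well.\<close>

lemma polynomial_approx_lift:
  fixes g g' :: "real \<Rightarrow> 'a::real_normed_vector"
  assumes g: "\<And>t. \<bar>t - x\<bar> < \<delta> \<Longrightarrow> (g has_vector_derivative g' t) (at t)"
    and B: "0 \<le> B" and s: "0 \<le> s" and d: "0 < \<delta>"
    and b: "\<And>t. 0 < \<bar>t - x\<bar> \<Longrightarrow> \<bar>t - x\<bar> < \<delta> \<Longrightarrow>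
        norm (g' t - (\<Sum>k<n. (t - x) ^ k *\<^sub>R c k)) \<le> B * \<bar>t - x\<bar> powr s"
    and t: "0 < \<bar>t - x\<bar>" "\<bar>t - x\<bar> < \<delta>"
  shows "norm (g t - (g x + (\<Sum>k<n. (t - x) ^ Suc k *\<^sub>R (c k /\<^sub>R real (Suc k))))) \<le> B * \<bar>t - x\<bar> powr (s + 1)"
proof -
  define h where "h u = g u - (g x + (\<Sum>k<n. (u - x) ^ Suc k *\<^sub>R (c k /\<^sub>R real (Suc k))))" for u
  define h' where "h' u = g' u - (\<Sum>k<n. (u - x) ^ k *\<^sub>R c k)" for u
  have dh: "(h has_vector_derivative h' u) (at u)" if "\<bar>u - x\<bar> < \<delta>" for u
    unfolding h_def h'_def
    by (intro has_vector_derivative_diff g that has_vector_derivative_polynomial)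
  have h0: "h x = 0" by (simp add: h_def)
  have bd: "norm (h' u) \<le> B * \<bar>t - x\<bar> powr s" if "0 < \<bar>u - x\<bar>" "\<bar>u - x\<bar> \<le> \<bar>t - x\<bar>" for u
  proof -
    have "norm (h' u) \<le> B * \<bar>u - x\<bar> powr s" unfolding h'_def using b that t by auto
    also have "\<dots> \<le> B * \<bar>t - x\<bar> powr s" using that B s by (intro mult_left_mono powr_mono2) auto
    finally show ?thesis .
  qed
  define lo hi where "lo = min t x" and "hi = max t x"
  have lh: "lo < hi" "hi - lo = \<bar>t - x\<bar>" using t by (auto simp: lo_def hi_def)
  have "norm (h hi - h lo) \<le> B * \<bar>t - x\<bar> powr s * hi - B * \<bar>t - x\<bar> powr s * lo"
  proof (rule differentiable_bound_general[OF lh(1)])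
    show "continuous_on {lo..hi} h"
      by (rule continuous_on_vector_derivative[of _ _ h'])
         (use t in \<open>auto intro!: has_vector_derivative_at_within dh simp: lo_def hi_def\<close>)
    show "(h has_vector_derivative h' u) (at u)" if "lo < u" "u < hi" for u
      using that t by (intro dh) (auto simp: lo_def hi_def min_def max_def split: if_splits)
    show "((*) (B * \<bar>t - x\<bar> powr s) has_vector_derivative B * \<bar>t - x\<bar> powr s) (at u)" for u
      by (auto intro!: derivative_eq_intros simp: has_real_derivative_iff_has_vector_derivative[symmetric])
    show "norm (h' u) \<le> B * \<bar>t - x\<bar> powr s" if "lo < u" "u < hi" for u
      using that t by (intro bd) (auto simp: lo_def hi_def min_def max_def split: if_splits)
  qed (auto intro!: continuous_intros)
  also have "\<dots> = B * \<bar>t - x\<bar> powr s * (hi - lo)" by (simp add: algebra_simps)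
  also have "\<dots> = B * \<bar>t - x\<bar> powr (s + 1)" using lh t by (simp add: powr_add)
  finally show ?thesis using h0 unfolding lo_def hi_def h_def[symmetric]
    by (auto simp: min_def max_def norm_minus_commute split: if_splits)
qed

lemma peano_lift:
  fixes g g' :: "real \<Rightarrow> 'a::real_normed_vector"
  assumes g: "\<And>t. \<bar>t - x\<bar> < \<rho> \<Longrightarrow> (g has_vector_derivative g' t) (at t)"
    and s: "0 \<le> s" and r: "0 < \<rho>" and p: "peano s g' x"
  shows "peano (s + 1) g x"
proof -
  obtain n c where b: "\<And>\<epsilon>. 0 < \<epsilon> \<Longrightarrow> \<exists>\<delta>>0. \<forall>t. 0 < \<bar>t - x\<bar> \<and> \<bar>t - x\<bar> < \<delta> \<longrightarrow>
     norm (g' t - (\<Sum>k<n. (t - x) ^ k *\<^sub>R c k)) \<le> \<epsilon> * \<bar>t - x\<bar> powr s"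
    using p unfolding peano_def by blast
  define c' where "c' k = (case k of 0 \<Rightarrow> g x | Suc k \<Rightarrow> c k /\<^sub>R real (Suc k))" for k
  have c': "(\<Sum>k<Suc n. (t - x) ^ k *\<^sub>R c' k) = g x + (\<Sum>k<n. (t - x) ^ Suc k *\<^sub>R (c k /\<^sub>R real (Suc k)))" for t
    by (subst sum.lessThan_Suc_shift) (simp add: c'_def)
  show ?thesis unfolding peano_def
  proof (intro exI[of _ "Suc n"] exI[of _ c'] allI impI)
    fix \<epsilon> :: real assume e: "0 < \<epsilon>"
    obtain \<delta> where d: "0 < \<delta>" and d2: "\<And>t. 0 < \<bar>t - x\<bar> \<Longrightarrow> \<bar>t - x\<bar> < \<delta> \<Longrightarrow>
       norm (g' t - (\<Sum>k<n. (t - x) ^ k *\<^sub>R c k)) \<le> \<epsilon> * \<bar>t - x\<bar> powr s"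
      using b[OF e] by blast
    have "norm (g t - (\<Sum>k<Suc n. (t - x) ^ k *\<^sub>R c' k)) \<le> \<epsilon> * \<bar>t - x\<bar> powr (s + 1)"
      if "0 < \<bar>t - x\<bar>" "\<bar>t - x\<bar> < min \<delta> \<rho>" for t
      unfolding c'
      by (rule polynomial_approx_lift[of _ "min \<delta> \<rho>" _ g']) (use g d2 that e s d r in auto)
    then show "\<exists>\<delta>>0. \<forall>t. 0 < \<bar>t - x\<bar> \<and> \<bar>t - x\<bar> < \<delta> \<longrightarrow>
       norm (g t - (\<Sum>k<Suc n. (t - x) ^ k *\<^sub>R c' k)) \<le> \<epsilon> * \<bar>t - x\<bar> powr (s + 1)"
      using d r by (intro exI[of _ "min \<delta> \<rho>"]) auto
  qed
qed

lemma peano_of_derivative: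
  assumes "(g has_vector_derivative v) (at x)"
  shows "peano 1 g x"
  unfolding peano_def
proof (rule exI[of _ 2], rule exI[of _ "\<lambda>k. if k = 0 then g x else v"], intro allI impI)
  fix \<epsilon> :: real assume "0 < \<epsilon>"
  then obtain d where "0 < d" and d: "\<And>t. norm (t - x) < d \<Longrightarrow>
     norm (g t - g x - (t - x) *\<^sub>R v) \<le> \<epsilon> * norm (t - x)"
    using assms unfolding has_vector_derivative_def has_derivative_at_alt by blast
  then show "\<exists>\<delta>>0. \<forall>t. 0 < \<bar>t - x\<bar> \<and> \<bar>t - x\<bar> < \<delta> \<longrightarrow>
     norm (g t - (\<Sum>k<2. (t - x) ^ k *\<^sub>R (if k = 0 then g x else v))) \<le> \<epsilon> * \<bar>t - x\<bar> powr 1"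
    by (intro exI[of _ d]) (auto simp: numeral_2_eq_2 algebra_simps)
qed

lemma derivs_on_peano:
  assumes D: "derivs_on k g D {a<..<b}" and x: "a < x" "x < b"
    and s: "0 \<le> s" and p: "peano s (D k) x"
  shows "peano (real k + s) g x"
proof -
  define \<rho> where "\<rho> = min (x - a) (b - x)"
  have r: "0 < \<rho>" using x by (auto simp: \<rho>_def)
  have "peano (real i + s) (D (k - i)) x" if "i \<le> k" for i
    using that
  proof (induction i)
    case 0
    then show ?case using p by simp
  next
    case (Suc i)
    have e: "Suc (k - Suc i) = k - i" using Suc.prems by auto
    have "peano (real i + s + 1) (D (k - Suc i)) x"
    proof (rule peano_lift[OF _ _ r])
      show "(D (k - Suc i) has_vector_derivative D (k - i) t) (at t)" if "\<bar>t - x\<bar> < \<rho>" for t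
      proof -
        have "k - Suc i < k" "t \<in> {a<..<b}" using that Suc.prems unfolding \<rho>_def by auto
        then show ?thesis using D unfolding derivs_on_def e[symmetric] by blast
      qed
    qed (use Suc s in auto)
    then show ?case by (simp add: algebra_simps)
  qed
  from this[of k] show ?thesis using D by (simp add: derivs_on_def)
qed

text \<open>The mere existence of the last derivative at \<open>x\<close> is a first order expansion
  of the one before it, which is then lifted. At a point without good expansions this limits the
  number of derivatives.\<close>

lemma derivs_on_peano_order:
  assumes D: "derivs_on k g D {a<..<b}" and x: "a < x" "x < b" and s: "s \<le> real k" and k: "0 < k"
  shows "peano s g x"
proof -
  obtain j where j: "k = Suc j" using k by (cases k) auto
  have "derivs_on j g D {a<..<b}" using D by (auto simp: derivs_on_def j)
  moreover have "peano 1 (D j) x"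
    using D x by (intro peano_of_derivative[of _ "D (Suc j) x"]) (auto simp: derivs_on_def j)
  ultimately have "peano (real j + 1) g x"
    using x by (intro derivs_on_peano) auto
  then show ?thesis by (rule peano_mono) (use s in \<open>auto simp: j\<close>)
qed

lemma Lambda_on_imp_holder_C:
  assumes L: "Lambda_on s g {a..b}" and x: "a < x" "x < b" and s: "0 < s"
  shows "holder_C s g x"
proof -
  obtain C where C: "\<And>t u. t \<in> {a..b} \<Longrightarrow> u \<in> {a..b} \<Longrightarrow> norm (g t - g u) \<le> C * \<bar>t - u\<bar> powr s"
    using L unfolding Lambda_on_def by blast
  show ?thesis
    by (rule holder_C_of_polynomial[of "min (x - a) (b - x)" s s x g "\<lambda>_. g x" 1 C])
       (use x s in \<open>auto intro!: C\<close>)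
qed

subsection \<open>Exponential series in the upper half plane\<close>

text \<open>The inequality \<open>ln t \<le> t - 1\<close> at \<open>t = l * \<delta> / p\<close>
  yields the constant \<open>(p / \<delta>) powr p\<close>; for \<open>p \<le> 0\<close> the power
  is largest at \<open>l = \<mu>\<close>.\<close>

lemma powr_le_exp:
  fixes p \<delta> \<mu> :: real
  assumes "0 < \<delta>" "0 < \<mu>"
  obtains C where "0 \<le> C" "\<And>l. \<mu> \<le> l \<Longrightarrow> l powr p \<le> C * exp (\<delta> * l)"
proof (cases "0 < p")
  case True
  have "l powr p \<le> exp (p * ln (p / \<delta>)) * exp (\<delta> * l)" if "\<mu> \<le> l" for l
  proof -
    have l: "0 < l" using that assms by linarith
    have "ln (l * \<delta> / p) \<le> l * \<delta> / p - 1" using l True assms by (intro ln_le_minus_one) auto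
    then have "ln l \<le> l * \<delta> / p + ln (p / \<delta>)"
      using l True assms by (simp add: ln_mult ln_div)
    then have "p * ln l \<le> \<delta> * l + p * ln (p / \<delta>)"
      using True by (auto simp: field_simps dest: mult_left_mono[of _ _ p])
    then have "exp (p * ln l) \<le> exp (p * ln (p / \<delta>) + \<delta> * l)" by simp
    then show ?thesis using l by (simp add: powr_def exp_add)
  qed
  then show ?thesis by (intro that[of "exp (p * ln (p / \<delta>))"]) auto
next
  case False
  have "l powr p \<le> \<mu> powr p * exp (\<delta> * l)" if "\<mu> \<le> l" for l
  proof -
    have "l powr p \<le> \<mu> powr p * 1" using that assms False by (auto intro: powr_mono2')
    also have "\<dots> \<le> \<mu> powr p * exp (\<delta> * l)" using assms that by (intro mult_left_mono) auto
    finally show ?thesis .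
  qed
  then show ?thesis by (intro that[of "\<mu> powr p"]) auto
qed

text \<open>The Fourier series of a form without its constant term, detached from modularity;
  \<open>w\<close> will be \<open>2 * pi\<close> divided by the width. In \<open>fs\<close> the
  order 0 is the form itself, positive orders are fractional integrals, and negative integer orders
  are derivatives up to powers of \<open>\<i> * w\<close>.\<close>

locale qseries =
  fixes c :: "nat \<Rightarrow> complex" and \<kappa> w :: real
  assumes kappa: "0 \<le> \<kappa>" and w: "0 < w" and c0: "\<kappa> = 0 \<Longrightarrow> c 0 = 0"
    and conv: "\<And>y. 0 < y \<Longrightarrow> summable (\<lambda>n. norm (c n) * exp (- (w * (real n + \<kappa>) * y)))"
begin

definition lam :: "nat \<Rightarrow> real" where "lam n = real n + \<kappa>"

text \<open>The smallest frequency: for \<open>\<kappa> = 0\<close> the constant term is excluded by \<open>c0\<close>.\<close>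

definition low :: real where "low = (if \<kappa> = 0 then 1 else \<kappa>)"

definition tm :: "real \<Rightarrow> nat \<Rightarrow> complex \<Rightarrow> complex" where
  "tm \<beta> n z = c n * of_real (lam n powr (- \<beta>)) * exp (\<i> * of_real (w * lam n) * z)"

definition fs :: "real \<Rightarrow> complex \<Rightarrow> complex" where
  "fs \<beta> z = (\<Sum>n. tm \<beta> n z)"

lemma low_pos: "0 < low" using kappa by (auto simp: low_def)

lemma low_le: "c n \<noteq> 0 \<Longrightarrow> low \<le> lam n"
  using kappa c0 by (cases n) (auto simp: low_def lam_def)

lemma lam_pos: "c n \<noteq> 0 \<Longrightarrow> 0 < lam n"
  using low_le[of n] low_pos by linarith

lemma norm_tm: "norm (tm \<beta> n z) = norm (c n) * lam n powr (- \<beta>) * exp (- (w * lam n * Im z))"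
  by (simp add: tm_def norm_mult)

text \<open>The power of the frequency is paid for with half of the exponential decay.\<close>

lemma summable_bound:
  assumes "0 < y"
  shows "summable (\<lambda>n. norm (c n) * lam n powr (- \<beta>) * exp (- (w * lam n * y)))"
proof -
  obtain C where C: "0 \<le> C" "\<And>l. low \<le> l \<Longrightarrow> l powr (- \<beta>) \<le> C * exp (w * y / 2 * l)"
    using powr_le_exp[of "w * y / 2" low "- \<beta>"] w low_pos assms by auto
  have "summable (\<lambda>n. C * (norm (c n) * exp (- (w * (real n + \<kappa>) * (y / 2)))))"
    using conv[of "y / 2"] assms by (intro summable_mult) auto
  then show ?thesis
  proof (rule summable_comparison_test'[where N = 0])
    fix n
    show "norm (norm (c n) * lam n powr (- \<beta>) * exp (- (w * lam n * y)))
        \<le> C * (norm (c n) * exp (- (w * (real n + \<kappa>) * (y / 2))))"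
    proof (cases "c n = 0")
      case False
      have "norm (c n) * lam n powr (- \<beta>) * exp (- (w * lam n * y))
         \<le> norm (c n) * (C * exp (w * y / 2 * lam n)) * exp (- (w * lam n * y))"
        using C low_le[OF False] by (intro mult_right_mono mult_left_mono) auto
      also have "\<dots> = C * (norm (c n) * exp (w * y / 2 * lam n + - (w * lam n * y)))"
        unfolding exp_add by (simp only: mult_ac)
      also have "w * y / 2 * lam n + - (w * lam n * y) = - (w * (real n + \<kappa>) * (y / 2))"
        by (simp add: lam_def field_simps)
      finally show ?thesis by simp
    qed auto
  qed
qed

lemma summable_norm_tm: "0 < Im z \<Longrightarrow> summable (\<lambda>n. norm (tm \<beta> n z))"
  unfolding norm_tm by (rule summable_bound)

lemma tm_sums: "0 < Im z \<Longrightarrow> (\<lambda>n. tm \<beta> n z) sums fs \<beta> z"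
  unfolding fs_def by (rule summable_sums[OF summable_norm_cancel[OF summable_norm_tm]])

text \<open>Going up from height \<open>y\<close>, every term shrinks at least as fast as one of
  frequency \<open>low\<close> would, and at height \<open>y\<close> the terms are absolutely
  summable.\<close>

lemma fs_decay:
  assumes "0 < y"
  obtains C where "0 \<le> C" "\<And>z. y \<le> Im z \<Longrightarrow> norm (fs \<beta> z) \<le> C * exp (- (w * low * Im z))"
proof -
  define S where "S = (\<Sum>n. norm (c n) * lam n powr (- \<beta>) * exp (- (w * lam n * y)))"
  have "norm (fs \<beta> z) \<le> S * exp (w * low * y) * exp (- (w * low * Im z))" if z: "y \<le> Im z" for z
  proof -
    have "norm (fs \<beta> z) \<le> (\<Sum>n. norm (tm \<beta> n z))"
      unfolding fs_def using z assms by (intro summable_norm summable_norm_tm) auto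
    also have "\<dots> \<le> (\<Sum>n. norm (c n) * lam n powr (- \<beta>) * exp (- (w * lam n * y)) * exp (- (w * low * (Im z - y))))"
    proof (rule suminf_le)
      fix n
      show "norm (tm \<beta> n z) \<le> norm (c n) * lam n powr (- \<beta>) * exp (- (w * lam n * y)) * exp (- (w * low * (Im z - y)))"
      proof (cases "c n = 0")
        case False
        have "w * low * (Im z - y) \<le> w * lam n * (Im z - y)"
          using low_le[OF False] w z by (intro mult_right_mono mult_left_mono) auto
        then have "exp (- (w * lam n * Im z)) \<le> exp (- (w * lam n * y) + - (w * low * (Im z - y)))"
          by (simp add: algebra_simps)
        then show ?thesis unfolding norm_tm exp_add
          by (simp add: mult.assoc mult_left_mono)
      qed (simp add: tm_def)
      show "summable (\<lambda>n. norm (tm \<beta> n z))" using z assms by (intro summable_norm_tm) auto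
      show "summable (\<lambda>n. norm (c n) * lam n powr (- \<beta>) * exp (- (w * lam n * y)) * exp (- (w * low * (Im z - y))))"
        by (intro summable_mult2 summable_bound assms)
    qed
    also have "\<dots> = S * exp (- (w * low * (Im z - y)))"
      unfolding S_def by (intro suminf_mult2[symmetric] summable_bound assms)
    also have "\<dots> = S * exp (w * low * y) * exp (- (w * low * Im z))"
      by (simp add: exp_diff right_diff_distrib exp_minus field_simps)
    finally show ?thesis .
  qed
  moreover have "0 \<le> S * exp (w * low * y)"
    unfolding S_def by (intro mult_nonneg_nonneg suminf_nonneg summable_bound assms) auto
  ultimately show ?thesis by (rule that[rotated])
qed

lemma tm_deriv: "(tm \<beta> n has_field_derivative \<i> * of_real w * tm (\<beta> - 1) n z) (at z within S)"
proof (cases "c n = 0")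
  case False
  have "lam n powr (- (\<beta> - 1)) = lam n * lam n powr (- \<beta>)"
    using lam_pos[OF False] by (simp add: powr_diff powr_minus divide_inverse powr_add)
  then show ?thesis unfolding tm_def
    by (auto intro!: derivative_eq_intros simp: algebra_simps)
qed (simp add: tm_def[abs_def])

lemma convex_halfplane_ge: "convex {z. a \<le> Im z}"
  using convex_halfspace_Im_ge[of a] by simp

lemma fs_deriv:
  assumes z: "0 < Im z"
  shows "(fs \<beta> has_field_derivative \<i> * of_real w * fs (\<beta> - 1) z) (at z)"
proof -
  define S where "S = {u. Im z / 2 \<le> Im u}"
  have uc: "uniformly_convergent_on S (\<lambda>n u. \<Sum>i<n. \<i> * of_real w * tm (\<beta> - 1) i u)"
  proof (rule Weierstrass_m_test')
    fix n u assume u: "u \<in> S"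
    have "norm (tm (\<beta> - 1) n u) \<le> norm (c n) * lam n powr (- (\<beta> - 1)) * exp (- (w * lam n * (Im z / 2)))"
    proof (cases "c n = 0")
      case False
      then show ?thesis using u w lam_pos[OF False] unfolding norm_tm S_def
        by (intro mult_left_mono) auto
    qed (simp add: tm_def)
    then show "norm (\<i> * of_real w * tm (\<beta> - 1) n u) \<le> w * (norm (c n) * lam n powr (- (\<beta> - 1)) * exp (- (w * lam n * (Im z / 2))))"
      using w by (simp add: norm_mult)
  next
    show "summable (\<lambda>n. w * (norm (c n) * lam n powr (- (\<beta> - 1)) * exp (- (w * lam n * (Im z / 2)))))"
      using z by (intro summable_mult summable_bound) auto
  qed
  have int: "z \<in> interior S"
  proof (rule interiorI)
    show "open {u. Im z / 2 < Im u}" by (rule open_halfspace_Im_gt)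
  qed (use z in \<open>auto simp: S_def\<close>)
  have cS: "convex S" unfolding S_def by (rule convex_halfplane_ge)
  have "((\<lambda>x. \<Sum>n. tm \<beta> n x) has_field_derivative (\<Sum>n. \<i> * of_real w * tm (\<beta> - 1) n z)) (at z)"
    by (rule has_field_derivative_series'(2)[OF cS _ uc _ _ int, of _ z])
       (use z int interior_subset tm_deriv in
          \<open>auto simp: S_def intro!: summable_norm_cancel[OF summable_norm_tm]\<close>)
  also have "(\<Sum>n. \<i> * of_real w * tm (\<beta> - 1) n z) = \<i> * of_real w * fs (\<beta> - 1) z"
    unfolding fs_def using z by (intro suminf_mult summable_norm_cancel[OF summable_norm_tm])
  finally show ?thesis unfolding fs_def[abs_def] .
qed

lemma fs_holomorphic: "fs \<beta> holomorphic_on {z. 0 < Im z}"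
  using fs_deriv by (auto simp: holomorphic_on_open[OF open_halfspace_Im_gt])

lemma fs_higher_deriv:
  assumes "0 < Im z"
  shows "(deriv ^^ j) (fs \<beta>) z = (\<i> * of_real w) ^ j * fs (\<beta> - real j) z"
  using assms
proof (induction j arbitrary: z)
  case (Suc j)
  have "eventually (\<lambda>u. 0 < Im u) (nhds z)"
    using Suc.prems by (intro eventually_nhds_in_open[OF open_halfspace_Im_gt[of 0], simplified]) auto
  then have "eventually (\<lambda>u. (deriv ^^ j) (fs \<beta>) u = (\<i> * of_real w) ^ j * fs (\<beta> - real j) u) (nhds z)"
    by eventually_elim (rule Suc.IH)
  then have "deriv ((deriv ^^ j) (fs \<beta>)) z = deriv (\<lambda>u. (\<i> * of_real w) ^ j * fs (\<beta> - real j) u) z"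
    by (rule deriv_cong_ev) simp
  also have "\<dots> = (\<i> * of_real w) ^ j * (\<i> * of_real w * fs (\<beta> - real j - 1) z)"
    by (intro DERIV_imp_deriv DERIV_cmult fs_deriv Suc.prems)
  finally show ?case by (simp add: mult_ac algebra_simps)
qed simp

text \<open>Term by term this is Euler's integral, which turns
  \<open>exp (- (w * lam n * u))\<close> into the factor \<open>lam n powr (- \<gamma>)\<close> and
  so raises the order by \<open>\<gamma>\<close>. Interchanging sum and integral is legitimate
  because the integrals of the norms are a multiple of the norms of the terms of order
  \<open>\<beta> + \<gamma>\<close>, which are summable.\<close>

lemma fs_Gamma_integral:
  assumes g: "0 < \<gamma>" and z: "0 < Im z"
  shows "(\<lambda>u. of_real (u powr (\<gamma> - 1)) * fs \<beta> (z + \<i> * of_real u)) absolutely_integrable_on {0<..}"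
    and "((\<lambda>u. of_real (u powr (\<gamma> - 1)) * fs \<beta> (z + \<i> * of_real u)) has_integral
           of_real (Gamma \<gamma> * w powr (- \<gamma>)) * fs (\<beta> + \<gamma>) z) {0<..}"
proof -
  define F where "F n u = tm \<beta> n z * of_real (u powr (\<gamma> - 1) * exp (- (w * lam n * u)))" for n u
  define f where "f n u = indicator {0<..} u *\<^sub>R F n u" for n u
  define k where "k = Gamma \<gamma> * w powr (- \<gamma>)"
  have Feq: "of_real (u powr (\<gamma> - 1)) * tm \<beta> n (z + \<i> * of_real u) = F n u" for n u
    unfolding F_def tm_def by (simp add: exp_of_real[symmetric] exp_add[symmetric] algebra_simps)
  have nF: "norm (F n u) = norm (tm \<beta> n z) * (u powr (\<gamma> - 1) * exp (- (w * lam n * u)))" for n u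
    by (simp add: F_def norm_mult)
  have base: "(\<lambda>u. u powr (\<gamma> - 1) * exp (- (w * lam n * u))) absolutely_integrable_on {0<..}"
    and basev: "((\<lambda>u. u powr (\<gamma> - 1) * exp (- (w * lam n * u))) has_integral (k * lam n powr (- \<gamma>))) {0<..}"
    if "c n \<noteq> 0" for n
  proof -
    have p: "0 < w * lam n" using lam_pos[OF that] w by simp
    from Gamma_integral_scaled[OF g p] lam_pos[OF that] w
    show "((\<lambda>u. u powr (\<gamma> - 1) * exp (- (w * lam n * u))) has_integral (k * lam n powr (- \<gamma>))) {0<..}"
      by (simp add: k_def powr_mult mult_ac)
    then show "(\<lambda>u. u powr (\<gamma> - 1) * exp (- (w * lam n * u))) absolutely_integrable_on {0<..}"
      by (intro nonnegative_absolutely_integrable_1) auto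
  qed
  have tmk: "of_real (k * lam n powr (- \<gamma>)) * tm \<beta> n z = of_real k * tm (\<beta> + \<gamma>) n z" for n
    by (cases "c n = 0") (auto simp: tm_def powr_diff powr_minus powr_add divide_inverse mult_ac)
  have ntmk: "norm (tm \<beta> n z) * (k * lam n powr (- \<gamma>)) = k * norm (tm (\<beta> + \<gamma>) n z)" for n
    by (cases "c n = 0") (auto simp: norm_tm powr_diff powr_minus powr_add divide_inverse mult_ac)
  have int: "integrable lebesgue (f n)" for n
  proof (cases "c n = 0")
    case False
    have "(\<lambda>u. complex_of_real (u powr (\<gamma> - 1) * exp (- (w * lam n * u)))) absolutely_integrable_on {0<..}"
      using base[OF False] by (rule absolutely_integrable_linear[of _ _ of_real, unfolded o_def]) (rule bounded_linear_of_real)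
    then have "(\<lambda>u. F n u) absolutely_integrable_on {0<..}"
      unfolding F_def by (rule set_integrable_mult_right)
    then show ?thesis by (simp add: f_def[abs_def] set_integrable_def)
  qed (simp add: f_def[abs_def] F_def tm_def)
  have hint: "(F n has_integral of_real k * tm (\<beta> + \<gamma>) n z) {0<..}" for n
  proof (cases "c n = 0")
    case False
    have "((\<lambda>u. complex_of_real (u powr (\<gamma> - 1) * exp (- (w * lam n * u)))) has_integral of_real (k * lam n powr (- \<gamma>))) {0<..}"
      using has_integral_linear[OF basev[OF False] bounded_linear_of_real] by (simp add: o_def)
    from has_integral_mult_right[OF this, of "tm \<beta> n z"] show ?thesis
      unfolding F_def[abs_def] tmk[of n, symmetric] by (simp only: mult.commute[of "tm \<beta> n z" "of_real (k * lam n powr (- \<gamma>))"])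
  qed (simp add: F_def[abs_def] tm_def)
  have lint: "integral\<^sup>L lebesgue (f n) = of_real k * tm (\<beta> + \<gamma>) n z" for n
    using has_integral_set_lebesgue[of "{0<..}" "F n"] int[of n] hint[of n]
    unfolding f_def set_integrable_def set_lebesgue_integral_def
    by (metis has_integral_unique)
  have nint: "(\<integral>u. norm (f n u) \<partial>lebesgue) = k * norm (tm (\<beta> + \<gamma>) n z)" for n
  proof (cases "c n = 0")
    case False
    have "(\<integral>u. norm (f n u) \<partial>lebesgue) = (LINT u:{0<..}|lebesgue. norm (F n u))"
      unfolding set_lebesgue_integral_def f_def by (intro Bochner_Integration.integral_cong) (auto simp: indicator_def)
    also have "\<dots> = norm (tm \<beta> n z) * (LINT u:{0<..}|lebesgue. u powr (\<gamma> - 1) * exp (- (w * lam n * u)))"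
      unfolding nF by simp
    also have "(LINT u:{0<..}|lebesgue. u powr (\<gamma> - 1) * exp (- (w * lam n * u))) = k * lam n powr (- \<gamma>)"
      by (rule has_integral_unique[OF has_integral_set_lebesgue[OF base[OF False]] basev[OF False]])
    finally show ?thesis using ntmk by simp
  qed (simp add: f_def F_def tm_def)
  have sumF: "summable (\<lambda>n. norm (F n u))" if "0 < u" for u
  proof -
    have "summable (\<lambda>n. u powr (\<gamma> - 1) * norm (tm \<beta> n (z + \<i> * of_real u)))"
      using that z by (intro summable_mult summable_norm_tm) auto
    then show ?thesis unfolding Feq[symmetric] by (simp add: norm_mult)
  qed
  have s1: "AE u in lebesgue. summable (\<lambda>n. norm (f n u))"
  proof (rule AE_I2)
    fix u show "summable (\<lambda>n. norm (f n u))"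
      using sumF[of u] by (cases "0 < u") (auto simp: f_def)
  qed
  have s2: "summable (\<lambda>n. \<integral>u. norm (f n u) \<partial>lebesgue)"
    unfolding nint using z by (intro summable_mult summable_norm_tm)
  have sumeq: "(\<Sum>n. f n u) = indicator {0<..} u *\<^sub>R (of_real (u powr (\<gamma> - 1)) * fs \<beta> (z + \<i> * of_real u))" for u
  proof (cases "0 < u")
    case True
    have "of_real (u powr (\<gamma> - 1)) * fs \<beta> (z + \<i> * of_real u) = (\<Sum>n. F n u)"
      unfolding fs_def Feq[symmetric] using True z
      by (intro suminf_mult[symmetric] summable_norm_cancel[OF summable_norm_tm]) auto
    then show ?thesis using True by (simp add: f_def)
  qed (simp add: f_def)
  have I: "integrable lebesgue (\<lambda>u. \<Sum>n. f n u)"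
    by (rule integrable_suminf[OF int s1 s2])
  then show ai: "(\<lambda>u. of_real (u powr (\<gamma> - 1)) * fs \<beta> (z + \<i> * of_real u)) absolutely_integrable_on {0<..}"
    unfolding sumeq set_integrable_def .
  have "(\<lambda>n. of_real k * tm (\<beta> + \<gamma>) n z) sums (\<integral>u. (\<Sum>n. f n u) \<partial>lebesgue)"
    using sums_integral[OF int s1 s2] unfolding lint .
  moreover have "(\<lambda>n. of_real k * tm (\<beta> + \<gamma>) n z) sums (of_real k * fs (\<beta> + \<gamma>) z)"
    using z by (intro sums_mult tm_sums)
  ultimately have "(LINT u:{0<..}|lebesgue. of_real (u powr (\<gamma> - 1)) * fs \<beta> (z + \<i> * of_real u)) = of_real k * fs (\<beta> + \<gamma>) z"
    unfolding set_lebesgue_integral_def sumeq by (rule sums_unique2)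
  then show "((\<lambda>u. of_real (u powr (\<gamma> - 1)) * fs \<beta> (z + \<i> * of_real u)) has_integral
           of_real (Gamma \<gamma> * w powr (- \<gamma>)) * fs (\<beta> + \<gamma>) z) {0<..}"
    using has_integral_set_lebesgue[OF ai] by (simp add: k_def)
qed

lemma fs_Gamma_bound:
  assumes g: "0 < \<gamma>" and z: "0 < Im z"
    and M: "(\<lambda>u. u powr (\<gamma> - 1) * M u) integrable_on {0<..}"
    and b: "\<And>u. 0 < u \<Longrightarrow> norm (fs \<beta> (z + \<i> * of_real u)) \<le> M u"
  shows "norm (fs (\<beta> + \<gamma>) z) \<le> w powr \<gamma> / Gamma \<gamma> * integral {0<..} (\<lambda>u. u powr (\<gamma> - 1) * M u)"
proof -
  have "norm (of_real (Gamma \<gamma> * w powr (- \<gamma>)) * fs (\<beta> + \<gamma>) z) \<le> integral {0<..} (\<lambda>u. u powr (\<gamma> - 1) * M u)"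
    unfolding integral_unique[OF fs_Gamma_integral(2)[OF g z], symmetric]
  proof (rule integral_norm_bound_integral[OF _ M])
    show "(\<lambda>u. of_real (u powr (\<gamma> - 1)) * fs \<beta> (z + \<i> * of_real u)) integrable_on {0<..}"
      using fs_Gamma_integral(2)[OF g z] by blast
  qed (auto simp: norm_mult intro!: mult_left_mono b)
  then have "Gamma \<gamma> * w powr (- \<gamma>) * norm (fs (\<beta> + \<gamma>) z) \<le> integral {0<..} (\<lambda>u. u powr (\<gamma> - 1) * M u)"
    using Gamma_real_pos[OF g] by (simp add: norm_mult)
  then show ?thesis using Gamma_real_pos[OF g] w by (simp add: powr_minus field_simps)
qed

end

subsection \<open>Continuity up to the real axis\<close>

lemma abs_sin_ge:
  fixes x :: real
  assumes "\<bar>x\<bar> \<le> pi / 2"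
  shows "\<bar>x\<bar> / 2 \<le> \<bar>sin x\<bar>"
proof -
  have "\<bar>sin x - x\<bar> \<le> \<bar>x\<bar> ^ 3 / 6"
    using Maclaurin_sin_bound[of x 3] by (simp add: sin_coeff_def numeral_3_eq_3 lessThan_Suc)
  moreover have "\<bar>x\<bar> ^ 3 / 6 \<le> \<bar>x\<bar> / 2"
  proof -
    have "pi \<le> 34 / 10" using pi_approx by simp
    then have "\<bar>x\<bar> \<le> 17 / 10" using assms by linarith
    then have "\<bar>x\<bar> * \<bar>x\<bar> \<le> 17 / 10 * (17 / 10)" by (intro mult_mono) auto
    then have "\<bar>x\<bar> * (\<bar>x\<bar> * \<bar>x\<bar>) \<le> \<bar>x\<bar> * 3" by (intro mult_left_mono) auto
    then show ?thesis by (simp add: power3_eq_cube)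
  qed
  ultimately show ?thesis by linarith
qed

text \<open>Up to a quarter turn the imaginary part suffices; beyond it the cosine is nonpositive
  and the real part is at least 1. The lower bound 1/3 fits radii
  \<open>exp (- (1 / (real N + 1)))\<close>, which are at least \<open>exp (- 1)\<close>.\<close>

lemma norm_one_minus_cis_ge:
  fixes \<rho> \<theta> :: real
  assumes r: "1/3 \<le> \<rho>" "\<rho> < 1" and t: "\<bar>\<theta>\<bar> \<le> pi"
  shows "\<bar>\<theta>\<bar> / 6 \<le> norm (1 - of_real \<rho> * cis \<theta>)"
proof (cases "\<bar>\<theta>\<bar> \<le> pi / 2")
  case True
  have "\<bar>\<theta>\<bar> / 6 \<le> 1/3 * \<bar>sin \<theta>\<bar>" using abs_sin_ge[OF True] by simp
  also have "\<dots> \<le> \<rho> * \<bar>sin \<theta>\<bar>" using r by (intro mult_right_mono) auto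
  also have "\<dots> = \<bar>Im (1 - of_real \<rho> * cis \<theta>)\<bar>" using r by (simp add: abs_mult)
  also have "\<dots> \<le> norm (1 - of_real \<rho> * cis \<theta>)" by (rule abs_Im_le_cmod)
  finally show ?thesis .
next
  case False
  have "0 \<le> cos (pi - \<bar>\<theta>\<bar>)" using False t by (intro cos_ge_zero) auto
  then have c: "cos \<theta> \<le> 0" by simp
  have "\<bar>\<theta>\<bar> / 6 \<le> 1" using t pi_less_4 by linarith
  also have "1 \<le> Re (1 - of_real \<rho> * cis \<theta>)" using c r by (simp add: mult_nonneg_nonpos)
  also have "\<dots> \<le> norm (1 - of_real \<rho> * cis \<theta>)" by (rule complex_Re_le_cmod)
  finally show ?thesis .
qed

lemma has_integral_abs_powr:
  fixes \<epsilon> a :: real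
  assumes "0 < \<epsilon>" "0 \<le> a"
  shows "((\<lambda>t. \<bar>t\<bar> powr (\<epsilon> - 1)) has_integral (2 * a powr \<epsilon> / \<epsilon>)) {-a..a}"
proof -
  have 1: "((\<lambda>t. t powr (\<epsilon> - 1)) has_integral (a powr \<epsilon> / \<epsilon>)) {0..a}"
    using has_integral_powr_from_0[of "\<epsilon> - 1" a] assms by simp
  then have 2: "((\<lambda>t. \<bar>t\<bar> powr (\<epsilon> - 1)) has_integral (a powr \<epsilon> / \<epsilon>)) {0..a}"
    by (rule has_integral_eq[rotated]) auto
  have "((\<lambda>t. (- t) powr (\<epsilon> - 1)) has_integral (a powr \<epsilon> / \<epsilon>)) {-a..0}"
    using 1 has_integral_reflect_real[of "\<lambda>t. t powr (\<epsilon> - 1)" "a powr \<epsilon> / \<epsilon>" a 0] by simp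
  then have 3: "((\<lambda>t. \<bar>t\<bar> powr (\<epsilon> - 1)) has_integral (a powr \<epsilon> / \<epsilon>)) {-a..0}"
    by (rule has_integral_eq[rotated]) auto
  have "((\<lambda>t. \<bar>t\<bar> powr (\<epsilon> - 1)) has_integral (a powr \<epsilon> / \<epsilon> + a powr \<epsilon> / \<epsilon>)) {-a..a}"
    by (rule has_integral_combine[OF _ _ 3 2]) (use assms in auto)
  then show ?thesis by simp
qed

lemma has_integral_cis_int:
  fixes n :: int
  shows "((\<lambda>t. cis (of_int n * t)) has_integral (if n = 0 then 2 * pi else 0)) {-pi..pi}"
proof (cases "n = 0")
  case True
  then show ?thesis using has_integral_const_real[of "1::complex" "-pi" pi] by (simp add: scaleR_conv_of_real)
next
  case False
  have d: "((\<lambda>t. cis (of_int n * t) / (\<i> * of_int n)) has_vector_derivative cis (of_int n * t)) (at t within S)" for t S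
  proof -
    have "((\<lambda>z. exp (\<i> * of_int n * z) / (\<i> * of_int n)) has_field_derivative exp (\<i> * of_int n * z)) (at z)" for z
      using False by (auto intro!: derivative_eq_intros)
    from has_vector_derivative_real_field[OF this, of t] show ?thesis
      by (simp add: cis_conv_exp mult_ac has_vector_derivative_at_within)
  qed
  have "((\<lambda>t. cis (of_int n * t)) has_integral (cis (of_int n * pi) / (\<i> * of_int n) - cis (of_int n * (-pi)) / (\<i> * of_int n))) {-pi..pi}"
    by (rule fundamental_theorem_of_calculus) (auto intro: d)
  moreover have "cis (of_int n * pi) = cis (of_int n * (-pi))"
  proof -
    have "cis (of_int n * pi) = cis (of_int n * (-pi) + 2 * pi * of_int n)" by (simp add: algebra_simps)
    also have "\<dots> = cis (of_int n * (-pi))" by (simp only: cis_mult[symmetric] cis_multiple_2pi[OF Ints_of_int] mult_1_right)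
    finally show ?thesis .
  qed
  ultimately show ?thesis using False by simp
qed

text \<open>Cauchy's coefficient formula: orthogonality of the exponentials, integrated termwise
  thanks to uniform convergence on the circle.\<close>

lemma powser_coeff_integral:
  fixes b :: "nat \<Rightarrow> complex" and \<rho> :: real
  assumes r: "0 < \<rho>" and s: "summable (\<lambda>k. norm (b k) * \<rho> ^ k)"
  shows "((\<lambda>\<theta>. (\<Sum>k. b k * (of_real \<rho> * cis \<theta>) ^ k) * inverse (of_real \<rho> * cis \<theta>) ^ n) has_integral (2 * pi * b n)) {-pi..pi}"
proof -
  define q where "q \<theta> = of_real \<rho> * cis \<theta>" for \<theta>
  define P where "P N \<theta> = (\<Sum>k<N. b k * q \<theta> ^ k * inverse (q \<theta>) ^ n)" for N \<theta>
  have q0: "q \<theta> \<noteq> 0" for \<theta> using r by (simp add: q_def)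
  have nq: "norm (q \<theta>) = \<rho>" for \<theta> using r by (simp add: q_def norm_mult)
  have ul: "uniform_limit {-pi..pi} P (\<lambda>\<theta>. \<Sum>k. b k * q \<theta> ^ k * inverse (q \<theta>) ^ n) sequentially"
    unfolding P_def
  proof (rule Weierstrass_m_test)
    show "norm (b k * q \<theta> ^ k * inverse (q \<theta>) ^ n) \<le> norm (b k) * \<rho> ^ k * inverse \<rho> ^ n" for k \<theta>
      by (simp add: norm_mult norm_power nq norm_inverse)
    show "summable (\<lambda>k. norm (b k) * \<rho> ^ k * inverse \<rho> ^ n)"
      by (intro summable_mult2 s)
  qed
  have cont: "continuous_on {-pi..pi} (P N)" for N
    unfolding P_def q_def by (intro continuous_intros) (use r in auto)
  have trm: "((\<lambda>\<theta>. b k * q \<theta> ^ k * inverse (q \<theta>) ^ n) has_integral (if k = n then 2 * pi * b n else 0)) {-pi..pi}" for k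
  proof -
    have e: "b k * q \<theta> ^ k * inverse (q \<theta>) ^ n = (b k * of_real (\<rho> ^ k * inverse \<rho> ^ n)) * cis (of_int (int k - int n) * \<theta>)" for \<theta>
    proof -
      have "cis (of_int (int k - int n) * \<theta>) = cis \<theta> ^ k * inverse (cis \<theta>) ^ n"
        by (simp add: Complex.DeMoivre cis_inverse cis_mult algebra_simps)
      then show ?thesis by (simp add: q_def power_mult_distrib mult_ac)
    qed
    show ?thesis unfolding e
      using has_integral_mult_right[OF has_integral_cis_int[of "int k - int n"], of "b k * of_real (\<rho> ^ k * inverse \<rho> ^ n)"] r
      by (auto simp: power_mult_distrib[symmetric] mult_ac)
  qed
  have PI: "(P N has_integral (\<Sum>k<N. if k = n then 2 * pi * b n else 0)) {-pi..pi}" for N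
    unfolding P_def[abs_def] by (rule has_integral_sum) (simp_all only: finite_lessThan trm)
  obtain I J where I: "\<And>N. (P N has_integral I N) {-pi..pi}"
    and J: "((\<lambda>\<theta>. \<Sum>k. b k * q \<theta> ^ k * inverse (q \<theta>) ^ n) has_integral J) {-pi..pi}" and lim: "I \<longlonglongrightarrow> J"
    using uniform_limit_integral[OF ul cont] by auto
  have Ieq: "I N = 2 * pi * b n" if "N > n" for N
    using has_integral_unique[OF I PI] that by (simp add: sum.delta)
  have "I \<longlonglongrightarrow> 2 * pi * b n"
    by (rule tendsto_eventually) (auto simp: eventually_sequentially Ieq intro!: exI[of _ "Suc n"])
  with lim have "J = 2 * pi * b n" by (rule LIMSEQ_unique)
  moreover have "(\<Sum>k. b k * q \<theta> ^ k * inverse (q \<theta>) ^ n) = (\<Sum>k. b k * q \<theta> ^ k) * inverse (q \<theta>) ^ n" for \<theta>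
    by (rule suminf_mult2[symmetric], rule summable_norm_cancel) (use s in \<open>simp add: norm_mult norm_power nq\<close>)
  ultimately show ?thesis using J by (simp add: q_def)
qed

text \<open>A bound for a power series on the circle of radius \<open>exp (- 1 / (N + 1))\<close> bounds its partial
  sums up to an arbitrarily small power of \<open>N\<close>: convolve with the kernel
  \<open>\<Sum>k\<le>N. q ^ (- k)\<close>, which is at most a multiple of \<open>(N + 1) powr \<epsilon> * \<bar>\<theta>\<bar> powr (\<epsilon> - 1)\<close>.\<close>

lemma norm_partial_sum_le:
  fixes b :: "nat \<Rightarrow> complex" and N :: nat and \<epsilon> M :: real
  defines "\<rho> \<equiv> exp (- (1 / (real N + 1)))"
  assumes e: "0 < \<epsilon>" "\<epsilon> \<le> 1" and s: "summable (\<lambda>k. norm (b k) * \<rho> ^ k)"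
    and M: "\<And>\<theta>. norm (\<Sum>k. b k * (of_real \<rho> * cis \<theta>) ^ k) \<le> M"
  shows "norm (\<Sum>k\<le>N. b k) \<le> 48 * pi powr \<epsilon> / \<epsilon> * M * (real N + 1) powr \<epsilon>"
proof -
  define q where "q \<theta> = of_real \<rho> * cis \<theta>" for \<theta>
  define K where "K \<theta> = (\<Sum>k\<le>N. inverse (q \<theta>) ^ k)" for \<theta>
  have r0: "0 < \<rho>" and r1: "\<rho> < 1" by (auto simp: \<rho>_def)
  have M0: "0 \<le> M" using order_trans[OF norm_ge_zero M] .
  have "exp (-1::real) \<le> \<rho>" by (auto simp: \<rho>_def)
  moreover have "(1::real) / 3 \<le> exp (- 1)"
    using exp_le by (simp add: exp_minus field_simps)
  ultimately have r3: "1/3 \<le> \<rho>" by linarith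
  have q0: "q \<theta> \<noteq> 0" for \<theta> using r0 by (simp add: q_def)
  have nq: "norm (q \<theta>) = \<rho>" for \<theta> using r0 by (simp add: q_def norm_mult)
  \<comment> \<open>The radius is chosen so that this power is exactly \<open>exp 1\<close>; it
    bounds every power in the kernel and in its geometric sum.\<close>
  have rN: "inverse \<rho> ^ (Suc N) \<le> 3"
  proof -
    have "inverse \<rho> ^ (Suc N) = exp (1::real)"
      unfolding \<rho>_def by (simp add: exp_minus[symmetric] exp_of_nat_mult[symmetric] add.commute del: power_Suc)
    then show ?thesis using exp_le by simp
  qed
  have rk: "inverse \<rho> ^ k \<le> 3" if "k \<le> Suc N" for k
    by (rule order_trans[OF power_increasing[OF that] rN]) (use r0 r1 in \<open>simp add: one_le_inverse\<close>)
  have K1: "norm (K \<theta>) \<le> 3 * (real N + 1)" for \<theta>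
  proof -
    have "norm (K \<theta>) \<le> (\<Sum>k\<le>N. 3)" unfolding K_def
      by (rule sum_norm_le) (use rk in \<open>auto simp: norm_power norm_inverse nq\<close>)
    then show ?thesis by simp
  qed
  have K2: "norm (K \<theta>) * \<bar>\<theta>\<bar> \<le> 24" if "\<bar>\<theta>\<bar> \<le> pi" for \<theta>
  proof -
    have "(1 - inverse (q \<theta>)) * K \<theta> = 1 - inverse (q \<theta>) ^ Suc N"
      unfolding K_def by (simp add: one_diff_power_eq lessThan_Suc_atMost del: power_Suc)
    then have "norm (1 - inverse (q \<theta>)) * norm (K \<theta>) = norm (1 - inverse (q \<theta>) ^ Suc N)"
      by (metis norm_mult)
    also have "\<dots> \<le> 1 + inverse \<rho> ^ Suc N"
      by (rule order_trans[OF norm_triangle_ineq4]) (simp add: norm_mult norm_power norm_inverse nq)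
    also have "\<dots> \<le> 4" using rN by simp
    finally have a: "norm (1 - inverse (q \<theta>)) * norm (K \<theta>) \<le> 4" .
    have "\<rho> * norm (1 - inverse (q \<theta>)) = norm (q \<theta> * (1 - inverse (q \<theta>)))" by (simp add: norm_mult nq)
    also have "q \<theta> * (1 - inverse (q \<theta>)) = - (1 - q \<theta>)" using q0[of \<theta>] by (simp add: field_simps)
    finally have "\<bar>\<theta>\<bar> / 6 \<le> \<rho> * norm (1 - inverse (q \<theta>))"
      using norm_one_minus_cis_ge[OF r3 r1 that] unfolding norm_minus_cancel q_def by linarith
    also have "\<dots> \<le> norm (1 - inverse (q \<theta>))" using r1 r0 by (simp add: mult_left_le_one_le)
    finally have "\<bar>\<theta>\<bar> / 6 * norm (K \<theta>) \<le> 4" using a by (meson mult_right_mono norm_ge_zero order_trans)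
    then show ?thesis by (simp add: mult.commute)
  qed
  \<comment> \<open>Interpolation of the two kernel bounds with weights \<open>\<epsilon>\<close>
    and \<open>1 - \<epsilon>\<close> gives a majorant integrable at 0. The point 0 is set apart
    because there \<open>\<bar>\<theta>\<bar> powr (\<epsilon> - 1)\<close> has the value 0.\<close>
  define B where "B \<theta> = (if \<theta> = 0 then M * (3 * (real N + 1)) else M * (24 * (real N + 1) powr \<epsilon> * \<bar>\<theta>\<bar> powr (\<epsilon> - 1)))" for \<theta>
  have KB: "M * norm (K \<theta>) \<le> B \<theta>" if t: "\<bar>\<theta>\<bar> \<le> pi" for \<theta>
  proof (cases "\<theta> = 0")
    case True
    then show ?thesis using K1[of \<theta>] M0 by (simp add: B_def mult_left_mono)
  next
    case False
    have "norm (K \<theta>) = norm (K \<theta>) powr \<epsilon> * norm (K \<theta>) powr (1 - \<epsilon>)"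
      by (simp add: powr_add[symmetric])
    also have "\<dots> \<le> (24 * (real N + 1)) powr \<epsilon> * (24 / \<bar>\<theta>\<bar>) powr (1 - \<epsilon>)"
    proof (intro mult_mono powr_mono2)
      show "norm (K \<theta>) \<le> 24 * (real N + 1)" using K1[of \<theta>] by simp
      show "norm (K \<theta>) \<le> 24 / \<bar>\<theta>\<bar>" using K2[OF t] False by (simp add: field_simps)
    qed (use e in auto)
    also have "\<dots> = (24 powr \<epsilon> * 24 powr (1 - \<epsilon>)) * ((real N + 1) powr \<epsilon> * \<bar>\<theta>\<bar> powr (\<epsilon> - 1))"
    proof -
      have 1: "(24 * (real N + 1)) powr \<epsilon> = 24 powr \<epsilon> * (real N + 1) powr \<epsilon>" by (subst powr_mult) auto
      have 2: "(24 / \<bar>\<theta>\<bar>) powr (1 - \<epsilon>) = 24 powr (1 - \<epsilon>) * \<bar>\<theta>\<bar> powr (\<epsilon> - 1)"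
        using powr_minus[of "\<bar>\<theta>\<bar>" "1 - \<epsilon>"] unfolding powr_divide by (simp add: divide_inverse)
      show ?thesis unfolding 1 2 by (simp add: mult_ac)
    qed
    also have "24 powr \<epsilon> * 24 powr (1 - \<epsilon>) = (24::real)" by (simp add: powr_add[symmetric])
    finally show ?thesis using False M0 by (simp add: B_def mult_left_mono mult.assoc)
  qed
  have BI: "(B has_integral (M * (24 * (real N + 1) powr \<epsilon> * (2 * pi powr \<epsilon> / \<epsilon>)))) {-pi..pi}"
    by (rule has_integral_spike_finite[of "{0}", OF _ _ has_integral_mult_right[OF has_integral_mult_right[OF has_integral_abs_powr]]])
       (use e in \<open>auto simp: B_def\<close>)
  have I: "((\<lambda>\<theta>. (\<Sum>k. b k * q \<theta> ^ k) * K \<theta>) has_integral (\<Sum>k\<le>N. 2 * pi * b k)) {-pi..pi}"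
    unfolding K_def sum_distrib_left q_def
    by (rule has_integral_sum) (simp_all only: finite_atMost powser_coeff_integral[OF r0 s])
  have "norm (\<Sum>k\<le>N. 2 * pi * b k) \<le> M * (24 * (real N + 1) powr \<epsilon> * (2 * pi powr \<epsilon> / \<epsilon>))"
    unfolding integral_unique[OF I, symmetric] integral_unique[OF BI, symmetric]
  proof (rule integral_norm_bound_integral)
    fix \<theta> assume "\<theta> \<in> {-pi..pi}"
    then have "M * norm (K \<theta>) \<le> B \<theta>" by (intro KB) auto
    moreover have "norm ((\<Sum>k. b k * q \<theta> ^ k) * K \<theta>) \<le> M * norm (K \<theta>)"
      unfolding norm_mult using M[of \<theta>] by (intro mult_right_mono) (auto simp: q_def)
    ultimately show "norm ((\<Sum>k. b k * q \<theta> ^ k) * K \<theta>) \<le> B \<theta>" by linarith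
  qed (use I BI in blast)+
  moreover have "norm (\<Sum>k\<le>N. 2 * pi * b k) = 2 * pi * norm (\<Sum>k\<le>N. b k)"
    by (simp add: sum_distrib_left[symmetric] norm_mult)
  moreover have "1 * norm (\<Sum>k\<le>N. b k) \<le> 2 * pi * norm (\<Sum>k\<le>N. b k)"
    using pi_ge_two by (intro mult_right_mono) auto
  ultimately have "norm (\<Sum>k\<le>N. b k) \<le> M * (24 * (real N + 1) powr \<epsilon> * (2 * pi powr \<epsilon> / \<epsilon>))" by linarith
  then show ?thesis by (simp add: field_simps)
qed

section \<open>Summation by parts, uniformly up to the real axis\<close>

lemma abel_summation:
  fixes b :: "nat \<Rightarrow> complex" and W :: "nat \<Rightarrow> real"
  shows "(\<Sum>k<n. b k * of_real (W k)) = (\<Sum>k<n. (\<Sum>i\<le>k. b i) * of_real (W k - W (Suc k))) + (\<Sum>k<n. b k) * of_real (W n)"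
  by (induction n) (simp_all add: lessThan_Suc_atMost[symmetric] algebra_simps)

text \<open>Partial sums of order \<open>n powr q\<close> meet weight differences of order
  \<open>n powr (- p - 1)\<close>, so the transformed series converges like the sum of
  \<open>n powr (q - p - 1)\<close>; the boundary term is of order \<open>n powr (q - p)\<close> and
  vanishes in the limit. All bounds are uniform in \<open>z\<close>.\<close>

lemma uniformly_convergent_abel:
  fixes b :: "nat \<Rightarrow> 'a \<Rightarrow> complex" and W :: "nat \<Rightarrow> 'a \<Rightarrow> real"
  assumes q: "q < p" "0 \<le> q"
    and B: "\<And>n z. z \<in> S \<Longrightarrow> norm (\<Sum>k\<le>n. b k z) \<le> C * (real n + 1) powr q"
    and D: "\<And>n z. z \<in> S \<Longrightarrow> \<bar>W n z - W (Suc n) z\<bar> \<le> C' * (real n + 1) powr (- p - 1)"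
    and W: "\<And>n z. z \<in> S \<Longrightarrow> \<bar>W n z\<bar> \<le> C' * (real n + 1) powr (- p)"
  shows "uniformly_convergent_on S (\<lambda>n z. \<Sum>k<n. b k z * of_real (W k z))"
proof (cases "S = {}")
  case False
  then obtain z0 where z0: "z0 \<in> S" by blast
  have C: "0 \<le> C" using order_trans[OF norm_ge_zero B[OF z0, of 0]] by simp
  have C': "0 \<le> C'" using order_trans[OF abs_ge_zero W[OF z0, of 0]] by simp
  have "uniformly_convergent_on S (\<lambda>n z. \<Sum>k<n. (\<Sum>i\<le>k. b i z) * of_real (W k z - W (Suc k) z))"
  proof (rule Weierstrass_m_test')
    fix n z assume z: "z \<in> S"
    have "norm ((\<Sum>i\<le>n. b i z) * of_real (W n z - W (Suc n) z)) \<le> (C * (real n + 1) powr q) * (C' * (real n + 1) powr (- p - 1))"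
      unfolding norm_mult norm_of_real using C by (intro mult_mono B D z) auto
    also have "\<dots> = C * C' * (real (n + 1) powr (q - p - 1))"
    proof -
      have "(real n + 1) powr q * (real n + 1) powr (- p - 1) = real (n + 1) powr (q - p - 1)"
        by (subst powr_add[symmetric]) (simp add: algebra_simps)
      then show ?thesis by (simp add: mult_ac)
    qed
    finally show "norm ((\<Sum>i\<le>n. b i z) * of_real (W n z - W (Suc n) z)) \<le> C * C' * (real (n + 1) powr (q - p - 1))" .
  next
    have "summable (\<lambda>n. real n powr (q - p - 1))" using q by (subst summable_real_powr_iff) auto
    then show "summable (\<lambda>n. C * C' * (real (n + 1) powr (q - p - 1)))"
      by (intro summable_mult summable_ignore_initial_segment)
  qed
  moreover have "uniform_limit S (\<lambda>n z. (\<Sum>k<n. b k z) * of_real (W n z)) (\<lambda>_. 0) sequentially"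
  proof (rule uniform_limitI)
    fix e :: real assume e: "0 < e"
    have "((\<lambda>n. C * C' * real n powr (q - p)) \<longlongrightarrow> C * C' * 0) sequentially"
      using q by (intro tendsto_intros tendsto_neg_powr filterlim_real_sequentially) auto
    then have "eventually (\<lambda>n. C * C' * real n powr (q - p) < e) sequentially"
      using e by (intro order_tendstoD) auto
    then show "eventually (\<lambda>n. \<forall>z\<in>S. dist ((\<Sum>k<n. b k z) * of_real (W n z)) 0 < e) sequentially"
      using eventually_gt_at_top[of 0]
    proof eventually_elim
      case (elim n)
      then obtain m where m: "n = Suc m" by (cases n) auto
      have "norm ((\<Sum>k<n. b k z) * of_real (W n z)) \<le> C * C' * real n powr (q - p)" if z: "z \<in> S" for z
      proof -
        have "norm ((\<Sum>k<n. b k z) * of_real (W n z)) \<le> (C * (real m + 1) powr q) * (C' * (real n + 1) powr (- p))"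
          unfolding norm_mult norm_of_real m lessThan_Suc_atMost using C by (intro mult_mono B W[of z "Suc m"] z) auto
        also have "\<dots> \<le> (C * real n powr q) * (C' * real n powr (- p))"
        proof (intro mult_mono)
          show "(real m + 1) powr q \<le> real n powr q" by (simp add: m add.commute)
          show "(real n + 1) powr (- p) \<le> real n powr (- p)" using q m by (intro powr_mono2') auto
        qed (use C C' in auto)
        also have "\<dots> = C * C' * real n powr (q - p)" by (simp add: powr_add[symmetric] mult_ac)
        finally show ?thesis .
      qed
      with elim show ?case by (auto simp: dist_norm intro: le_less_trans)
    qed
  qed
  then have "uniformly_convergent_on S (\<lambda>n z. (\<Sum>k<n. b k z) * of_real (W n z))"
    by (rule uniformly_convergentI)
  ultimately have "uniformly_convergent_on S (\<lambda>n z. (\<Sum>k<n. (\<Sum>i\<le>k. b i z) * of_real (W k z - W (Suc k) z))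
      + (\<Sum>k<n. b k z) * of_real (W n z))"
    by (rule uniformly_convergent_add)
  moreover have "(\<lambda>n z. (\<Sum>k<n. (\<Sum>i\<le>k. b i z) * of_real (W k z - W (Suc k) z)) + (\<Sum>k<n. b k z) * of_real (W n z))
      = (\<lambda>n z. \<Sum>k<n. b k z * of_real (W k z))"
    by (intro ext abel_summation[symmetric])
  ultimately show ?thesis by (simp only:)
qed (auto intro: uniformly_convergentI[of _ _ "\<lambda>_. 0"])

text \<open>Mean value theorem. Since \<open>v * z * exp (- (v * z)) \<le> 1\<close>, the bound is
  free of \<open>v\<close>; this uniformity lets the height in the half plane go down to 0.\<close>

lemma powr_exp_diff_le:
  fixes l p v :: real
  assumes l: "0 < l" and p: "0 < p" and v: "0 \<le> v"
  shows "\<bar>l powr (- p) * exp (- (v * l)) - (l + 1) powr (- p) * exp (- (v * (l + 1)))\<bar> \<le> (p + 1) * l powr (- p - 1)"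
proof -
  define W where "W u = u powr (- p) * exp (- (v * u))" for u
  define W' where "W' u = - (u powr (- p - 1) * exp (- (v * u)) * (p + v * u))" for u
  have d: "(W has_real_derivative W' u) (at u)" if "0 < u" for u
  proof -
    have "u powr (- p) = u powr (- p - 1) * u" using that by (simp add: powr_diff)
    then show ?thesis unfolding W_def W'_def using that
      by (auto intro!: derivative_eq_intros simp: field_simps powr_diff)
  qed
  obtain z where z: "l < z" "z < l + 1" "W (l + 1) - W l = (l + 1 - l) * W' z"
    using MVT2[of l "l + 1" W W'] l d by auto
  have "(p + v * z) * exp (- (v * z)) \<le> p + 1"
  proof -
    have "v * z * exp (- (v * z)) \<le> 1"
    proof -
      have "v * z \<le> exp (v * z)" using exp_ge_add_one_self[of "v * z"] by linarith
      then show ?thesis by (simp add: exp_minus field_simps)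
    qed
    moreover have "p * exp (- (v * z)) \<le> p" using p v z l by simp
    ultimately show ?thesis by (simp add: algebra_simps)
  qed
  then have "(p + v * z) * exp (- (v * z)) * z powr (- p - 1) \<le> (p + 1) * l powr (- p - 1)"
    using z l p v by (intro mult_mono powr_mono2') auto
  moreover have "\<bar>W' z\<bar> = (p + v * z) * exp (- (v * z)) * z powr (- p - 1)"
    using z l p v by (simp add: W'_def abs_mult mult_ac)
  ultimately show ?thesis using z(3) unfolding W_def by (simp add: abs_minus_commute)
qed

locale qseries_bounded = qseries +
  fixes a0 :: real
  assumes a0: "0 < a0" and bound: "\<exists>C. \<forall>z. 0 < Im z \<and> Im z \<le> 1 \<longrightarrow> norm (fs 0 z) \<le> C * Im z powr (- a0)"
begin

lemma bound_upto:
  obtains C where "0 \<le> C" "\<And>z. 0 < Im z \<Longrightarrow> Im z \<le> Y \<Longrightarrow> norm (fs 0 z) \<le> C * Im z powr (- a0)"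
proof -
  obtain C1 where C1: "\<And>z. 0 < Im z \<Longrightarrow> Im z \<le> 1 \<Longrightarrow> norm (fs 0 z) \<le> C1 * Im z powr (- a0)"
    using bound by blast
  obtain C2 where C2: "0 \<le> C2" "\<And>z. 1 \<le> Im z \<Longrightarrow> norm (fs 0 z) \<le> C2 * exp (- (w * low * Im z))"
    using fs_decay[of 1 0] by auto
  have "norm (fs 0 z) \<le> (\<bar>C1\<bar> + C2 * \<bar>Y\<bar> powr a0) * Im z powr (- a0)" if z: "0 < Im z" "Im z \<le> Y" for z
  proof (cases "Im z \<le> 1")
    case True
    have "norm (fs 0 z) \<le> C1 * Im z powr (- a0)" using C1 z True by blast
    also have "\<dots> \<le> (\<bar>C1\<bar> + C2 * \<bar>Y\<bar> powr a0) * Im z powr (- a0)"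
      using C2(1) by (intro mult_right_mono) (auto intro: add_increasing2)
    finally show ?thesis .
  next
    case False
    have "norm (fs 0 z) \<le> C2 * 1"
      by (rule order_trans[OF C2(2)]) (use False C2(1) w low_pos in \<open>auto intro!: mult_left_le\<close>)
    also have "\<dots> \<le> C2 * (\<bar>Y\<bar> powr a0 * Im z powr (- a0))"
    proof (intro mult_left_mono C2(1))
      have "Im z powr a0 \<le> \<bar>Y\<bar> powr a0" using z a0 by (intro powr_mono2) auto
      then show "1 \<le> \<bar>Y\<bar> powr a0 * Im z powr (- a0)" using z by (simp add: powr_minus field_simps)
    qed
    also have "\<dots> \<le> (\<bar>C1\<bar> + C2 * \<bar>Y\<bar> powr a0) * Im z powr (- a0)" by (simp add: algebra_simps)
    finally show ?thesis .
  qed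
  then show ?thesis by (intro that[of "\<bar>C1\<bar> + C2 * \<bar>Y\<bar> powr a0"]) (use C2 in auto)
qed

text \<open>The first \<open>n + 1\<close> terms are seen at height
  \<open>1 / (w * (real n + 1))\<close>, where the growth condition gives
  \<open>(real n + 1) powr a0\<close>. The summation kernel adds an arbitrarily small power, hence
  \<open>q > a0\<close>.\<close>

lemma partial_sums_bound:
  assumes q: "a0 < q"
  obtains C where "\<And>n t. norm (\<Sum>k\<le>n. c k * exp (\<i> * of_real (w * lam k * t))) \<le> C * (real n + 1) powr q"
proof -
  define e where "e = min (q - a0) 1"
  have e: "0 < e" "e \<le> 1" using q by (auto simp: e_def)
  obtain C where C: "0 \<le> C" "\<And>z. 0 < Im z \<Longrightarrow> Im z \<le> 1 / w \<Longrightarrow> norm (fs 0 z) \<le> C * Im z powr (- a0)"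
    using bound_upto by blast
  have "norm (\<Sum>k\<le>n. c k * exp (\<i> * of_real (w * lam k * t))) \<le>
     48 * pi powr e / e * exp \<kappa> * C * w powr a0 * (real n + 1) powr q" for n t
  proof -
    define y where "y = 1 / (w * (real n + 1))"
    define \<rho> where "\<rho> = exp (- (1 / (real n + 1)))"
    define b where "b k = c k * exp (\<i> * of_real (w * lam k * t))" for k
    have y: "0 < y" "y \<le> 1 / w" "w * y = 1 / (real n + 1)" using w by (auto simp: y_def divide_simps)
    have wy: "w * y \<le> 1" unfolding y(3) by simp
    have rhoy: "\<rho> = exp (- (w * y))" by (simp add: \<rho>_def y(3))
    have s: "summable (\<lambda>k. norm (b k) * \<rho> ^ k)"
    proof -
      have "summable (\<lambda>k. exp (w * \<kappa> * y) * (norm (c k) * exp (- (w * (real k + \<kappa>) * y))))"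
        by (intro summable_mult conv y)
      moreover have "exp (w * \<kappa> * y) * (norm (c k) * exp (- (w * (real k + \<kappa>) * y))) = norm (b k) * \<rho> ^ k" for k
        by (simp add: b_def norm_mult rhoy exp_of_nat_mult[symmetric] exp_add[symmetric] algebra_simps)
      ultimately show ?thesis by simp
    qed
    have M: "norm (\<Sum>k. b k * (of_real \<rho> * cis \<theta>) ^ k) \<le> exp \<kappa> * C * y powr (- a0)" for \<theta>
    proof -
      \<comment> \<open>The power series with coefficients \<open>b\<close> on the circle of radius
        \<open>\<rho>\<close> is \<open>fs 0\<close> at height \<open>y\<close>, the angle acting as
        a horizontal shift, up to a factor of modulus \<open>exp (\<kappa> * (w * y))\<close> that
        comes from \<open>lam k = real k + \<kappa>\<close>.\<close>
      define z where "z = of_real (t + \<theta> / w) + \<i> * of_real y"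
      have z: "0 < Im z" "Im z = y" using y by (auto simp: z_def)
      have qe: "of_real \<rho> * cis \<theta> = exp (\<i> * (of_real \<theta> + \<i> * of_real (w * y)))"
        by (simp add: rhoy cis_conv_exp exp_of_real[symmetric] exp_add[symmetric] algebra_simps)
      have "b k * (of_real \<rho> * cis \<theta>) ^ k = exp (- (\<i> * of_real \<kappa> * (of_real \<theta> + \<i> * of_real (w * y)))) * tm 0 k z" for k
      proof (cases "c k = 0")
        case False
        have "\<i> * of_real (w * lam k) * z = \<i> * of_real (w * lam k * t) + of_real (lam k) * (\<i> * (of_real \<theta> + \<i> * of_real (w * y)))"
          using w by (simp add: z_def field_simps)
        then have "tm 0 k z = c k * exp (\<i> * of_real (w * lam k * t)) * exp (of_real (lam k) * (\<i> * (of_real \<theta> + \<i> * of_real (w * y))))"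
          using lam_pos[OF False] by (simp add: tm_def exp_add)
        moreover have "exp (- (\<i> * of_real \<kappa> * (of_real \<theta> + \<i> * of_real (w * y)))) *
            exp (of_real (lam k) * (\<i> * (of_real \<theta> + \<i> * of_real (w * y)))) = (of_real \<rho> * cis \<theta>) ^ k"
          unfolding qe exp_of_nat_mult[symmetric] exp_add[symmetric]
          by (simp add: lam_def algebra_simps)
        ultimately show ?thesis by (simp add: b_def mult_ac)
      qed (simp add: b_def tm_def)
      then have "(\<Sum>k. b k * (of_real \<rho> * cis \<theta>) ^ k) = exp (- (\<i> * of_real \<kappa> * (of_real \<theta> + \<i> * of_real (w * y)))) * fs 0 z"
        unfolding fs_def by (simp add: suminf_mult summable_norm_cancel[OF summable_norm_tm[OF z(1)]])
      then have "norm (\<Sum>k. b k * (of_real \<rho> * cis \<theta>) ^ k) = exp (\<kappa> * (w * y)) * norm (fs 0 z)"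
        by (simp add: norm_mult)
      also have "\<dots> \<le> exp \<kappa> * (C * y powr (- a0))"
        using mult_left_le[OF wy kappa] C(2)[of z] z y wy kappa by (intro mult_mono) auto
      finally show ?thesis by (simp add: mult.assoc)
    qed
    have "norm (\<Sum>k\<le>n. b k) \<le> 48 * pi powr e / e * (exp \<kappa> * C * y powr (- a0)) * (real n + 1) powr e"
      by (rule norm_partial_sum_le[OF e]) (use s M in \<open>auto simp: \<rho>_def\<close>)
    also have "y powr (- a0) = w powr a0 * (real n + 1) powr a0"
      using w by (simp add: y_def powr_minus powr_divide powr_mult)
    also have "48 * pi powr e / e * (exp \<kappa> * C * (w powr a0 * (real n + 1) powr a0)) * (real n + 1) powr e
       = 48 * pi powr e / e * exp \<kappa> * C * w powr a0 * (real n + 1) powr (a0 + e)"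
      by (simp add: powr_add)
    also have "\<dots> \<le> 48 * pi powr e / e * exp \<kappa> * C * w powr a0 * (real n + 1) powr q"
      using e C(1) by (intro mult_left_mono powr_mono) (auto simp: e_def)
    finally show ?thesis by (simp add: b_def)
  qed
  then show ?thesis by (rule that)
qed

text \<open>Each term is split into the coefficient with its phase on the real line, whose partial
  sums have some order \<open>q < \<alpha>\<close>, and a real weight
  \<open>lam k powr (- \<alpha>) * exp (- (w * Im z * lam k))\<close>, whose variation is bounded
  independently of \<open>Im z \<ge> 0\<close>.\<close>

lemma tm_uniformly_convergent:
  assumes al: "a0 < \<alpha>"
  shows "uniformly_convergent_on {z. 0 \<le> Im z} (\<lambda>n z. \<Sum>k<n. tm \<alpha> k z)"
proof -
  obtain q where q: "a0 < q" "q < \<alpha>" using dense al by blast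
  obtain C where C: "\<And>n t. norm (\<Sum>k\<le>n. c k * exp (\<i> * of_real (w * lam k * t))) \<le> C * (real n + 1) powr q"
    using partial_sums_bound[OF q(1)] by blast
  have al0: "0 < \<alpha>" using al a0 by linarith
  define W where "W k z = lam k powr (- \<alpha>) * exp (- (w * Im z * lam k))" for k z
  \<comment> \<open>The first summand serves \<open>n > 0\<close>, where \<open>lam n\<close> is at
    least \<open>(real n + 1) / 2\<close>; the second serves \<open>n = 0\<close>, where
    \<open>lam n\<close> is only \<open>\<kappa>\<close>.\<close>
  define C' where "C' = 2 powr (\<alpha> + 1) * (\<alpha> + 1) + 2 * low powr (- \<alpha>)"
  have lam1: "(real n + 1) / 2 \<le> lam n" "0 < lam n" if "n \<noteq> 0" for n using kappa that by (auto simp: lam_def field_simps)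
  have Wlow: "\<bar>W n z\<bar> \<le> low powr (- \<alpha>)" if "0 \<le> Im z" for n z
  proof -
    have "lam n powr (- \<alpha>) \<le> low powr (- \<alpha>)"
    proof (cases "lam n = 0")
      case False
      then have "low \<le> lam n" using kappa by (cases n) (auto simp: lam_def low_def)
      then show ?thesis using low_pos al0 by (intro powr_mono2') auto
    qed simp
    moreover have "exp (- (w * Im z * lam n)) \<le> 1" using that w kappa by (simp add: lam_def)
    ultimately have "lam n powr (- \<alpha>) * exp (- (w * Im z * lam n)) \<le> low powr (- \<alpha>) * 1" by (intro mult_mono) auto
    then show ?thesis by (simp add: W_def)
  qed
  have "uniformly_convergent_on {z. 0 \<le> Im z} (\<lambda>n z. \<Sum>k<n. (c k * exp (\<i> * of_real (w * lam k * Re z))) * of_real (W k z))"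
  proof (rule uniformly_convergent_abel[OF q(2)])
    show "0 \<le> q" using q a0 by linarith
    fix n and z :: complex assume "z \<in> {z. 0 \<le> Im z}"
    then have z: "0 \<le> Im z" by simp
    show "norm (\<Sum>k\<le>n. c k * exp (\<i> * of_real (w * lam k * Re z))) \<le> C * (real n + 1) powr q" by (rule C)
    show "\<bar>W n z - W (Suc n) z\<bar> \<le> C' * (real n + 1) powr (- \<alpha> - 1)"
    proof (cases "n = 0")
      case True
      have "\<bar>W n z - W (Suc n) z\<bar> \<le> 2 * low powr (- \<alpha>)" using Wlow[OF z, of n] Wlow[OF z, of "Suc n"] by linarith
      moreover have "0 \<le> 2 powr (\<alpha> + 1) * (\<alpha> + 1)" using al0 by simp
      ultimately have "\<bar>W n z - W (Suc n) z\<bar> \<le> C'" unfolding C'_def by linarith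
      then show ?thesis using True by simp
    next
      case False
      have "\<bar>W n z - W (Suc n) z\<bar> \<le> (\<alpha> + 1) * lam n powr (- \<alpha> - 1)"
        using powr_exp_diff_le[OF lam1(2)[OF False] al0, of "w * Im z"] z w
        by (simp add: W_def lam_def algebra_simps)
      also have "\<dots> \<le> (\<alpha> + 1) * ((real n + 1) / 2) powr (- \<alpha> - 1)"
        using al0 lam1[OF False] by (intro mult_left_mono powr_mono2') auto
      also have "\<dots> = 2 powr (\<alpha> + 1) * (\<alpha> + 1) * (real n + 1) powr (- \<alpha> - 1)"
        by (simp add: powr_divide powr_diff powr_minus powr_add field_simps)
      also have "\<dots> \<le> C' * (real n + 1) powr (- \<alpha> - 1)"
        unfolding C'_def by (intro mult_right_mono) auto
      finally show ?thesis .
    qed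
    show "\<bar>W n z\<bar> \<le> C' * (real n + 1) powr (- \<alpha>)"
    proof (cases "n = 0")
      case True
      then show ?thesis using Wlow[OF z, of n] al0 by (simp add: C'_def add_increasing)
    next
      case False
      have "\<bar>W n z\<bar> \<le> lam n powr (- \<alpha>) * 1"
        unfolding W_def abs_mult using z w lam1[OF False] by (intro mult_mono) auto
      also have "\<dots> \<le> ((real n + 1) / 2) powr (- \<alpha>)"
        using al0 lam1[OF False] by (simp add: powr_mono2')
      also have "\<dots> = 2 powr \<alpha> * (real n + 1) powr (- \<alpha>)"
        by (simp add: powr_divide powr_minus field_simps)
      also have "\<dots> \<le> C' * (real n + 1) powr (- \<alpha>)"
      proof (rule mult_right_mono)
        have "2 powr \<alpha> * 1 \<le> 2 powr (\<alpha> + 1) * (\<alpha> + 1)" using al0 by (intro mult_mono) auto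
        then show "2 powr \<alpha> \<le> C'" unfolding C'_def using powr_ge_zero[of low "- \<alpha>"] by linarith
      qed simp
      finally show ?thesis .
    qed
  qed
  moreover have "(c k * exp (\<i> * of_real (w * lam k * Re z))) * of_real (W k z) = tm \<alpha> k z" for k z
  proof -
    have "exp (\<i> * of_real (w * lam k) * z) = exp (\<i> * of_real (w * lam k * Re z)) * of_real (exp (- (w * Im z * lam k)))"
    proof -
      have "\<i> * of_real (w * lam k) * z = \<i> * of_real (w * lam k * Re z) + of_real (- (w * Im z * lam k))"
        by (subst (1) complex_eq[of z]) (simp add: algebra_simps)
      then show ?thesis by (simp only: exp_add exp_of_real)
    qed
    then show ?thesis by (simp add: tm_def W_def mult_ac)
  qed
  ultimately show ?thesis by simp
qed

lemma fs_uniform_limit: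
  assumes "a0 < \<alpha>"
  shows "uniform_limit {z. 0 \<le> Im z} (\<lambda>n z. \<Sum>k<n. tm \<alpha> k z) (fs \<alpha>) sequentially"
proof -
  obtain l where l: "uniform_limit {z. 0 \<le> Im z} (\<lambda>n z. \<Sum>k<n. tm \<alpha> k z) l sequentially"
    using tm_uniformly_convergent[OF assms] by (auto simp: uniformly_convergent_on_def)
  have "l z = fs \<alpha> z" if "0 \<le> Im z" for z
  proof -
    have "(\<lambda>k. tm \<alpha> k z) sums l z"
      using tendsto_uniform_limitI[OF l] that by (simp add: sums_def)
    then show ?thesis by (simp add: fs_def sums_unique)
  qed
  then show ?thesis
    by (intro uniform_limit_cong'[THEN iffD1, OF _ _ l]) auto
qed

lemma fs_continuous:
  assumes "a0 < \<alpha>"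
  shows "continuous_on {z. 0 \<le> Im z} (fs \<alpha>)"
  by (rule uniform_limit_theorem[OF _ fs_uniform_limit[OF assms]])
     (auto simp: tm_def intro!: always_eventually continuous_intros)

text \<open>As \<open>\<alpha> - 1\<close> still exceeds \<open>a0\<close>, the differentiated
  series converges uniformly on the closed half plane, and termwise differentiation extends to the
  axis.\<close>

lemma fs_deriv_boundary:
  assumes al: "a0 < \<alpha> - 1" and z: "0 \<le> Im z"
  shows "(fs \<alpha> has_field_derivative \<i> * of_real w * fs (\<alpha> - 1) z) (at z within {z. 0 \<le> Im z})"
proof -
  define S where "S = {z. 0 \<le> Im z}"
  have "\<exists>g. \<forall>x\<in>S. (\<lambda>n. tm \<alpha> n x) sums g x \<and> (g has_field_derivative \<i> * of_real w * fs (\<alpha> - 1) x) (at x within S)"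
  proof (rule has_complex_derivative_series)
    show "convex S" unfolding S_def by (rule convex_halfplane_ge)
    show "(tm \<alpha> n has_field_derivative \<i> * of_real w * tm (\<alpha> - 1) n x) (at x within S)" for n x by (rule tm_deriv)
    have "uniform_limit S (\<lambda>n z. \<i> * of_real w * (\<Sum>k<n. tm (\<alpha> - 1) k z)) (\<lambda>z. \<i> * of_real w * fs (\<alpha> - 1) z) sequentially"
      unfolding S_def by (intro bounded_linear.uniform_limit[OF bounded_linear_mult_right] fs_uniform_limit al)
    then have "\<exists>N. \<forall>n\<ge>N. \<forall>x\<in>S. dist (\<i> * of_real w * (\<Sum>k<n. tm (\<alpha> - 1) k x)) (\<i> * of_real w * fs (\<alpha> - 1) x) < e" if "0 < e" for e
      using that by (auto simp: uniform_limit_iff eventually_sequentially)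
    then show "\<exists>N. \<forall>n x. n \<ge> N \<longrightarrow> x \<in> S \<longrightarrow> cmod ((\<Sum>i<n. \<i> * of_real w * tm (\<alpha> - 1) i x) - \<i> * of_real w * fs (\<alpha> - 1) x) \<le> e"
      if "0 < e" for e
      using that by (fastforce simp: dist_norm sum_distrib_left intro: less_imp_le)
    show "\<exists>x l. x \<in> S \<and> (\<lambda>n. tm \<alpha> n x) sums l"
      using tm_sums[of \<i> \<alpha>] by (intro exI[of _ \<i>] exI[of _ "fs \<alpha> \<i>"]) (auto simp: S_def)
  qed
  then obtain g where g: "\<And>x. x \<in> S \<Longrightarrow> (\<lambda>n. tm \<alpha> n x) sums g x"
      "\<And>x. x \<in> S \<Longrightarrow> (g has_field_derivative \<i> * of_real w * fs (\<alpha> - 1) x) (at x within S)" by blast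
  have "g x = fs \<alpha> x" if "x \<in> S" for x
    using g(1)[OF that] by (simp add: fs_def sums_unique)
  then show ?thesis using has_field_derivative_transform_within[OF g(2)[of z], of 1 "fs \<alpha>"] z unfolding S_def
    by auto
qed

lemma fs_real_deriv:
  assumes al: "a0 < \<alpha> - 1"
  shows "((\<lambda>t. fs \<alpha> (of_real t)) has_vector_derivative \<i> * of_real w * fs (\<alpha> - 1) (of_real t)) (at t)"
proof -
  have 1: "(of_real has_vector_derivative (1::complex)) (at t)"
    using has_vector_derivative_of_real[OF DERIV_ident] by simp
  have "(fs \<alpha> has_field_derivative \<i> * of_real w * fs (\<alpha> - 1) (of_real t)) (at (of_real t) within range of_real)"
    by (rule DERIV_subset[OF fs_deriv_boundary[OF al]]) auto
  from field_vector_diff_chain_within[OF 1 this] show ?thesis by (simp add: o_def)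
qed

end

subsection \<open>From Peano expansions to growth bounds\<close>

lemma linepath_Cauchy_deriv:
  fixes h :: "complex \<Rightarrow> complex"
  assumes h: "continuous_on (closed_segment a b) h" and z: "z \<notin> closed_segment a b"
  shows "((\<lambda>z. fact j * contour_integral (linepath a b) (\<lambda>u. h u / (u - z) ^ Suc j)) has_field_derivative
     fact (Suc j) * contour_integral (linepath a b) (\<lambda>u. h u / (u - z) ^ Suc (Suc j))) (at z)"
proof -
  have "((\<lambda>z. contour_integral (linepath a b) (\<lambda>u. h u / (u - z) ^ Suc j)) has_field_derivative
     of_nat (Suc j) * contour_integral (linepath a b) (\<lambda>u. h u / (u - z) ^ Suc (Suc j))) (at z)"
  proof (rule Cauchy_next_derivative(2)[where S = UNIV and B = "norm (b - a)"])
    fix v assume v: "v \<in> UNIV - path_image (linepath a b)"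
    have "(\<lambda>u. h u / (u - v) ^ Suc j) contour_integrable_on (linepath a b)"
      using v by (intro contour_integrable_continuous_linepath continuous_intros h) auto
    then show "((\<lambda>u. h u / (u - v) ^ Suc j) has_contour_integral contour_integral (linepath a b) (\<lambda>u. h u / (u - v) ^ Suc j)) (linepath a b)"
      by (rule has_contour_integral_integral)
  qed (use h z in auto)
  from DERIV_cmult[OF this, of "fact j"] show ?thesis
    by (simp add: fact_Suc mult_ac)
qed

lemma linepath_Cauchy_bound:
  fixes h :: "complex \<Rightarrow> complex"
  assumes h: "continuous_on (closed_segment a b) h" and d: "0 < d"
  obtains C where "0 \<le> C" "\<And>z. (\<And>u. u \<in> closed_segment a b \<Longrightarrow> d \<le> norm (u - z)) \<Longrightarrow>
     norm (fact j * contour_integral (linepath a b) (\<lambda>u. h u / (u - z) ^ Suc j)) \<le> C"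
proof -
  have "bounded (h ` closed_segment a b)"
    by (intro compact_imp_bounded compact_continuous_image h compact_segment)
  then obtain M where M: "0 < M" "\<And>u. u \<in> closed_segment a b \<Longrightarrow> norm (h u) \<le> M"
    by (auto simp: bounded_pos)
  have "norm (fact j * contour_integral (linepath a b) (\<lambda>u. h u / (u - z) ^ Suc j)) \<le> fact j * (M / d ^ Suc j * norm (b - a))"
    if z: "\<And>u. u \<in> closed_segment a b \<Longrightarrow> d \<le> norm (u - z)" for z
  proof -
    have "norm (contour_integral (linepath a b) (\<lambda>u. h u / (u - z) ^ Suc j)) \<le> M / d ^ Suc j * norm (b - a)"
    proof (rule contour_integral_bound_linepath)
      have "z \<notin> closed_segment a b" using z[of z] d by auto
      then show "(\<lambda>u. h u / (u - z) ^ Suc j) contour_integrable_on linepath a b"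
        by (intro contour_integrable_continuous_linepath continuous_intros h) auto
      show "norm (h u / (u - z) ^ Suc j) \<le> M / d ^ Suc j" if "u \<in> closed_segment a b" for u
        unfolding norm_divide norm_power using z[OF that] M(2)[OF that] M(1) d
        by (intro frac_le power_mono) (auto simp del: power_Suc)
    qed (use M d in auto)
    then show ?thesis unfolding norm_mult norm_fact by (rule mult_left_mono) simp
  qed
  moreover have "0 \<le> fact j * (M / d ^ Suc j * norm (b - a))" using M d by simp
  ultimately show ?thesis by (rule that[rotated])
qed

lemma integral_Poisson_le:
  fixes v y lo hi :: real
  assumes y: "0 < y" and lh: "lo \<le> hi"
  shows "((\<lambda>t. 1 / ((t - v)\<^sup>2 + y\<^sup>2)) has_integral ((arctan ((hi - v) / y) - arctan ((lo - v) / y)) / y)) {lo..hi}"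
    and "(arctan ((hi - v) / y) - arctan ((lo - v) / y)) / y \<le> pi / y"
proof -
  have "((\<lambda>t. arctan ((t - v) / y) / y) has_real_derivative 1 / ((t - v)\<^sup>2 + y\<^sup>2)) (at t within {lo..hi})" for t
  proof -
    have "((\<lambda>t. arctan ((t - v) / y) / y) has_real_derivative (inverse (1 + ((t - v) / y)\<^sup>2) * (1 / y)) / y) (at t within {lo..hi})"
      using y by (auto intro!: derivative_eq_intros)
    moreover have "(inverse (1 + ((t - v) / y)\<^sup>2) * (1 / y)) / y = 1 / ((t - v)\<^sup>2 + y\<^sup>2)"
    proof -
      have "1 + ((t - v) / y)\<^sup>2 = ((t - v)\<^sup>2 + y\<^sup>2) / y\<^sup>2" using y by (simp add: power_divide add_divide_distrib)
      then show ?thesis using y by (simp add: power2_eq_square)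
    qed
    ultimately show ?thesis by simp
  qed
  then have "((\<lambda>t. 1 / ((t - v)\<^sup>2 + y\<^sup>2)) has_integral (arctan ((hi - v) / y) / y - arctan ((lo - v) / y) / y)) {lo..hi}"
    using lh by (intro fundamental_theorem_of_calculus) (auto simp: has_real_derivative_iff_has_vector_derivative)
  then show "((\<lambda>t. 1 / ((t - v)\<^sup>2 + y\<^sup>2)) has_integral ((arctan ((hi - v) / y) - arctan ((lo - v) / y)) / y)) {lo..hi}"
    by (simp add: diff_divide_distrib)
  show "(arctan ((hi - v) / y) - arctan ((lo - v) / y)) / y \<le> pi / y"
    using arctan_bounded[of "(hi - v) / y"] arctan_bounded[of "(lo - v) / y"] y
    by (intro divide_right_mono) linarith+
qed

text \<open>Let \<open>D\<close> be the distance from \<open>t\<close> to \<open>z\<close> and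
  \<open>Z\<close> that from \<open>z\<close> to \<open>x\<close>. Both are at least
  \<open>y\<close>, so \<open>\<bar>t - x\<bar> \<le> D + Z \<le> 2 * D * Z / y\<close>. Powers of
  \<open>D\<close> beyond the Poisson kernel \<open>1 / D ^ 2\<close> are replaced by powers of
  \<open>y\<close>, which uses \<open>s + 1 \<le> j\<close>, and the kernel has mass at most
  \<open>pi / y\<close> on any interval.\<close>

lemma real_segment_Cauchy_bound:
  fixes g :: "complex \<Rightarrow> complex" and z :: complex
  assumes g: "continuous_on (closed_segment (of_real (x - \<delta>)) (of_real (x + \<delta>))) g"
    and d: "0 < \<delta>" and B: "0 \<le> B" and s: "0 \<le> s" "s + 1 \<le> real j"
    and b: "\<And>t. \<bar>t - x\<bar> \<le> \<delta> \<Longrightarrow> norm (g (of_real t)) \<le> B * \<bar>t - x\<bar> powr s"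
    and y: "0 < Im z"
  shows "norm (contour_integral (linepath (of_real (x - \<delta>)) (of_real (x + \<delta>))) (\<lambda>u. g u / (u - z) ^ Suc j))
     \<le> B * 2 powr s * pi * norm (z - of_real x) powr s * Im z powr (- real j)"
proof -
  define y where "y = Im z"
  define Z where "Z = norm (z - of_real x)"
  define K where "K = B * 2 powr s * Z powr s * y powr (1 - real j)"
  have y0: "0 < y" using y by (simp add: y_def)
  have Zy: "y \<le> Z" using abs_Im_le_cmod[of "z - of_real x"] y0 by (simp add: y_def Z_def)
  have K0: "0 \<le> K" using B by (simp add: K_def)
  have ne: "of_real t - z \<noteq> 0" for t using y by (auto simp: complex_eq_iff)
  have le: "norm (g (of_real t) / (of_real t - z) ^ Suc j) \<le> K * (1 / ((t - Re z)\<^sup>2 + y\<^sup>2))" if t: "t \<in> {x - \<delta>..x + \<delta>}" for t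
  proof -
    define D where "D = norm (of_real t - z)"
    have D2: "D ^ 2 = (t - Re z)\<^sup>2 + y\<^sup>2" by (simp add: D_def y_def cmod_power2)
    have Dy: "y \<le> D" using abs_Im_le_cmod[of "of_real t - z"] y0 by (simp add: D_def y_def)
    have "\<bar>t - x\<bar> = norm ((of_real t - z) + (z - of_real x))" by (metis (no_types, opaque_lifting) diff_add_cancel add_diff_eq norm_of_real of_real_diff)
    also have "\<dots> \<le> D + Z" unfolding D_def Z_def by (rule norm_triangle_ineq)
    also have "\<dots> \<le> 2 * D * Z / y"
    proof -
      have "D * y \<le> D * Z" "y * Z \<le> D * Z" using Dy Zy y0 by (auto intro!: mult_mono)
      then show ?thesis using y0 by (simp add: field_simps)
    qed
    finally have tx: "\<bar>t - x\<bar> \<le> 2 * D * Z / y" .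
    have "norm (g (of_real t)) \<le> B * \<bar>t - x\<bar> powr s" using t by (intro b) auto
    also have "\<dots> \<le> B * (2 * D * Z / y) powr s" using tx s B by (intro mult_left_mono powr_mono2) auto
    also have "\<dots> = B * 2 powr s * Z powr s * (D powr s * y powr (- s))"
    proof -
      have "(2 * D * Z / y) powr s = 2 powr s * D powr s * Z powr s * y powr (- s)"
        unfolding powr_divide powr_mult by (simp add: powr_minus divide_inverse)
      then show ?thesis by (simp add: mult_ac)
    qed
    finally have 1: "norm (g (of_real t)) \<le> B * 2 powr s * Z powr s * (D powr s * y powr (- s))" .
    have "norm (g (of_real t) / (of_real t - z) ^ Suc j) = norm (g (of_real t)) * D powr (- (real j + 1))"
    proof -
      have "D ^ Suc j = D powr (real j + 1)" using Dy y0 powr_realpow[of D "Suc j"] by (simp add: add.commute)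
      then have "norm ((of_real t - z) ^ Suc j) = D powr (real j + 1)" unfolding norm_power D_def .
      then show ?thesis unfolding norm_divide powr_minus by (simp only: divide_inverse)
    qed
    also have "\<dots> \<le> B * 2 powr s * Z powr s * (D powr s * y powr (- s)) * D powr (- (real j + 1))"
      using 1 by (intro mult_right_mono) auto
    also have "\<dots> = B * 2 powr s * Z powr s * y powr (- s) * (D powr (- (real j - s - 1)) * D powr (- 2))"
      by (simp add: powr_add[symmetric] mult_ac) (simp add: algebra_simps)
    also have "\<dots> \<le> B * 2 powr s * Z powr s * y powr (- s) * (y powr (- (real j - s - 1)) * D powr (- 2))"
      using s Dy y0 B by (intro mult_left_mono mult_right_mono powr_mono2') auto
    also have "\<dots> = K * D powr (- 2)"
      unfolding K_def by (simp add: powr_add[symmetric] mult_ac)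
    also have "D powr (- 2) = 1 / ((t - Re z)\<^sup>2 + y\<^sup>2)"
      using Dy y0 unfolding D2[symmetric] by (simp add: powr_minus divide_inverse)
    finally show ?thesis .
  qed
  have int: "(\<lambda>u. g u / (u - z) ^ Suc j) contour_integrable_on linepath (of_real (x - \<delta>)) (of_real (x + \<delta>))"
  proof (intro contour_integrable_continuous_linepath continuous_intros g ballI)
    fix u assume "u \<in> closed_segment (complex_of_real (x - \<delta>)) (of_real (x + \<delta>))"
    then have "Im u = 0" by (auto simp: closed_segment_def)
    then show "(u - z) ^ Suc j \<noteq> 0" using y by auto
  qed
  have eq: "contour_integral (linepath (of_real (x - \<delta>)) (of_real (x + \<delta>))) (\<lambda>u. g u / (u - z) ^ Suc j)
      = integral {x - \<delta>..x + \<delta>} (\<lambda>t. g (of_real t) / (of_real t - z) ^ Suc j)"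
    by (subst contour_integral_linepath_Reals_eq) (use d in auto)
  have ri: "(\<lambda>t. g (of_real t) / (of_real t - z) ^ Suc j) integrable_on {x - \<delta>..x + \<delta>}"
    using int by (subst (asm) contour_integrable_linepath_Reals_iff) (use d in auto)
  note P = integral_Poisson_le[OF y0, of "x - \<delta>" "x + \<delta>" "Re z"]
  have "norm (integral {x - \<delta>..x + \<delta>} (\<lambda>t. g (of_real t) / (of_real t - z) ^ Suc j))
      \<le> integral {x - \<delta>..x + \<delta>} (\<lambda>t. K * (1 / ((t - Re z)\<^sup>2 + y\<^sup>2)))"
  proof (rule integral_norm_bound_integral[OF ri _ le])
    have "x - \<delta> \<le> x + \<delta>" using d by simp
    from has_integral_mult_right[OF P(1)[OF this], of K]
    show "(\<lambda>t. K * (1 / ((t - Re z)\<^sup>2 + y\<^sup>2))) integrable_on {x - \<delta>..x + \<delta>}" by blast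
  qed
  also have "\<dots> = K * ((arctan ((x + \<delta> - Re z) / y) - arctan ((x - \<delta> - Re z) / y)) / y)"
    using has_integral_mult_right[OF P(1), of K] d by (intro integral_unique) auto
  also have "\<dots> \<le> K * (pi / y)" using P(2) d K0 by (intro mult_left_mono) auto
  also have "\<dots> = B * 2 powr s * pi * Z powr s * y powr (- real j)"
    using y0 by (simp add: K_def powr_diff powr_minus divide_inverse)
  finally show ?thesis unfolding eq by (simp add: y_def Z_def)
qed

lemma deriv_seq_unique:
  fixes F G :: "nat \<Rightarrow> complex \<Rightarrow> complex"
  assumes U: "open U" and F: "\<And>j z. z \<in> U \<Longrightarrow> (F j has_field_derivative F (Suc j) z) (at z)"
    and G: "\<And>j z. z \<in> U \<Longrightarrow> (G j has_field_derivative G (Suc j) z) (at z)"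
    and eq: "\<And>z. z \<in> U \<Longrightarrow> F 0 z = G 0 z" and z: "z \<in> U"
  shows "F j z = G j z"
  using z
proof (induction j arbitrary: z)
  case (Suc j)
  have "(F j has_field_derivative G (Suc j) z) (at z)"
    by (rule has_field_derivative_transform_within_open[OF G[OF Suc.prems] U Suc.prems]) (simp add: Suc.IH)
  with F[OF Suc.prems] show ?case by (rule DERIV_unique)
qed (rule eq)

text \<open>Cauchy's formula on a rectangle above the real segment and Cauchy's theorem on its mirror image share
  the integral over the segment, so only the sum of the two boundary values enters.\<close>

lemma boundary_estimate:
  fixes D :: "nat \<Rightarrow> complex \<Rightarrow> complex" and \<Psi> :: "complex \<Rightarrow> complex"
  assumes d: "0 < \<delta>" and B: "0 \<le> B" and s: "0 \<le> s" "s + 1 \<le> real j"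
    and contD: "continuous_on {z. 0 \<le> Im z} (D 0)"
    and D: "\<And>j z. 0 < Im z \<Longrightarrow> (D j has_field_derivative D (Suc j) z) (at z)"
    and cont\<Psi>: "continuous_on {z. Im z \<le> 0} \<Psi>"
    and \<Psi>: "\<And>z. Im z < 0 \<Longrightarrow> \<Psi> field_differentiable at z"
    and b: "\<And>t. \<bar>t - x\<bar> \<le> \<delta> \<Longrightarrow> norm (D 0 (of_real t) + \<Psi> (of_real t)) \<le> B * \<bar>t - x\<bar> powr s"
  obtains C where "0 \<le> C" "\<And>z. \<bar>Re z - x\<bar> \<le> \<delta> / 2 \<Longrightarrow> 0 < Im z \<Longrightarrow> Im z \<le> \<delta> / 2 \<Longrightarrow>
     norm (D j z) \<le> C + fact j * 2 powr s * B * norm (z - of_real x) powr s * Im z powr (- real j)"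
proof -
  define a1 a2 a3 a4 b3 b4 where "a1 = Complex (x - \<delta>) 0" and "a2 = Complex (x + \<delta>) 0"
    and "a3 = Complex (x + \<delta>) \<delta>" and "a4 = Complex (x - \<delta>) \<delta>"
    and "b3 = Complex (x + \<delta>) (- \<delta>)" and "b4 = Complex (x - \<delta>) (- \<delta>)"
  note ab = a1_def a2_def a3_def a4_def b3_def b4_def
  define U where "U = box a1 a3"
  define E where "E h p q j z = fact j * contour_integral (linepath p q) (\<lambda>u. h u / (u - z) ^ Suc j)"
    for h :: "complex \<Rightarrow> complex" and p q :: complex and j :: nat and z :: complex
  define g where "g u = D 0 u + \<Psi> u" for u
  have Upos: "0 < Im z" if "z \<in> U" for z using that by (simp add: U_def in_box_complex_iff ab)
  have up: "closed_segment p q \<subseteq> cbox a1 a3" if "p \<in> {a1,a2,a3,a4}" "q \<in> {a1,a2,a3,a4}" for p q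
    using that d by (intro closed_segment_subset) (auto simp: in_cbox_complex_iff ab)
  have lo: "closed_segment p q \<subseteq> cbox b4 a2" if "p \<in> {a1,a2,b3,b4}" "q \<in> {a1,a2,b3,b4}" for p q
    using that d by (intro closed_segment_subset) (auto simp: in_cbox_complex_iff ab)
  have cD: "continuous_on (cbox a1 a3) (D 0)"
    by (rule continuous_on_subset[OF contD]) (auto simp: in_cbox_complex_iff ab)
  have cP: "continuous_on (cbox b4 a2) \<Psi>"
    by (rule continuous_on_subset[OF cont\<Psi>]) (auto simp: in_cbox_complex_iff ab)
  note cDs = continuous_on_subset[OF cD up] and cPs = continuous_on_subset[OF cP lo]
  have cg: "continuous_on (closed_segment a1 a2) g"
    unfolding g_def by (intro continuous_intros cDs cPs) auto
  have off: "z \<notin> closed_segment p q" if z: "z \<in> U" and pq: "(p, q) \<in> {(a1,a2),(a2,a3),(a3,a4),(a4,a1)}" for z p q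
    using z pq d unfolding U_def in_box_complex_iff
    by (auto simp: ab closed_segment_def complex_eq_iff algebra_simps)
  have offl: "z \<notin> closed_segment p q" if z: "z \<in> U" and pq: "(p, q) \<in> {(a1,a2),(a2,b3),(b3,b4),(b4,a1)}" for z p q
  proof -
    have "closed_segment p q \<subseteq> cbox b4 a2" using pq by (intro lo) auto
    then show ?thesis using Upos[OF z] by (auto simp: in_cbox_complex_iff ab)
  qed
  have ci: "(\<lambda>u. h u / (u - z)) contour_integrable_on linepath p q"
    if "continuous_on (closed_segment p q) h" "z \<notin> closed_segment p q" for h z p q
    using that by (intro contour_integrable_continuous_linepath continuous_intros) auto
  have upper: "2 * pi * \<i> * D 0 z = E (D 0) a1 a2 0 z + E (D 0) a2 a3 0 z + E (D 0) a3 a4 0 z + E (D 0) a4 a1 0 z" if z: "z \<in> U" for z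
  proof -
    have rp: "rectpath a1 a3 = linepath a1 a2 +++ linepath a2 a3 +++ linepath a3 a4 +++ linepath a4 a1"
      by (simp add: rectpath_def Let_def ab)
    have "((\<lambda>u. D 0 u / (u - z)) has_contour_integral (2 * pi * \<i> * winding_number (rectpath a1 a3) z * D 0 z)) (rectpath a1 a3)"
    proof (rule Cauchy_integral_formula_weak[where S = "cbox a1 a3" and k = "{}"])
      show "D 0 field_differentiable at u" if "u \<in> interior (cbox a1 a3) - {}" for u
        using that D[of u 0] Upos by (auto simp: field_differentiable_def interior_cbox U_def)
      show "path_image (rectpath a1 a3) \<subseteq> cbox a1 a3 - {z}"
        using z path_image_rectpath_subset_cbox[of a1 a3] d
        by (auto simp: U_def path_image_rectpath_cbox_minus_box ab)
    qed (use z cD in \<open>auto simp: interior_cbox U_def\<close>)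
    moreover have "winding_number (rectpath a1 a3) z = 1" using z by (intro winding_number_rectpath) (simp add: U_def)
    ultimately have h: "((\<lambda>u. D 0 u / (u - z)) has_contour_integral (2 * pi * \<i> * D 0 z)) (linepath a1 a2 +++ linepath a2 a3 +++ linepath a3 a4 +++ linepath a4 a1)"
      by (simp add: rp)
    have "((\<lambda>u. D 0 u / (u - z)) has_contour_integral
        (contour_integral (linepath a1 a2) (\<lambda>u. D 0 u / (u - z)) + (contour_integral (linepath a2 a3) (\<lambda>u. D 0 u / (u - z)) +
        (contour_integral (linepath a3 a4) (\<lambda>u. D 0 u / (u - z)) + contour_integral (linepath a4 a1) (\<lambda>u. D 0 u / (u - z))))))
        (linepath a1 a2 +++ linepath a2 a3 +++ linepath a3 a4 +++ linepath a4 a1)"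
      by (intro has_contour_integral_join has_contour_integral_integral ci cDs off[OF z]) auto
    from contour_integral_unique[OF this] contour_integral_unique[OF h] show ?thesis
      by (simp add: E_def add.assoc)
  qed
  have lower: "0 = E \<Psi> a1 a2 0 z + E \<Psi> a2 b3 0 z + E \<Psi> b3 b4 0 z + E \<Psi> b4 a1 0 z" if z: "z \<in> U" for z
  proof -
    have h: "((\<lambda>u. \<Psi> u / (u - z)) has_contour_integral 0) (linepath a1 a2 +++ linepath a2 b3 +++ linepath b3 b4 +++ linepath b4 a1)"
    proof (rule Cauchy_theorem_convex[where S = "cbox b4 a2" and K = "{}"])
      have zn: "u \<noteq> z" if "u \<in> cbox b4 a2" for u using that Upos[OF z] by (auto simp: in_cbox_complex_iff ab)
      then show "continuous_on (cbox b4 a2) (\<lambda>u. \<Psi> u / (u - z))"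
        by (intro continuous_intros cP) auto
      show "(\<lambda>u. \<Psi> u / (u - z)) field_differentiable at u" if "u \<in> interior (cbox b4 a2) - {}" for u
      proof -
        have u: "u \<in> box b4 a2" using that by (simp add: interior_cbox)
        then have "Im u < 0" by (simp add: in_box_complex_iff ab)
        then show ?thesis using zn[of u] u box_subset_cbox
          by (intro field_differentiable_divide \<Psi> field_differentiable_diff field_differentiable_ident field_differentiable_const) auto
      qed
      show "path_image (linepath a1 a2 +++ linepath a2 b3 +++ linepath b3 b4 +++ linepath b4 a1) \<subseteq> cbox b4 a2"
        using lo by (auto simp: path_image_join)
    qed auto
    have "((\<lambda>u. \<Psi> u / (u - z)) has_contour_integral
        (contour_integral (linepath a1 a2) (\<lambda>u. \<Psi> u / (u - z)) + (contour_integral (linepath a2 b3) (\<lambda>u. \<Psi> u / (u - z)) +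
        (contour_integral (linepath b3 b4) (\<lambda>u. \<Psi> u / (u - z)) + contour_integral (linepath b4 a1) (\<lambda>u. \<Psi> u / (u - z))))))
        (linepath a1 a2 +++ linepath a2 b3 +++ linepath b3 b4 +++ linepath b4 a1)"
      by (intro has_contour_integral_join has_contour_integral_integral ci cPs offl[OF z]) auto
    from contour_integral_unique[OF this] contour_integral_unique[OF h] show ?thesis
      by (simp add: E_def add.assoc)
  qed
  \<comment> \<open>The two integrals along the real segment are merged into the one of
    \<open>g\<close>. The other six sides stay at distance at least \<open>\<delta> / 2\<close> from
    the points considered and contribute only a constant.\<close>
  define T where "T j z = E g a1 a2 j z + E (D 0) a2 a3 j z + E (D 0) a3 a4 j z + E (D 0) a4 a1 j z
     + E \<Psi> a2 b3 j z + E \<Psi> b3 b4 j z + E \<Psi> b4 a1 j z" for j z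
  have T0: "2 * pi * \<i> * D 0 z = T 0 z" if z: "z \<in> U" for z
  proof -
    have "E g a1 a2 0 z = E (D 0) a1 a2 0 z + E \<Psi> a1 a2 0 z"
      unfolding E_def g_def by (simp add: add_divide_distrib contour_integral_add ci cDs cPs off[OF z])
    then show ?thesis using upper[OF z] lower[OF z] by (simp add: T_def algebra_simps)
  qed
  have ED: "(E h p q j has_field_derivative E h p q (Suc j) z) (at z)"
    if "continuous_on (closed_segment p q) h" "z \<notin> closed_segment p q" for h p q j z
    using linepath_Cauchy_deriv[OF that] unfolding E_def .
  have TD: "(T j has_field_derivative T (Suc j) z) (at z)" if z: "z \<in> U" for j z
    unfolding T_def by (intro DERIV_add ED cg cDs cPs off[OF z] offl[OF z]) auto
  have DT: "2 * pi * \<i> * D j z = T j z" if z: "z \<in> U" for j z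
    by (rule deriv_seq_unique[of U "\<lambda>j z. 2 * pi * \<i> * D j z" T])
       (use z T0 TD in \<open>auto intro!: DERIV_cmult D Upos simp: U_def open_box\<close>)
  have sides: "\<exists>C\<ge>0. \<forall>z. (\<forall>u\<in>closed_segment p q. \<delta> / 2 \<le> norm (u - z)) \<longrightarrow> norm (E h p q j z) \<le> C"
    if "continuous_on (closed_segment p q) h" for h p q
    using linepath_Cauchy_bound[OF that, of "\<delta> / 2" j] d unfolding E_def by (metis half_gt_zero)
  obtain C1 where C1: "0 \<le> C1" "\<And>z. (\<forall>u\<in>closed_segment a2 a3. \<delta> / 2 \<le> norm (u - z)) \<Longrightarrow> norm (E (D 0) a2 a3 j z) \<le> C1"
    using sides[OF cDs, of a2 a3] by auto
  obtain C2 where C2: "0 \<le> C2" "\<And>z. (\<forall>u\<in>closed_segment a3 a4. \<delta> / 2 \<le> norm (u - z)) \<Longrightarrow> norm (E (D 0) a3 a4 j z) \<le> C2"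
    using sides[OF cDs, of a3 a4] by auto
  obtain C3 where C3: "0 \<le> C3" "\<And>z. (\<forall>u\<in>closed_segment a4 a1. \<delta> / 2 \<le> norm (u - z)) \<Longrightarrow> norm (E (D 0) a4 a1 j z) \<le> C3"
    using sides[OF cDs, of a4 a1] by auto
  obtain C4 where C4: "0 \<le> C4" "\<And>z. (\<forall>u\<in>closed_segment a2 b3. \<delta> / 2 \<le> norm (u - z)) \<Longrightarrow> norm (E \<Psi> a2 b3 j z) \<le> C4"
    using sides[OF cPs, of a2 b3] by auto
  obtain C5 where C5: "0 \<le> C5" "\<And>z. (\<forall>u\<in>closed_segment b3 b4. \<delta> / 2 \<le> norm (u - z)) \<Longrightarrow> norm (E \<Psi> b3 b4 j z) \<le> C5"
    using sides[OF cPs, of b3 b4] by auto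
  obtain C6 where C6: "0 \<le> C6" "\<And>z. (\<forall>u\<in>closed_segment b4 a1. \<delta> / 2 \<le> norm (u - z)) \<Longrightarrow> norm (E \<Psi> b4 a1 j z) \<le> C6"
    using sides[OF cPs, of b4 a1] by auto
  define C where "C = C1 + C2 + C3 + C4 + C5 + C6"
  have "norm (D j z) \<le> C + fact j * 2 powr s * B * norm (z - of_real x) powr s * Im z powr (- real j)"
    if z: "\<bar>Re z - x\<bar> \<le> \<delta> / 2" "0 < Im z" "Im z \<le> \<delta> / 2" for z
  proof -
    have "- (\<delta> / 2) \<le> Re z - x" "Re z - x \<le> \<delta> / 2" using z(1) by linarith+
    then have zU: "z \<in> U" using z d by (simp add: U_def in_box_complex_iff ab)
    have re: "\<delta> / 2 \<le> norm (u - z)" if "\<bar>Re u - x\<bar> = \<delta>" for u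
      using abs_Re_le_cmod[of "u - z"] z that by (simp add: abs_if split: if_splits)
    have im: "\<delta> / 2 \<le> norm (u - z)" if "\<bar>Im u\<bar> = \<delta>" for u
      using abs_Im_le_cmod[of "u - z"] z that by (simp add: abs_if split: if_splits)
    have r2: "Re u = x + \<delta>" if "u \<in> closed_segment a2 a3 \<or> u \<in> closed_segment a2 b3" for u
      using that unfolding closed_segment_def ab by (auto simp: left_diff_distrib)
    have r1: "Re u = x - \<delta>" if "u \<in> closed_segment a4 a1 \<or> u \<in> closed_segment b4 a1" for u
      using that unfolding closed_segment_def ab by (auto simp: left_diff_distrib)
    have i2: "Im u = \<delta>" if "u \<in> closed_segment a3 a4" for u
      using that unfolding closed_segment_def ab by (auto simp: left_diff_distrib)
    have i1: "Im u = - \<delta>" if "u \<in> closed_segment b3 b4" for u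
      using that unfolding closed_segment_def ab by (auto simp: left_diff_distrib)
    have a12: "a1 = of_real (x - \<delta>)" "a2 = of_real (x + \<delta>)" by (auto simp: ab complex_eq_iff)
    have "norm (E g a1 a2 j z) \<le> fact j * (B * 2 powr s * pi * norm (z - of_real x) powr s * Im z powr (- real j))"
      unfolding E_def norm_mult a12
    proof (intro mult_mono real_segment_Cauchy_bound d B s)
      show "continuous_on (closed_segment (complex_of_real (x - \<delta>)) (complex_of_real (x + \<delta>))) g" using cg by (simp add: a12)
    qed (use z b in \<open>auto simp: g_def\<close>)
    note ng = this
    have tri: "norm (p1 + p2 + p3 + p4 + p5 + p6 + p7) \<le> M" if "norm p1 + norm p2 + norm p3 + norm p4 + norm p5 + norm p6 + norm p7 \<le> M" for p1 p2 p3 p4 p5 p6 p7 :: complex and M :: real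
      using that norm_triangle_ineq[of "p1" p2] norm_triangle_ineq[of "p1 + p2" p3] norm_triangle_ineq[of "p1 + p2 + p3" p4] norm_triangle_ineq[of "p1 + p2 + p3 + p4" p5] norm_triangle_ineq[of "p1 + p2 + p3 + p4 + p5" p6] norm_triangle_ineq[of "p1 + p2 + p3 + p4 + p5 + p6" p7] by linarith
    note ng
    moreover have "norm (E (D 0) a2 a3 j z) \<le> C1" using r2 d by (intro C1(2) ballI re) auto
    moreover have "norm (E (D 0) a3 a4 j z) \<le> C2" using i2 d by (intro C2(2) ballI im) auto
    moreover have "norm (E (D 0) a4 a1 j z) \<le> C3" using r1 d by (intro C3(2) ballI re) auto
    moreover have "norm (E \<Psi> a2 b3 j z) \<le> C4" using r2 d by (intro C4(2) ballI re) auto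
    moreover have "norm (E \<Psi> b3 b4 j z) \<le> C5" using i1 d by (intro C5(2) ballI im) auto
    moreover have "norm (E \<Psi> b4 a1 j z) \<le> C6" using r1 d by (intro C6(2) ballI re) auto
    ultimately have nT: "norm (T j z) \<le> C + fact j * (B * 2 powr s * pi * norm (z - of_real x) powr s * Im z powr (- real j))"
      unfolding T_def C_def by (intro tri) linarith
    have "norm (2 * pi * \<i> * D j z) = 2 * pi * norm (D j z)" by (simp add: norm_mult)
    then have n2: "2 * pi * norm (D j z) \<le> C + fact j * (B * 2 powr s * pi * norm (z - of_real x) powr s * Im z powr (- real j))"
      using nT DT[OF zU, of j] by metis
    \<comment> \<open>Giving up a factor 2 cancels the mass \<open>pi\<close> of the Poisson
      kernel.\<close>
    have "pi * norm (D j z) \<le> 2 * pi * norm (D j z)" by (intro mult_right_mono) auto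
    also note n2
    also have "C \<le> pi * C" using C1 C2 C3 C4 C5 C6 pi_ge_two unfolding C_def by (intro mult_le_cancel_right1[THEN iffD2]) auto
    finally have "pi * norm (D j z) \<le> pi * (C + fact j * 2 powr s * B * norm (z - of_real x) powr s * Im z powr (- real j))"
      by (simp add: algebra_simps)
    then show ?thesis by simp
  qed
  moreover have "0 \<le> C" unfolding C_def using C1 C2 C3 C4 C5 C6 by simp
  ultimately show ?thesis by (rule that[rotated])
qed

lemma pderiv_funpow_eq_0:
  fixes P :: "complex poly"
  shows "degree P < n \<Longrightarrow> (pderiv ^^ n) P = 0"
proof (induction n arbitrary: P)
  case (Suc n)
  show ?case
  proof (cases "degree P = 0")
    case True
    then have "pderiv P = 0" by (simp add: pderiv_eq_0_iff)
    moreover have "(pderiv ^^ k) (0::complex poly) = 0" for k by (induction k) auto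
    ultimately show ?thesis by (simp add: funpow_swap1[symmetric] funpow_Suc_right del: funpow.simps)
  next
    case False
    then have "degree (pderiv P) < n" using Suc.prems by (simp add: degree_pderiv)
    then show ?thesis using Suc.IH by (simp add: funpow_Suc_right del: funpow.simps)
  qed
qed simp

context qseries_bounded
begin

text \<open>By reflection the summand with \<open>\<nu>\<close> is the boundary value of a function
  holomorphic below the axis, so \<open>boundary_estimate\<close> bounds derivatives of the summand
  with \<open>\<eta>\<close> minus the polynomial; as \<open>n < j\<close> the polynomial is
  differentiated away. The remainder constant \<open>B\<close> stays a separate factor next to
  \<open>C\<close>, so that it can be made small later.\<close>

lemma wavelet_boundary_bound:
  assumes al: "a0 < \<alpha>" and l: "\<eta> \<noteq> 0" and d: "0 < \<delta>" and B: "0 \<le> B" and s: "0 \<le> s" "s + 1 \<le> real j" and n: "n < j"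
    and b: "\<And>t. \<bar>t - x\<bar> \<le> \<delta> \<Longrightarrow> norm (\<eta> * fs \<alpha> (of_real t) + \<nu> * cnj (fs \<alpha> (of_real t)) - (\<Sum>k<n. (t - x) ^ k *\<^sub>R p k)) \<le> B * \<bar>t - x\<bar> powr s"
  obtains C where "0 \<le> C" "\<And>z. \<bar>Re z - x\<bar> \<le> \<delta> / 2 \<Longrightarrow> 0 < Im z \<Longrightarrow> Im z \<le> \<delta> / 2 \<Longrightarrow>
     norm (fs (\<alpha> - real j) z) \<le> C + fact j * 2 powr s / (norm \<eta> * w ^ j) * B * norm (z - of_real x) powr s * Im z powr (- real j)"
proof -
  define P where "P = (\<Sum>k<n. monom (p k) k)"
  have dP: "degree P \<le> n" unfolding P_def
    by (rule degree_sum_le) (auto intro: order_trans[OF degree_monom_le])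
  define D where "D i z = \<eta> * ((\<i> * of_real w) ^ i * fs (\<alpha> - real i) z) - poly ((pderiv ^^ i) P) (z - of_real x)" for i z
  define \<Psi> where "\<Psi> z = \<nu> * cnj (fs \<alpha> (cnj z))" for z
  have fsdiff: "((\<lambda>z. fs \<alpha> z) has_field_derivative \<i> * of_real w * fs (\<alpha> - 1) z) (at z)" if "0 < Im z" for z
    by (rule fs_deriv[OF that])
  have cont: "continuous_on {z. 0 \<le> Im z} (fs \<alpha>)" by (rule fs_continuous[OF al])
  obtain C where C: "0 \<le> C" "\<And>z. \<bar>Re z - x\<bar> \<le> \<delta> / 2 \<Longrightarrow> 0 < Im z \<Longrightarrow> Im z \<le> \<delta> / 2 \<Longrightarrow>
     norm (D j z) \<le> C + fact j * 2 powr s * B * norm (z - of_real x) powr s * Im z powr (- real j)"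
  proof (rule boundary_estimate[OF d B s, of D \<Psi> x])
    show "continuous_on {z. 0 \<le> Im z} (D 0)"
      unfolding D_def by (auto intro!: continuous_intros cont)
    show "(D i has_field_derivative D (Suc i) z) (at z)" if "0 < Im z" for i z
    proof -
      have e: "\<alpha> - real i - 1 = \<alpha> - real (Suc i)" by simp
      have "((\<lambda>z. poly ((pderiv ^^ i) P) (z - of_real x)) has_field_derivative poly ((pderiv ^^ Suc i) P) (z - of_real x)) (at z)"
        by (auto intro!: derivative_eq_intros poly_DERIV[THEN DERIV_chain2])
      then show ?thesis unfolding D_def
        by (auto intro!: derivative_eq_intros fs_deriv that simp: e simp del: of_nat_Suc)
    qed
    have "continuous_on {z. Im z \<le> 0} (\<lambda>z. fs \<alpha> (cnj z))"
      by (rule continuous_on_compose2[OF cont]) (auto intro!: continuous_intros)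
    then show "continuous_on {z. Im z \<le> 0} \<Psi>"
      unfolding \<Psi>_def by (intro continuous_intros)
    show "\<Psi> field_differentiable at z" if z: "Im z < 0" for z
    proof -
      have "(cnj \<circ> fs \<alpha> \<circ> cnj has_field_derivative cnj (\<i> * of_real w * fs (\<alpha> - 1) (cnj z))) (at z)"
        using fs_deriv[of "cnj z" \<alpha>] z by (intro has_field_derivative_cnj_cnj) auto
      then have "(\<lambda>z. cnj (fs \<alpha> (cnj z))) field_differentiable at z"
        by (auto simp: field_differentiable_def o_def)
      then show ?thesis unfolding \<Psi>_def by (intro derivative_intros) 
    qed
    show "norm (D 0 (of_real t) + \<Psi> (of_real t)) \<le> B * \<bar>t - x\<bar> powr s" if "\<bar>t - x\<bar> \<le> \<delta>" for t
    proof -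
      have "poly P (of_real t - of_real x) = (\<Sum>k<n. (t - x) ^ k *\<^sub>R p k)"
        by (simp add: P_def poly_sum poly_monom scaleR_conv_of_real mult.commute)
      then have "D 0 (of_real t) + \<Psi> (of_real t) = \<eta> * fs \<alpha> (of_real t) + \<nu> * cnj (fs \<alpha> (of_real t)) - (\<Sum>k<n. (t - x) ^ k *\<^sub>R p k)"
        by (simp add: D_def \<Psi>_def)
      then show ?thesis using b[OF that] by simp
    qed
  qed blast
  have L: "0 < norm \<eta> * w ^ j" using l w by simp
  have Dj: "norm (D j z) = norm \<eta> * w ^ j * norm (fs (\<alpha> - real j) z)" for z
    using pderiv_funpow_eq_0[of P j] dP n w by (simp add: D_def norm_mult norm_power)
  have "norm (fs (\<alpha> - real j) z) \<le> C / (norm \<eta> * w ^ j) + fact j * 2 powr s / (norm \<eta> * w ^ j) * B * norm (z - of_real x) powr s * Im z powr (- real j)"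
    if "\<bar>Re z - x\<bar> \<le> \<delta> / 2" "0 < Im z" "Im z \<le> \<delta> / 2" for z
  proof -
    have "norm \<eta> * w ^ j * norm (fs (\<alpha> - real j) z) \<le> C + fact j * 2 powr s * B * norm (z - of_real x) powr s * Im z powr (- real j)"
      using C(2)[OF that] unfolding Dj .
    then have "norm (fs (\<alpha> - real j) z) \<le> (C + fact j * 2 powr s * B * norm (z - of_real x) powr s * Im z powr (- real j)) / (norm \<eta> * w ^ j)"
      using L by (simp only: pos_le_divide_eq mult.commute)
    then show ?thesis by (simp add: add_divide_distrib)
  qed
  moreover have "0 \<le> C / (norm \<eta> * w ^ j)" using C(1) L by simp
  ultimately show ?thesis by (rule that[rotated])
qed

text \<open>The boundary bound concerns order \<open>\<alpha> - real j\<close>, and a Gamma integral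
  of order \<open>real j - \<alpha>\<close> returns to order 0. At
  \<open>z + \<i> * of_real u\<close> the remainder splits into \<open>norm z powr s\<close>, which
  integrates to \<open>Im z powr (- \<alpha>)\<close>, and
  \<open>u powr s \<le> u powr (\<alpha> - \<sigma>)\<close> for \<open>u \<le> 1\<close>, which
  integrates to \<open>Im z powr (- \<sigma>)\<close>; that integral converges because
  \<open>\<sigma> > 0\<close>.\<close>

lemma peano_imp_bound:
  assumes al: "a0 < \<alpha>" and l: "\<eta> \<noteq> 0"
    and p: "peano s (\<lambda>t. \<eta> * fs \<alpha> (of_real t) + \<nu> * cnj (fs \<alpha> (of_real t))) x"
    and s: "0 < s" "0 < \<sigma>" "\<alpha> - \<sigma> \<le> s" and e: "0 < \<epsilon>"
  shows "\<exists>C \<delta>. 0 < \<delta> \<and> (\<forall>z. 0 < Im z \<and> norm z < \<delta> \<longrightarrow>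
     norm (fs 0 (of_real x + z)) \<le> C + \<epsilon> * (norm z powr s * Im z powr (- \<alpha>) + Im z powr (- \<sigma>)))"
proof -
  obtain n c where pe: "\<And>\<epsilon>. 0 < \<epsilon> \<Longrightarrow> \<exists>\<delta>>0. \<forall>t. 0 < \<bar>t - x\<bar> \<and> \<bar>t - x\<bar> < \<delta> \<longrightarrow>
     norm (\<eta> * fs \<alpha> (of_real t) + \<nu> * cnj (fs \<alpha> (of_real t)) - (\<Sum>k<n. (t - x) ^ k *\<^sub>R c k)) \<le> \<epsilon> * \<bar>t - x\<bar> powr s"
    using p unfolding peano_def by blast
  obtain j :: nat where j: "real j > \<bar>\<alpha>\<bar> + \<bar>\<sigma>\<bar> + s + real n + 1" using reals_Archimedean2 by blast
  have al0: "0 < \<alpha>" using al a0 by linarith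
  define \<gamma> where "\<gamma> = real j - \<alpha>"
  have g: "0 < \<gamma>" using j s by (simp add: \<gamma>_def)
  define K1 where "K1 = 1 / \<gamma> + 1 / (real j - \<gamma>)"
  define K2 where "K2 = 1 / (real j - \<sigma>) + 1 / \<sigma>"
  define A where "A = fact j * 2 powr s / (norm \<eta> * w ^ j) * 2 powr s"
  define W where "W = w powr \<gamma> / Gamma \<gamma>"
  have K1: "0 < K1" unfolding K1_def using g al0 by (intro add_pos_pos) (auto simp: \<gamma>_def)
  have K2: "0 < K2" unfolding K2_def using j s al0 by (intro add_pos_pos) auto
  have A: "0 < A" using l w by (simp add: A_def)
  have W: "0 < W" using w Gamma_real_pos[OF g] by (simp add: W_def)
  \<comment> \<open>The remainder constant in the expansion is preset so that all factors collected
    below multiply to \<open>\<epsilon>\<close>.\<close>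
  define e' where "e' = \<epsilon> / (W * A * (K1 + K2))"
  have e': "0 < e'" using e W A K1 K2 by (simp add: e'_def)
  obtain \<delta>0 where d0: "0 < \<delta>0" and b0: "\<And>t. 0 < \<bar>t - x\<bar> \<Longrightarrow> \<bar>t - x\<bar> < \<delta>0 \<Longrightarrow>
     norm (\<eta> * fs \<alpha> (of_real t) + \<nu> * cnj (fs \<alpha> (of_real t)) - (\<Sum>k<n. (t - x) ^ k *\<^sub>R c k)) \<le> e' * \<bar>t - x\<bar> powr s"
    using pe[OF e'] by blast
  define \<delta> where "\<delta> = min (\<delta>0 / 2) 1"
  have d: "0 < \<delta>" "\<delta> < \<delta>0" "\<delta> \<le> 1" using d0 by (auto simp: \<delta>_def)
  define G where "G t = \<eta> * fs \<alpha> (of_real t) + \<nu> * cnj (fs \<alpha> (of_real t)) - (\<Sum>k<n. (t - x) ^ k *\<^sub>R c k)" for t :: real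
  \<comment> \<open>A Peano expansion says nothing at \<open>x\<close> itself; the value there
    follows by continuity.\<close>
  have G0: "norm (G x) \<le> 0"
  proof (rule tendsto_le[of "at x"])
    have "continuous_on UNIV G" unfolding G_def
      by (intro continuous_intros continuous_on_compose2[OF fs_continuous[OF al]]) auto
    then have "isCont G x" by (simp add: continuous_on_eq_continuous_at)
    then show "((\<lambda>t. norm (G t)) \<longlongrightarrow> norm (G x)) (at x)" by (intro tendsto_norm) (simp add: isCont_def)
    have "isCont (\<lambda>t. e' * \<bar>t - x\<bar> powr s) x" using s by (intro continuous_intros) auto
    then show "((\<lambda>t. e' * \<bar>t - x\<bar> powr s) \<longlongrightarrow> 0) (at x)" using s by (simp add: isCont_def)
    show "eventually (\<lambda>t. norm (G t) \<le> e' * \<bar>t - x\<bar> powr s) (at x)"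
      unfolding eventually_at using d0 b0 by (intro exI[of _ \<delta>0]) (auto simp: dist_real_def G_def)
  qed simp
  have bb: "norm (\<eta> * fs \<alpha> (of_real t) + \<nu> * cnj (fs \<alpha> (of_real t)) - (\<Sum>k<n. (t - x) ^ k *\<^sub>R c k)) \<le> e' * \<bar>t - x\<bar> powr s"
    if "\<bar>t - x\<bar> \<le> \<delta>" for t
    using b0[of t] G0 that d s by (cases "t = x") (auto simp: G_def)
  have sj: "s + 1 \<le> real j" "n < j" using j s by linarith+
  obtain C1 where C1: "0 \<le> C1" "\<And>z. \<bar>Re z - x\<bar> \<le> \<delta> / 2 \<Longrightarrow> 0 < Im z \<Longrightarrow> Im z \<le> \<delta> / 2 \<Longrightarrow>
     norm (fs (\<alpha> - real j) z) \<le> C1 + fact j * 2 powr s / (norm \<eta> * w ^ j) * e' * norm (z - of_real x) powr s * Im z powr (- real j)"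
    using wavelet_boundary_bound[OF al l d(1) less_imp_le[OF e'] less_imp_le[OF s(1)] sj bb] by blast
  obtain C2 where C2: "0 \<le> C2" "\<And>z. \<delta> / 2 \<le> Im z \<Longrightarrow> norm (fs (\<alpha> - real j) z) \<le> C2 * exp (- (w * low * Im z))"
    using fs_decay[of "\<delta> / 2" "\<alpha> - real j"] d by auto
  define C3 where "C3 = C1 * exp (w * low) + C2"
  define C4 where "C4 = W * (C3 * (Gamma \<gamma> * (w * low) powr (- \<gamma>)))"
  have wl: "0 < w * low" using w low_pos by simp
  have "norm (fs 0 (of_real x + z)) \<le> C4 + \<epsilon> * (norm z powr s * Im z powr (- \<alpha>) + Im z powr (- \<sigma>))"
    if z: "0 < Im z" "norm z < \<delta> / 4" for z
  proof -
    \<comment> \<open>The exponential covers the constant \<open>C1\<close> while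
      \<open>u \<le> 1\<close> and everything above height \<open>\<delta> / 2\<close>; after
      integration it only feeds the constant \<open>C4\<close>.\<close>
    define M where "M u = C3 * exp (- (w * low * u)) + A * e' * (norm z powr s + u powr (\<alpha> - \<sigma>)) * (Im z + u) powr (- real j)" for u
    define K where "K p u = u powr (p - 1) * (Im z + u) powr (- real j)" for p u
    have yz: "Im z \<le> norm z" "\<bar>Re z\<bar> \<le> norm z" using abs_Im_le_cmod[of z] abs_Re_le_cmod[of z] by auto
    have bM: "norm (fs (\<alpha> - real j) (of_real x + z + \<i> * of_real u)) \<le> M u" if u: "0 < u" for u
    proof (cases "Im z + u \<le> \<delta> / 2")
      case True
      have u1: "u \<le> 1" using True z d by linarith
      have "norm (fs (\<alpha> - real j) (of_real x + z + \<i> * of_real u)) \<le>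
         C1 + fact j * 2 powr s / (norm \<eta> * w ^ j) * e' * norm (z + \<i> * of_real u) powr s * (Im z + u) powr (- real j)"
        using C1(2)[of "of_real x + z + \<i> * of_real u"] True z u yz d by simp
      moreover have "norm (z + \<i> * of_real u) powr s \<le> 2 powr s * (norm z powr s + u powr (\<alpha> - \<sigma>))"
      proof -
        have "norm (z + \<i> * of_real u) \<le> norm z + u"
          using norm_triangle_ineq[of z "\<i> * of_real u"] u by (simp add: norm_mult)
        also have "\<dots> \<le> 2 * max (norm z) u" by simp
        finally have "norm (z + \<i> * of_real u) powr s \<le> (2 * max (norm z) u) powr s"
          using s by (intro powr_mono2) auto
        also have "\<dots> = 2 powr s * max (norm z) u powr s" by (rule powr_mult)
        also have "max (norm z) u powr s \<le> norm z powr s + u powr s" by (auto simp: max_def)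
        also have "u powr s \<le> u powr (\<alpha> - \<sigma>)" using u u1 s by (intro powr_mono') auto
        finally show ?thesis by simp
      qed
      then have "fact j * 2 powr s / (norm \<eta> * w ^ j) * e' * norm (z + \<i> * of_real u) powr s * (Im z + u) powr (- real j)
         \<le> fact j * 2 powr s / (norm \<eta> * w ^ j) * e' * (2 powr s * (norm z powr s + u powr (\<alpha> - \<sigma>))) * (Im z + u) powr (- real j)"
        using l w e' by (intro mult_right_mono mult_left_mono) auto
      moreover have "C1 \<le> C3 * exp (- (w * low * u))"
      proof -
        have "1 \<le> exp (w * low - w * low * u)" using u1 wl by (simp add: mult_left_le)
        then have "C1 * 1 \<le> C1 * exp (w * low - w * low * u)" using C1 by (intro mult_left_mono) auto
        also have "\<dots> = C1 * exp (w * low) * exp (- (w * low * u))" by (simp add: exp_diff exp_minus divide_inverse)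
        also have "\<dots> \<le> C3 * exp (- (w * low * u))" unfolding C3_def using C2 by (intro mult_right_mono) auto
        finally show ?thesis by simp
      qed
      ultimately have "norm (fs (\<alpha> - real j) (of_real x + z + \<i> * of_real u)) \<le> C3 * exp (- (w * low * u)) +
         fact j * 2 powr s / (norm \<eta> * w ^ j) * e' * (2 powr s * (norm z powr s + u powr (\<alpha> - \<sigma>))) * (Im z + u) powr (- real j)"
        by linarith
      then show ?thesis unfolding M_def A_def by (simp add: mult_ac)
    next
      case False
      have "norm (fs (\<alpha> - real j) (of_real x + z + \<i> * of_real u)) \<le> C2 * exp (- (w * low * (Im z + u)))"
        using C2(2)[of "of_real x + z + \<i> * of_real u"] False by simp
      also have "\<dots> \<le> C3 * exp (- (w * low * u))"
      proof (rule mult_mono)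
        have "w * low * u \<le> w * low * (Im z + u)" by (rule mult_left_mono) (use z wl in linarith)+
        then show "exp (- (w * low * (Im z + u))) \<le> exp (- (w * low * u))" by simp
      qed (use C1 C2 in \<open>auto simp: C3_def\<close>)
      also have "\<dots> \<le> M u" unfolding M_def using A e' by simp
      finally show ?thesis .
    qed
    have i0: "((\<lambda>u. u powr (\<gamma> - 1) * exp (- (w * low * u))) has_integral (Gamma \<gamma> * (w * low) powr (- \<gamma>))) {0<..}"
      by (rule Gamma_integral_scaled[OF g wl])
    have i1: "K \<gamma> integrable_on {0<..}" "integral {0<..} (K \<gamma>) \<le> K1 * Im z powr (- \<alpha>)"
      using kernel_integral_bound[of \<gamma> "real j" "Im z"] g z al0 unfolding K_def[abs_def] K1_def by (auto simp: \<gamma>_def)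
    have i2: "K (real j - \<sigma>) integrable_on {0<..}" "integral {0<..} (K (real j - \<sigma>)) \<le> K2 * Im z powr (- \<sigma>)"
      using kernel_integral_bound[of "real j - \<sigma>" "real j" "Im z"] s j z al0 unfolding K_def[abs_def] K2_def by auto
    define R where "R u = C3 * (u powr (\<gamma> - 1) * exp (- (w * low * u))) + A * e' * (norm z powr s * K \<gamma> u + K (real j - \<sigma>) u)" for u
    have RM: "u powr (\<gamma> - 1) * M u = R u" if "u \<in> {0<..}" for u
    proof -
      have "u powr (\<gamma> - 1) * u powr (\<alpha> - \<sigma>) = u powr (real j - \<sigma> - 1)"
        by (simp add: powr_add[symmetric] \<gamma>_def algebra_simps)
      then show ?thesis unfolding R_def M_def K_def by (simp add: algebra_simps)
    qed
    have hR: "(R has_integral (C3 * (Gamma \<gamma> * (w * low) powr (- \<gamma>)) + A * e' * (norm z powr s * integral {0<..} (K \<gamma>) + integral {0<..} (K (real j - \<sigma>))))) {0<..}"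
      unfolding R_def[abs_def]
      by (intro has_integral_add has_integral_mult_right i0 integrable_integral i1 i2)
    have hM: "((\<lambda>u. u powr (\<gamma> - 1) * M u) has_integral (C3 * (Gamma \<gamma> * (w * low) powr (- \<gamma>)) + A * e' * (norm z powr s * integral {0<..} (K \<gamma>) + integral {0<..} (K (real j - \<sigma>))))) {0<..}"
      using hR by (rule has_integral_eq[rotated]) (simp add: RM)
    have "norm (fs (\<alpha> - real j + \<gamma>) (of_real x + z)) \<le> W * integral {0<..} (\<lambda>u. u powr (\<gamma> - 1) * M u)"
      unfolding W_def by (rule fs_Gamma_bound[OF g]) (use z hM bM in auto)
    also have "\<alpha> - real j + \<gamma> = 0" by (simp add: \<gamma>_def)
    also have "integral {0<..} (\<lambda>u. u powr (\<gamma> - 1) * M u) =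
       C3 * (Gamma \<gamma> * (w * low) powr (- \<gamma>)) + A * e' * (norm z powr s * integral {0<..} (K \<gamma>) + integral {0<..} (K (real j - \<sigma>)))"
      by (rule integral_unique[OF hM])
    also have "W * \<dots> \<le> W * (C3 * (Gamma \<gamma> * (w * low) powr (- \<gamma>)) + A * e' * (norm z powr s * ((K1 + K2) * Im z powr (- \<alpha>)) + (K1 + K2) * Im z powr (- \<sigma>)))"
    proof -
      have "integral {0<..} (K \<gamma>) \<le> (K1 + K2) * Im z powr (- \<alpha>)"
        using i1(2) K2 by (rule_tac order_trans[OF i1(2)]) (auto intro: mult_right_mono)
      moreover have "integral {0<..} (K (real j - \<sigma>)) \<le> (K1 + K2) * Im z powr (- \<sigma>)"
        using K1 by (rule_tac order_trans[OF i2(2)]) (auto intro: mult_right_mono)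
      ultimately show ?thesis using W A e' by (intro mult_left_mono add_mono order_refl) auto
    qed
    also have "\<dots> = C4 + W * A * e' * (K1 + K2) * (norm z powr s * Im z powr (- \<alpha>) + Im z powr (- \<sigma>))"
      by (simp add: C4_def algebra_simps)
    also have "W * A * e' * (K1 + K2) = \<epsilon>"
    proof -
      have "W * A * (K1 + K2) \<noteq> 0" using W A K1 K2 by simp
      then show ?thesis unfolding e'_def by (simp add: mult_ac)
    qed
    finally show ?thesis .
  qed
  then show ?thesis using d by (intro exI[of _ C4] exI[of _ "\<delta> / 4"]) auto
qed

end

subsection \<open>From growth bounds to Taylor expansions\<close>

lemma ex_pderiv: "\<exists>Q. pderiv Q = (P :: complex poly)"
proof (intro exI)
  show "pderiv (\<Sum>k\<le>degree P. monom (coeff P k / of_nat (Suc k)) (Suc k)) = P"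
  proof (rule poly_eqI)
    fix n
    have "coeff (pderiv (\<Sum>k\<le>degree P. monom (coeff P k / of_nat (Suc k)) (Suc k))) n
       = of_nat (Suc n) * (\<Sum>k\<le>degree P. if k = n then coeff P k / of_nat (Suc k) else 0)"
      by (simp add: coeff_pderiv coeff_sum del: of_nat_Suc)
    also have "\<dots> = coeff P n"
      by (simp add: sum.delta coeff_eq_0 not_le del: of_nat_Suc)
    finally show "coeff (pderiv (\<Sum>k\<le>degree P. monom (coeff P k / of_nat (Suc k)) (Suc k))) n = coeff P n" .
  qed
qed

lemma complex_Im_le_norm: "Im z \<le> norm z"
  using abs_Im_le_cmod[of z] by linarith

lemma vertical_bound:
  fixes \<psi> \<psi>' :: "complex \<Rightarrow> complex"
  assumes d: "\<And>z. 0 < Im z \<Longrightarrow> (\<psi> has_field_derivative \<psi>' z) (at z)"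
    and y: "0 < y1" "y1 \<le> y2" and b: "b \<noteq> 0"
    and bd: "\<And>v. y1 \<le> v \<Longrightarrow> v \<le> y2 \<Longrightarrow> norm (\<psi>' (Complex u v)) \<le> C * v powr (b - 1)"
  shows "norm (\<psi> (Complex u y2) - \<psi> (Complex u y1)) \<le> C * y2 powr b / b - C * y1 powr b / b"
proof (cases "y1 = y2")
  case False
  then have lt: "y1 < y2" using y by simp
  have e: "Complex u v = of_real u + \<i> * of_real v" for v by (simp add: complex_eq_iff)
  have dv: "((\<lambda>v. \<psi> (Complex u v)) has_vector_derivative \<i> * \<psi>' (Complex u v)) (at v)" if "0 < v" for v
  proof -
    have "((\<lambda>v. Complex u v) has_vector_derivative \<i>) (at v)"
      unfolding e by (auto intro!: derivative_eq_intros)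
    moreover have "(\<psi> has_field_derivative \<psi>' (Complex u v)) (at (Complex u v) within range (Complex u))"
      by (rule has_field_derivative_at_within[OF d]) (use that in simp)
    ultimately show ?thesis
      using field_vector_diff_chain_within[of "Complex u" \<i> v UNIV \<psi> "\<psi>' (Complex u v)"] by (simp add: o_def)
  qed
  show ?thesis
  proof (rule differentiable_bound_general[OF lt, where f' = "\<lambda>v. \<i> * \<psi>' (Complex u v)" and \<phi>' = "\<lambda>v. C * v powr (b - 1)"])
    show "continuous_on {y1..y2} (\<lambda>v. \<psi> (Complex u v))"
      by (rule continuous_on_vector_derivative[of _ _ "\<lambda>v. \<i> * \<psi>' (Complex u v)"])
         (use y in \<open>auto intro!: has_vector_derivative_at_within dv\<close>)
    show "continuous_on {y1..y2} (\<lambda>v. C * v powr b / b)"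
      using y b by (intro continuous_intros) auto
    show "((\<lambda>v. C * v powr b / b) has_vector_derivative C * v powr (b - 1)) (at v)" if "y1 < v" "v < y2" for v
      using that y b by (auto intro!: derivative_eq_intros simp: has_real_derivative_iff_has_vector_derivative[symmetric])
    show "norm (\<i> * \<psi>' (Complex u v)) \<le> C * v powr (b - 1)" if "y1 < v" "v < y2" for v
      using bd[of v] that by (simp add: norm_mult)
  qed (use y dv in auto)
qed simp

text \<open>For \<open>b < 0\<close> the bound grows towards 0 and the value at height
  \<open>\<rho>\<close> can serve as the constant; for \<open>b > 0\<close> the values converge at 0
  and their limit serves. For \<open>b = 0\<close> a logarithm would appear.\<close>

lemma axis_bound:
  fixes h :: "real \<Rightarrow> complex"
  assumes C: "0 \<le> C" and b: "b \<noteq> 0" and r: "0 < \<rho>"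
    and h: "\<And>v1 v2. 0 < v1 \<Longrightarrow> v1 \<le> v2 \<Longrightarrow> v2 \<le> \<rho> \<Longrightarrow> norm (h v2 - h v1) \<le> C * v2 powr b / b - C * v1 powr b / b"
  obtains c where "\<And>v. 0 < v \<Longrightarrow> v \<le> \<rho> \<Longrightarrow> norm (h v - c) \<le> C * v powr b / \<bar>b\<bar>"
proof (cases "b < 0")
  case True
  have "norm (h v - h \<rho>) \<le> C * v powr b / \<bar>b\<bar>" if v: "0 < v" "v \<le> \<rho>" for v
  proof -
    have "norm (h v - h \<rho>) \<le> C * \<rho> powr b / b - C * v powr b / b"
      using h[OF v order_refl] by (simp add: norm_minus_commute)
    also have "C * \<rho> powr b / b \<le> 0" using C True by (simp add: divide_nonneg_neg)
    finally show ?thesis using True by simp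
  qed
  then show ?thesis by (rule that)
next
  case False
  then have b0: "0 < b" using b by simp
  define s where "s n = \<rho> / real (Suc n)" for n
  have s: "0 < s n" "s n \<le> \<rho>" for n using r by (auto simp: s_def field_simps)
  have s0: "s \<longlonglongrightarrow> 0" unfolding s_def using LIMSEQ_Suc[OF lim_const_over_n[of \<rho>]] by simp
  have bd: "norm (h v - h u) \<le> C / b * v powr b" if "0 < u" "u \<le> v" "v \<le> \<rho>" for u v
    using h[OF that] C b0 by (simp add: order_trans)
  have lim0: "(\<lambda>n. C / b * s n powr b) \<longlonglongrightarrow> 0"
    using tendsto_mult[OF tendsto_const tendsto_powr'[OF s0 tendsto_const[of b]], of "C / b"] b0 s by (auto simp: less_imp_le)
  have smono: "s n \<le> s m" if "m \<le> n" for m n using that r by (auto simp: s_def frac_le)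
  have "Cauchy (\<lambda>n. h (s n))"
  proof (rule CauchyI')
    fix e :: real assume e: "0 < e"
    then have "eventually (\<lambda>n. C / b * s n powr b < e) sequentially"
      by (rule order_tendstoD(2)[OF lim0])
    then obtain M where M: "\<And>n. n \<ge> M \<Longrightarrow> C / b * s n powr b < e" by (auto simp: eventually_sequentially)
    have "norm (h (s m) - h (s n)) < e" if "m \<ge> M" "n > m" for m n
      using bd[of "s n" "s m"] s smono[of m n] that M[of m] by (meson le_less_trans less_imp_le)
    then show "\<exists>M. \<forall>m\<ge>M. \<forall>n>m. dist (h (s m)) (h (s n)) < e" unfolding dist_norm by blast
  qed
  then obtain c where c: "(\<lambda>n. h (s n)) \<longlonglongrightarrow> c" using Cauchy_convergent convergent_def by blast
  have "norm (h v - c) \<le> C * v powr b / \<bar>b\<bar>" if v: "0 < v" "v \<le> \<rho>" for v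
  proof (rule tendsto_upperbound)
    show "(\<lambda>n. norm (h v - h (s n))) \<longlonglongrightarrow> norm (h v - c)" by (intro tendsto_intros c)
    have "eventually (\<lambda>n. s n < v) sequentially" using order_tendstoD(2)[OF s0 v(1)] .
    then show "eventually (\<lambda>n. norm (h v - h (s n)) \<le> C * v powr b / \<bar>b\<bar>) sequentially"
      by eventually_elim (use bd s v b0 in \<open>simp add: less_imp_le\<close>)
  qed simp
  then show ?thesis by (rule that)
qed

text \<open>The path goes from \<open>z\<close> straight up to the height
  \<open>max (Im z) \<bar>Re z\<bar>\<close>, then horizontally to the imaginary axis, then along
  that axis. On the first two pieces moduli are at most \<open>2 * norm z\<close>, so
  \<open>norm z powr p\<close> can be pulled out and only powers of the height are integrated; on
  the axis modulus and height coincide.\<close>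

lemma integrate_step:
  fixes \<psi> \<psi>' :: "complex \<Rightarrow> complex"
  assumes d: "\<And>z. 0 < Im z \<Longrightarrow> (\<psi> has_field_derivative \<psi>' z) (at z)"
    and C: "0 \<le> C" and p: "0 \<le> p" and b: "b \<noteq> 0" "p + b \<noteq> 0" and r: "0 < \<rho>"
    and bd: "\<And>z. \<bar>Re z\<bar> \<le> \<rho> \<Longrightarrow> 0 < Im z \<Longrightarrow> Im z \<le> \<rho> \<Longrightarrow> norm (\<psi>' z) \<le> C * norm z powr p * Im z powr (b - 1)"
  obtains c C' where "0 \<le> C'" "\<And>z. \<bar>Re z\<bar> \<le> \<rho> \<Longrightarrow> 0 < Im z \<Longrightarrow> Im z \<le> \<rho> \<Longrightarrow>
     norm (\<psi> z - c) \<le> C' * norm z powr p * (Im z powr b + norm z powr b)"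
proof -
  have ax: "norm (\<psi> (Complex 0 v2) - \<psi> (Complex 0 v1)) \<le> C * v2 powr (p + b) / (p + b) - C * v1 powr (p + b) / (p + b)"
    if "0 < v1" "v1 \<le> v2" "v2 \<le> \<rho>" for v1 v2
  proof (rule vertical_bound[OF d that(1,2) b(2)])
    fix v assume v: "v1 \<le> v" "v \<le> v2"
    have "norm (Complex 0 v) = v" using v that by (simp add: cmod_def)
    then show "norm (\<psi>' (Complex 0 v)) \<le> C * v powr (p + b - 1)"
      using bd[of "Complex 0 v"] v that r by (simp add: mult.assoc powr_add[symmetric] add_diff_eq)
  qed
  obtain c where c: "\<And>v. 0 < v \<Longrightarrow> v \<le> \<rho> \<Longrightarrow> norm (\<psi> (Complex 0 v) - c) \<le> C * v powr (p + b) / \<bar>p + b\<bar>"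
    using axis_bound[OF C b(2) r, of "\<lambda>v. \<psi> (Complex 0 v)"] ax by metis
  define K where "K = C * 2 powr p"
  have K: "0 \<le> K" "C \<le> K"
    unfolding K_def using C p by (auto intro!: mult_le_cancel_left1[THEN iffD2] ge_one_powr_ge_zero)
  define C' where "C' = K / \<bar>b\<bar> + (K / \<bar>b\<bar> + K + K / \<bar>p + b\<bar>) * 2 powr \<bar>b\<bar>"
  have "norm (\<psi> z - c) \<le> C' * norm z powr p * (Im z powr b + norm z powr b)"
    if z: "\<bar>Re z\<bar> \<le> \<rho>" "0 < Im z" "Im z \<le> \<rho>" for z
  proof -
    define u y Y where "u = Re z" and "y = Im z" and "Y = max (Im z) \<bar>Re z\<bar>"
    have zc: "z = Complex u y" by (simp add: u_def y_def)
    have nz: "0 < norm z" using z(2) by auto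
    have yY: "y \<le> Y" "\<bar>u\<bar> \<le> Y" "0 < y" "0 < Y" "Y \<le> \<rho>" using z by (auto simp: Y_def u_def y_def)
    have Yz: "Y \<le> norm z" using abs_Re_le_cmod[of z] abs_Im_le_cmod[of z] z by (auto simp: Y_def)
    have zY: "norm z \<le> 2 * Y" using cmod_le[of z] z yY unfolding u_def y_def by linarith
    have small: "norm (Complex t v) \<le> 2 * norm z" if "\<bar>t\<bar> \<le> \<bar>u\<bar>" "0 \<le> v" "v \<le> Y" for t v
    proof -
      have "norm (Complex t v) \<le> \<bar>t\<bar> + \<bar>v\<bar>" using cmod_le[of "Complex t v"] by simp
      also have "\<dots> \<le> norm z + norm z" using that Yz yY by linarith
      finally show ?thesis by simp
    qed
    have der: "norm (\<psi>' (Complex t v)) \<le> K * norm z powr p * v powr (b - 1)" if "\<bar>t\<bar> \<le> \<bar>u\<bar>" "0 < v" "v \<le> Y" for t v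
    proof -
      have "norm (\<psi>' (Complex t v)) \<le> C * norm (Complex t v) powr p * v powr (b - 1)"
        using bd[of "Complex t v"] that z yY by (simp add: u_def)
      also have "norm (Complex t v) powr p \<le> (2 * norm z) powr p"
        using small[of t v] that p by (intro powr_mono2) auto
      finally show ?thesis using C by (simp add: K_def powr_mult mult_right_mono mult_left_mono mult.assoc)
    qed
    have Yb: "Y powr b \<le> 2 powr \<bar>b\<bar> * norm z powr b"
    proof (cases "0 \<le> b")
      case True
      have "1 * Y powr b \<le> 2 powr \<bar>b\<bar> * norm z powr b"
        using True Yz yY by (intro mult_mono powr_mono2) (auto intro: ge_one_powr_ge_zero)
      then show ?thesis by simp
    next
      case False
      have "Y powr b \<le> (norm z / 2) powr b" by (rule powr_mono2') (use False nz zY in linarith)+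
      also have "\<dots> = 2 powr \<bar>b\<bar> * norm z powr b" 
      proof -
        have ab: "\<bar>b\<bar> = - b" using False by simp
        show ?thesis unfolding ab powr_divide powr_minus by (simp add: divide_inverse mult.commute)
      qed
      finally show ?thesis .
    qed
    have 1: "norm (\<psi> (Complex u Y) - \<psi> (Complex u y)) \<le> K * norm z powr p / \<bar>b\<bar> * (Y powr b + y powr b)"
    proof -
      have "norm (\<psi> (Complex u Y) - \<psi> (Complex u y)) \<le> (K * norm z powr p) * Y powr b / b - (K * norm z powr p) * y powr b / b"
        by (rule vertical_bound[OF d yY(3,1) b(1)]) (use der yY in auto)
      also have "\<dots> = K * norm z powr p * ((Y powr b - y powr b) / b)" by (simp add: diff_divide_distrib right_diff_distrib)
      also have "\<dots> \<le> K * norm z powr p * ((Y powr b + y powr b) / \<bar>b\<bar>)"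
      proof (intro mult_left_mono)
        have "(Y powr b - y powr b) / b \<le> \<bar>(Y powr b - y powr b) / b\<bar>" by (rule abs_ge_self)
        also have "\<dots> = \<bar>Y powr b - y powr b\<bar> / \<bar>b\<bar>" by simp
        also have "\<dots> \<le> (Y powr b + y powr b) / \<bar>b\<bar>"
          using powr_ge_zero[of Y b] powr_ge_zero[of y b] by (intro divide_right_mono) linarith+
        finally show "(Y powr b - y powr b) / b \<le> (Y powr b + y powr b) / \<bar>b\<bar>" .
      qed (use K in simp)
      finally show ?thesis by simp
    qed
    have 2: "norm (\<psi> (Complex 0 Y) - \<psi> (Complex u Y)) \<le> K * norm z powr p * Y powr b"
    proof -
      have seg: "closed_segment (Complex u Y) (Complex 0 Y) \<subseteq> {v. \<bar>Re v\<bar> \<le> \<bar>u\<bar> \<and> Im v = Y}"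
      proof
        fix v assume "v \<in> closed_segment (Complex u Y) (Complex 0 Y)"
        then obtain t where t: "0 \<le> t" "t \<le> 1" "v = (1 - t) *\<^sub>R Complex u Y + t *\<^sub>R Complex 0 Y" by (auto simp: in_segment)
        have "\<bar>(1 - t) * u\<bar> \<le> \<bar>u\<bar>" using t by (simp add: abs_mult mult_left_le_one_le)
        moreover have "Re v = (1 - t) * u" "Im v = (1 - t) * Y + t * Y" using t by auto
        ultimately show "v \<in> {v. \<bar>Re v\<bar> \<le> \<bar>u\<bar> \<and> Im v = Y}" by (auto simp: algebra_simps)
      qed
      have "norm (\<psi> (Complex 0 Y) - \<psi> (Complex u Y)) \<le> (K * norm z powr p * Y powr (b - 1)) * norm (Complex 0 Y - Complex u Y)"
      proof (rule field_differentiable_bound[of "closed_segment (Complex u Y) (Complex 0 Y)"])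
        fix v assume "v \<in> closed_segment (Complex u Y) (Complex 0 Y)"
        then have v: "\<bar>Re v\<bar> \<le> \<bar>u\<bar>" "Im v = Y" using seg by auto
        show "(\<psi> has_field_derivative \<psi>' v) (at v within closed_segment (Complex u Y) (Complex 0 Y))"
          by (rule has_field_derivative_at_within[OF d]) (simp only: v(2) yY(4))
        have vv: "Complex (Re v) Y = v" using v by (simp add: complex_eq_iff)
        show "norm (\<psi>' v) \<le> K * norm z powr p * Y powr (b - 1)"
          using der[OF v(1) yY(4) order_refl] unfolding vv .
      qed auto
      also have "norm (Complex 0 Y - Complex u Y) \<le> Y" using yY by (simp add: complex_diff cmod_def)
      also have "K * norm z powr p * Y powr (b - 1) * Y = K * norm z powr p * Y powr b"
        using yY by (simp add: powr_diff)
      finally show ?thesis using K by (simp add: mult_left_mono)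
    qed
    have 3: "norm (\<psi> (Complex 0 Y) - c) \<le> K / \<bar>p + b\<bar> * norm z powr p * Y powr b"
    proof -
      have "norm (\<psi> (Complex 0 Y) - c) \<le> C * Y powr (p + b) / \<bar>p + b\<bar>" by (rule c) (use yY in auto)
      also have "\<dots> = C / \<bar>p + b\<bar> * (Y powr p * Y powr b)" by (simp add: powr_add)
      also have "\<dots> \<le> K / \<bar>p + b\<bar> * (norm z powr p * Y powr b)"
        using K C Yz p yY by (intro mult_mono divide_right_mono powr_mono2 order_refl) auto
      finally show ?thesis by (simp add: mult_ac)
    qed
    have "norm (\<psi> z - c) \<le> norm (\<psi> (Complex u Y) - \<psi> (Complex u y)) + norm (\<psi> (Complex 0 Y) - \<psi> (Complex u Y)) + norm (\<psi> (Complex 0 Y) - c)"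
    proof -
      have "\<psi> z - c = - (\<psi> (Complex u Y) - \<psi> (Complex u y)) - (\<psi> (Complex 0 Y) - \<psi> (Complex u Y)) + (\<psi> (Complex 0 Y) - c)"
        by (simp add: zc)
      then have "norm (\<psi> z - c) \<le> norm (- (\<psi> (Complex u Y) - \<psi> (Complex u y)) - (\<psi> (Complex 0 Y) - \<psi> (Complex u Y))) + norm (\<psi> (Complex 0 Y) - c)"
        by (simp only: norm_triangle_ineq)
      also have "norm (- (\<psi> (Complex u Y) - \<psi> (Complex u y)) - (\<psi> (Complex 0 Y) - \<psi> (Complex u Y))) \<le>
          norm (- (\<psi> (Complex u Y) - \<psi> (Complex u y))) + norm (\<psi> (Complex 0 Y) - \<psi> (Complex u Y))"
        by (rule norm_triangle_ineq4)
      finally show ?thesis by (simp only: norm_minus_cancel add_right_mono)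
    qed
    also have "\<dots> \<le> K * norm z powr p / \<bar>b\<bar> * (Y powr b + y powr b) + K * norm z powr p * Y powr b + K / \<bar>p + b\<bar> * norm z powr p * Y powr b"
      using 1 2 3 by linarith
    also have "\<dots> = norm z powr p * (K / \<bar>b\<bar> * y powr b + (K / \<bar>b\<bar> + K + K / \<bar>p + b\<bar>) * Y powr b)"
      by (simp add: algebra_simps add_divide_distrib)
    also have "\<dots> \<le> norm z powr p * (C' * y powr b + C' * norm z powr b)"
    proof (intro mult_left_mono add_mono)
      have nn: "0 \<le> K / \<bar>b\<bar>" "0 \<le> K / \<bar>b\<bar> + K + K / \<bar>p + b\<bar>" using K by auto
      show "K / \<bar>b\<bar> * y powr b \<le> C' * y powr b" unfolding C'_def using nn by (intro mult_right_mono) auto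
      have "(K / \<bar>b\<bar> + K + K / \<bar>p + b\<bar>) * Y powr b \<le> (K / \<bar>b\<bar> + K + K / \<bar>p + b\<bar>) * (2 powr \<bar>b\<bar> * norm z powr b)"
        using Yb nn by (intro mult_left_mono) auto
      also have "\<dots> \<le> C' * norm z powr b" unfolding C'_def using nn
        by (simp add: mult.assoc[symmetric] mult_right_mono)
      finally show "(K / \<bar>b\<bar> + K + K / \<bar>p + b\<bar>) * Y powr b \<le> C' * norm z powr b" .
    qed simp
    finally show ?thesis by (simp add: y_def algebra_simps)
  qed
  moreover have "0 \<le> C'" unfolding C'_def using K by simp
  ultimately show ?thesis by (rule that[rotated])
qed

text \<open>The order of differentiation goes down by one at a time, each time with a new
  polynomial. While the exponent \<open>e - real i\<close> is negative, the power of
  \<open>norm z\<close> is absorbed by that of \<open>Im z\<close>; in the last step it is positive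
  and \<open>norm z\<close> wins. The conditions on \<open>e\<close> and \<open>p + e\<close> keep
  every exponent that is integrated away from 0. The bound one step before the end is recorded too,
  since it controls the derivative on the vertical ray.\<close>

lemma integrate_repeatedly:
  fixes D :: "nat \<Rightarrow> complex \<Rightarrow> complex"
  assumes D: "\<And>i z. 0 < Im z \<Longrightarrow> (D i has_field_derivative D (Suc i) z) (at z)"
    and C: "0 \<le> C" and p: "0 \<le> p" and e: "0 < e" "e < 1" and pe: "p + e \<notin> \<int>" and r: "0 < \<rho>" and j: "0 < j"
    and bd: "\<And>z. \<bar>Re z\<bar> \<le> \<rho> \<Longrightarrow> 0 < Im z \<Longrightarrow> Im z \<le> \<rho> \<Longrightarrow> norm (D j z) \<le> C * norm z powr p * Im z powr (e - real j)"
  obtains P C' where "0 \<le> C'"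
    "\<And>z. \<bar>Re z\<bar> \<le> \<rho> \<Longrightarrow> 0 < Im z \<Longrightarrow> Im z \<le> \<rho> \<Longrightarrow> norm (D 0 z - poly P z) \<le> C' * norm z powr (p + e)"
    "\<And>z. \<bar>Re z\<bar> \<le> \<rho> \<Longrightarrow> 0 < Im z \<Longrightarrow> Im z \<le> \<rho> \<Longrightarrow> norm (D 1 z - poly (pderiv P) z) \<le> C' * norm z powr p * Im z powr (e - 1)"
proof -
  have ne: "p + (e - real i) \<noteq> 0" for i
  proof
    assume "p + (e - real i) = 0"
    then have "p + e = of_nat i" by simp
    then show False using pe by simp
  qed
  have step: "\<exists>C' Q. 0 \<le> C' \<and> pderiv Q = P \<and> (\<forall>z. \<bar>Re z\<bar> \<le> \<rho> \<and> 0 < Im z \<and> Im z \<le> \<rho> \<longrightarrow>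
       norm (D i z - poly Q z) \<le> C' * norm z powr p * (Im z powr (e - real i) + norm z powr (e - real i)))"
    if C1: "0 \<le> C1" and b1: "\<And>z. \<bar>Re z\<bar> \<le> \<rho> \<Longrightarrow> 0 < Im z \<Longrightarrow> Im z \<le> \<rho> \<Longrightarrow>
       norm (D (Suc i) z - poly P z) \<le> C1 * norm z powr p * Im z powr (e - real (Suc i))" for i C1 P
  proof -
    obtain Q0 where Q0: "pderiv Q0 = P" using ex_pderiv by blast
    have dd: "((\<lambda>z. D i z - poly Q0 z) has_field_derivative (D (Suc i) z - poly P z)) (at z)" if "0 < Im z" for z
      using that by (auto intro!: derivative_eq_intros D simp: Q0)
    have ei: "e - real i \<noteq> 0" using e by (cases i) auto
    have sh: "e - real i - 1 = e - real (Suc i)" by simp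
    obtain c C' where c: "0 \<le> C'" "\<And>z. \<bar>Re z\<bar> \<le> \<rho> \<Longrightarrow> 0 < Im z \<Longrightarrow> Im z \<le> \<rho> \<Longrightarrow>
       norm (D i z - poly Q0 z - c) \<le> C' * norm z powr p * (Im z powr (e - real i) + norm z powr (e - real i))"
      using integrate_step[OF dd C1 p ei ne r] b1 unfolding sh by metis
    show ?thesis
      by (rule exI[of _ C'], rule exI[of _ "Q0 + [:c:]"]) (use c Q0 in \<open>auto simp: pderiv_add pderiv_pCons algebra_simps\<close>)
  qed
  have main: "\<exists>C' P. 0 \<le> C' \<and> (\<forall>z. \<bar>Re z\<bar> \<le> \<rho> \<and> 0 < Im z \<and> Im z \<le> \<rho> \<longrightarrow>
       norm (D (j - i) z - poly P z) \<le> C' * norm z powr p * Im z powr (e - real (j - i)))" if "i < j" for i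
    using that
  proof (induction i)
    case 0
    then show ?case using C bd by (intro exI[of _ C] exI[of _ 0]) auto
  next
    case (Suc i)
    then obtain C1 P where 1: "0 \<le> C1" "\<And>z. \<bar>Re z\<bar> \<le> \<rho> \<Longrightarrow> 0 < Im z \<Longrightarrow> Im z \<le> \<rho> \<Longrightarrow>
       norm (D (j - i) z - poly P z) \<le> C1 * norm z powr p * Im z powr (e - real (j - i))"
      using Suc_lessD by blast
    have ji: "j - i = Suc (j - Suc i)" using Suc.prems by simp
    obtain C' Q where 2: "0 \<le> C'" "\<And>z. \<bar>Re z\<bar> \<le> \<rho> \<Longrightarrow> 0 < Im z \<Longrightarrow> Im z \<le> \<rho> \<Longrightarrow>
       norm (D (j - Suc i) z - poly Q z) \<le> C' * norm z powr p * (Im z powr (e - real (j - Suc i)) + norm z powr (e - real (j - Suc i)))"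
      using step[OF 1(1), of "j - Suc i" P] 1(2) unfolding ji by blast
    have "norm (D (j - Suc i) z - poly Q z) \<le> (2 * C') * norm z powr p * Im z powr (e - real (j - Suc i))"
      if z: "\<bar>Re z\<bar> \<le> \<rho>" "0 < Im z" "Im z \<le> \<rho>" for z
    proof -
      have "1 \<le> j - Suc i" using Suc.prems by auto
      then have "e - real (j - Suc i) \<le> 0" using e by linarith
      then have "norm z powr (e - real (j - Suc i)) \<le> Im z powr (e - real (j - Suc i))"
        using z(2) complex_Im_le_norm by (intro powr_mono2')
      then have "C' * norm z powr p * (Im z powr (e - real (j - Suc i)) + norm z powr (e - real (j - Suc i)))
         \<le> C' * norm z powr p * (Im z powr (e - real (j - Suc i)) + Im z powr (e - real (j - Suc i)))"
        using 2(1) by (intro mult_left_mono add_left_mono) auto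
      then show ?thesis using 2(2)[OF z] by simp
    qed
    then show ?case using 2(1) by (intro exI[of _ "2 * C'"] exI[of _ Q]) auto
  qed
  have "j - (j - 1) = 1" using j by simp
  then obtain C1 P1 where 1: "0 \<le> C1" "\<And>z. \<bar>Re z\<bar> \<le> \<rho> \<Longrightarrow> 0 < Im z \<Longrightarrow> Im z \<le> \<rho> \<Longrightarrow>
       norm (D 1 z - poly P1 z) \<le> C1 * norm z powr p * Im z powr (e - real 1)"
    using main[of "j - 1"] j by (metis diff_less less_numeral_extra(1))
  obtain C' Q where 2: "0 \<le> C'" "pderiv Q = P1" "\<And>z. \<bar>Re z\<bar> \<le> \<rho> \<Longrightarrow> 0 < Im z \<Longrightarrow> Im z \<le> \<rho> \<Longrightarrow>
       norm (D 0 z - poly Q z) \<le> C' * norm z powr p * (Im z powr e + norm z powr e)"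
    using step[OF 1(1), of 0 P1] 1(2) by force
  have "norm (D 0 z - poly Q z) \<le> (C1 + 2 * C') * norm z powr (p + e)"
    if z: "\<bar>Re z\<bar> \<le> \<rho>" "0 < Im z" "Im z \<le> \<rho>" for z
  proof -
    have "Im z powr e \<le> norm z powr e" using z abs_Im_le_cmod[of z] e by (intro powr_mono2) auto
    then have "C' * norm z powr p * (Im z powr e + norm z powr e) \<le> C' * norm z powr p * (norm z powr e + norm z powr e)"
      using 2(1) by (intro mult_left_mono add_right_mono) auto
    also have "\<dots> = (2 * C') * norm z powr (p + e)" by (simp add: powr_add)
    also have "\<dots> \<le> (C1 + 2 * C') * norm z powr (p + e)" using 1(1) by (intro mult_right_mono) auto
    finally show ?thesis using 2(3)[OF z] by linarith
  qed
  moreover have "norm (D 1 z - poly (pderiv Q) z) \<le> (C1 + 2 * C') * norm z powr p * Im z powr (e - 1)"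
    if z: "\<bar>Re z\<bar> \<le> \<rho>" "0 < Im z" "Im z \<le> \<rho>" for z
  proof -
    have "norm (D 1 z - poly (pderiv Q) z) \<le> C1 * norm z powr p * Im z powr (e - real 1)" unfolding 2(2) by (rule 1(2)[OF z])
    also have "\<dots> \<le> (C1 + 2 * C') * norm z powr p * Im z powr (e - 1)" using 2(1) by (simp add: mult_right_mono)
    finally show ?thesis .
  qed
  ultimately show ?thesis using that[of "C1 + 2 * C'" Q] 1(1) 2(1) by auto
qed

context qseries_bounded
begin

text \<open>Cauchy's inequality on the disc of radius \<open>Im z / 2\<close>, where the height is
  at least \<open>Im z / 2\<close> and the distance to \<open>x\<close> at most
  \<open>2 * norm z\<close>. Differentiation removes the constant \<open>A\<close>.\<close>

lemma fs_derivative_bound: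
  assumes p: "0 \<le> p" and q: "0 \<le> q" and B: "0 \<le> B" and j: "0 < j"
    and bd: "\<And>z. 0 < Im z \<Longrightarrow> norm z \<le> 1 \<Longrightarrow> norm (fs 0 (of_real x + z) + A) \<le> B * norm z powr p * Im z powr (- q)"
    and z: "0 < Im z" "norm z \<le> 1/2"
  shows "norm (fs (- real j) (of_real x + z)) \<le> fact j * 2 ^ j * B * 2 powr p * 2 powr q / w ^ j * norm z powr p * Im z powr (- q - real j)"
proof -
  define R where "R = Im z / 2"
  have R: "0 < R" using z by (simp add: R_def)
  define f where "f u = fs 0 u + A" for u
  have holf: "f holomorphic_on {u. 0 < Im u}" unfolding f_def by (intro holomorphic_intros fs_holomorphic)
  have near: "R \<le> Im u" "norm (u - of_real x) \<le> 2 * norm z" "norm (u - of_real x) \<le> 1" if "norm (u - (of_real x + z)) \<le> R" for u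
  proof -
    have "\<bar>Im (u - (of_real x + z))\<bar> \<le> R" using that abs_Im_le_cmod order_trans by blast
    then have "\<bar>Im u - Im z\<bar> \<le> Im z / 2" by (simp add: R_def)
    then show "R \<le> Im u" unfolding R_def by linarith
    have "norm (u - of_real x) \<le> norm (u - (of_real x + z)) + norm z"
      using norm_triangle_ineq[of "u - (of_real x + z)" z] by simp
    also have "\<dots> \<le> norm z / 2 + norm z" using that complex_Im_le_norm[of z] by (simp add: R_def)
    finally show "norm (u - of_real x) \<le> 2 * norm z" "norm (u - of_real x) \<le> 1" using z norm_ge_zero[of z] by linarith+
  qed
  have sub: "cball (of_real x + z) R \<subseteq> {u. 0 < Im u}" using near(1) R by (force simp: dist_norm norm_minus_commute)
  have "norm ((deriv ^^ j) f (of_real x + z)) \<le> fact j * (B * (2 * norm z) powr p * R powr (- q)) / R ^ j"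
  proof (rule Cauchy_inequality[OF _ _ R])
    show "f holomorphic_on ball (of_real x + z) R" using holf sub by (meson ball_subset_cball holomorphic_on_subset order_trans)
    show "continuous_on (cball (of_real x + z) R) f" using holomorphic_on_imp_continuous_on[OF holf] sub continuous_on_subset by blast
    fix u assume "norm (of_real x + z - u) = R"
    then have u: "norm (u - (of_real x + z)) \<le> R" by (simp add: norm_minus_commute)
    have "norm (f u) \<le> B * norm (u - of_real x) powr p * Im (u - of_real x) powr (- q)"
      using bd[of "u - of_real x"] near[OF u] R by (simp add: f_def)
    also have "\<dots> \<le> B * (2 * norm z) powr p * R powr (- q)"
      using near[OF u] R p q B by (intro mult_mono powr_mono2 powr_mono2') auto
    finally show "norm (f u) \<le> B * (2 * norm z) powr p * R powr (- q)" .
  qed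
  also have "(deriv ^^ j) f (of_real x + z) = (\<i> * of_real w) ^ j * fs (- real j) (of_real x + z)"
  proof -
    have "(deriv ^^ j) f (of_real x + z) = (deriv ^^ j) (fs 0) (of_real x + z) + (deriv ^^ j) (\<lambda>_. A) (of_real x + z)"
      unfolding f_def by (rule higher_deriv_add[OF fs_holomorphic _ open_halfspace_Im_gt]) (use z in auto)
    then show ?thesis using fs_higher_deriv[of "of_real x + z" j 0] z j by simp
  qed
  finally have "w ^ j * norm (fs (- real j) (of_real x + z)) \<le> fact j * (B * (2 * norm z) powr p * R powr (- q)) / R ^ j"
    using w by (simp add: norm_mult norm_power)
  also have "fact j * (B * (2 * norm z) powr p * R powr (- q)) / R ^ j
     = fact j * 2 ^ j * B * 2 powr p * 2 powr q * norm z powr p * Im z powr (- q - real j)"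
  proof -
    have 1: "R powr (- q) = 2 powr q * Im z powr (- q)"
      unfolding R_def powr_divide powr_minus by (simp add: divide_inverse)
    have 2: "Im z powr (- q - real j) = Im z powr (- q) / Im z ^ j"
      using z by (simp add: powr_diff powr_realpow)
    have 3: "R ^ j = Im z ^ j / 2 ^ j" by (simp add: R_def power_divide)
    show ?thesis unfolding 1 2 3 powr_mult by simp
  qed
  finally show ?thesis using w by (simp add: field_simps)
qed

text \<open>Differentiating \<open>j\<close> times by Cauchy's inequality and then integrating with
  a Gamma integral of order \<open>\<alpha>\<close> gives the order
  \<open>\<alpha> - real j\<close>. The constant is fixed before \<open>x\<close>, so a growth bound
  uniform along the axis will give a uniform Hoelder condition.\<close>

lemma two_microlocal_bound:
  assumes al: "0 < \<alpha>" and p: "0 \<le> p" and q: "0 \<le> q" "q < \<alpha>" and B: "0 \<le> B" and j: "0 < j" "\<alpha> + p - q < real j"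
  obtains C where "0 \<le> C" "\<And>x z. (\<And>z. 0 < Im z \<Longrightarrow> norm z \<le> 1 \<Longrightarrow> norm (fs 0 (of_real x + z) + A) \<le> B * norm z powr p * Im z powr (- q)) \<Longrightarrow>
     0 < Im z \<Longrightarrow> norm z \<le> 1/4 \<Longrightarrow> norm (fs (\<alpha> - real j) (of_real x + z)) \<le> C * norm z powr p * Im z powr (\<alpha> - q - real j)"
proof -
  define C1 where "C1 = fact j * 2 ^ j * B * 2 powr p * 2 powr q / w ^ j"
  have C1: "0 \<le> C1" using B w by (simp add: C1_def)
  obtain C2 where C2: "0 \<le> C2" "\<And>z. 1/4 \<le> Im z \<Longrightarrow> norm (fs (- real j) z) \<le> C2 * exp (- (w * low * Im z))"
    using fs_decay[of "1/4" "- real j"] by auto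
  define j' where "j' = q + real j"
  have j': "0 < j'" "\<alpha> < j'" "\<alpha> + p < j'" using j p q by (auto simp: j'_def)
  define K1 where "K1 = 1 / \<alpha> + 1 / (j' - \<alpha>)"
  define K2 where "K2 = 1 / (\<alpha> + p) + 1 / (j' - (\<alpha> + p))"
  have K: "0 \<le> K1" "0 \<le> K2" using al p j' by (auto simp: K1_def K2_def)
  have wl: "0 < w * low" using w low_pos by simp
  define W where "W = w powr \<alpha> / Gamma \<alpha>"
  have W: "0 \<le> W" using Gamma_real_pos[OF al] by (simp add: W_def)
  define K3 where "K3 = C2 * (Gamma \<alpha> * (w * low) powr (- \<alpha>))"
  have K3: "0 \<le> K3" using C2 Gamma_real_pos[OF al] by (simp add: K3_def)
  define C where "C = W * (K3 + C1 * 2 powr p * (K1 + K2))"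
  have "norm (fs (\<alpha> - real j) (of_real x + z)) \<le> C * norm z powr p * Im z powr (\<alpha> - q - real j)"
    if bd: "\<And>z. 0 < Im z \<Longrightarrow> norm z \<le> 1 \<Longrightarrow> norm (fs 0 (of_real x + z) + A) \<le> B * norm z powr p * Im z powr (- q)"
      and z: "0 < Im z" "norm z \<le> 1/4" for x z
  proof -
    define K where "K r u = u powr (r - 1) * (Im z + u) powr (- j')" for r u
    define M where "M u = C2 * exp (- (w * low * u)) + C1 * 2 powr p * ((norm z powr p + u powr p) * (Im z + u) powr (- j'))" for u
    have bM: "norm (fs (- real j) (of_real x + z + \<i> * of_real u)) \<le> M u" if u: "0 < u" for u
    proof (cases "norm (z + \<i> * of_real u) \<le> 1/2")
      case True
      have jj: "- q - real j = - j'" by (simp add: j'_def)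
      have "norm (fs (- real j) (of_real x + (z + \<i> * of_real u))) \<le> C1 * norm (z + \<i> * of_real u) powr p * Im (z + \<i> * of_real u) powr (- q - real j)"
        unfolding C1_def by (rule fs_derivative_bound[OF p q(1) B j(1) bd]) (use z u True in auto)
      also have "\<dots> \<le> C1 * (2 powr p * (norm z powr p + u powr p)) * (Im z + u) powr (- j')"
      proof -
        have "norm (z + \<i> * of_real u) \<le> norm z + u"
          using norm_triangle_ineq[of z "\<i> * of_real u"] u by (simp add: norm_mult)
        also have "\<dots> \<le> 2 * max (norm z) u" by simp
        finally have "norm (z + \<i> * of_real u) powr p \<le> (2 * max (norm z) u) powr p"
          using p by (intro powr_mono2) auto
        also have "\<dots> = 2 powr p * max (norm z) u powr p" by (rule powr_mult)
        also have "\<dots> \<le> 2 powr p * (norm z powr p + u powr p)" by (intro mult_left_mono) (auto simp: max_def)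
        finally have "C1 * norm (z + \<i> * of_real u) powr p * (Im z + u) powr (- j') \<le> C1 * (2 powr p * (norm z powr p + u powr p)) * (Im z + u) powr (- j')"
          using C1 by (intro mult_right_mono mult_left_mono) auto
        then show ?thesis unfolding jj by simp
      qed
      also have "\<dots> \<le> M u" using C2(1) by (simp add: M_def mult_ac)
      finally show ?thesis by (simp add: add.assoc)
    next
      case False
      have "norm (z + \<i> * of_real u) \<le> norm z + u"
        using norm_triangle_ineq[of z "\<i> * of_real u"] u by (simp add: norm_mult)
      then have u4: "1/4 \<le> u" using False z by linarith
      have "norm (fs (- real j) (of_real x + z + \<i> * of_real u)) \<le> C2 * exp (- (w * low * (Im z + u)))"
        using C2(2)[of "of_real x + z + \<i> * of_real u"] u4 z by simp
      also have "\<dots> \<le> C2 * exp (- (w * low * u))"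
      proof (rule mult_left_mono[OF _ C2(1)])
        have "w * low * u \<le> w * low * (Im z + u)" by (rule mult_left_mono) (use z wl in linarith)+
        then show "exp (- (w * low * (Im z + u))) \<le> exp (- (w * low * u))" by simp
      qed
      also have "\<dots> \<le> M u" unfolding M_def using C1 by simp
      finally show ?thesis .
    qed
    have i0: "((\<lambda>u. u powr (\<alpha> - 1) * exp (- (w * low * u))) has_integral (Gamma \<alpha> * (w * low) powr (- \<alpha>))) {0<..}"
      by (rule Gamma_integral_scaled[OF al wl])
    have i1: "K \<alpha> integrable_on {0<..}" "integral {0<..} (K \<alpha>) \<le> K1 * Im z powr (\<alpha> - j')"
      using kernel_integral_bound[of \<alpha> j' "Im z"] al j' z unfolding K_def[abs_def] K1_def by auto
    have i2: "K (\<alpha> + p) integrable_on {0<..}" "integral {0<..} (K (\<alpha> + p)) \<le> K2 * Im z powr (\<alpha> + p - j')"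
      using kernel_integral_bound[of "\<alpha> + p" j' "Im z"] al p j' z unfolding K_def[abs_def] K2_def by auto
    define R where "R u = C2 * (u powr (\<alpha> - 1) * exp (- (w * low * u))) + C1 * 2 powr p * (norm z powr p * K \<alpha> u + K (\<alpha> + p) u)" for u
    have RM: "u powr (\<alpha> - 1) * M u = R u" for u
    proof -
      have "u powr (\<alpha> - 1) * u powr p = u powr (\<alpha> + p - 1)"
        by (simp add: powr_add[symmetric] algebra_simps)
      then show ?thesis unfolding R_def M_def K_def by (simp add: algebra_simps)
    qed
    have hR: "(R has_integral (K3 + C1 * 2 powr p * (norm z powr p * integral {0<..} (K \<alpha>) + integral {0<..} (K (\<alpha> + p))))) {0<..}"
      unfolding R_def[abs_def] K3_def
      by (intro has_integral_add has_integral_mult_right i0 integrable_integral i1 i2)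
    have hM: "((\<lambda>u. u powr (\<alpha> - 1) * M u) has_integral (K3 + C1 * 2 powr p * (norm z powr p * integral {0<..} (K \<alpha>) + integral {0<..} (K (\<alpha> + p))))) {0<..}"
      unfolding RM by (rule hR)
    have "norm (fs (- real j + \<alpha>) (of_real x + z)) \<le> W * integral {0<..} (\<lambda>u. u powr (\<alpha> - 1) * M u)"
      unfolding W_def by (rule fs_Gamma_bound[OF al]) (use z hM bM in auto)
    also have "\<dots> = W * (K3 + C1 * 2 powr p * (norm z powr p * integral {0<..} (K \<alpha>) + integral {0<..} (K (\<alpha> + p))))"
      unfolding integral_unique[OF hM] ..
    also have "\<dots> \<le> W * (K3 * (norm z powr p * Im z powr (\<alpha> - j')) + C1 * 2 powr p * (norm z powr p * (K1 * Im z powr (\<alpha> - j')) + K2 * (norm z powr p * Im z powr (\<alpha> - j'))))"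
    proof (intro mult_left_mono add_mono W)
      have y1: "Im z \<le> 1" using complex_Im_le_norm[of z] z by linarith
      have yp: "Im z powr p * Im z powr (\<alpha> - j') \<le> norm z powr p * Im z powr (\<alpha> - j')"
        using p z complex_Im_le_norm by (intro mult_right_mono powr_mono2) auto
      \<comment> \<open>The exponent is negative and the height at most 1, so the constant left by
        the exponential part is absorbed into the main term.\<close>
      have "Im z powr 0 \<le> Im z powr (p + (\<alpha> - j'))" using y1 z j' by (intro powr_mono') auto
      then have "1 \<le> Im z powr p * Im z powr (\<alpha> - j')" using z by (simp add: powr_add)
      then have "1 \<le> norm z powr p * Im z powr (\<alpha> - j')" using yp by (rule order_trans)
      then show "K3 \<le> K3 * (norm z powr p * Im z powr (\<alpha> - j'))" using K3 by (simp add: mult_le_cancel_left1)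
      have "Im z powr (\<alpha> + p - j') = Im z powr p * Im z powr (\<alpha> - j')" by (simp add: powr_add[symmetric] algebra_simps)
      then show "integral {0<..} (K (\<alpha> + p)) \<le> K2 * (norm z powr p * Im z powr (\<alpha> - j'))"
        using i2(2) mult_left_mono[OF yp K(2)] by simp
    qed (use i1(2) C1 in auto)
    also have "\<dots> = C * norm z powr p * Im z powr (\<alpha> - j')"
      by (simp add: C_def algebra_simps)
    finally show ?thesis by (simp add: j'_def algebra_simps)
  qed
  moreover have "0 \<le> C" unfolding C_def using W K3 C1 K by simp
  ultimately show ?thesis by (rule that[rotated])
qed

text \<open>The growth exponents contribute \<open>p - q\<close> and the fractional integration
  \<open>\<alpha>\<close> to the order; \<open>\<alpha> - q\<close>, which lies between 0 and 1,
  plays the role of \<open>e\<close> in \<open>integrate_repeatedly\<close>. The expansion is found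
  above the axis and reaches it by continuity. The second conclusion uses the same polynomial, so
  that the derivative at \<open>x\<close> can be identified with a limit along the ray.\<close>

lemma Taylor_at_boundary:
  assumes al: "a0 < \<alpha>" and p: "0 \<le> p" and q: "0 \<le> q" "\<alpha> - 1 < q" "q < \<alpha>" and s: "p + (\<alpha> - q) \<notin> \<int>" and B: "0 \<le> B"
    and bd: "\<And>z. 0 < Im z \<Longrightarrow> norm z \<le> 1 \<Longrightarrow> norm (fs 0 (of_real x + z) + A) \<le> B * norm z powr p * Im z powr (- q)"
  obtains P C where "\<And>t. \<bar>t\<bar> \<le> 1/8 \<Longrightarrow> norm (fs \<alpha> (of_real (x + t)) - poly P (of_real t)) \<le> C * \<bar>t\<bar> powr (p + (\<alpha> - q))"
    "\<And>y. 0 < y \<Longrightarrow> y \<le> 1/8 \<Longrightarrow> norm (\<i> * of_real w * fs (\<alpha> - 1) (of_real x + \<i> * of_real y) - poly (pderiv P) (\<i> * of_real y)) \<le> C * y powr (p + (\<alpha> - q) - 1)"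
proof -
  have al0: "0 < \<alpha>" using al a0 by linarith
  obtain j :: nat where j: "real j > \<alpha> + p - q + 1" using reals_Archimedean2 by blast
  have j0: "0 < j" "\<alpha> + p - q < real j" using j p q by (auto intro!: Nat.gr0I)
  obtain C0 where C0: "0 \<le> C0" "\<And>z. 0 < Im z \<Longrightarrow> norm z \<le> 1/4 \<Longrightarrow>
     norm (fs (\<alpha> - real j) (of_real x + z)) \<le> C0 * norm z powr p * Im z powr (\<alpha> - q - real j)"
    using two_microlocal_bound[OF al0 p q(1,3) B j0, of A] bd by metis
  define D where "D i z = (\<i> * of_real w) ^ i * fs (\<alpha> - real i) (of_real x + z)" for i z
  have D: "(D i has_field_derivative D (Suc i) z) (at z)" if "0 < Im z" for i z
  proof -
    have e: "\<alpha> - real i - 1 = \<alpha> - real (Suc i)" by simp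
    have "((\<lambda>z. fs (\<alpha> - real i) (of_real x + z)) has_field_derivative \<i> * of_real w * fs (\<alpha> - real i - 1) (of_real x + z)) (at z)"
      using fs_deriv[of "of_real x + z" "\<alpha> - real i"] that DERIV_shift[of "fs (\<alpha> - real i)" _ z "of_real x"] by (simp add: add.commute)
    from DERIV_cmult[OF this, of "(\<i> * of_real w) ^ i"] show ?thesis
      unfolding D_def e by (simp add: mult_ac)
  qed
  have b8: "norm (D j z) \<le> (w ^ j * C0) * norm z powr p * Im z powr (\<alpha> - q - real j)"
    if z: "\<bar>Re z\<bar> \<le> 1/8" "0 < Im z" "Im z \<le> 1/8" for z
  proof -
    have "norm z \<le> 1/4" using cmod_le[of z] z by linarith
    then have "norm (fs (\<alpha> - real j) (of_real x + z)) \<le> C0 * norm z powr p * Im z powr (\<alpha> - q - real j)"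
      using C0(2) z by blast
    then show ?thesis using w by (simp add: D_def norm_mult norm_power mult.assoc mult_left_mono)
  qed
  obtain P C where PC: "0 \<le> C"
    "\<And>z. \<bar>Re z\<bar> \<le> 1/8 \<Longrightarrow> 0 < Im z \<Longrightarrow> Im z \<le> 1/8 \<Longrightarrow> norm (D 0 z - poly P z) \<le> C * norm z powr (p + (\<alpha> - q))"
    "\<And>z. \<bar>Re z\<bar> \<le> 1/8 \<Longrightarrow> 0 < Im z \<Longrightarrow> Im z \<le> 1/8 \<Longrightarrow> norm (D 1 z - poly (pderiv P) z) \<le> C * norm z powr p * Im z powr ((\<alpha> - q) - 1)"
    by (rule integrate_repeatedly[of D "w ^ j * C0" p "\<alpha> - q" "1/8" j]) (use D b8 C0(1) w p q s j0 in auto)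
  show ?thesis
  proof (rule that)
    fix y :: real assume y: "0 < y" "y \<le> 1/8"
    have "norm (D 1 (\<i> * of_real y) - poly (pderiv P) (\<i> * of_real y)) \<le> C * y powr p * y powr ((\<alpha> - q) - 1)"
      using PC(3)[of "\<i> * of_real y"] y by (simp add: norm_mult)
    then show "norm (\<i> * of_real w * fs (\<alpha> - 1) (of_real x + \<i> * of_real y) - poly (pderiv P) (\<i> * of_real y)) \<le> C * y powr (p + (\<alpha> - q) - 1)"
      by (simp add: D_def mult.assoc powr_add[symmetric] add_diff_eq)
  next
    fix t :: real assume t: "\<bar>t\<bar> \<le> 1/8"
    define ph where "ph y = of_real t + \<i> * of_real y" for y :: real
    show "norm (fs \<alpha> (of_real (x + t)) - poly P (of_real t)) \<le> C * \<bar>t\<bar> powr (p + (\<alpha> - q))"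
    proof (rule tendsto_le[of "at_right 0"])
      have c1: "continuous_on {0..} (\<lambda>y. norm (fs \<alpha> (of_real x + ph y) - poly P (ph y)))"
        unfolding ph_def by (intro continuous_intros continuous_on_compose2[OF fs_continuous[OF al]]) auto
      have c2: "continuous_on {0..} (\<lambda>y. C * norm (ph y) powr (p + (\<alpha> - q)))"
      proof -
        have "continuous_on {0..} (\<lambda>y. norm (ph y))" unfolding ph_def by (intro continuous_intros)
        then show ?thesis using p q by (intro continuous_on_mult continuous_on_powr' continuous_on_const) auto
      qed
      have lim: "(g \<longlongrightarrow> g 0) (at_right 0)" if "continuous_on {0..} g" for g :: "real \<Rightarrow> real"
      proof -
        have "(g \<longlongrightarrow> g 0) (at 0 within {0..})" using that by (auto simp: continuous_on_def)
        then show ?thesis by (rule tendsto_within_subset) auto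
      qed
      show "((\<lambda>y. norm (fs \<alpha> (of_real x + ph y) - poly P (ph y))) \<longlongrightarrow> norm (fs \<alpha> (of_real (x + t)) - poly P (of_real t))) (at_right 0)"
        using lim[OF c1] by (simp add: ph_def)
      show "((\<lambda>y. C * norm (ph y) powr (p + (\<alpha> - q))) \<longlongrightarrow> C * \<bar>t\<bar> powr (p + (\<alpha> - q))) (at_right 0)"
        using lim[OF c2] by (simp add: ph_def)
      have "eventually (\<lambda>y. y \<in> {0<..<1/8}) (at_right (0::real))" by (rule eventually_at_right_real) simp
      then show "eventually (\<lambda>y. norm (fs \<alpha> (of_real x + ph y) - poly P (ph y)) \<le> C * norm (ph y) powr (p + (\<alpha> - q))) (at_right 0)"
        by eventually_elim (use PC(2)[of "ph _"] t in \<open>simp add: ph_def D_def\<close>)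
    qed simp
  qed
qed

end

lemma norm_powr_complex: "z \<noteq> 0 \<Longrightarrow> norm (z powr complex_of_real r) = norm z powr r"
  by (simp add: powr_def)

subsection \<open>Integer matrices acting on the upper half plane\<close>

lemma SL2Z_mult: "g \<in> SL2Z \<Longrightarrow> h \<in> SL2Z \<Longrightarrow> imat_mult g h \<in> SL2Z"
proof -
  assume "g \<in> SL2Z" "h \<in> SL2Z"
  obtain a b c d where g: "g = (a,b,c,d)" by (cases g)
  obtain a' b' c' d' where h: "h = (a',b',c',d')" by (cases h)
  have 1: "a*d - b*c = 1" "a'*d' - b'*c' = 1" using \<open>g \<in> SL2Z\<close> \<open>h \<in> SL2Z\<close> by (auto simp: g h SL2Z_def)
  have "(a*a'+b*c')*(c*b'+d*d') - (a*b'+b*d')*(c*a'+d*c') = (a*d - b*c)*(a'*d' - b'*c')" by (simp add: algebra_simps)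
  then show ?thesis using 1 by (simp add: g h SL2Z_def)
qed

lemma SL2Z_inv: "g \<in> SL2Z \<Longrightarrow> imat_inv g \<in> SL2Z"
  by (cases g) (auto simp: SL2Z_def algebra_simps)

lemma SL2Z_neg: "g \<in> SL2Z \<Longrightarrow> imat_neg g \<in> SL2Z"
  by (cases g) (auto simp: SL2Z_def algebra_simps)

lemma imat_mult_assoc: "imat_mult (imat_mult g h) k = imat_mult g (imat_mult h k)"
  by (cases g; cases h; cases k) (simp add: algebra_simps)

lemma imat_mult_inv: "g \<in> SL2Z \<Longrightarrow> imat_mult g (imat_inv g) = (1,0,0,1)"
  by (cases g) (simp add: SL2Z_def algebra_simps)

lemma imat_inv_mult: "g \<in> SL2Z \<Longrightarrow> imat_mult (imat_inv g) g = (1,0,0,1)"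
  by (cases g) (simp add: SL2Z_def algebra_simps)

lemma imat_inv_mult_distrib: "imat_inv (imat_mult g h) = imat_mult (imat_inv h) (imat_inv g)"
  by (cases g; cases h) (simp add: algebra_simps)

lemma imat_inv_inv [simp]: "imat_inv (imat_inv g) = g"
  by (cases g) simp

lemma imat_mult_one [simp]: "imat_mult (1,0,0,1) g = g" "imat_mult g (1,0,0,1) = g"
  by (cases g; simp)+

lemma imat_neg_mult: "imat_mult (imat_neg g) h = imat_neg (imat_mult g h)" "imat_mult g (imat_neg h) = imat_neg (imat_mult g h)"
  by (cases g; cases h; simp)+

lemma mobius_denominator_nonzero:
  assumes "(a,b,c,d) \<in> SL2Z" "0 < Im z"
  shows "of_int c * z + of_int d \<noteq> 0"
proof
  assume 0: "of_int c * z + of_int d = 0"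
  then have "Im (of_int c * z + of_int d) = 0" by simp
  then have "c = 0" using assms(2) by simp
  moreover from this 0 have "d = 0" by simp
  ultimately show False using assms(1) by (simp add: SL2Z_def)
qed

lemma Im_mobius:
  assumes g: "(a,b,c,d) \<in> SL2Z" and z: "0 < Im z"
  shows "Im (mobius (a,b,c,d) z) = Im z / (norm (of_int c * z + of_int d))\<^sup>2"
proof -
  have det: "real_of_int a * real_of_int d - real_of_int b * real_of_int c = 1"
    using g unfolding SL2Z_def by (metis (mono_tags, lifting) case_prodD mem_Collect_eq of_int_1 of_int_diff of_int_mult)
  have "Im ((of_int a * z + of_int b) / (of_int c * z + of_int d)) =
     Im ((of_int a * z + of_int b) * cnj (of_int c * z + of_int d)) / (norm (of_int c * z + of_int d))\<^sup>2"
    by (simp add: Im_divide cmod_power2 algebra_simps)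
  also have "Im ((of_int a * z + of_int b) * cnj (of_int c * z + of_int d)) = (real_of_int a * real_of_int d - real_of_int b * real_of_int c) * Im z"
    by (simp add: algebra_simps)
  finally show ?thesis by (simp add: det)
qed

lemma Im_mobius_pos:
  assumes "g \<in> SL2Z" "0 < Im z"
  shows "0 < Im (mobius g z)"
proof -
  obtain a b c d where g: "g = (a,b,c,d)" by (cases g)
  show ?thesis using Im_mobius[of a b c d z] mobius_denominator_nonzero[of a b c d z] assms by (simp add: g)
qed

lemma mobius_mult:
  assumes g: "g \<in> SL2Z" and h: "h \<in> SL2Z" and z: "0 < Im z"
  shows "mobius (imat_mult g h) z = mobius g (mobius h z)"
proof -
  obtain a b c d where ge: "g = (a,b,c,d)" by (cases g)
  obtain a' b' c' d' where he: "h = (a',b',c',d')" by (cases h)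
  define D where "D = of_int c' * z + of_int d'"
  define N where "N = of_int a' * z + of_int b'"
  have D: "D \<noteq> 0" unfolding D_def using mobius_denominator_nonzero h z he by blast
  have "mobius g (mobius h z) = (of_int a * (N / D) + of_int b) / (of_int c * (N / D) + of_int d)"
    by (simp add: ge he N_def D_def)
  also have "\<dots> = ((of_int a * (N / D) + of_int b) * D) / ((of_int c * (N / D) + of_int d) * D)"
    using D by simp
  also have "\<dots> = (of_int a * N + of_int b * D) / (of_int c * N + of_int d * D)"
    using D by (simp add: distrib_right)
  also have "\<dots> = mobius (imat_mult g h) z"
    by (simp add: ge he N_def D_def algebra_simps)
  finally show ?thesis ..
qed

lemma mobius_one [simp]: "mobius (1,0,0,1) z = z"
  by simp

lemma mobius_neg: "mobius (imat_neg g) z = mobius g z"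
proof (cases g)
  case (fields a b c d)
  have "mobius (imat_neg g) z = (- (of_int a * z + of_int b)) / (- (of_int c * z + of_int d))" by (simp add: fields)
  then show ?thesis by (simp only: divide_minus_left divide_minus_right minus_minus) (simp add: fields)
qed

lemma mobius_inv_cancel:
  assumes "g \<in> SL2Z" "0 < Im z"
  shows "mobius (imat_inv g) (mobius g z) = z" "mobius g (mobius (imat_inv g) z) = z"
  using mobius_mult[of "imat_inv g" g z] mobius_mult[of g "imat_inv g" z] assms
  by (simp_all add: SL2Z_inv imat_inv_mult imat_mult_inv del: mobius.simps)

lemma coprime_imp_SL2Z:
  assumes "coprime c d"
  obtains a b where "(a,b,c,d) \<in> SL2Z"
proof -
  obtain u v where "u * c + v * d = gcd c d" using bezout_int by blast
  then have "v * d - (- u) * c = 1" using assms by simp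
  then show ?thesis by (intro that[of v "- u"]) (simp add: SL2Z_def)
qed

text \<open>Dirichlet approximation of \<open>Re z\<close> with denominators up to \<open>1 / sqrt (Im z)\<close> replaces the reduction
  to a fundamental domain.\<close>

lemma move_up:
  assumes y: "0 < Im z" "Im z \<le> 1"
  obtains g where "g \<in> SL2Z" "1/5 \<le> Im (mobius g z)" "Im (mobius g z) \<le> 1 / Im z"
proof -
  define y where "y = Im z"
  define N where "N = nat \<lceil>1 / sqrt y\<rceil>"
  have y0: "0 < y" "y \<le> 1" using assms by (auto simp: y_def)
  have s: "0 < sqrt y" "sqrt y \<le> 1" using y0 by auto
  have N1: "1 / sqrt y \<le> real N" unfolding N_def using s by (simp add: of_nat_ceiling)
  have "real N \<le> 1 / sqrt y + 1" unfolding N_def using s by (simp add: of_nat_nat)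
  moreover have "1 \<le> 1 / sqrt y" using s by simp
  moreover have "2 / sqrt y = 1 / sqrt y + 1 / sqrt y" by simp
  ultimately have N2: "real N \<le> 2 / sqrt y" by linarith
  have "0 < real N" using N1 s by (smt (verit) divide_pos_pos)
  then have Npos: "N > 0" by simp
  obtain h k where hk: "coprime h k" "0 < k" "k \<le> int N" "\<bar>of_int k * Re z - of_int h\<bar> < 1/N"
    using Dirichlet_approx_coprime[OF Npos, of "Re z"] by blast
  have "coprime k (- h)" using hk(1) by (simp add: coprime_commute)
  then obtain a b where g: "(a,b,k,-h) \<in> SL2Z" using coprime_imp_SL2Z by blast
  have n2: "(norm (of_int k * z + of_int (- h)))\<^sup>2 = (of_int k * Re z - of_int h)\<^sup>2 + (of_int k * y)\<^sup>2"
    by (simp add: cmod_power2 y_def)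
  have "(of_int k * Re z - of_int h)\<^sup>2 \<le> (1/N)\<^sup>2"
    using hk(4) by (intro power2_le_iff_abs_le[THEN iffD2]) auto
  also have "(1/N)\<^sup>2 \<le> (sqrt y)\<^sup>2"
    using N1 s \<open>0 < real N\<close> by (intro power_mono) (auto simp: field_simps)
  finally have 1: "(of_int k * Re z - of_int h)\<^sup>2 \<le> y" using y0 by simp
  have "of_int k * y \<le> real N * y" using hk(3) y0 by (intro mult_right_mono) linarith+
  also have "\<dots> \<le> 2 / sqrt y * y" using N2 y0 by (intro mult_right_mono) auto
  also have "\<dots> = 2 * sqrt y" using y0 real_div_sqrt[of y] by (simp only: times_divide_eq_left times_divide_eq_right[symmetric])
  finally have "(of_int k * y)\<^sup>2 \<le> (2 * sqrt y)\<^sup>2" using hk(2) y0 by (intro power_mono) auto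
  then have 2: "(of_int k * y)\<^sup>2 \<le> 4 * y" using y0 by (simp add: power_mult_distrib)
  have up: "(norm (of_int k * z + of_int (- h)))\<^sup>2 \<le> 5 * y" unfolding n2 using 1 2 by linarith
  have "1 * y \<le> real_of_int k * y" using hk(2) y0 by (intro mult_right_mono) auto
  then have "y\<^sup>2 \<le> (of_int k * y)\<^sup>2" using y0 by (intro power_mono) auto
  then have lo: "y\<^sup>2 \<le> (norm (of_int k * z + of_int (- h)))\<^sup>2" unfolding n2 by (simp add: add_increasing)
  have Imeq: "Im (mobius (a,b,k,-h) z) = y / (norm (of_int k * z + of_int (- h)))\<^sup>2"
    using Im_mobius[OF g assms(1)] unfolding y_def .
  have pos: "0 < (norm (of_int k * z + of_int (- h)))\<^sup>2"
    using lo y0 by (smt (verit) zero_less_power)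
  show ?thesis
  proof (rule that[OF g])
    show "1/5 \<le> Im (mobius (a,b,k,-h) z)" unfolding Imeq using up pos by (simp add: field_simps)
    have "y / (norm (of_int k * z + of_int (- h)))\<^sup>2 \<le> y / y\<^sup>2"
      by (intro divide_left_mono mult_pos_pos lo pos) (use y0 in auto)
    then show "Im (mobius (a,b,k,-h) z) \<le> 1 / Im z" unfolding Imeq y_def[symmetric] using y0 by (simp add: power2_eq_square)
  qed
qed

subsection \<open>Fourier expansions\<close>

text \<open>Absolute summability follows from convergence alone: at half the height the terms are
  bounded, and the other half of the exponential supplies a geometric series.\<close>

lemma fourier_exp_qseries:
  fixes a :: "nat \<Rightarrow> complex" and m :: real
  assumes F: "fourier_exp k \<kappa> a" and m: "0 < m"
  defines "c \<equiv> \<lambda>n. if 0 < real n + \<kappa> then a n else 0"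
  shows "qseries c \<kappa> (2 * pi / m)"
    and "0 < Im z \<Longrightarrow> k (z / of_real m) = qseries.fs c \<kappa> (2 * pi / m) 0 z + (if \<kappa> = 0 then a 0 else 0)"
proof -
  have kap: "0 \<le> \<kappa>" "\<kappa> < 1" and
    sums: "\<And>z. 0 < Im z \<Longrightarrow> (\<lambda>n. a n * exp (2 * of_real pi * \<i> * (of_nat n + of_real \<kappa>) * z)) sums k z"
    using F by (auto simp: fourier_exp_def)
  have ne: "norm (a n * exp (2 * of_real pi * \<i> * (of_nat n + of_real \<kappa>) * (\<i> * of_real y))) = norm (a n) * exp (- (2 * pi * (real n + \<kappa>) * y))" for n y
  proof -
    have "2 * of_real pi * \<i> * (of_nat n + of_real \<kappa>) * (\<i> * of_real y) = of_real (- (2 * pi * (real n + \<kappa>) * y))"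
      by (simp add: algebra_simps)
    then show ?thesis by (simp only: norm_mult exp_of_real norm_of_real abs_exp_cancel)
  qed
  show q: "qseries c \<kappa> (2 * pi / m)"
  proof
    show "0 \<le> \<kappa>" by (rule kap)
    show "0 < 2 * pi / m" using m by simp
    show "c 0 = 0" if "\<kappa> = 0" using that by (simp add: c_def)
    fix y :: real assume y: "0 < y"
    define v where "v = y / m / 2"
    have v: "0 < v" using y m by (simp add: v_def)
    have "(\<lambda>n. a n * exp (2 * of_real pi * \<i> * (of_nat n + of_real \<kappa>) * (\<i> * of_real v))) \<longlonglongrightarrow> 0"
      using sums[of "\<i> * of_real v"] v by (intro summable_LIMSEQ_zero) (auto simp: summable_def)
    then have "Bseq (\<lambda>n. a n * exp (2 * of_real pi * \<i> * (of_nat n + of_real \<kappa>) * (\<i> * of_real v)))"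
      using convergentI convergent_imp_Bseq by blast
    then obtain B where B: "0 < B" "\<And>n. norm (a n) * exp (- (2 * pi * (real n + \<kappa>) * v)) \<le> B"
      unfolding Bseq_def ne by blast
    have "summable (\<lambda>n. B * exp (- (2 * pi * v)) ^ n)" using v by (intro summable_mult summable_geometric) auto
    then show "summable (\<lambda>n. norm (c n) * exp (- (2 * pi / m * (real n + \<kappa>) * y)))"
    proof (rule summable_comparison_test'[where N = 0])
      fix n
      have "2 * pi / m * (real n + \<kappa>) * y = 2 * pi * (real n + \<kappa>) * v + 2 * pi * (real n + \<kappa>) * v"
        using m by (simp add: v_def field_simps)
      then have "exp (- (2 * pi / m * (real n + \<kappa>) * y)) = exp (- (2 * pi * (real n + \<kappa>) * v)) * exp (- (2 * pi * (real n + \<kappa>) * v))"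
        by (simp add: exp_add[symmetric])
      then have "norm (c n) * exp (- (2 * pi / m * (real n + \<kappa>) * y)) \<le>
         (norm (a n) * exp (- (2 * pi * (real n + \<kappa>) * v))) * exp (- (2 * pi * (real n + \<kappa>) * v))"
        by (simp only: c_def mult.assoc) simp
      also have "\<dots> \<le> B * exp (- (2 * pi * v)) ^ n"
      proof (rule mult_mono)
        have "exp (- (2 * pi * v)) ^ n = exp (- (2 * pi * v * real n))" by (simp add: exp_of_nat_mult[symmetric] mult.commute)
        moreover have "2 * pi * v * real n \<le> 2 * pi * (real n + \<kappa>) * v"
          using kap v by (simp add: algebra_simps)
        ultimately show "exp (- (2 * pi * (real n + \<kappa>) * v)) \<le> exp (- (2 * pi * v)) ^ n" by simp
      qed (use B in auto)
      finally show "norm (norm (c n) * exp (- (2 * pi / m * (real n + \<kappa>) * y))) \<le> B * exp (- (2 * pi * v)) ^ n" by simp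
    qed
  qed
  interpret qseries c \<kappa> "2 * pi / m" by (rule q)
  assume z: "0 < Im z"
  then have zm: "0 < Im (z / of_real m)" using m by simp
  have "(\<lambda>n. tm 0 n z + (if n = 0 then (if \<kappa> = 0 then a 0 else 0) else 0)) sums (fs 0 z + (if \<kappa> = 0 then a 0 else 0))"
    by (intro sums_add tm_sums z) (rule sums_single[of 0 "\<lambda>_. if \<kappa> = 0 then a 0 else 0", simplified])
  moreover have "tm 0 n z + (if n = 0 then (if \<kappa> = 0 then a 0 else 0) else 0) = a n * exp (2 * of_real pi * \<i> * (of_nat n + of_real \<kappa>) * (z / of_real m))" for n
  proof (cases "0 < real n + \<kappa>")
    case True
    have "tm 0 n z = a n * exp (\<i> * of_real (2 * pi / m * (real n + \<kappa>)) * z)"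
      unfolding tm_def lam_def using True by (simp add: c_def)
    also have "\<i> * of_real (2 * pi / m * (real n + \<kappa>)) * z = 2 * of_real pi * \<i> * (of_nat n + of_real \<kappa>) * (z / of_real m)"
      by simp
    finally have "tm 0 n z = a n * exp (2 * of_real pi * \<i> * (of_nat n + of_real \<kappa>) * (z / of_real m))" .
    moreover have "(if n = 0 then (if \<kappa> = 0 then a 0 else 0) else 0) = 0" using True by auto
    ultimately show ?thesis by (simp only: add_0_right)
  next
    case False
    then have "n = 0" "\<kappa> = 0" using kap by auto
    moreover have "tm 0 n z = 0" unfolding tm_def using False by (simp add: c_def)
    ultimately show ?thesis by simp
  qed
  ultimately have "(\<lambda>n. a n * exp (2 * of_real pi * \<i> * (of_nat n + of_real \<kappa>) * (z / of_real m))) sums (fs 0 z + (if \<kappa> = 0 then a 0 else 0))"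
    by (simp only:)
  from sums_unique2[OF sums[OF zm] this] show "k (z / of_real m) = fs 0 z + (if \<kappa> = 0 then a 0 else 0)" .
qed

text \<open>Near a point where \<open>k\<close> does not vanish the quotient of
  \<open>k (z + 1)\<close> and \<open>k z\<close> is holomorphic of modulus 1, hence constant by the
  maximum principle; analytic continuation spreads the identity over the half plane. The multiplier
  of a translation is thus found from moduli only.\<close>

lemma periodic_modulus_imp_multiplier:
  fixes k :: "complex \<Rightarrow> complex"
  assumes hol: "k holomorphic_on {z. 0 < Im z}" and nz: "0 < Im z0" "k z0 \<noteq> 0"
    and per: "\<And>z. 0 < Im z \<Longrightarrow> norm (k (z + 1)) = norm (k z)"
  obtains c where "norm c = 1" "\<And>z. 0 < Im z \<Longrightarrow> k (z + 1) = c * k z"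
proof -
  define S where "S = {z::complex. 0 < Im z}"
  have opS: "open S" unfolding S_def by (rule open_halfspace_Im_gt)
  have conS: "connected S" unfolding S_def by (intro convex_connected convex_halfspace_Im_gt)
  have holS: "k holomorphic_on S" using hol by (simp add: S_def)
  have hol1: "(\<lambda>z. k (z + 1)) holomorphic_on S"
  proof -
    have 1: "(\<lambda>z::complex. z + 1) holomorphic_on S" by (intro holomorphic_intros)
    have 2: "(\<lambda>z. z + 1) ` S \<subseteq> S" by (auto simp: S_def)
    from holomorphic_on_compose_gen[OF 1 holS 2] show ?thesis by (simp add: o_def)
  qed
  have "continuous_on S k" by (rule holomorphic_on_imp_continuous_on[OF holS])
  then have "isCont k z0" using opS nz(1) by (simp add: continuous_on_eq_continuous_at S_def)
  then obtain e where e: "0 < e" "\<And>u. dist z0 u < e \<Longrightarrow> k u \<noteq> 0"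
    using continuous_at_avoid[of z0 k 0] nz by (auto simp: dist_commute)
  obtain e' where e': "0 < e'" "ball z0 e' \<subseteq> S" using opS nz by (auto simp: S_def open_contains_ball)
  define U where "U = ball z0 (min e e')"
  have U: "open U" "connected U" "z0 \<in> U" "U \<subseteq> S" "\<And>u. u \<in> U \<Longrightarrow> k u \<noteq> 0"
    unfolding U_def using e e' by auto
  have nR: "norm (k (u + 1) / k u) = 1" if "u \<in> U" for u
    using U(5)[OF that] per[of u] U(4) that by (auto simp: norm_divide S_def)
  have "(\<lambda>u. k (u + 1) / k u) constant_on U"
  proof (rule maximum_modulus_principle[OF _ U(1,2,1) order_refl U(3)])
    show "(\<lambda>u. k (u + 1) / k u) holomorphic_on U"
      using U(4,5) holS hol1 by (intro holomorphic_intros) (auto intro: holomorphic_on_subset)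
  qed (simp add: nR U(3))
  then obtain c where c: "\<And>u. u \<in> U \<Longrightarrow> k (u + 1) / k u = c" by (auto simp: constant_on_def)
  have "k (z + 1) = c * k z" if "0 < Im z" for z
  proof (rule analytic_continuation_open[OF U(1) opS _ conS U(4) hol1])
    show "(\<lambda>z. c * k z) holomorphic_on S" by (intro holomorphic_intros holS)
    show "U \<noteq> {}" using U(3) by auto
    show "k (u + 1) = c * k u" if "u \<in> U" for u using c[OF that] U(5)[OF that] by (simp add: field_simps)
  qed (use that in \<open>simp add: S_def\<close>)
  moreover have "norm c = 1" using nR[OF U(3)] c[OF U(3)] by simp
  ultimately show ?thesis by (rule that[rotated])
qed

text \<open>After removal of the multiplier by
  \<open>exp (- (2 * of_real pi * \<i> * of_real \<kappa> * z))\<close> the function is periodic and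
  descends to the punctured disc in \<open>exp (2 * of_real pi * \<i> * z)\<close>. Polynomial
  growth makes 0 a removable singularity, and the Taylor series there is the expansion. Growth is
  asked for in one vertical strip because the modulus of \<open>k\<close> is periodic.\<close>

lemma ex_fourier_exp:
  fixes k :: "complex \<Rightarrow> complex"
  assumes hol: "k holomorphic_on {z. 0 < Im z}" and nz: "0 < Im z0" "k z0 \<noteq> 0"
    and per: "\<And>z. 0 < Im z \<Longrightarrow> norm (k (z + 1)) = norm (k z)"
    and gr: "\<And>z. 1 \<le> Im z \<Longrightarrow> 0 \<le> Re z \<Longrightarrow> Re z \<le> 1 \<Longrightarrow> norm (k z) \<le> C * Im z powr N"
  obtains \<kappa> a where "fourier_exp k \<kappa> a"
proof -
  obtain c where c: "norm c = 1" "\<And>z. 0 < Im z \<Longrightarrow> k (z + 1) = c * k z"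
    using periodic_modulus_imp_multiplier[OF hol nz per] by blast
  define \<kappa> where "\<kappa> = frac (Arg c / (2 * pi))"
  have kap: "0 \<le> \<kappa>" "\<kappa> < 1" by (auto simp: \<kappa>_def frac_lt_1)
  have ck: "c = exp (2 * of_real pi * \<i> * of_real \<kappa>)"
  proof -
    have "c \<noteq> 0" using c(1) by auto
    then have "c = cis (Arg c)" using c(1) by (simp add: cis_Arg sgn_eq)
    also have "Arg c = 2 * pi * \<kappa> + 2 * pi * of_int \<lfloor>Arg c / (2 * pi)\<rfloor>"
      by (simp add: \<kappa>_def frac_def field_simps)
    also have "cis \<dots> = cis (2 * pi * \<kappa>)"
      by (simp only: cis_mult[symmetric] cis_multiple_2pi[OF Ints_of_int] mult_1_right)
    finally show ?thesis by (simp add: cis_conv_exp mult_ac)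
  qed
  define E where "E z = k z * exp (- (2 * of_real pi * \<i> * of_real \<kappa> * z))" for z
  have E1: "E (z + 1) = E z" if "0 < Im z" for z
  proof -
    have "exp (- (2 * of_real pi * \<i> * of_real \<kappa> * (z + 1))) = exp (- (2 * of_real pi * \<i> * of_real \<kappa> * z)) * inverse c"
      unfolding ck exp_minus[symmetric] exp_add[symmetric] by (simp add: algebra_simps)
    moreover have "c \<noteq> 0" using c(1) by auto
    ultimately show ?thesis using c(2)[OF that] by (simp add: E_def)
  qed
  have En: "E (z + of_nat n) = E z" if "0 < Im z" for z n
  proof (induction n)
    case (Suc n)
    have "E (z + of_nat (Suc n)) = E ((z + of_nat n) + 1)" by (simp add: add_ac)
    also have "\<dots> = E (z + of_nat n)" using that by (intro E1) simp
    finally show ?case using Suc by simp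
  qed simp
  have Ei: "E (z + of_int n) = E z" if "0 < Im z" for z n
  proof (cases "0 \<le> n")
    case True
    then show ?thesis using En[OF that, of "nat n"] by simp
  next
    case False
    then show ?thesis using En[of "z + of_int n" "nat (- n)"] that by simp
  qed
  define L where "L q = Ln q / (2 * of_real pi * \<i>)" for q
  define p where "p q = E (L q)" for q
  have ImL: "Im (L q) = - (ln (norm q) / (2 * pi))" if "q \<noteq> 0" for q
  proof -
    have "L q = - (\<i> * Ln q / of_real (2 * pi))" by (simp add: L_def field_simps)
    then show ?thesis using that by (simp only: uminus_complex.sel Im_divide_of_real) (simp add: Re_Ln)
  qed
  have pE: "p (exp (2 * of_real pi * \<i> * z)) = E z" if z: "0 < Im z" for z
  proof -
    have "exp (Ln (exp (2 * of_real pi * \<i> * z))) = exp (2 * of_real pi * \<i> * z)" by (simp add: exp_Ln)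
    then obtain n :: int where n: "Ln (exp (2 * of_real pi * \<i> * z)) = 2 * of_real pi * \<i> * z + (of_int (2 * n) * pi) * \<i>"
      using exp_eq by blast
    have "L (exp (2 * of_real pi * \<i> * z)) = z + of_int n"
      unfolding L_def n by (simp add: field_simps)
    then show ?thesis unfolding p_def using Ei[OF z] by simp
  qed
  have holE: "E holomorphic_on {z. 0 < Im z}"
    unfolding E_def by (intro holomorphic_intros hol)
  have holp: "p holomorphic_on ball 0 1 - {0}"
  proof -
    have "p field_differentiable at q" if q: "q \<in> ball 0 1 - {0}" for q
    proof -
      \<comment> \<open>A branch of the logarithm centred at \<open>q\<close>, holomorphic there
        even when \<open>q\<close> lies on the cut of \<open>Ln\<close>; \<open>E\<close> does not
        notice the change of branch.\<close>
      define l where "l u = L q + Ln (u / q) / (2 * of_real pi * \<i>)" for u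
      have q0: "q \<noteq> 0" "norm q < 1" using q by auto
      have lq: "l q = L q" "0 < Im (L q)" using q0 ImL[OF q0(1)] by (auto simp: l_def divide_neg_pos)
      have dl: "l field_differentiable at q"
      proof -
        have "((\<lambda>u. u / q) has_field_derivative 1 / q) (at q)" by (rule DERIV_cdivide[OF DERIV_ident])
        moreover have "(Ln has_field_derivative inverse (q / q)) (at (q / q))"
          using q0 by (intro has_field_derivative_Ln) auto
        ultimately have "((\<lambda>u. Ln (u / q)) has_field_derivative inverse (q / q) * (1 / q)) (at q)"
          by (rule DERIV_chain2[rotated])
        from DERIV_add[OF DERIV_const DERIV_cdivide[OF this]]
        show ?thesis unfolding l_def field_differentiable_def by blast
      qed
      have "isCont l q" using dl by (rule field_differentiable_imp_continuous_at)
      then have icl: "isCont (\<lambda>u. Im (l u)) q" unfolding isCont_def by (rule tendsto_Im)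
      have ev1: "eventually (\<lambda>u. 0 < Im (l u)) (nhds q)"
      proof (rule order_tendstoD(1))
        show "((\<lambda>u. Im (l u)) \<longlongrightarrow> Im (l q)) (nhds q)"
          using icl tendsto_at_iff_tendsto_nhds[of "\<lambda>u. Im (l u)" q] by (simp only: isCont_def)
        show "0 < Im (l q)" using lq by simp
      qed
      have ev2: "eventually (\<lambda>u. u \<noteq> 0) (nhds q)" using q0 by (intro eventually_nhds_in_open[of "- {0}", simplified]) auto
      have "eventually (\<lambda>u. E (l u) = p u) (nhds q)"
        using ev1 ev2
      proof eventually_elim
        case (elim u)
        have "exp (2 * of_real pi * \<i> * l u) = exp (Ln q + Ln (u / q))"
          unfolding l_def L_def distrib_left by simp
        also have "\<dots> = u" using elim q0 by (simp add: exp_add)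
        finally show ?case using pE[OF elim(1)] by simp
      qed
      moreover have "(\<lambda>u. E (l u)) field_differentiable at q"
      proof -
        have "E field_differentiable at (l q)"
          using holE lq by (auto simp: holomorphic_on_open[OF open_halfspace_Im_gt] field_differentiable_def)
        then show ?thesis using field_differentiable_compose[OF dl] by (simp add: o_def)
      qed
      ultimately show ?thesis
        using DERIV_cong_ev[of q q "\<lambda>u. E (l u)" p] unfolding field_differentiable_def by metis
    qed
    then show ?thesis by (auto simp: holomorphic_on_def intro: field_differentiable_at_within)
  qed
  have normk: "norm (k (z + of_int n)) = norm (k z)" if "0 < Im z" for z n
  proof -
    have "norm (k u) = norm (E u) * exp (- (2 * pi * \<kappa> * Im u))" for u
      by (simp add: E_def norm_mult exp_add[symmetric])
    then show ?thesis using Ei[OF that, of n] by simp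
  qed
  have gr': "norm (k z) \<le> C * Im z powr N" if "1 \<le> Im z" for z
    using gr[of "z + of_int (- \<lfloor>Re z\<rfloor>)"] normk[of z "- \<lfloor>Re z\<rfloor>"] that by (simp add: le_floor_iff) linarith
  have lim: "((\<lambda>q. (q - 0) * p q) \<longlongrightarrow> 0) (at 0)"
  proof -
    \<comment> \<open>Half of the room \<open>2 * pi * (1 - \<kappa>)\<close> between the decay of
      \<open>q\<close> and the growth caused by removing the multiplier; the other half leaves the
      positive power \<open>(1 - \<kappa>) / 2\<close> of \<open>norm q\<close>.\<close>
    define \<delta> where "\<delta> = pi * (1 - \<kappa>)"
    have d: "0 < \<delta>" using kap by (simp add: \<delta>_def)
    obtain C' where C': "0 \<le> C'" "\<And>l. 1 \<le> l \<Longrightarrow> l powr N \<le> C' * exp (\<delta> * l)"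
      using powr_le_exp[OF d, of 1 N] by auto
    have bd: "norm (q * p q) \<le> \<bar>C\<bar> * C' * norm q powr ((1 - \<kappa>) / 2)" if q: "q \<noteq> 0" "norm q < exp (- (2 * pi))" for q
    proof -
      define y where "y = Im (L q)"
      have lnq: "ln (norm q) = - (2 * pi * y)" using ImL[OF q(1)] by (simp add: y_def)
      have "ln (norm q) < - (2 * pi)" using q by (metis exp_less_cancel_iff exp_ln zero_less_norm_iff)
      then have y1: "1 \<le> y" using lnq by simp
      have nq: "norm q = exp (- (2 * pi * y))" using lnq q by (metis exp_ln zero_less_norm_iff)
      have "norm (p q) = norm (k (L q)) * exp (2 * pi * \<kappa> * y)"
        by (simp add: p_def E_def norm_mult y_def)
      also have "\<dots> \<le> (\<bar>C\<bar> * (C' * exp (\<delta> * y))) * exp (2 * pi * \<kappa> * y)"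
      proof (rule mult_right_mono)
        have "norm (k (L q)) \<le> C * y powr N" using gr'[of "L q"] y1 by (simp add: y_def)
        also have "\<dots> \<le> \<bar>C\<bar> * y powr N" by (intro mult_right_mono) auto
        also have "\<dots> \<le> \<bar>C\<bar> * (C' * exp (\<delta> * y))" using C'(2)[OF y1] by (intro mult_left_mono) auto
        finally show "norm (k (L q)) \<le> \<bar>C\<bar> * (C' * exp (\<delta> * y))" .
      qed simp
      finally have "norm (q * p q) \<le> exp (- (2 * pi * y)) * ((\<bar>C\<bar> * (C' * exp (\<delta> * y))) * exp (2 * pi * \<kappa> * y))"
        unfolding norm_mult nq by (rule mult_left_mono) simp
      also have "\<dots> = \<bar>C\<bar> * C' * exp (- (2 * pi * y) + \<delta> * y + 2 * pi * \<kappa> * y)"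
        unfolding exp_add by (simp add: mult_ac)
      also have "- (2 * pi * y) + \<delta> * y + 2 * pi * \<kappa> * y = (1 - \<kappa>) / 2 * ln (norm q)"
        by (simp add: lnq \<delta>_def field_simps)
      also have "exp ((1 - \<kappa>) / 2 * ln (norm q)) = norm q powr ((1 - \<kappa>) / 2)" using q by (simp add: powr_def)
      finally show ?thesis .
    qed
    have t0: "((\<lambda>q::complex. \<bar>C\<bar> * C' * norm q powr ((1 - \<kappa>) / 2)) \<longlongrightarrow> 0) (at 0)"
    proof -
      have "((\<lambda>q::complex. norm q powr ((1 - \<kappa>) / 2)) \<longlongrightarrow> 0) (at 0)"
        using tendsto_norm_zero[OF tendsto_ident_at] tendsto_powr'[of "\<lambda>q::complex. norm q" 0 "at 0" "\<lambda>_. (1 - \<kappa>) / 2" "(1 - \<kappa>) / 2"] kap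
        by auto
      then show ?thesis by (rule tendsto_mult_right_zero)
    qed
    show ?thesis
    proof (rule Lim_null_comparison[OF _ t0])
      show "eventually (\<lambda>q. norm ((q - 0) * p q) \<le> \<bar>C\<bar> * C' * norm q powr ((1 - \<kappa>) / 2)) (at 0)"
        unfolding eventually_at by (rule exI[of _ "exp (- (2 * pi))"]) (use bd in auto)
    qed
  qed
  have "(0::complex) \<in> interior (ball 0 1)" by simp
  then obtain g where g: "g holomorphic_on ball 0 1" "\<And>q. q \<in> ball 0 1 - {0} \<Longrightarrow> g q = p q"
    using holomorphic_on_extend_lim[OF holp] lim by blast
  define a where "a n = (deriv ^^ n) g 0 / fact n" for n
  have "fourier_exp k \<kappa> a"
    unfolding fourier_exp_def
  proof (intro conjI kap allI impI)
    fix z :: complex assume z: "0 < Im z"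
    define q where "q = exp (2 * of_real pi * \<i> * z)"
    have q: "q \<in> ball 0 1 - {0}" using z by (simp add: q_def)
    have "(\<lambda>n. a n * (q - 0) ^ n) sums g q"
      unfolding a_def by (rule holomorphic_power_series[OF g(1)]) (use q in auto)
    also have "g q = E z" using g(2)[OF q] pE[OF z] by (simp add: q_def)
    finally have "(\<lambda>n. a n * q ^ n * exp (2 * of_real pi * \<i> * of_real \<kappa> * z)) sums (E z * exp (2 * of_real pi * \<i> * of_real \<kappa> * z))"
      by (intro sums_mult2) simp
    moreover have "E z * exp (2 * of_real pi * \<i> * of_real \<kappa> * z) = k z"
      by (simp add: E_def mult.assoc exp_add[symmetric])
    moreover have "a n * q ^ n * exp (2 * of_real pi * \<i> * of_real \<kappa> * z) = a n * exp (2 * of_real pi * \<i> * (of_nat n + of_real \<kappa>) * z)" for n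
    proof -
      have "q ^ n * exp (2 * of_real pi * \<i> * of_real \<kappa> * z) = exp (2 * of_real pi * \<i> * (of_nat n + of_real \<kappa>) * z)"
        unfolding q_def exp_of_nat_mult[symmetric] exp_add[symmetric] by (simp add: algebra_simps)
      then show ?thesis by (simp add: mult.assoc)
    qed
    ultimately show "(\<lambda>n. a n * exp (2 * of_real pi * \<i> * (of_nat n + of_real \<kappa>) * z)) sums k z" by simp
  qed
  then show ?thesis by (rule that)
qed

section \<open>Parabolic elements fixing a cusp, and matrices sending infinity to a given
  cusp\<close>

definition conjT :: "imat \<Rightarrow> int \<Rightarrow> imat" where
  "conjT g i = imat_mult g (imat_mult (1,i,0,1) (imat_inv g))"

lemma translation_SL2Z: "(1,i,0,1) \<in> SL2Z"
  by (simp add: SL2Z_def)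

lemma conjT_SL2Z: "g \<in> SL2Z \<Longrightarrow> conjT g i \<in> SL2Z"
  unfolding conjT_def by (intro SL2Z_mult SL2Z_inv translation_SL2Z)

lemma conjT_mult_right: "g \<in> SL2Z \<Longrightarrow> imat_mult (conjT g i) g = imat_mult g (1,i,0,1)"
  unfolding conjT_def by (simp add: imat_mult_assoc imat_inv_mult del: imat_mult.simps)

lemma conjT_add:
  assumes "g \<in> SL2Z"
  shows "imat_mult (conjT g i) (conjT g j) = conjT g (i + j)"
proof -
  have "imat_mult (conjT g i) (conjT g j) = imat_mult (imat_mult (conjT g i) g) (imat_mult (1,j,0,1) (imat_inv g))"
    unfolding conjT_def[of g j] by (simp only: imat_mult_assoc)
  also have "\<dots> = imat_mult g (imat_mult (imat_mult (1,i,0,1) (1,j,0,1)) (imat_inv g))"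
    unfolding conjT_mult_right[OF assms] by (simp only: imat_mult_assoc)
  also have "imat_mult (1,i,0,1) (1,j,0,1) = (1,i+j,0,1)" by simp
  finally show ?thesis unfolding conjT_def .
qed

lemma conjT_0: "g \<in> SL2Z \<Longrightarrow> conjT g 0 = (1,0,0,1)"
  unfolding conjT_def by (simp add: imat_mult_inv del: imat_mult.simps)

text \<open>For \<open>c = 0\<close> this rules out \<open>d = -1\<close>, where the denominator of
  \<open>slash\<close> would be a negative real number and sit on the branch cut.\<close>

definition sign_normalized :: "imat \<Rightarrow> bool" where
  "sign_normalized g \<longleftrightarrow> (case g of (a,b,c,d) \<Rightarrow> c < 0 \<or> (c = 0 \<and> d = 1))"

lemma sign_normalized_or_neg:
  assumes "g \<in> SL2Z"
  shows "sign_normalized g \<or> sign_normalized (imat_neg g)"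
proof -
  obtain a b c d where g: "g = (a,b,c,d)" by (cases g)
  have "d = 1 \<or> d = -1" if "c = 0" using assms that by (simp add: g SL2Z_def) (metis zmult_eq_1_iff mult.commute)
  then show ?thesis by (auto simp: g sign_normalized_def)
qed

lemma ex_SL2Z_cusp:
  obtains g where "g \<in> SL2Z" "sign_normalized g" "cusp_image g = Some x"
proof -
  obtain p q where x: "x = Fract p q" "0 < q" "coprime p q" by (cases x)
  obtain u v where "u * p + v * q = gcd p q" using bezout_int by blast
  then have uv: "u * p + v * q = 1" using x(3) by simp
  show ?thesis
    by (rule that[of "(- p, v, - q, - u)"])
       (use uv x in \<open>auto simp: SL2Z_def sign_normalized_def algebra_simps minus_rat_cancel\<close>)
qed

lemma cusp_image_Some:
  assumes "cusp_image (a,b,c,d) = Some x"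
  shows "c \<noteq> 0" "real_of_rat x = of_int a / of_int c"
  using assms by (auto split: if_splits simp: of_rat_rat)

text \<open>From \<open>a / c\<close> minus the image of \<open>w\<close> being
  \<open>1 / (c * (c * w + d))\<close>, solving for the image \<open>a / c + z\<close> gives this
  \<open>w\<close>. It moves the neighbourhood of the cusp \<open>a / c\<close> to infinity, and
  \<open>Im w\<close> is large exactly when \<open>z\<close> lies deep in a horodisc at that
  cusp.\<close>

lemma mobius_cusp_coordinate:
  assumes g: "(a,b,c,d) \<in> SL2Z" and c: "c \<noteq> 0" and z: "0 < Im z"
  defines "w \<equiv> - of_int d / of_int c - 1 / ((of_int c)\<^sup>2 * z)"
  shows "mobius (a,b,c,d) w = of_int a / of_int c + z" "Im w = Im z / ((of_int c)\<^sup>2 * (norm z)\<^sup>2)" "0 < Im w"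
proof -
  have z0: "z \<noteq> 0" using z by auto
  have det: "of_int a * of_int d - of_int b * of_int c = (1::complex)"
    using g unfolding SL2Z_def by (metis (mono_tags, lifting) case_prodD mem_Collect_eq of_int_1 of_int_diff of_int_mult)
  have c0: "(of_int c :: complex) \<noteq> 0" using c by simp
  have den: "of_int c * w + of_int d = - (1 / (of_int c * z))"
    unfolding w_def using c0 z0 by (simp add: field_simps power2_eq_square)
  have "(of_int a * w + of_int b) = (of_int a / of_int c) * (of_int c * w + of_int d) - (of_int a * of_int d - of_int b * of_int c) / of_int c"
    using c0 by (simp add: field_simps)
  then have num: "of_int a * w + of_int b = (of_int a / of_int c) * (of_int c * w + of_int d) - 1 / of_int c"
    unfolding det .
  have dn: "of_int c * w + of_int d \<noteq> 0" unfolding den using c0 z0 by simp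
  have "mobius (a,b,c,d) w = of_int a / of_int c - (1 / of_int c) / (of_int c * w + of_int d)"
    using dn by (simp add: num diff_divide_distrib)
  also have "(1 / of_int c) / (of_int c * w + of_int d) = - z"
    unfolding den using c0 z0 by simp
  finally show "mobius (a,b,c,d) w = of_int a / of_int c + z" by simp
  have "Im w = - Im (1 / z) / (of_int c)\<^sup>2"
  proof -
    have "w = of_real (- of_int d / of_int c) - (1 / z) / of_real ((of_int c)\<^sup>2)" unfolding w_def using c0 z0 by (simp add: field_simps)
    then show ?thesis by (simp only: minus_complex.sel Im_complex_of_real Im_divide_of_real)
  qed
  also have "Im (1 / z) = - Im z / (norm z)\<^sup>2" by (simp add: Im_divide cmod_power2)
  finally show iw: "Im w = Im z / ((of_int c)\<^sup>2 * (norm z)\<^sup>2)" by simp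
  show "0 < Im w" unfolding iw using z z0 c by (intro divide_pos_pos mult_pos_pos) auto
qed

subsection \<open>Growth of modular forms near the real axis\<close>

locale modform =
  fixes G :: "imat set" and \<mu> :: "imat \<Rightarrow> complex" and r :: real and f :: "complex \<Rightarrow> complex" and \<kappa> :: real and coef :: "nat \<Rightarrow> complex"
  assumes G: "finite_index_subgroup G" and mu: "multiplier_system G \<mu>" and r: "0 < r"
    and mf: "modular_form G \<mu> r f" and nonzero: "\<exists>z. 0 < Im z \<and> f z \<noteq> 0"
    and expansion: "fourier_exp (\<lambda>z. f (of_nat (cusp_width G (1,0,0,1)) * z)) \<kappa> coef"
begin

lemma f_holomorphic: "f holomorphic_on {z. 0 < Im z}"
  using mf by (simp add: modular_form_def)

definition h :: "complex \<Rightarrow> real" where "h z = Im z powr (r / 2) * norm (f z)"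

lemma norm_f_eq: "0 < Im z \<Longrightarrow> norm (f z) = Im z powr (- (r / 2)) * h z"
  by (simp add: h_def powr_add[symmetric] mult.assoc[symmetric])

lemma G_SL2Z: "g \<in> G \<Longrightarrow> g \<in> SL2Z"
  using G by (auto simp: finite_index_subgroup_def)

lemma h_invariant_G:
  assumes g: "g \<in> G" and z: "0 < Im z"
  shows "h (mobius g z) = h z"
proof -
  obtain a b c d where ge: "g = (a,b,c,d)" by (cases g)
  define n where "n = norm (of_int c * z + of_int d)"
  have nz: "of_int c * z + of_int d \<noteq> 0" using mobius_denominator_nonzero G_SL2Z[OF g] z ge by blast
  have n: "0 < n" using nz by (simp add: n_def)
  have "f (mobius g z) = \<mu> g * (of_int c * z + of_int d) powr (of_real r) * f z"
    using mf g z unfolding modular_form_def ge by fastforce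
  then have nf: "norm (f (mobius g z)) = n powr r * norm (f z)"
    using mu g nz by (simp add: norm_mult norm_powr_complex multiplier_system_def n_def)
  have "Im (mobius g z) = Im z / n\<^sup>2" unfolding ge n_def using Im_mobius G_SL2Z[OF g] z ge by blast
  then have "Im (mobius g z) powr (r / 2) = Im z powr (r / 2) / n powr r"
    using n by (simp add: powr_divide powr_powr flip: powr_numeral)
  then show ?thesis unfolding h_def nf using n by simp
qed

definition plus_minus_G :: "imat \<Rightarrow> bool" where "plus_minus_G g \<longleftrightarrow> g \<in> G \<or> imat_neg g \<in> G"

lemma h_invariant: "plus_minus_G g \<Longrightarrow> 0 < Im z \<Longrightarrow> h (mobius g z) = h z"
  unfolding plus_minus_G_def using h_invariant_G mobius_neg by metis

text \<open>Pigeonhole: the index is finite, so two powers of the parabolic element lie in the same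
  coset, and their quotient is a positive power inside the group. Hence the least number defining
  the width exists.\<close>

lemma cusp_width_pos_and_mem:
  assumes g: "g \<in> SL2Z"
  shows "0 < cusp_width G g \<and> plus_minus_G (conjT g (int (cusp_width G g)))"
proof -
  define S where "S i = imat_mult (conjT g (int i)) ` G" for i :: nat
  have one: "(1,0,0,1) \<in> G" and fin: "finite ((\<lambda>g. imat_mult g ` G) ` SL2Z)" using G by (auto simp: finite_index_subgroup_def)
  have "range S \<subseteq> (\<lambda>g. imat_mult g ` G) ` SL2Z" using conjT_SL2Z[OF g] by (auto simp: S_def)
  then have "finite (range S)" using fin finite_subset by blast
  then have "\<not> inj S" using finite_imageD infinite_UNIV_nat by blast
  then obtain i j where ij: "i < j" "S i = S j" by (metis injI linorder_neqE_nat)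
  have "conjT g (int j) \<in> S j" unfolding S_def by (rule image_eqI[OF _ one]) simp
  then have "conjT g (int j) \<in> S i" using ij(2) by simp
  then obtain \<gamma> where \<gamma>: "\<gamma> \<in> G" "conjT g (int j) = imat_mult (conjT g (int i)) \<gamma>" unfolding S_def by blast
  have "conjT g (int (j - i)) = imat_mult (conjT g (- int i)) (conjT g (int j))"
    using ij by (simp add: conjT_add[OF g] of_nat_diff)
  also have "\<dots> = imat_mult (imat_mult (conjT g (- int i)) (conjT g (int i))) \<gamma>" unfolding \<gamma>(2) imat_mult_assoc ..
  also have "\<dots> = \<gamma>" using conjT_0[OF g] by (simp add: conjT_add[OF g])
  finally have "conjT g (int (j - i)) \<in> G" using \<gamma> by simp
  then have "0 < j - i \<and> plus_minus_G (conjT g (int (j - i)))" using ij by (simp add: plus_minus_G_def)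
  then have "\<exists>m. 0 < m \<and> plus_minus_G (conjT g (int m))" by blast
  moreover have "cusp_width G g = (LEAST m. 0 < m \<and> plus_minus_G (conjT g (int m)))"
    unfolding cusp_width_def plus_minus_G_def conjT_def by simp
  ultimately show ?thesis by (metis (mono_tags, lifting) LeastI_ex)
qed

lemma plus_minus_G_conjT_multiple:
  assumes g: "g \<in> SL2Z"
  shows "plus_minus_G (conjT g (int n * int (cusp_width G g)))"
proof (induction n)
  case 0
  then show ?case using G by (simp add: conjT_0[OF g] plus_minus_G_def finite_index_subgroup_def)
next
  case (Suc n)
  have mult: "plus_minus_G (imat_mult x y)" if "plus_minus_G x" "plus_minus_G y" for x y
  proof -
    have neg2: "imat_neg (imat_neg z) = z" for z by (cases z) simp
    have "imat_mult x y \<in> G" if "x \<in> G" "y \<in> G" for x y using G that by (auto simp: finite_index_subgroup_def)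
    then show ?thesis using that unfolding plus_minus_G_def by (metis imat_neg_mult neg2)
  qed
  have "conjT g (int (Suc n) * int (cusp_width G g)) = imat_mult (conjT g (int n * int (cusp_width G g))) (conjT g (int (cusp_width G g)))"
    by (simp add: conjT_add[OF g] algebra_simps)
  then show ?case using mult Suc cusp_width_pos_and_mem[OF g] by simp
qed

lemma mobius_conjT:
  assumes g: "g \<in> SL2Z" and w: "0 < Im w"
  shows "mobius (conjT g i) (mobius g w) = mobius g (w + of_int i)"
proof -
  have "mobius (conjT g i) (mobius g w) = mobius (imat_mult (conjT g i) g) w"
    by (rule mobius_mult[OF conjT_SL2Z[OF g] g w, symmetric])
  also have "\<dots> = mobius g (mobius (1,i,0,1) w)"
    unfolding conjT_mult_right[OF g] by (rule mobius_mult[OF g translation_SL2Z w])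
  finally show ?thesis by simp
qed

lemma h_period:
  assumes g: "g \<in> SL2Z" and w: "0 < Im w"
  shows "h (mobius g (w + of_nat (n * cusp_width G g))) = h (mobius g w)"
proof -
  have "h (mobius g (w + of_int (int n * int (cusp_width G g)))) = h (mobius (conjT g (int n * int (cusp_width G g))) (mobius g w))"
    unfolding mobius_conjT[OF g w] ..
  also have "\<dots> = h (mobius g w)" by (rule h_invariant[OF plus_minus_G_conjT_multiple[OF g] Im_mobius_pos[OF g w]])
  finally show ?thesis by simp
qed

definition scal :: "imat \<Rightarrow> rmat" where
  "scal g = rmat_mult (rmat_of g) (sqrt (real (cusp_width G g)), 0, 0, 1 / sqrt (real (cusp_width G g)))"

lemma scaling_matrices_eq: "scaling_matrices G cp = {scal g | g. g \<in> SL2Z \<and> cusp_image g = cp \<and> sign_normalized g}"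
  unfolding scaling_matrices_def scal_def sign_normalized_def ..

lemma slash_scal:
  assumes g: "(a,b,c,d) \<in> SL2Z"
  defines "M \<equiv> real (cusp_width G (a,b,c,d))"
  shows "slash r f (scal (a,b,c,d)) z = f (mobius (a,b,c,d) (of_real M * z)) / ((of_int c * (of_real M * z) + of_int d) / of_real (sqrt M)) powr (of_real r)"
proof -
  have M: "0 < M" using cusp_width_pos_and_mem[OF g] by (simp add: M_def)
  have det: "real_of_int a * real_of_int d - real_of_int b * real_of_int c = 1"
    using g unfolding SL2Z_def by (metis (mono_tags, lifting) case_prodD mem_Collect_eq of_int_1 of_int_diff of_int_mult)
  define s where "s = sqrt M"
  have s: "0 < s" "s * s = M" using M by (auto simp: s_def)
  have sc: "scal (a,b,c,d) = (a * s, b / s, c * s, d / s)" by (simp add: scal_def M_def s_def)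
  have 1: "of_real (a * s) * z + of_real (b / s) = (of_int a * (of_real M * z) + of_int b) / of_real s" for a b :: int
    unfolding s(2)[symmetric] using s(1) by (simp add: field_simps)
  have d1: "a * s * (d / s) - b / s * (c * s) = 1" using s(1) det by simp
  have "slash r f (scal (a,b,c,d)) z = f ((of_real (a * s) * z + of_real (b / s)) / (of_real (c * s) * z + of_real (d / s))) / (of_real (c * s) * z + of_real (d / s)) powr (of_real r)"
    unfolding sc slash.simps d1 by simp
  also have "\<dots> = f (mobius (a,b,c,d) (of_real M * z)) / ((of_int c * (of_real M * z) + of_int d) / of_real s) powr (of_real r)"
    unfolding 1 using s(1) by simp
  finally show ?thesis by (simp add: s_def)
qed

lemma norm_slash_scal:
  assumes g: "g \<in> SL2Z" and z: "0 < Im z"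
  shows "norm (slash r f (scal g) z) = Im z powr (- (r / 2)) * h (mobius g (of_nat (cusp_width G g) * z))"
proof -
  obtain a b c d where ge: "g = (a,b,c,d)" by (cases g)
  define M where "M = real (cusp_width G g)"
  have M: "0 < M" using cusp_width_pos_and_mem[OF g] by (simp add: M_def)
  define n where "n = norm (of_int c * (of_real M * z) + of_int d)"
  have Mz: "0 < Im (of_real M * z)" using M z by simp
  have nz: "of_int c * (of_real M * z) + of_int d \<noteq> 0" using mobius_denominator_nonzero g Mz ge by blast
  then have n: "0 < n" by (simp add: n_def)
  have "norm (slash r f (scal g) z) = norm (f (mobius g (of_real M * z))) / (n / sqrt M) powr r"
    unfolding ge slash_scal[OF g[unfolded ge]] using nz M
    by (simp add: norm_divide norm_powr_complex n_def M_def ge[symmetric])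
  also have "\<dots> = Im z powr (- (r / 2)) * ((M * Im z / n\<^sup>2) powr (r / 2) * norm (f (mobius g (of_real M * z))))"
  proof -
    have 1: "(n / sqrt M) powr r = n powr r / M powr (r / 2)"
      using M by (simp add: powr_divide powr_half_sqrt[symmetric] powr_powr)
    have 2: "(M * Im z / n\<^sup>2) powr (r / 2) = M powr (r / 2) * Im z powr (r / 2) / n powr r"
      using n by (simp add: powr_divide powr_mult powr_powr flip: powr_numeral)
    have 3: "Im z powr (- (r / 2)) * Im z powr (r / 2) = 1" using z by (simp add: powr_add[symmetric])
    show ?thesis unfolding 1 2 using 3 n M by (simp add: field_simps)
  qed
  also have "M * Im z / n\<^sup>2 = Im (mobius g (of_real M * z))"
    unfolding ge Im_mobius[OF g[unfolded ge] Mz] n_def by simp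
  finally show ?thesis by (simp add: h_def M_def)
qed

lemma slash_holomorphic:
  assumes g: "g \<in> SL2Z" and n: "sign_normalized g"
  shows "slash r f (scal g) holomorphic_on {z. 0 < Im z}"
proof -
  obtain a b c d where ge: "g = (a,b,c,d)" by (cases g)
  define M where "M = real (cusp_width G g)"
  have M: "0 < M" using cusp_width_pos_and_mem[OF g] by (simp add: M_def)
  have nz: "of_int c * (of_real M * z) + of_int d \<noteq> 0" if "0 < Im z" for z
    using mobius_denominator_nonzero[of a b c d "of_real M * z"] g M that ge by simp
  have nR: "(of_int c * (of_real M * z) + of_int d) / of_real (sqrt M) \<notin> \<real>\<^sub>\<le>\<^sub>0" if z: "0 < Im z" for z
  proof (cases "c = 0")
    case True
    then have "d = 1" using n by (simp add: ge sign_normalized_def)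
    then have "(of_int c * (of_real M * z) + of_int d) / of_real (sqrt M) = complex_of_real (1 / sqrt M)" using True by simp
    then show ?thesis using M by (simp only: complex_nonpos_Reals_iff) simp
  next
    case False
    have "Im ((of_int c * (of_real M * z) + of_int d) / of_real (sqrt M)) = of_int c * (M * Im z) / sqrt M"
      by (simp only: Im_divide_of_real) simp
    then show ?thesis using False M z by (auto simp: complex_nonpos_Reals_iff)
  qed
  have mob: "(\<lambda>z. mobius g (of_real M * z)) holomorphic_on {z. 0 < Im z}"
    unfolding ge mobius.simps using nz by (intro holomorphic_intros) auto
  have sub: "(\<lambda>z. mobius g (of_real M * z)) ` {z. 0 < Im z} \<subseteq> {z. 0 < Im z}"
    using Im_mobius_pos[OF g] M by auto
  have "(\<lambda>z. f (mobius g (of_real M * z))) holomorphic_on {z. 0 < Im z}"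
    using holomorphic_on_compose_gen[OF mob f_holomorphic sub] by (simp add: o_def)
  then have "(\<lambda>z. f (mobius g (of_real M * z)) / ((of_int c * (of_real M * z) + of_int d) / of_real (sqrt M)) powr (of_real r)) holomorphic_on {z. 0 < Im z}"
    using nR nz M by (intro holomorphic_intros) auto
  then show ?thesis unfolding ge slash_scal[OF g[unfolded ge], abs_def] M_def ge .
qed

text \<open>The growth condition in \<open>modular_form\<close> only concerns heights up to 1; above
  that the given expansion at infinity takes over.\<close>

lemma f_bounded_above_1: "\<exists>C. \<forall>z. 1 \<le> Im z \<longrightarrow> norm (f z) \<le> C"
proof -
  define m where "m = real (cusp_width G (1,0,0,1))"
  have m: "0 < m" using cusp_width_pos_and_mem[of "(1,0,0,1)"] by (simp add: m_def SL2Z_def)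
  define c where "c n = (if 0 < real n + \<kappa> then coef n else 0)" for n
  have q: "qseries c \<kappa> (2 * pi / m)" unfolding c_def by (rule fourier_exp_qseries(1)[OF expansion m])
  then interpret qseries c \<kappa> "2 * pi / m" .
  obtain C where C: "0 \<le> C" "\<And>z. 1 \<le> Im z \<Longrightarrow> norm (fs 0 z) \<le> C * exp (- (2 * pi / m * low * Im z))"
    using fs_decay[of 1 0] by auto
  have "norm (f z) \<le> C + norm (if \<kappa> = 0 then coef 0 else 0)" if z: "1 \<le> Im z" for z
  proof -
    have "f z = fs 0 z + (if \<kappa> = 0 then coef 0 else 0)"
      using fourier_exp_qseries(2)[OF expansion m, of z] z m unfolding c_def[symmetric] by (simp add: m_def)
    then have "norm (f z) \<le> norm (fs 0 z) + norm (if \<kappa> = 0 then coef 0 else 0)" by (simp add: norm_triangle_ineq)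
    also have "norm (fs 0 z) \<le> C * 1"
    proof (rule order_trans[OF C(2)[OF z] mult_left_mono[OF _ C(1)]])
      have "0 \<le> 2 * pi / m * low * Im z" using z m low_pos by simp
      then show "exp (- (2 * pi / m * low * Im z)) \<le> 1" by simp
    qed
    finally show ?thesis by simp
  qed
  then show ?thesis by blast
qed

text \<open>Without an expansion \<open>cuspidal_at\<close> would be vacuously true, so existence
  has to be derived. Invariance of \<open>h\<close> makes the modulus of the slashed form
  1-periodic, and the growth condition of \<open>modular_form\<close> gives polynomial growth
  towards the cusp.\<close>

lemma expansion_at_cusp:
  assumes g: "g \<in> SL2Z" and n: "sign_normalized g"
  obtains \<kappa>' a' where "fourier_exp (slash r f (scal g)) \<kappa>' a'"
proof -
  obtain a b c d where ge: "g = (a,b,c,d)" by (cases g)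
  define M where "M = cusp_width G g"
  have M: "0 < M" using cusp_width_pos_and_mem[OF g] by (simp add: M_def)
  define k where "k = slash r f (scal g)"
  have hol: "k holomorphic_on {z. 0 < Im z}" unfolding k_def by (rule slash_holomorphic[OF g n])
  have nk: "norm (k z) = Im z powr (- (r / 2)) * h (mobius g (of_nat M * z))" if "0 < Im z" for z
    unfolding k_def M_def by (rule norm_slash_scal[OF g that])
  have per: "norm (k (z + 1)) = norm (k z)" if z: "0 < Im z" for z
    using h_period[OF g, of "of_nat M * z" 1] z M by (simp add: nk M_def[symmetric] distrib_left)
  obtain z1 where z1: "0 < Im z1" "f z1 \<noteq> 0" using nonzero by blast
  define z0 where "z0 = mobius (imat_inv g) z1 / of_nat M"
  have z0: "0 < Im z0" using Im_mobius_pos[OF SL2Z_inv[OF g] z1(1)] M by (simp add: z0_def)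
  have "h (mobius g (of_nat M * z0)) = h z1" using M mobius_inv_cancel(2)[OF g z1(1)] by (simp add: z0_def)
  then have kz0: "k z0 \<noteq> 0" using nk[OF z0] z0 z1 by (auto simp: h_def)
  have "\<exists>C N. \<forall>z. 1 \<le> Im z \<longrightarrow> 0 \<le> Re z \<longrightarrow> Re z \<le> 1 \<longrightarrow> norm (k z) \<le> C * Im z powr N"
  proof (cases "c = 0")
    case True
    have d: "d = 1" "a = 1" using n g True by (auto simp: ge sign_normalized_def SL2Z_def)
    obtain C where C: "\<And>z. 1 \<le> Im z \<Longrightarrow> norm (f z) \<le> C" using f_bounded_above_1 by blast
    have "norm (k z) \<le> (C * real M powr (r / 2)) * Im z powr 0" if z: "1 \<le> Im z" for z
    proof -
      have mz: "mobius g (of_nat M * z) = of_nat M * z + of_int b" by (simp add: ge True d)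
      have "1 * 1 \<le> real M * Im z" using M z by (intro mult_mono) auto
      then have i1: "1 \<le> Im (of_nat M * z + of_int b)" by simp
      have "norm (k z) = Im z powr (- (r / 2)) * ((real M * Im z) powr (r / 2) * norm (f (of_nat M * z + of_int b)))"
        using nk[of z] z mz by (simp add: h_def)
      also have "\<dots> = real M powr (r / 2) * norm (f (of_nat M * z + of_int b))"
        using z by (simp add: powr_mult powr_minus field_simps)
      also have "\<dots> \<le> real M powr (r / 2) * C" using C[OF i1] by (intro mult_left_mono) auto
      finally show ?thesis using z by (simp add: mult.commute)
    qed
    then show ?thesis by blast
  next
    case False
    \<comment> \<open>A matrix with \<open>c \<noteq> 0\<close> sends the heights
      \<open>y \<ge> 1\<close> of the strip to heights \<open>t \<le> 1\<close> with
      \<open>t \<ge> 1 / (D\<^sup>2 * y)\<close>, so polynomial growth near the real axis becomes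
      polynomial growth in \<open>y\<close>.\<close>
    obtain C N where CN: "\<And>z. 0 < Im z \<Longrightarrow> Im z \<le> 1 \<Longrightarrow> norm (f z) \<le> C * Im z powr (- N)"
      using mf unfolding modular_form_def by blast
    define D where "D = 2 * \<bar>real_of_int c\<bar> * real M + \<bar>real_of_int d\<bar>"
    have c1: "1 \<le> \<bar>real_of_int c\<bar>" using False by linarith
    have D0: "0 < D" unfolding D_def using c1 M by (intro add_pos_nonneg mult_pos_pos) auto
    have "norm (k z) \<le> (\<bar>C\<bar> * (D\<^sup>2) powr \<bar>N\<bar>) * Im z powr \<bar>N\<bar>" if z: "1 \<le> Im z" "0 \<le> Re z" "Re z \<le> 1" for z
    proof -
      define y where "y = Im z"
      define t where "t = Im (mobius g (of_nat M * z))"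
      have y: "1 \<le> y" using z by (simp add: y_def)
      have Mz: "0 < Im (of_nat M * z)" using M z by simp
      define q where "q = norm (of_int c * (of_nat M * z) + of_int d)"
      have te: "t = real M * y / q\<^sup>2" unfolding t_def ge q_def using Im_mobius[OF g[unfolded ge] Mz] by (simp add: y_def)
      have M1: "1 \<le> real M" using M by simp
      have "norm z \<le> 2 * y" using cmod_le[of z] z by (simp add: y_def)
      have "q \<le> \<bar>real_of_int c\<bar> * real M * norm z + \<bar>real_of_int d\<bar>"
        unfolding q_def by (rule order_trans[OF norm_triangle_ineq]) (simp add: norm_mult)
      also have "\<dots> \<le> \<bar>real_of_int c\<bar> * real M * (2 * y) + \<bar>real_of_int d\<bar> * y"
        using \<open>norm z \<le> 2 * y\<close> y by (intro add_mono mult_left_mono) (auto simp: mult_le_cancel_left1)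
      also have "\<dots> = D * y" by (simp add: D_def algebra_simps)
      finally have qD: "q \<le> D * y" .
      have "1 * (real M * y) \<le> \<bar>real_of_int c\<bar> * (real M * y)" using c1 y by (intro mult_right_mono) auto
      then have "real M * y \<le> \<bar>real_of_int c\<bar> * (real M * y)" by simp
      also have "\<dots> = \<bar>Im (of_int c * (of_nat M * z) + of_int d)\<bar>" using y by (simp add: y_def abs_mult)
      also have "\<dots> \<le> q" unfolding q_def by (rule abs_Im_le_cmod)
      finally have qM: "real M * y \<le> q" .
      have My: "1 \<le> real M * y" using mult_mono[of 1 "real M" 1 y] M1 y by simp
      have q0: "1 \<le> q" using qM My by linarith
      have t1: "t \<le> 1"
      proof -
        have "real M * y \<le> q * q" using qM q0 by (smt (verit) mult_le_cancel_left1)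
        then show ?thesis unfolding te using q0 by (simp add: power2_eq_square divide_le_eq)
      qed
      have tpos: "0 < t" unfolding t_def by (rule Im_mobius_pos[OF g Mz])
      have tlow: "1 / (D\<^sup>2 * y) \<le> t"
      proof -
        have "q\<^sup>2 \<le> (D * y)\<^sup>2" using qD q0 by (intro power_mono) auto
        then have "real M * y / (D * y)\<^sup>2 \<le> t" unfolding te using q0 y D0 by (intro divide_left_mono mult_pos_pos) auto
        moreover have "1 / (D\<^sup>2 * y) \<le> real M * y / (D * y)\<^sup>2"
          using M1 y D0 by (simp add: power2_eq_square field_simps)
        ultimately show ?thesis by linarith
      qed
      have "norm (k z) = y powr (- (r / 2)) * (t powr (r / 2) * norm (f (mobius g (of_nat M * z))))"
        using nk[of z] z by (simp add: h_def y_def t_def)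
      also have "\<dots> \<le> 1 * (1 * norm (f (mobius g (of_nat M * z))))"
      proof (intro mult_mono)
        have "y powr (- (r / 2)) \<le> y powr 0" using y r by (intro powr_mono) auto
        then show "y powr (- (r / 2)) \<le> 1" using y by simp
        have "t powr (r / 2) \<le> 1 powr (r / 2)" using t1 tpos r by (intro powr_mono2) auto
        then show "t powr (r / 2) \<le> 1" by simp
      qed auto
      also have "\<dots> \<le> C * t powr (- N)" using CN[of "mobius g (of_nat M * z)"] t1 tpos by (simp add: t_def)
      also have "\<dots> \<le> \<bar>C\<bar> * t powr (- \<bar>N\<bar>)" using t1 tpos by (intro mult_mono powr_mono') auto
      also have "\<dots> \<le> \<bar>C\<bar> * (1 / (D\<^sup>2 * y)) powr (- \<bar>N\<bar>)" using tlow y D0 by (intro mult_left_mono powr_mono2') auto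
      also have "(1 / (D\<^sup>2 * y)) powr (- \<bar>N\<bar>) = (D\<^sup>2) powr \<bar>N\<bar> * y powr \<bar>N\<bar>"
        unfolding powr_divide powr_mult powr_minus by simp
      finally show ?thesis by (simp add: y_def mult.assoc)
    qed
    then show ?thesis by blast
  qed
  then obtain C N where "\<And>z. 1 \<le> Im z \<Longrightarrow> 0 \<le> Re z \<Longrightarrow> Re z \<le> 1 \<Longrightarrow> norm (k z) \<le> C * Im z powr N" by blast
  from ex_fourier_exp[OF hol z0 kz0 per this] show ?thesis using that unfolding k_def by blast
qed

end

section \<open>Size of \<open>h\<close> at the cusps, and bounds uniform over
  \<open>SL2Z\<close>\<close>

context modform
begin

text \<open>The constant term of the expansion is the main term and the remaining series decays
  exponentially. The behaviour of \<open>h\<close> at cuspidal and at other cusps is read off from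
  this one estimate.\<close>

lemma h_expansion:
  assumes g: "g \<in> SL2Z" and F: "fourier_exp (slash r f (scal g)) \<kappa>' a'" and y0: "0 < y0"
  obtains C \<epsilon> where "0 \<le> C" "0 < \<epsilon>" "\<And>w. y0 \<le> Im w \<Longrightarrow>
     \<bar>h (mobius g w) - real (cusp_width G g) powr (- (r / 2)) * Im w powr (r / 2) * norm (if \<kappa>' = 0 then a' 0 else 0)\<bar> \<le> C * Im w powr (r / 2) * exp (- (\<epsilon> * Im w))"
proof -
  define M where "M = real (cusp_width G g)"
  have M: "0 < M" using cusp_width_pos_and_mem[OF g] by (simp add: M_def)
  define c where "c n = (if 0 < real n + \<kappa>' then a' n else 0)" for n
  define A where "A = (if \<kappa>' = 0 then a' 0 else 0)"
  have one: "(0::real) < 1" by simp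
  have "qseries c \<kappa>' (2 * pi / 1)" unfolding c_def by (rule fourier_exp_qseries(1)[OF F one])
  then interpret qseries c \<kappa>' "2 * pi" by simp
  define \<epsilon> where "\<epsilon> = 2 * pi * low / M"
  have e: "0 < \<epsilon>" using low_pos M by (simp add: \<epsilon>_def)
  have y0M: "0 < y0 / M" using y0 M by simp
  obtain C where C: "0 \<le> C" "\<And>z. y0 / M \<le> Im z \<Longrightarrow> norm (fs 0 z) \<le> C * exp (- (2 * pi * low * Im z))"
    using fs_decay[OF y0M, of 0] by auto
  have "\<bar>h (mobius g w) - M powr (- (r / 2)) * Im w powr (r / 2) * norm A\<bar> \<le> (M powr (- (r / 2)) * C) * Im w powr (r / 2) * exp (- (\<epsilon> * Im w))"
    if w: "y0 \<le> Im w" for w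
  proof -
    define z where "z = w / of_real M"
    have wpos: "0 < Im w" using w y0 by linarith
    have z: "0 < Im z" "Im z = Im w / M" "y0 / M \<le> Im z" using wpos w M by (auto simp: z_def divide_right_mono)
    have wz: "of_nat (cusp_width G g) * z = w" using M by (simp add: z_def M_def)
    have "slash r f (scal g) z = fs 0 z + A"
      using fourier_exp_qseries(2)[OF F one z(1)] unfolding c_def[symmetric] A_def by simp
    then have "norm (fs 0 z + A) = Im z powr (- (r / 2)) * h (mobius g w)"
      using norm_slash_scal[OF g z(1)] wz by simp
    then have hz: "h (mobius g w) = Im z powr (r / 2) * norm (fs 0 z + A)"
      using z(1) by (simp add: powr_minus field_simps)
    have zM: "Im z powr (r / 2) = M powr (- (r / 2)) * Im w powr (r / 2)"
      unfolding z(2) powr_divide powr_minus_divide by simp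
    have "\<bar>h (mobius g w) - M powr (- (r / 2)) * Im w powr (r / 2) * norm A\<bar> = M powr (- (r / 2)) * Im w powr (r / 2) * \<bar>norm (fs 0 z + A) - norm A\<bar>"
      unfolding hz zM right_diff_distrib[symmetric] abs_mult by simp
    also have "\<dots> \<le> M powr (- (r / 2)) * Im w powr (r / 2) * (C * exp (- (\<epsilon> * Im w)))"
    proof (rule mult_left_mono)
      have "\<bar>norm (fs 0 z + A) - norm A\<bar> \<le> norm (fs 0 z)"
        using norm_triangle_ineq3[of "fs 0 z + A" A] by simp
      also have "norm (fs 0 z) \<le> C * exp (- (\<epsilon> * Im w))"
        using C(2)[OF z(3)] by (simp add: z(2) \<epsilon>_def)
      finally show "\<bar>norm (fs 0 z + A) - norm A\<bar> \<le> C * exp (- (\<epsilon> * Im w))" .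
    qed simp
    finally show ?thesis by (simp only: mult_ac)
  qed
  moreover have "0 \<le> M powr (- (r / 2)) * C" using C by simp
  ultimately show ?thesis using that e unfolding A_def M_def by blast
qed

lemma h_upper_normalized:
  assumes g: "g \<in> SL2Z" and n: "sign_normalized g" and y0: "0 < y0"
  shows "\<exists>C\<ge>0. \<forall>w. y0 \<le> Im w \<longrightarrow> h (mobius g w) \<le> C * Im w powr (r / 2)"
proof -
  obtain \<kappa>' a' where F: "fourier_exp (slash r f (scal g)) \<kappa>' a'" using expansion_at_cusp[OF g n] by blast
  define B where "B = real (cusp_width G g) powr (- (r / 2)) * norm (if \<kappa>' = 0 then a' 0 else 0)"
  obtain C \<epsilon> where C: "0 \<le> C" "0 < \<epsilon>" "\<And>w. y0 \<le> Im w \<Longrightarrow>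
     \<bar>h (mobius g w) - real (cusp_width G g) powr (- (r / 2)) * Im w powr (r / 2) * norm (if \<kappa>' = 0 then a' 0 else 0)\<bar> \<le> C * Im w powr (r / 2) * exp (- (\<epsilon> * Im w))"
    using h_expansion[OF g F y0] by blast
  have "h (mobius g w) \<le> (B + C) * Im w powr (r / 2)" if w: "y0 \<le> Im w" for w
  proof -
    have "0 \<le> \<epsilon> * Im w" using C(2) w y0 by simp
    then have "exp (- (\<epsilon> * Im w)) \<le> 1" by simp
    then have "C * Im w powr (r / 2) * exp (- (\<epsilon> * Im w)) \<le> C * Im w powr (r / 2) * 1"
      using C(1) by (intro mult_left_mono) auto
    then have "h (mobius g w) \<le> B * Im w powr (r / 2) + C * Im w powr (r / 2)"
      using C(3)[OF w] unfolding B_def by (simp add: mult_ac abs_le_iff)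
    then show ?thesis by (simp add: distrib_right)
  qed
  moreover have "0 \<le> B + C" unfolding B_def using C by simp
  ultimately show ?thesis by blast
qed

lemma h_decay_cuspidal:
  assumes g: "g \<in> SL2Z" and n: "sign_normalized g" and cu: "cuspidal_at G r f (cusp_image g)" and y0: "0 < y0"
  shows "\<exists>C \<epsilon>. 0 \<le> C \<and> 0 < \<epsilon> \<and> (\<forall>w. y0 \<le> Im w \<longrightarrow> h (mobius g w) \<le> C * Im w powr (r / 2) * exp (- (\<epsilon> * Im w)))"
proof -
  obtain \<kappa>' a' where F: "fourier_exp (slash r f (scal g)) \<kappa>' a'" using expansion_at_cusp[OF g n] by blast
  have "scal g \<in> scaling_matrices G (cusp_image g)" unfolding scaling_matrices_eq using g n by blast
  then have "0 < \<kappa>' \<or> a' 0 = 0" using cu F unfolding cuspidal_at_def by blast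
  then have A: "(if \<kappa>' = 0 then a' 0 else 0) = 0" by auto
  obtain C \<epsilon> where C: "0 \<le> C" "0 < \<epsilon>" "\<And>w. y0 \<le> Im w \<Longrightarrow>
     \<bar>h (mobius g w) - real (cusp_width G g) powr (- (r / 2)) * Im w powr (r / 2) * norm (if \<kappa>' = 0 then a' 0 else 0)\<bar> \<le> C * Im w powr (r / 2) * exp (- (\<epsilon> * Im w))"
    using h_expansion[OF g F y0] by blast
  then show ?thesis unfolding A by (intro exI[of _ C] exI[of _ \<epsilon>]) (auto simp: abs_le_iff)
qed

lemma h_lower_not_cuspidal:
  assumes "\<not> cuspidal_at G r f cp"
  obtains g c V where "g \<in> SL2Z" "cusp_image g = cp" "0 < c" "0 < V" "\<And>w. V \<le> Im w \<Longrightarrow> c * Im w powr (r / 2) \<le> h (mobius g w)"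
proof -
  obtain g \<kappa>' a' where g: "g \<in> SL2Z" "cusp_image g = cp" and F: "fourier_exp (slash r f (scal g)) \<kappa>' a'"
    and A: "\<not> (0 < \<kappa>' \<or> a' 0 = 0)"
    using assms unfolding cuspidal_at_def scaling_matrices_eq by blast
  have "\<kappa>' = 0" using A F by (auto simp: fourier_exp_def)
  define B where "B = real (cusp_width G g) powr (- (r / 2)) * norm (a' 0)"
  have B: "0 < B" using A cusp_width_pos_and_mem[OF g(1)] by (auto simp: B_def)
  obtain C \<epsilon> where C: "0 \<le> C" "0 < \<epsilon>" "\<And>w. 1 \<le> Im w \<Longrightarrow>
     \<bar>h (mobius g w) - real (cusp_width G g) powr (- (r / 2)) * Im w powr (r / 2) * norm (if \<kappa>' = 0 then a' 0 else 0)\<bar> \<le> C * Im w powr (r / 2) * exp (- (\<epsilon> * Im w))"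
    using h_expansion[OF g(1) F, of 1] by auto
  have "((\<lambda>v. C * exp (- (\<epsilon> * v))) \<longlongrightarrow> C * 0) at_top"
    using C(2) by (intro tendsto_mult tendsto_const filterlim_compose[OF exp_at_bot] filterlim_compose[OF filterlim_uminus_at_bot_at_top])
      (auto intro: filterlim_tendsto_pos_mult_at_top[OF tendsto_const _ filterlim_ident])
  then have "eventually (\<lambda>v. C * exp (- (\<epsilon> * v)) < B / 2) at_top"
    using B by (intro order_tendstoD) auto
  then obtain V0 where V0: "\<And>v. V0 \<le> v \<Longrightarrow> C * exp (- (\<epsilon> * v)) < B / 2" by (auto simp: eventually_at_top_linorder)
  have "B / 2 * Im w powr (r / 2) \<le> h (mobius g w)" if w: "max V0 1 \<le> Im w" for w
  proof -
    have "C * exp (- (\<epsilon> * Im w)) * Im w powr (r / 2) \<le> B / 2 * Im w powr (r / 2)"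
      using V0[of "Im w"] w by (intro mult_right_mono) auto
    moreover have "B * Im w powr (r / 2) - C * exp (- (\<epsilon> * Im w)) * Im w powr (r / 2) \<le> h (mobius g w)"
      using C(3)[of w] w \<open>\<kappa>' = 0\<close> by (simp add: B_def abs_le_iff mult_ac)
    ultimately show ?thesis by (simp add: field_simps)
  qed
  then show ?thesis using B g that[of g "B / 2" "max V0 1"] by auto
qed

text \<open>By invariance the translate by the inverse of \<open>g\<close> depends only on the coset
  of \<open>g\<close>, and there are finitely many cosets. The translates are set to 0 off the half
  plane so that equal ones are equal as functions.\<close>

lemma finite_h_translates: "finite ((\<lambda>g w. if 0 < Im w then h (mobius g w) else 0) ` SL2Z)"
proof -
  define H where "H g = (\<lambda>w. if 0 < Im w then h (mobius g w) else 0)" for g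
  define \<Phi> where "\<Phi> S = H (imat_inv (SOME g. g \<in> S))" for S
  have one: "(1,0,0,1) \<in> G" and fin: "finite ((\<lambda>g. imat_mult g ` G) ` SL2Z)"
    and ginv: "\<And>g. g \<in> G \<Longrightarrow> imat_inv g \<in> G" using G by (auto simp: finite_index_subgroup_def)
  have eq: "H (imat_inv g) = \<Phi> (imat_mult g ` G)" if g: "g \<in> SL2Z" for g
  proof -
    define g' where "g' = (SOME x. x \<in> imat_mult g ` G)"
    have "g \<in> imat_mult g ` G" by (rule image_eqI[OF _ one]) simp
    then have "g' \<in> imat_mult g ` G" unfolding g'_def by (rule someI)
    then obtain \<gamma> where \<gamma>: "\<gamma> \<in> G" "g' = imat_mult g \<gamma>" by blast
    have "h (mobius (imat_inv g') w) = h (mobius (imat_inv g) w)" if w: "0 < Im w" for w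
    proof -
      have "mobius (imat_inv g') w = mobius (imat_inv \<gamma>) (mobius (imat_inv g) w)"
        unfolding \<gamma>(2) imat_inv_mult_distrib by (rule mobius_mult[OF SL2Z_inv[OF G_SL2Z[OF \<gamma>(1)]] SL2Z_inv[OF g] w])
      then show ?thesis using h_invariant_G[OF ginv[OF \<gamma>(1)] Im_mobius_pos[OF SL2Z_inv[OF g] w]] by simp
    qed
    then show ?thesis unfolding \<Phi>_def g'_def[symmetric] by (auto simp: H_def fun_eq_iff)
  qed
  have "H ` SL2Z \<subseteq> \<Phi> ` ((\<lambda>g. imat_mult g ` G) ` SL2Z)"
  proof
    fix u assume "u \<in> H ` SL2Z"
    then obtain g where g: "g \<in> SL2Z" "u = H g" by blast
    then have "u = \<Phi> (imat_mult (imat_inv g) ` G)" using eq[OF SL2Z_inv[OF g(1)]] by simp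
    then show "u \<in> \<Phi> ` ((\<lambda>g. imat_mult g ` G) ` SL2Z)" using SL2Z_inv[OF g(1)] by blast
  qed
  then show ?thesis using fin unfolding H_def by (meson finite_imageI finite_subset)
qed

text \<open>Only finitely many translates occur, so the sum of their constants serves for all
  matrices at once. Replacing a matrix by its negative, which acts in the same way, makes it
  normalized.\<close>

lemma h_upper_uniform:
  assumes ex: "\<And>g. g \<in> SL2Z \<Longrightarrow> sign_normalized g \<Longrightarrow> \<exists>C\<ge>0. \<forall>w. y0 \<le> Im w \<longrightarrow> h (mobius g w) \<le> C * Im w powr p"
    and y0: "0 < y0"
  obtains C where "0 \<le> C" "\<And>g w. g \<in> SL2Z \<Longrightarrow> y0 \<le> Im w \<Longrightarrow> h (mobius g w) \<le> C * Im w powr p"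
proof -
  define \<H> where "\<H> = (\<lambda>g w. if 0 < Im w then h (mobius g w) else 0) ` SL2Z"
  have "\<exists>C\<ge>0. \<forall>w. y0 \<le> Im w \<longrightarrow> u w \<le> C * Im w powr p" if u: "u \<in> \<H>" for u
  proof -
    obtain g where g: "g \<in> SL2Z" "u = (\<lambda>w. if 0 < Im w then h (mobius g w) else 0)" using u by (auto simp: \<H>_def)
    obtain g' where g': "g' \<in> SL2Z" "sign_normalized g'" "\<And>w. mobius g' w = mobius g w"
      using sign_normalized_or_neg[OF g(1)] g(1) SL2Z_neg mobius_neg by metis
    show ?thesis using ex[OF g'(1,2)] y0 unfolding g(2) g'(3) by fastforce
  qed
  then obtain c where c: "\<And>u. u \<in> \<H> \<Longrightarrow> 0 \<le> c u \<and> (\<forall>w. y0 \<le> Im w \<longrightarrow> u w \<le> c u * Im w powr p)" by metis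
  have fin: "finite \<H>" unfolding \<H>_def by (rule finite_h_translates)
  have "h (mobius g w) \<le> (\<Sum>u\<in>\<H>. c u) * Im w powr p" if g: "g \<in> SL2Z" and w: "y0 \<le> Im w" for g w
  proof -
    define u where "u = (\<lambda>w. if 0 < Im w then h (mobius g w) else 0)"
    have u: "u \<in> \<H>" unfolding u_def \<H>_def using g by blast
    have "h (mobius g w) = u w" using w y0 by (simp add: u_def)
    also have "\<dots> \<le> c u * Im w powr p" using c[OF u] w by blast
    also have "c u \<le> (\<Sum>u\<in>\<H>. c u)" using fin u c by (intro member_le_sum) auto
    finally show ?thesis by (simp add: mult_right_mono)
  qed
  moreover have "0 \<le> (\<Sum>u\<in>\<H>. c u)" using c by (intro sum_nonneg) auto
  ultimately show ?thesis by (rule that[rotated])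
qed

abbreviation "\<alpha>0 \<equiv> alpha0 G r f"

lemma alpha0_pos: "0 < \<alpha>0" "r / 2 \<le> \<alpha>0" using r by (auto simp: alpha0_def)

text \<open>A point \<open>z\<close> of small height is moved to a height between 1/5 and
  \<open>1 / Im z\<close>, where translates of \<open>h\<close> are at most a multiple of the power
  \<open>p\<close> of the height: \<open>p = 0\<close> for a cusp form, by exponential decay at all
  cusps, and \<open>p = r / 2\<close> otherwise. In both cases
  \<open>p = \<alpha>0 - r / 2\<close>.\<close>

lemma h_bound_small:
  obtains C where "0 \<le> C" "\<And>g z. g \<in> SL2Z \<Longrightarrow> 0 < Im z \<Longrightarrow> Im z \<le> 1 \<Longrightarrow> h (mobius g z) \<le> C * Im z powr (r / 2 - \<alpha>0)"
proof -
  define p where "p = (if cusp_form G r f then 0 else r / 2)"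
  have ex: "\<exists>C\<ge>0. \<forall>w. 1/5 \<le> Im w \<longrightarrow> h (mobius g w) \<le> C * Im w powr p" if g: "g \<in> SL2Z" "sign_normalized g" for g
  proof (cases "cusp_form G r f")
    case False
    then show ?thesis using h_upper_normalized[OF g, of "1/5"] by (simp add: p_def)
  next
    case True
    then have cu: "cuspidal_at G r f (cusp_image g)" by (simp add: cusp_form_def)
    obtain C \<epsilon> where C: "0 \<le> C" "0 < \<epsilon>" "\<And>w. 1/5 \<le> Im w \<Longrightarrow> h (mobius g w) \<le> C * Im w powr (r / 2) * exp (- (\<epsilon> * Im w))"
      using h_decay_cuspidal[OF g cu, of "1/5"] by auto
    obtain K where K: "0 \<le> K" "\<And>l. 1/5 \<le> l \<Longrightarrow> l powr (r / 2) \<le> K * exp (\<epsilon> * l)"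
      using powr_le_exp[OF C(2), of "1/5" "r / 2"] by auto
    have "h (mobius g w) \<le> (C * K) * Im w powr p" if w: "1/5 \<le> Im w" for w
    proof -
      have "h (mobius g w) \<le> C * Im w powr (r / 2) * exp (- (\<epsilon> * Im w))" by (rule C(3)[OF w])
      also have "\<dots> \<le> C * (K * exp (\<epsilon> * Im w)) * exp (- (\<epsilon> * Im w))"
        using K(2)[OF w] C(1) by (intro mult_right_mono mult_left_mono) auto
      also have "\<dots> = C * K" by (simp add: exp_minus)
      finally show ?thesis using w True by (simp add: p_def)
    qed
    then show ?thesis using C K by (intro exI[of _ "C * K"]) auto
  qed
  obtain C where C: "0 \<le> C" "\<And>g w. g \<in> SL2Z \<Longrightarrow> 1/5 \<le> Im w \<Longrightarrow> h (mobius g w) \<le> C * Im w powr p"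
    using h_upper_uniform[OF ex] by auto
  have p: "0 \<le> p" "- p = r / 2 - \<alpha>0" using r by (auto simp: p_def alpha0_def)
  have "h (mobius g z) \<le> C * Im z powr (r / 2 - \<alpha>0)" if g: "g \<in> SL2Z" and z: "0 < Im z" "Im z \<le> 1" for g z
  proof -
    obtain \<delta> where d: "\<delta> \<in> SL2Z" "1/5 \<le> Im (mobius \<delta> z)" "Im (mobius \<delta> z) \<le> 1 / Im z" using move_up[OF z] by blast
    have w: "0 < Im (mobius \<delta> z)" using d by linarith
    have "mobius g z = mobius (imat_mult g (imat_inv \<delta>)) (mobius \<delta> z)"
      using mobius_mult[OF g SL2Z_inv[OF d(1)] w] mobius_inv_cancel(1)[OF d(1) z(1)] by simp
    then have "h (mobius g z) \<le> C * Im (mobius \<delta> z) powr p"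
      using C(2)[OF SL2Z_mult[OF g SL2Z_inv[OF d(1)]] d(2)] by simp
    also have "\<dots> \<le> C * (1 / Im z) powr p" using C(1) p d w by (intro mult_left_mono powr_mono2) auto
    also have "(1 / Im z) powr p = Im z powr (r / 2 - \<alpha>0)" unfolding p(2)[symmetric] powr_divide powr_minus_divide by simp
    finally show ?thesis .
  qed
  then show ?thesis using C(1) that by blast
qed

lemma f_bound:
  obtains C where "0 \<le> C" "\<And>z. 0 < Im z \<Longrightarrow> Im z \<le> 1 \<Longrightarrow> norm (f z) \<le> C * Im z powr (- \<alpha>0)"
proof -
  obtain C where C: "0 \<le> C" "\<And>g z. g \<in> SL2Z \<Longrightarrow> 0 < Im z \<Longrightarrow> Im z \<le> 1 \<Longrightarrow> h (mobius g z) \<le> C * Im z powr (r / 2 - \<alpha>0)"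
    using h_bound_small by blast
  have "norm (f z) \<le> C * Im z powr (- \<alpha>0)" if z: "0 < Im z" "Im z \<le> 1" for z
  proof -
    have "norm (f z) = Im z powr (- (r / 2)) * h (mobius (1,0,0,1) z)" using norm_f_eq[OF z(1)] by simp
    also have "\<dots> \<le> Im z powr (- (r / 2)) * (C * Im z powr (r / 2 - \<alpha>0))"
      using C(2)[of "(1,0,0,1)" z] z by (intro mult_left_mono) (auto simp: SL2Z_def)
    also have "\<dots> = C * Im z powr (- \<alpha>0)" by (simp add: powr_add[symmetric])
    finally show ?thesis .
  qed
  then show ?thesis using C(1) that by blast
qed

text \<open>In the coordinate \<open>w\<close> at the cusp, \<open>h\<close> is at most a multiple
  of \<open>Im w powr (r / 2 - q)\<close> everywhere: for \<open>Im w \<le> 1\<close> since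
  \<open>q \<ge> \<alpha>0\<close>, for \<open>Im w > 1\<close> since exponential decay beats every
  power. Inserting \<open>Im w = Im z / (D * norm z)\<^sup>2\<close> gives the exponents
  \<open>2 * q - r\<close> and \<open>- q\<close>.\<close>

lemma f_bound_cuspidal:
  assumes cu: "cuspidal_at G r f (Some x)" and q: "\<alpha>0 \<le> q"
  obtains C where "0 \<le> C" "\<And>z. 0 < Im z \<Longrightarrow> norm (f (of_real (of_rat x) + z)) \<le> C * norm z powr (2 * q - r) * Im z powr (- q)"
proof -
  obtain g where g: "g \<in> SL2Z" "sign_normalized g" "cusp_image g = Some x" using ex_SL2Z_cusp by blast
  obtain a b c d where ge: "g = (a,b,c,d)" by (cases g)
  have c: "c \<noteq> 0" "real_of_rat x = of_int a / of_int c" using cusp_image_Some g(3) ge by auto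
  obtain C1 where C1: "0 \<le> C1" "\<And>g z. g \<in> SL2Z \<Longrightarrow> 0 < Im z \<Longrightarrow> Im z \<le> 1 \<Longrightarrow> h (mobius g z) \<le> C1 * Im z powr (r / 2 - \<alpha>0)"
    using h_bound_small by blast
  obtain C2 \<epsilon> where C2: "0 \<le> C2" "0 < \<epsilon>" "\<And>w. 1 \<le> Im w \<Longrightarrow> h (mobius g w) \<le> C2 * Im w powr (r / 2) * exp (- (\<epsilon> * Im w))"
    using h_decay_cuspidal[OF g(1,2), of 1] cu g(3) by auto
  obtain K where K: "0 \<le> K" "\<And>l. 1 \<le> l \<Longrightarrow> l powr q \<le> K * exp (\<epsilon> * l)"
    using powr_le_exp[OF C2(2), of 1 q] by auto
  have hb: "h (mobius g w) \<le> (C1 + C2 * K) * Im w powr (r / 2 - q)" if w: "0 < Im w" for w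
  proof (cases "Im w \<le> 1")
    case True
    have "h (mobius g w) \<le> C1 * Im w powr (r / 2 - \<alpha>0)" by (rule C1(2)[OF g(1) w True])
    also have "\<dots> \<le> (C1 + C2 * K) * Im w powr (r / 2 - q)"
      using C1 C2 K q w True by (intro mult_mono powr_mono') auto
    finally show ?thesis .
  next
    case False
    have "exp (- (\<epsilon> * Im w)) \<le> K * Im w powr (- q)"
      using K(2)[of "Im w"] False w by (simp add: exp_minus powr_minus field_simps)
    then have "C2 * Im w powr (r / 2) * exp (- (\<epsilon> * Im w)) \<le> C2 * Im w powr (r / 2) * (K * Im w powr (- q))"
      using C2 by (intro mult_left_mono) auto
    also have "\<dots> = (C2 * K) * Im w powr (r / 2 - q)" by (simp add: powr_add[symmetric])
    also have "\<dots> \<le> (C1 + C2 * K) * Im w powr (r / 2 - q)" using C1 by (intro mult_right_mono) auto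
    finally show ?thesis using C2(3)[of w] False by linarith
  qed
  define D where "D = \<bar>real_of_int c\<bar>"
  have D: "0 < D" "(of_int c)\<^sup>2 = D\<^sup>2" using c by (auto simp: D_def)
  have "norm (f (of_real (of_rat x) + z)) \<le> ((C1 + C2 * K) * D powr (2 * q - r)) * norm z powr (2 * q - r) * Im z powr (- q)" if z: "0 < Im z" for z
  proof -
    define w where "w = - of_int d / of_int c - 1 / ((of_int c)\<^sup>2 * z)"
    note co = mobius_cusp_coordinate[OF g(1)[unfolded ge] c(1) z, folded w_def]
    have xz: "of_real (of_rat x) + z = mobius g w" using co(1) c(2) by (simp add: ge)
    have nz: "0 < norm z" using z by auto
    have "norm (f (of_real (of_rat x) + z)) = Im z powr (- (r / 2)) * h (mobius g w)"
      using norm_f_eq[of "of_real (of_rat x) + z"] z by (simp add: xz[symmetric])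
    also have "\<dots> \<le> Im z powr (- (r / 2)) * ((C1 + C2 * K) * Im w powr (r / 2 - q))"
      by (intro mult_left_mono hb co(3)) auto
    also have "Im w powr (r / 2 - q) = Im z powr (r / 2 - q) * (D powr (2 * q - r) * norm z powr (2 * q - r))"
    proof -
      have "Im w = Im z / (D * norm z) powr 2" unfolding co(2) using D nz by (simp add: power_mult_distrib)
      then have "Im w powr (r / 2 - q) = Im z powr (r / 2 - q) / (D * norm z) powr (2 * (r / 2 - q))"
        by (simp only: powr_divide powr_powr)
      also have "\<dots> = Im z powr (r / 2 - q) * (D * norm z) powr (- (2 * (r / 2 - q)))"
        by (simp only: powr_minus_divide times_divide_eq_right mult_1_right)
      also have "- (2 * (r / 2 - q)) = 2 * q - r" by simp
      finally show ?thesis by (simp add: powr_mult)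
    qed
    also have "Im z powr (- (r / 2)) * ((C1 + C2 * K) * (Im z powr (r / 2 - q) * (D powr (2 * q - r) * norm z powr (2 * q - r))))
       = ((C1 + C2 * K) * D powr (2 * q - r)) * norm z powr (2 * q - r) * (Im z powr (- (r / 2)) * Im z powr (r / 2 - q))"
      by (simp only: mult_ac)
    also have "Im z powr (- (r / 2)) * Im z powr (r / 2 - q) = Im z powr (- q)" by (simp add: powr_add[symmetric])
    finally show ?thesis .
  qed
  then show ?thesis using that[of "(C1 + C2 * K) * D powr (2 * q - r)"] C1 C2 K by simp
qed

text \<open>The lower bound is asked for at arbitrarily small heights rather than at all small ones.
  This suffices to refute expansions at \<open>x\<close>, and it is what the Baire argument for cusp
  forms supplies.\<close>

definition vertical_lower :: "real \<Rightarrow> bool" where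
  "vertical_lower x \<longleftrightarrow> (\<exists>c>0. \<forall>\<eta>>0. \<exists>y. 0 < y \<and> y < \<eta> \<and> c * y powr (- \<alpha>0) \<le> norm (f (of_real x + \<i> * of_real y)))"

text \<open>At height \<open>y\<close> above the cusp the coordinate \<open>w\<close> has height
  \<open>1 / (D\<^sup>2 * y)\<close>. The factor \<open>y powr (- (r / 2))\<close> between
  \<open>f\<close> and \<open>h\<close> and the growth of \<open>h\<close> then combine to
  \<open>y powr (- r)\<close>.\<close>

lemma vertical_lower_of_matrix:
  assumes g: "(a,b,c,d) \<in> SL2Z" and c: "c \<noteq> 0" and k: "0 < k" "0 < V"
    and lo: "\<And>w. V \<le> Im w \<Longrightarrow> k * Im w powr (r / 2) \<le> h (mobius (a,b,c,d) w)" and al: "\<alpha>0 = r"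
  shows "vertical_lower (of_int a / of_int c)"
proof -
  define D where "D = \<bar>real_of_int c\<bar>"
  have D: "0 < D" "(of_int c)\<^sup>2 = D\<^sup>2" using c by (auto simp: D_def)
  define y0 where "y0 = 1 / (D\<^sup>2 * V)"
  have y0: "0 < y0" using D k by (simp add: y0_def)
  have main: "(k * D powr (- r)) * y powr (- \<alpha>0) \<le> norm (f (of_real (of_int a / of_int c) + \<i> * of_real y))" if y: "0 < y" "y < y0" for y
  proof -
    define z where "z = \<i> * of_real y"
    have z: "0 < Im z" "norm z = y" "Im z = y" using y by (auto simp: z_def norm_mult)
    define w where "w = - of_int d / of_int c - 1 / ((of_int c)\<^sup>2 * z)"
    note co = mobius_cusp_coordinate[OF g c z(1), folded w_def]
    have iw: "Im w = 1 / (D\<^sup>2 * y)" unfolding co(2) z D(2) using y D by (simp add: power2_eq_square)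
    have "V \<le> Im w" unfolding iw using y k D by (simp add: y0_def field_simps)
    then have "k * Im w powr (r / 2) \<le> h (of_int a / of_int c + z)" using lo[of w] co(1) by simp
    then have "y powr (- (r / 2)) * (k * Im w powr (r / 2)) \<le> norm (f (of_int a / of_int c + z))"
      using norm_f_eq[of "of_int a / of_int c + z"] z Im_complex_of_real[of "of_int a / of_int c"] by (simp add: mult_left_mono)
    moreover have "Im w powr (r / 2) = D powr (- r) * y powr (- (r / 2))"
    proof -
      have "Im w = 1 / (D powr 2 * y)" using iw D by simp
      then have "Im w powr (r / 2) = 1 / (D powr r * y powr (r / 2))" by (simp only: powr_divide powr_mult powr_powr powr_one_eq_one) simp
      then show ?thesis by (simp add: powr_minus_divide)
    qed
    moreover have "y powr (- (r / 2)) * (k * (D powr (- r) * y powr (- (r / 2)))) = (k * D powr (- r)) * y powr (- \<alpha>0)"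
    proof -
      have "y powr (- \<alpha>0) = y powr (- (r / 2)) * y powr (- (r / 2))" by (simp add: al powr_add[symmetric])
      then show ?thesis by (simp only: mult_ac)
    qed
    ultimately show ?thesis by (simp add: z_def)
  qed
  show ?thesis unfolding vertical_lower_def
  proof (rule exI[of _ "k * D powr (- r)"], intro conjI allI impI)
    show "0 < k * D powr (- r)" using k D by simp
    fix \<eta> :: real assume e: "0 < \<eta>"
    show "\<exists>y>0. y < \<eta> \<and> k * D powr (- r) * y powr (- \<alpha>0) \<le> norm (f (of_real (of_int a / of_int c) + \<i> * of_real y))"
      using main[of "min \<eta> y0 / 2"] e y0 by (intro exI[of _ "min \<eta> y0 / 2"]) auto
  qed
qed

lemma vertical_lower_not_cuspidal:
  assumes "\<not> cuspidal_at G r f (Some x)"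
  shows "vertical_lower (of_rat x)" "\<alpha>0 = r"
proof -
  show al: "\<alpha>0 = r" using assms by (auto simp: alpha0_def cusp_form_def)
  obtain g c V where g: "g \<in> SL2Z" "cusp_image g = Some x" "0 < c" "0 < V" "\<And>w. V \<le> Im w \<Longrightarrow> c * Im w powr (r / 2) \<le> h (mobius g w)"
    using h_lower_not_cuspidal[OF assms] by blast
  obtain p q s t where ge: "g = (p,q,s,t)" by (cases g)
  show "vertical_lower (of_rat x)"
    using vertical_lower_of_matrix[OF g(1)[unfolded ge] _ g(3,4,5)[unfolded ge] al] cusp_image_Some[OF g(2)[unfolded ge]] by simp
qed

text \<open>The points \<open>w0 + of_nat (n * M)\<close> have constant height, and \<open>h\<close>
  takes one nonzero value at their images. Near the cusp these images lie on the horocycle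
  \<open>Im z = V * (norm z)\<^sup>2\<close> and tend to the cusp, so \<open>f\<close> has size
  \<open>Im z powr (- (r / 2))\<close>, a multiple of \<open>norm z powr (- r)\<close>.\<close>

lemma horocycle_lower:
  obtains c V where "0 < c" "0 < V" "\<And>\<eta>. 0 < \<eta> \<Longrightarrow> \<exists>z. 0 < Im z \<and> norm z < \<eta> \<and> V * (norm z)\<^sup>2 \<le> Im z \<and>
     c * norm z powr (- r) \<le> norm (f (of_real (of_rat x) + z))"
proof -
  obtain g where g: "g \<in> SL2Z" "sign_normalized g" "cusp_image g = Some x" using ex_SL2Z_cusp by blast
  obtain a b c d where ge: "g = (a,b,c,d)" by (cases g)
  have c: "c \<noteq> 0" "real_of_rat x = of_int a / of_int c" using cusp_image_Some g(3) ge by auto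
  define D where "D = \<bar>real_of_int c\<bar>"
  have D: "1 \<le> D" "(of_int c)\<^sup>2 = D\<^sup>2" using c by (auto simp: D_def)
  define M where "M = cusp_width G g"
  have M: "0 < M" using cusp_width_pos_and_mem[OF g(1)] by (simp add: M_def)
  obtain z1 where z1: "0 < Im z1" "f z1 \<noteq> 0" using nonzero by blast
  define w0 where "w0 = mobius (imat_inv g) z1"
  have w0: "0 < Im w0" unfolding w0_def by (rule Im_mobius_pos[OF SL2Z_inv[OF g(1)] z1(1)])
  have h0: "0 < h (mobius g w0)" unfolding w0_def mobius_inv_cancel(2)[OF g(1) z1(1)] using z1 by (simp add: h_def)
  define H where "H = h (mobius g w0)"
  define v0 where "v0 = Im w0"
  define V where "V = v0 * D\<^sup>2"
  have V: "0 < V" using w0 D by (simp add: V_def v0_def)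
  define z where "z n = - 1 / (of_int c * (of_int c * (w0 + of_nat (n * M)) + of_int d))" for n
  have zprop: "0 < Im (z n)" "Im (z n) = V * (norm (z n))\<^sup>2" "norm (f (of_real (of_rat x) + z n)) = (V powr (- (r / 2)) * H) * norm (z n) powr (- r)" for n
  proof -
    define w where "w = w0 + of_nat (n * M)"
    have w: "0 < Im w" "Im w = v0" using w0 by (auto simp: w_def v0_def)
    define den where "den = of_int c * w + of_int d"
    have den: "den \<noteq> 0" unfolding den_def using mobius_denominator_nonzero[OF g(1)[unfolded ge] w(1)] .
    have zd: "z n = - 1 / (of_int c * den)" by (simp add: z_def den_def w_def)
    have c0: "(of_int c :: complex) \<noteq> 0" using c by simp
    have nzn: "0 < norm (z n)" using zd den c0 by simp
    have "Im (z n) = - Im (cnj (of_int c * den)) * (1 / (norm (of_int c * den))\<^sup>2)"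
      unfolding zd by (simp add: Im_divide cmod_power2)
    also have "Im (cnj (of_int c * den)) = - (D\<^sup>2 * v0)" using w(2) by (simp add: den_def D_def power2_eq_square abs_mult_self_eq)
    also have "1 / (norm (of_int c * den))\<^sup>2 = (norm (z n))\<^sup>2" unfolding zd by (simp add: norm_divide power_divide)
    finally show iz: "Im (z n) = V * (norm (z n))\<^sup>2"
      unfolding V_def by (simp only: minus_minus mult.commute)
    show iz0: "0 < Im (z n)" unfolding iz using V nzn by simp
    have "of_int d + of_int c * w = den" by (simp add: den_def)
    then have we: "- of_int d / of_int c - 1 / ((of_int c)\<^sup>2 * z n) = w"
      unfolding zd using c0 den by (simp add: field_simps power2_eq_square)
    have "mobius (a,b,c,d) w = of_int a / of_int c + z n"
      using mobius_cusp_coordinate(1)[OF g(1)[unfolded ge] c(1) iz0] unfolding we .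
    then have xz: "of_real (of_rat x) + z n = mobius g w" using c(2) by (simp add: ge)
    have "h (mobius g w) = H" unfolding w_def H_def M_def by (rule h_period[OF g(1) w0])
    then have "norm (f (of_real (of_rat x) + z n)) = Im (z n) powr (- (r / 2)) * H"
      using norm_f_eq[of "of_real (of_rat x) + z n"] iz0 by (simp add: xz[symmetric])
    also have "Im (z n) powr (- (r / 2)) = V powr (- (r / 2)) * norm (z n) powr (- r)"
      unfolding iz powr_mult using nzn by (simp add: powr_powr flip: powr_numeral)
    finally show "norm (f (of_real (of_rat x) + z n)) = (V powr (- (r / 2)) * H) * norm (z n) powr (- r)" by (simp add: mult_ac)
  qed
  have "\<exists>n. norm (z n) < \<eta>" if e: "0 < \<eta>" for \<eta>
  proof -
    obtain n :: nat where n: "real n > 1 / \<eta> + \<bar>of_int c * Re w0 + of_int d\<bar>" using reals_Archimedean2 by blast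
    define den where "den = of_int c * (w0 + of_nat (n * M)) + of_int d"
    have "real n * 1 \<le> real n * (real M * D)" using M D mult_mono[of 1 "real M" 1 D] by (intro mult_left_mono) auto
    moreover have "\<bar>real_of_int c * (real n * real M)\<bar> = real n * (real M * D)" by (simp add: D_def abs_mult)
    moreover have "Re den = real_of_int c * (real n * real M) + (of_int c * Re w0 + of_int d)" by (simp add: den_def algebra_simps)
    ultimately have "1 / \<eta> < \<bar>Re den\<bar>" using n by linarith
    also have "\<dots> \<le> norm den" by (rule abs_Re_le_cmod)
    finally have dn: "1 / \<eta> < norm den" .
    have "norm (z n) = 1 / (D * norm den)" by (simp add: z_def den_def norm_divide norm_mult D_def)
    also have "\<dots> < \<eta>"
    proof -
      have "0 < norm den" using dn e by (smt (verit) divide_pos_pos)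
      moreover have "1 < \<eta> * norm den" using dn e by (simp add: field_simps)
      moreover have "\<eta> * norm den \<le> \<eta> * (D * norm den)" using D e by (intro mult_left_mono mult_le_cancel_right1[THEN iffD2]) auto
      ultimately show ?thesis using D by (simp add: divide_less_eq) 
    qed
    finally show ?thesis by blast
  qed
  then have "\<exists>z. 0 < Im z \<and> norm z < \<eta> \<and> V * (norm z)\<^sup>2 \<le> Im z \<and> (V powr (- (r / 2)) * H) * norm z powr (- r) \<le> norm (f (of_real (of_rat x) + z))"
    if "0 < \<eta>" for \<eta> using zprop that by (metis order_refl)
  moreover have "0 < V powr (- (r / 2)) * H" using V h0 by (simp add: H_def)
  ultimately show ?thesis using that V by blast
qed

lemma orbit_near_rational:
  assumes lu: "l < (u::real)"
  obtains \<tau> p q s t where "\<tau> = (p,t,q,s)" "\<tau> \<in> SL2Z" "q \<noteq> 0" "l < of_int p / of_int q" "of_int p / of_int q < u"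
proof -
  obtain \<xi> :: rat where xi: "l < of_rat \<xi>" "of_rat \<xi> < u" using of_rat_dense[OF lu] by blast
  obtain \<tau> where t: "\<tau> \<in> SL2Z" "sign_normalized \<tau>" "cusp_image \<tau> = Some \<xi>" using ex_SL2Z_cusp by blast
  obtain p t' q s where te: "\<tau> = (p,t',q,s)" by (cases \<tau>)
  show ?thesis using that[OF te t(1)] cusp_image_Some[OF t(3)[unfolded te]] xi by simp
qed

text \<open>Powers of a parabolic element of the group (up to sign) fixing a rational
  \<open>p / q\<close> in the interval move any cusp towards \<open>p / q\<close>. Applied to a cusp
  where \<open>f\<close> is not cuspidal, they give cusps in the interval with the same lower bound
  for \<open>h\<close>. Their distance to \<open>p / q\<close> is computed from
  \<open>det\<close>.\<close>

lemma vertical_lower_dense_not_cusp_form: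
  assumes ncf: "\<not> cusp_form G r f" and lu: "l < u"
  obtains x where "l < x" "x < u" "vertical_lower x"
proof -
  have al: "\<alpha>0 = r" using ncf by (simp add: alpha0_def)
  obtain cp where cp: "\<not> cuspidal_at G r f cp" using ncf by (auto simp: cusp_form_def)
  obtain g k V where g: "g \<in> SL2Z" "0 < k" "0 < V" "\<And>w. V \<le> Im w \<Longrightarrow> k * Im w powr (r / 2) \<le> h (mobius g w)"
    by (rule h_lower_not_cuspidal[OF cp], rule that, assumption+)
  obtain \<tau> p q s t where t: "\<tau> = (p,t,q,s)" "\<tau> \<in> SL2Z" "q \<noteq> 0" "l < of_int p / of_int q" "of_int p / of_int q < u"
    by (rule orbit_near_rational[OF lu], rule that, assumption+)
  define M where "M = int (cusp_width G \<tau>)"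
  have M: "0 < M" using cusp_width_pos_and_mem[OF t(2)] by (simp add: M_def)
  obtain A B C D where ABCD: "imat_mult (imat_inv \<tau>) g = (A,B,C,D)" by (cases "imat_mult (imat_inv \<tau>) g")
  have g1: "(A,B,C,D) \<in> SL2Z" unfolding ABCD[symmetric] by (intro SL2Z_mult SL2Z_inv t g)
  define cn where "cn n = q * (A + int n * M * C) + s * C" for n
  define an where "an n = p * (A + int n * M * C) + t * C" for n
  have mat: "\<exists>b' d'. imat_mult (conjT \<tau> (int n * M)) g = (an n, b', cn n, d')" for n
  proof -
    have "imat_mult (conjT \<tau> (int n * M)) g = imat_mult \<tau> (imat_mult (1, int n * M, 0, 1) (imat_mult (imat_inv \<tau>) g))"
      unfolding conjT_def by (simp only: imat_mult_assoc)
    then have "imat_mult (conjT \<tau> (int n * M)) g = imat_mult \<tau> (imat_mult (1, int n * M, 0, 1) (A,B,C,D))"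
      unfolding ABCD .
    also have "\<dots> = (an n, p * (B + int n * M * D) + t * D, cn n, q * (B + int n * M * D) + s * D)"
      unfolding t(1) by (simp add: an_def cn_def)
    finally show ?thesis by blast
  qed
  have det: "p * s - t * q = 1" using t(2) by (simp add: t(1) SL2Z_def)
  have diff: "of_int (an n) / of_int (cn n) - of_int p / of_int q = - (of_int C / (of_int q * of_int (cn n)) :: real)" if "cn n \<noteq> 0" for n
  proof -
    have "an n * q - p * cn n = - C * (p * s - t * q)" by (simp add: an_def cn_def algebra_simps)
    then have "real_of_int (an n) * of_int q - of_int p * of_int (cn n) = - of_int C" unfolding det by (metis mult_1_right of_int_diff of_int_minus of_int_mult)
    then have "of_int (an n) * of_int q - of_int p * of_int (cn n) = (- of_int C :: real)" .
    moreover have "of_int (an n) / of_int (cn n) - of_int p / of_int q = (of_int (an n) * of_int q - of_int p * of_int (cn n)) / (of_int (cn n) * of_int q :: real)"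
      using that t(3) by (intro diff_frac_eq) auto
    ultimately show ?thesis by (simp add: mult.commute)
  qed
  define e where "e = min (of_int p / of_int q - l) (u - of_int p / of_int q)"
  have e: "0 < e" using t by (simp add: e_def)
  have "\<exists>n. cn n \<noteq> 0 \<and> \<bar>of_int C / (of_int q * of_int (cn n)) :: real\<bar> < e"
  proof (cases "C = 0")
    case True
    \<comment> \<open>Here the non-cuspidal cusp is already \<open>p / q\<close>, and
      \<open>n = 0\<close> works.\<close>
    then have "A \<noteq> 0" using g1 by (auto simp: SL2Z_def)
    then show ?thesis using True t(3) e by (intro exI[of _ 0]) (simp add: cn_def)
  next
    case False
    obtain n :: nat where n: "real n > \<bar>of_int C / e\<bar> + \<bar>of_int (q * A + s * C)\<bar>" using reals_Archimedean2 by blast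
    have "q * M * C \<noteq> 0" using t(3) M False by simp
    then have "1 \<le> \<bar>q * M * C\<bar>" by linarith
    then have "1 \<le> \<bar>real_of_int (q * M * C)\<bar>" by linarith
    then have "real n * 1 \<le> real n * \<bar>real_of_int (q * M * C)\<bar>" by (intro mult_left_mono) auto
    moreover have "real_of_int (cn n) = real n * real_of_int (q * M * C) + of_int (q * A + s * C)" by (simp add: cn_def algebra_simps)
    moreover have "\<bar>real n * real_of_int (q * M * C)\<bar> = real n * \<bar>real_of_int (q * M * C)\<bar>" by (simp add: abs_mult)
    ultimately have cn1: "\<bar>of_int C / e\<bar> < \<bar>real_of_int (cn n)\<bar>" using n by linarith
    then have "0 < \<bar>real_of_int (cn n)\<bar>" using abs_ge_zero[of "of_int C / e"] by linarith
    then have cn0: "cn n \<noteq> 0" by simp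
    have "\<bar>of_int C / (of_int q * of_int (cn n)) :: real\<bar> = \<bar>real_of_int C\<bar> / (\<bar>of_int q\<bar> * \<bar>of_int (cn n)\<bar>)" by (simp add: abs_mult)
    also have "\<dots> \<le> \<bar>real_of_int C\<bar> / (1 * \<bar>of_int (cn n)\<bar>)" using t(3) cn0 by (intro divide_left_mono mult_right_mono mult_pos_pos) auto
    also have "\<dots> < e" using cn1 cn0 e by (simp add: field_simps)
    finally show ?thesis using cn0 by blast
  qed
  then obtain n where n: "cn n \<noteq> 0" "\<bar>of_int C / (of_int q * of_int (cn n)) :: real\<bar> < e" by blast
  obtain b' d' where m: "imat_mult (conjT \<tau> (int n * M)) g = (an n, b', cn n, d')" using mat by blast
  have ms: "(an n, b', cn n, d') \<in> SL2Z" unfolding m[symmetric] by (intro SL2Z_mult conjT_SL2Z t g)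
  have "vertical_lower (of_int (an n) / of_int (cn n))"
  proof (rule vertical_lower_of_matrix[OF ms n(1) g(2,3) _ al])
    fix w assume w: "V \<le> Im w"
    then have w0: "0 < Im w" using g(3) by linarith
    have "h (mobius (imat_mult (conjT \<tau> (int n * M)) g) w) = h (mobius (conjT \<tau> (int n * M)) (mobius g w))"
      using mobius_mult[OF conjT_SL2Z[OF t(2)] g(1) w0] by simp
    also have "\<dots> = h (mobius g w)" unfolding M_def by (rule h_invariant[OF plus_minus_G_conjT_multiple[OF t(2)] Im_mobius_pos[OF g(1) w0]])
    finally show "k * Im w powr (r / 2) \<le> h (mobius (an n, b', cn n, d') w)" using g(4)[OF w] m by simp
  qed
  moreover have "l < of_int (an n) / of_int (cn n)" "of_int (an n) / of_int (cn n) < u"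
    using diff[OF n(1)] n(2) unfolding e_def by linarith+
  ultimately show ?thesis using that by blast
qed

lemma h_continuous: "continuous_on {z. 0 < Im z} h"
  unfolding h_def by (intro continuous_intros holomorphic_on_imp_continuous_on f_holomorphic) auto

text \<open>No rational point qualifies, since cusp forms decay there. The orbit of a point where \<open>f\<close> does not vanish
  accumulates at every real point, so Baire's theorem applies.\<close>

lemma vertical_lower_dense_cusp_form:
  assumes cf: "cusp_form G r f" and lu: "l < u"
  obtains x where "l < x" "x < u" "vertical_lower x"
proof -
  have al: "\<alpha>0 = r / 2" using cf by (simp add: alpha0_def)
  obtain z1 where z1: "0 < Im z1" "f z1 \<noteq> 0" using nonzero by blast
  define H where "H = h z1"
  have H: "0 < H" using z1 by (simp add: H_def h_def)
  \<comment> \<open>The strict inequality with half of the value \<open>H\<close> makes these sets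
    open. Above a point common to all of them there are heights tending to 0 at which
    \<open>h\<close> exceeds \<open>H / 2\<close>.\<close>
  define U where "U n = {t::real. \<exists>y. 0 < y \<and> y < 1 / real (Suc n) \<and> H / 2 < h (of_real t + \<i> * of_real y)}" for n :: nat
  have op: "open (U n)" for n
  proof -
    have "U n = (\<Union>y\<in>{0<..<1 / real (Suc n)}. {t. H / 2 < h (of_real t + \<i> * of_real y)})" by (auto simp: U_def)
    moreover have "open {t::real. H / 2 < h (of_real t + \<i> * of_real y)}" if "0 < y" for y
    proof -
      have "continuous_on UNIV (\<lambda>t::real. h (of_real t + \<i> * of_real y))"
        by (rule continuous_on_compose2[OF h_continuous]) (use that in \<open>auto intro!: continuous_intros\<close>)
      then show ?thesis by (intro open_Collect_less continuous_on_const)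
    qed
    ultimately show ?thesis by auto
  qed
  \<comment> \<open>The images under \<open>\<tau>\<close> of \<open>w0 + of_nat (k * M)\<close>
    carry the value \<open>H\<close> of \<open>h\<close> and tend to the rational
    \<open>p / q\<close>; for large \<open>k\<close> the real part is the required point.\<close>
  have near: "\<exists>t\<in>U n. l' < t \<and> t < u'" if lu': "l' < u'" for l' u' :: real and n
  proof -
    obtain \<tau> p q s t where t: "\<tau> = (p,t,q,s)" "\<tau> \<in> SL2Z" "q \<noteq> 0" "l' < of_int p / of_int q" "of_int p / of_int q < u'"
      by (rule orbit_near_rational[OF lu'], rule that, assumption+)
    define M where "M = cusp_width G \<tau>"
    have M: "0 < M" using cusp_width_pos_and_mem[OF t(2)] by (simp add: M_def)
    define e where "e = min (1 / real (Suc n)) (min (of_int p / of_int q - l') (u' - of_int p / of_int q))"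
    have e: "0 < e" using t by (simp add: e_def)
    define w0 where "w0 = mobius (imat_inv \<tau>) z1"
    have w0: "0 < Im w0" unfolding w0_def by (rule Im_mobius_pos[OF SL2Z_inv[OF t(2)] z1(1)])
    obtain k :: nat where k: "real k > 1 / e + \<bar>of_int q * Re w0 + of_int s\<bar>" using reals_Archimedean2 by blast
    define w where "w = w0 + of_nat (k * M)"
    have w: "0 < Im w" using w0 by (simp add: w_def)
    define den where "den = of_int q * w + of_int s"
    have den0: "den \<noteq> 0" unfolding den_def using mobius_denominator_nonzero[OF t(2)[unfolded t(1)] w] .
    have "1 \<le> \<bar>real_of_int q\<bar> * real M" using t(3) M mult_mono[of 1 "\<bar>real_of_int q\<bar>" 1 "real M"] by simp
    then have "real k * 1 \<le> real k * (\<bar>real_of_int q\<bar> * real M)" by (intro mult_left_mono) auto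
    moreover have "\<bar>real_of_int q * (real k * real M)\<bar> = real k * (\<bar>real_of_int q\<bar> * real M)" by (simp add: abs_mult)
    moreover have "Re den = real_of_int q * (real k * real M) + (of_int q * Re w0 + of_int s)" by (simp add: den_def w_def algebra_simps)
    ultimately have "1 / e < \<bar>Re den\<bar>" using k by linarith
    also have "\<dots> \<le> norm den" by (rule abs_Re_le_cmod)
    finally have dn: "1 / e < norm den" .
    have det: "of_int p * of_int s - of_int t * of_int q = (1::complex)"
      using t(2) unfolding t(1) SL2Z_def by (metis (mono_tags, lifting) case_prodD mem_Collect_eq of_int_1 of_int_diff of_int_mult)
    have "mobius \<tau> w - of_int p / of_int q = ((of_int p * w + of_int t) * of_int q - of_int p * den) / (of_int q * den)"
      using den0 t(3) unfolding t(1) den_def[symmetric] mobius.simps by (simp add: field_simps)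
    also have "(of_int p * w + of_int t) * of_int q - of_int p * den = - (of_int p * of_int s - of_int t * of_int q)"
      by (simp add: den_def algebra_simps)
    finally have md: "mobius \<tau> w - of_int p / of_int q = - 1 / (of_int q * den)" unfolding det .
    have "norm (mobius \<tau> w - of_int p / of_int q) = 1 / (\<bar>real_of_int q\<bar> * norm den)" unfolding md by (simp add: norm_divide norm_mult)
    also have "\<dots> \<le> 1 / (1 * norm den)" using t(3) den0 by (intro divide_left_mono mult_right_mono mult_pos_pos) auto
    also have "\<dots> < e" using dn e den0 by (simp add: field_simps)
    finally have nd: "norm (mobius \<tau> w - of_int p / of_int q) < e" .
    define z where "z = mobius \<tau> w"
    have zi: "0 < Im z" unfolding z_def by (rule Im_mobius_pos[OF t(2) w])
    have "Im (z - of_int p / of_int q) = Im z"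
    proof -
      have "z - of_int p / of_int q = z - of_real (of_int p / of_int q)" by simp
      then show ?thesis by (simp only: minus_complex.sel Im_complex_of_real diff_zero)
    qed
    moreover have "Re (z - of_int p / of_int q) = Re z - of_int p / of_int q"
    proof -
      have "z - of_int p / of_int q = z - of_real (of_int p / of_int q)" by simp
      then show ?thesis by (simp only: minus_complex.sel Re_complex_of_real)
    qed
    ultimately have ze: "Im z < e" "\<bar>Re z - of_int p / of_int q\<bar> < e"
      using nd abs_Im_le_cmod[of "z - of_int p / of_int q"] abs_Re_le_cmod[of "z - of_int p / of_int q"] zi unfolding z_def[symmetric] by linarith+
    have "h z = h (mobius \<tau> w0)" unfolding z_def w_def M_def by (rule h_period[OF t(2) w0])
    also have "\<dots> = H" unfolding w0_def mobius_inv_cancel(2)[OF t(2) z1(1)] H_def ..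
    finally have hz: "h z = H" .
    have "of_real (Re z) + \<i> * of_real (Im z) = z" by (simp add: complex_eq_iff)
    then have "Re z \<in> U n" unfolding U_def using zi ze H hz by (intro CollectI exI[of _ "Im z"]) (auto simp: e_def)
    moreover have "l' < Re z" "Re z < u'" using ze(2) unfolding e_def by linarith+
    ultimately show ?thesis by blast
  qed
  have "(UNIV::real set) \<subseteq> closure (\<Inter>(range U))"
  proof (rule Baire)
    show "openin (top_of_set UNIV) T \<and> UNIV \<subseteq> closure T" if T: "T \<in> range U" for T
    proof -
      obtain n where n: "T = U n" using T by blast
      have "x \<in> closure (U n)" for x
        unfolding closure_approachable
      proof (intro allI impI)
        fix e :: real assume "0 < e"
        then obtain t where "t \<in> U n" "x - e < t" "t < x + e" using near[of "x - e" "x + e" n] by auto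
        then show "\<exists>y\<in>U n. dist y x < e" by (intro bexI[of _ t]) (auto simp: dist_real_def)
      qed
      then show ?thesis using op by (auto simp: n)
    qed
  qed auto
  then have "(l + u) / 2 \<in> closure (\<Inter>(range U))" by blast
  then obtain x where x: "x \<in> \<Inter>(range U)" "dist x ((l + u) / 2) < (u - l) / 2"
    unfolding closure_approachable using lu by (metis diff_gt_0_iff_gt half_gt_zero)
  have "vertical_lower x"
    unfolding vertical_lower_def
  proof (rule exI[of _ "H / 2"], intro conjI allI impI)
    show "0 < H / 2" using H by simp
    fix \<eta> :: real assume e: "0 < \<eta>"
    obtain n where n: "1 / real (Suc n) < \<eta>" using e nat_approx_posE by blast
    have "x \<in> U n" using x(1) by blast
    then obtain y where y: "0 < y" "y < 1 / real (Suc n)" "H / 2 < h (of_real x + \<i> * of_real y)" by (auto simp: U_def)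
    have "norm (f (of_real x + \<i> * of_real y)) = y powr (- (r / 2)) * h (of_real x + \<i> * of_real y)"
      using norm_f_eq[of "of_real x + \<i> * of_real y"] y(1) by simp
    also have "\<dots> \<ge> y powr (- (r / 2)) * (H / 2)" using y(3) by (intro mult_left_mono) auto
    finally have "H / 2 * y powr (- \<alpha>0) \<le> norm (f (of_real x + \<i> * of_real y))" by (simp add: al mult.commute)
    then show "\<exists>y>0. y < \<eta> \<and> H / 2 * y powr (- \<alpha>0) \<le> norm (f (of_real x + \<i> * of_real y))"
      using y n by (intro exI[of _ y]) auto
  qed
  moreover have "l < x" "x < u" using x(2) by (auto simp: dist_real_def abs_less_iff field_simps)
  ultimately show ?thesis using that by blast
qed

lemma vertical_lower_dense:
  assumes "l < u"
  obtains x where "l < x" "x < u" "vertical_lower x"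
  using vertical_lower_dense_cusp_form[OF _ assms] vertical_lower_dense_not_cusp_form[OF _ assms] by blast

end

subsection \<open>Hoelder exponents of the fractional integral\<close>

text \<open>Two candidates at distance \<open>d\<close> with \<open>0 < d < 1\<close> cannot both be
  integers after the shift by \<open>k\<close>.\<close>

lemma ex_between_not_Ints:
  fixes l u k :: real
  assumes "l < u"
  obtains q where "l < q" "q < u" "q + k \<notin> \<int>"
proof -
  define d where "d = min (u - l) 1 / 3"
  have d: "0 < d" "d < 1" "2 * d < u - l" using assms by (auto simp: d_def min_def)
  have "\<not> (l + d + k \<in> \<int> \<and> l + 2 * d + k \<in> \<int>)"
  proof
    assume a: "l + d + k \<in> \<int> \<and> l + 2 * d + k \<in> \<int>"
    then have "(l + 2 * d + k) - (l + d + k) \<in> \<int>" by (intro Ints_diff) auto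
    then have "d \<in> \<int>" by simp
    then show False using d by (auto elim!: Ints_cases)
  qed
  then show ?thesis using that[of "l + d"] that[of "l + 2 * d"] d by auto
qed

lemma Sup_ereal_eqI:
  fixes S :: "real set" and b :: real
  assumes up: "\<And>s. s \<in> S \<Longrightarrow> s \<le> b" and lo: "\<And>y. y < b \<Longrightarrow> \<exists>s\<in>S. y \<le> s"
  shows "Sup (ereal ` S) = ereal b"
proof (rule antisym)
  show "Sup (ereal ` S) \<le> ereal b" by (rule SUP_least) (simp add: up)
  show "ereal b \<le> Sup (ereal ` S)"
  proof (rule dense_le)
    fix v :: ereal assume v: "v < ereal b"
    obtain s where s: "s \<in> S" "v \<le> ereal s"
    proof (cases v)
      case (real y)
      then show ?thesis using lo[of y] v that by auto
    next
      case MInf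
      then show ?thesis using lo[of "b - 1"] that by auto
    qed (use v in auto)
    show "v \<le> Sup (ereal ` S)" using s(2) SUP_upper[OF s(1), of ereal] by (rule order_trans)
  qed
qed

lemma derivs_on_unique:
  assumes D: "derivs_on k g D {l<..<u}" and E: "derivs_on k g E {l<..<u}" and i: "i \<le> k" and t: "t \<in> {l<..<u}"
  shows "D i t = E i t"
  using i t
proof (induction i arbitrary: t)
  case 0
  then show ?case using D E by (simp add: derivs_on_def)
next
  case (Suc i)
  have 1: "(D i has_vector_derivative D (Suc i) t) (at t)" using D Suc.prems by (simp add: derivs_on_def)
  have 2: "(E i has_vector_derivative E (Suc i) t) (at t)" using E Suc.prems by (simp add: derivs_on_def)
  have "(D i has_vector_derivative E (Suc i) t) (at t)"
    by (rule has_vector_derivative_transform_within_open[OF 2 open_greaterThanLessThan Suc.prems(2)]) (use Suc in auto)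
  then show ?case by (rule vector_derivative_unique_at[OF 1])
qed

lemma holder_C_cong:
  assumes h: "holder_C s g x" and e: "0 < e" and eq: "\<And>t. \<bar>t - x\<bar> < e \<Longrightarrow> g t = g' t"
  shows "holder_C s g' x"
proof -
  obtain c C \<delta> where d: "0 < \<delta>" and 
    b: "\<And>t. 0 < \<bar>t - x\<bar> \<Longrightarrow> \<bar>t - x\<bar> < \<delta> \<Longrightarrow>
        norm (g t - (\<Sum>k<nat \<lceil>s\<rceil>. (t - x) ^ k *\<^sub>R c k)) \<le> C * \<bar>t - x\<bar> powr s"
    using h unfolding holder_C_def Collect_real_less by blast
  show ?thesis
    by (rule holder_C_of_polynomial[of "min \<delta> e" s s x g' c "nat \<lceil>s\<rceil>" C]) (use d e b eq[symmetric] in auto)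
qed

text \<open>This covers the identity, \<open>Re\<close> and \<open>Im\<close> at once: \<open>J\<close> recovers from \<open>L \<circ> g\<close> a nontrivial combination
  of \<open>g\<close> and \<open>cnj g\<close>, to which \<open>peano_imp_bound\<close> applies.\<close>

definition admissible :: "(complex \<Rightarrow> 'b::real_normed_vector) \<Rightarrow> bool" where
  "admissible L \<longleftrightarrow> bounded_linear L \<and> (\<exists>J \<eta> \<nu>. bounded_linear J \<and> \<eta> \<noteq> 0 \<and> (\<forall>z. J (L z) = \<eta> * z + \<nu> * cnj z))"

lemma admissible_id: "admissible (\<lambda>z. z)"
  unfolding admissible_def
  by (intro conjI exI[of _ "\<lambda>z. z"] exI[of _ 1] exI[of _ 0]) (auto intro: bounded_linear_ident)

lemma admissible_Re: "admissible Re"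
  unfolding admissible_def
  by (intro conjI exI[of _ of_real] exI[of _ "1/2"]) (auto intro: bounded_linear_Re bounded_linear_of_real simp: complex_eq_iff)

lemma admissible_Im: "admissible Im"
  unfolding admissible_def
  by (intro conjI exI[of _ of_real] exI[of _ "- \<i>/2"] exI[of _ "\<i>/2"]) (auto intro: bounded_linear_Im bounded_linear_of_real simp: complex_eq_iff)

lemma admissible_mult:
  assumes "admissible L" "c \<noteq> 0"
  shows "admissible (\<lambda>z. L (c * z))"
proof -
  obtain J \<eta> \<nu> where L: "bounded_linear L" and J: "bounded_linear J" "\<eta> \<noteq> 0" "\<And>z. J (L z) = \<eta> * z + \<nu> * cnj z"
    using assms(1) unfolding admissible_def by blast
  show ?thesis unfolding admissible_def
  proof (intro conjI)
    show "bounded_linear (\<lambda>z. L (c * z))"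
      using bounded_linear_compose[OF L bounded_linear_mult_right] .
    show "\<exists>J \<eta> \<nu>. bounded_linear J \<and> \<eta> \<noteq> 0 \<and> (\<forall>z. J (L (c * z)) = \<eta> * z + \<nu> * cnj z)"
      by (intro exI[of _ J] exI[of _ "\<eta> * c"] exI[of _ "\<nu> * cnj c"]) (use J assms(2) in auto)
  qed
qed

section \<open>The modular form and its fractional integral as exponential series\<close>

context modform
begin

definition wid :: real where "wid = real (cusp_width G (1,0,0,1))"
definition fr :: real where "fr = 2 * pi / wid"
definition cc :: "nat \<Rightarrow> complex" where "cc n = (if 0 < real n + \<kappa> then coef n else 0)"
definition A0 :: complex where "A0 = (if \<kappa> = 0 then coef 0 else 0)"

lemma wid_pos: "0 < wid"
  using cusp_width_pos_and_mem[of "(1,0,0,1)"] by (simp add: wid_def SL2Z_def)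

lemma fr_pos: "0 < fr" using wid_pos by (simp add: fr_def)

lemma qseries_f: "qseries cc \<kappa> fr"
  unfolding cc_def[abs_def] fr_def by (rule fourier_exp_qseries(1)[OF expansion wid_pos])

lemma f_eq_fs: "0 < Im z \<Longrightarrow> f z = qseries.fs cc \<kappa> fr 0 z + A0"
  using fourier_exp_qseries(2)[OF expansion wid_pos, of z] wid_pos
  unfolding cc_def[abs_def, symmetric] fr_def[symmetric] A0_def by (simp add: wid_def)

lemma qseries_bounded_f: "qseries_bounded cc \<kappa> fr \<alpha>0"
proof -
  interpret q: qseries cc \<kappa> fr by (rule qseries_f)
  obtain C where C: "0 \<le> C" "\<And>z. 0 < Im z \<Longrightarrow> Im z \<le> 1 \<Longrightarrow> norm (f z) \<le> C * Im z powr (- \<alpha>0)" using f_bound by blast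
  show ?thesis
  proof
    show "0 < \<alpha>0" by (rule alpha0_pos)
    have "norm (q.fs 0 z) \<le> (C + norm A0) * Im z powr (- \<alpha>0)" if z: "0 < Im z" "Im z \<le> 1" for z
    proof -
      have "norm (q.fs 0 z) \<le> norm (f z) + norm A0"
        using norm_triangle_ineq4[of "f z" A0] f_eq_fs[OF z(1)] by simp
      moreover have "1 \<le> Im z powr (- \<alpha>0)"
        using powr_mono'[of "- \<alpha>0" 0 "Im z"] z alpha0_pos by simp
      then have "norm A0 * 1 \<le> norm A0 * Im z powr (- \<alpha>0)" by (intro mult_left_mono) auto
      ultimately show ?thesis using C(2)[OF z] by (simp add: distrib_right)
    qed
    then show "\<exists>C. \<forall>z. 0 < Im z \<and> Im z \<le> 1 \<longrightarrow> norm (q.fs 0 z) \<le> C * Im z powr (- \<alpha>0)" by blast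
  qed
qed

sublocale qs: qseries_bounded cc \<kappa> fr \<alpha>0
  by (rule qseries_bounded_f)

lemma frac_integral_eq: "frac_integral coef \<kappa> (cusp_width G (1,0,0,1)) \<alpha> t = qs.fs \<alpha> (of_real t)"
proof -
  have "(if 0 < real n + \<kappa> then coef n * of_real ((real n + \<kappa>) powr (- \<alpha>)) *
      exp (2 * of_real pi * \<i> * of_real (real n + \<kappa>) * of_real (t / wid)) else 0) = qs.tm \<alpha> n (of_real t)" for n
  proof -
    have "\<i> * of_real (fr * (real n + \<kappa>)) * of_real t = 2 * of_real pi * \<i> * of_real (real n + \<kappa>) * of_real (t / wid)"
      by (simp add: fr_def)
    then show ?thesis unfolding qs.tm_def qs.lam_def by (simp only: cc_def if_distrib[of "\<lambda>u. u * _"] mult_zero_left)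
  qed
  then show ?thesis unfolding frac_integral_def qs.fs_def wid_def by simp
qed

text \<open>With \<open>\<sigma> = \<alpha>0\<close> both terms of \<open>peano_imp_bound\<close>
  equal \<open>y powr (- \<alpha>0)\<close> on the ray. With \<open>\<epsilon>\<close> a quarter of
  the constant in \<open>vertical_lower\<close>, half of the lower bound survives and would have to
  stay bounded as \<open>y\<close> tends to 0.\<close>

lemma not_peano_vertical:
  assumes x: "vertical_lower x" and al: "\<alpha>0 < \<alpha>" and L: "admissible L"
  shows "\<not> peano (\<alpha> - \<alpha>0) (\<lambda>t. L (qs.fs \<alpha> (of_real t))) x"
proof
  assume p: "peano (\<alpha> - \<alpha>0) (\<lambda>t. L (qs.fs \<alpha> (of_real t))) x"
  obtain J \<eta> \<nu> where J: "bounded_linear J" "\<eta> \<noteq> 0" "\<And>z. J (L z) = \<eta> * z + \<nu> * cnj z"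
    using L unfolding admissible_def by blast
  obtain c where c: "0 < c" "\<And>\<eta>. 0 < \<eta> \<Longrightarrow> \<exists>y. 0 < y \<and> y < \<eta> \<and> c * y powr (- \<alpha>0) \<le> norm (f (of_real x + \<i> * of_real y))"
    using x unfolding vertical_lower_def by blast
  have p': "peano (\<alpha> - \<alpha>0) (\<lambda>t. \<eta> * qs.fs \<alpha> (of_real t) + \<nu> * cnj (qs.fs \<alpha> (of_real t))) x"
    using peano_linear[OF J(1) p] unfolding J(3) .
  have "0 < \<alpha> - \<alpha>0" "0 < \<alpha>0" "\<alpha> - \<alpha>0 \<le> \<alpha> - \<alpha>0" "0 < c / 4" using al alpha0_pos c by auto
  from qs.peano_imp_bound[OF al J(2) p' this]
  obtain C \<delta> where d: "0 < \<delta>" and bd: "\<And>z. 0 < Im z \<Longrightarrow> norm z < \<delta> \<Longrightarrow>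
     norm (qs.fs 0 (of_real x + z)) \<le> C + c / 4 * (norm z powr (\<alpha> - \<alpha>0) * Im z powr (- \<alpha>) + Im z powr (- \<alpha>0))" by blast
  define C' where "C' = \<bar>C\<bar> + norm A0 + 1"
  have C': "0 < C'" by (simp add: C'_def add_nonneg_pos)
  obtain \<delta>' where d': "0 < \<delta>'" "\<And>u. 0 < u \<Longrightarrow> u < \<delta>' \<Longrightarrow> u powr \<alpha>0 \<le> c / 2 / C'"
    using powr_less_eps[of \<alpha>0 "c / 2 / C'"] alpha0_pos c C' by auto
  obtain y where y: "0 < y" "y < min \<delta> \<delta>'" "c * y powr (- \<alpha>0) \<le> norm (f (of_real x + \<i> * of_real y))"
    using c(2)[of "min \<delta> \<delta>'"] d d' by auto
  have "y powr (\<alpha> - \<alpha>0) * y powr (- \<alpha>) = y powr (- \<alpha>0)" by (simp add: powr_add[symmetric])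
  then have "norm (qs.fs 0 (of_real x + \<i> * of_real y)) \<le> C + c / 2 * y powr (- \<alpha>0)"
    using bd[of "\<i> * of_real y"] y by (simp add: norm_mult)
  moreover have "norm (f (of_real x + \<i> * of_real y)) \<le> norm (qs.fs 0 (of_real x + \<i> * of_real y)) + norm A0"
    using f_eq_fs[of "of_real x + \<i> * of_real y"] y by (simp add: norm_triangle_ineq)
  ultimately have "c / 2 * y powr (- \<alpha>0) < C'" using y(3) unfolding C'_def by linarith
  then have "c / 2 < C' * y powr \<alpha>0" using y(1) by (simp add: powr_minus field_simps)
  moreover have "C' * y powr \<alpha>0 \<le> c / 2" using d'(2)[of y] y C' by (simp add: field_simps)
  ultimately show False by linarith
qed

text \<open>With \<open>\<sigma> = r / 2\<close> and \<open>Im z \<ge> V * (norm z)\<^sup>2\<close>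
  both terms of \<open>peano_imp_bound\<close> are at most a multiple of
  \<open>norm z powr (- r)\<close>, the size that \<open>f\<close> attains on the horocycle. A small
  \<open>\<epsilon>\<close> contradicts this.\<close>

lemma not_peano_horocycle:
  assumes al: "\<alpha>0 < \<alpha>" and L: "admissible L"
  shows "\<not> peano (2 * \<alpha> - r) (\<lambda>t. L (qs.fs \<alpha> (of_real t))) (of_rat x)"
proof
  assume p: "peano (2 * \<alpha> - r) (\<lambda>t. L (qs.fs \<alpha> (of_real t))) (of_rat x)"
  obtain J \<eta> \<nu> where J: "bounded_linear J" "\<eta> \<noteq> 0" "\<And>z. J (L z) = \<eta> * z + \<nu> * cnj z"
    using L unfolding admissible_def by blast
  obtain c V where c: "0 < c" and V: "0 < V" and hor: "\<And>\<eta>. 0 < \<eta> \<Longrightarrow> \<exists>z. 0 < Im z \<and> norm z < \<eta> \<and> V * (norm z)\<^sup>2 \<le> Im z \<and>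
     c * norm z powr (- r) \<le> norm (f (of_real (of_rat x) + z))"
    using horocycle_lower[of x] by blast
  have p': "peano (2 * \<alpha> - r) (\<lambda>t. \<eta> * qs.fs \<alpha> (of_real t) + \<nu> * cnj (qs.fs \<alpha> (of_real t))) (of_rat x)"
    using peano_linear[OF J(1) p] unfolding J(3) .
  define W where "W = V powr (- \<alpha>) + V powr (- (r / 2))"
  have W: "0 < W" using V by (simp add: W_def add_pos_pos)
  define \<epsilon> where "\<epsilon> = c / 2 / W"
  have "0 < 2 * \<alpha> - r" "0 < r / 2" "\<alpha> - r / 2 \<le> 2 * \<alpha> - r" "0 < \<epsilon>" using al alpha0_pos c r W by (auto simp: \<epsilon>_def)
  from qs.peano_imp_bound[OF al J(2) p' this]
  obtain C \<delta> where d: "0 < \<delta>" and bd: "\<And>z. 0 < Im z \<Longrightarrow> norm z < \<delta> \<Longrightarrow>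
     norm (qs.fs 0 (of_real (of_rat x) + z)) \<le> C + \<epsilon> * (norm z powr (2 * \<alpha> - r) * Im z powr (- \<alpha>) + Im z powr (- (r / 2)))" by blast
  define C' where "C' = \<bar>C\<bar> + norm A0 + 1"
  have C': "0 < C'" by (simp add: C'_def add_nonneg_pos)
  obtain \<delta>' where d': "0 < \<delta>'" "\<And>u. 0 < u \<Longrightarrow> u < \<delta>' \<Longrightarrow> u powr r \<le> c / 2 / C'"
    using powr_less_eps[of r "c / 2 / C'"] r c C' by auto
  obtain z where z: "0 < Im z" "norm z < min \<delta> \<delta>'" "V * (norm z)\<^sup>2 \<le> Im z" "c * norm z powr (- r) \<le> norm (f (of_real (of_rat x) + z))"
    using hor[of "min \<delta> \<delta>'"] d d' by auto
  have nz: "0 < norm z" using z(1) by auto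
  have pw: "Im z powr (- s) \<le> V powr (- s) * norm z powr (- (2 * s))" if "0 < s" for s
  proof -
    have "Im z powr (- s) \<le> (V * norm z powr 2) powr (- s)"
      using z(3) V nz that by (intro powr_mono2') auto
    then show ?thesis by (simp only: powr_mult powr_powr) simp
  qed
  have "norm z powr (2 * \<alpha> - r) * Im z powr (- \<alpha>) \<le> norm z powr (2 * \<alpha> - r) * (V powr (- \<alpha>) * norm z powr (- (2 * \<alpha>)))"
    using al alpha0_pos by (intro mult_left_mono pw) auto
  also have "\<dots> = V powr (- \<alpha>) * norm z powr (- r)" by (simp add: powr_add[symmetric])
  finally have 1: "norm z powr (2 * \<alpha> - r) * Im z powr (- \<alpha>) \<le> V powr (- \<alpha>) * norm z powr (- r)" .
  have 2: "Im z powr (- (r / 2)) \<le> V powr (- (r / 2)) * norm z powr (- r)" using pw[of "r / 2"] r by simp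
  have "\<epsilon> * (norm z powr (2 * \<alpha> - r) * Im z powr (- \<alpha>) + Im z powr (- (r / 2))) \<le> \<epsilon> * (W * norm z powr (- r))"
    using 1 2 \<open>0 < \<epsilon>\<close> unfolding W_def distrib_right by (intro mult_left_mono add_mono) auto
  also have "\<dots> = c / 2 * norm z powr (- r)" using W by (simp add: \<epsilon>_def)
  finally have "norm (qs.fs 0 (of_real (of_rat x) + z)) \<le> C + c / 2 * norm z powr (- r)"
    using bd[of z] z by auto
  moreover have "norm (f (of_real (of_rat x) + z)) \<le> norm (qs.fs 0 (of_real (of_rat x) + z)) + norm A0"
    using f_eq_fs[of "of_real (of_rat x) + z"] z by (simp add: norm_triangle_ineq)
  ultimately have "c / 2 * norm z powr (- r) < C'" using z(4) unfolding C'_def by linarith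
  then have "c / 2 < C' * norm z powr r" using nz by (simp add: powr_minus field_simps)
  moreover have "C' * norm z powr r \<le> c / 2" using d'(2)[of "norm z"] z nz C' by (simp add: field_simps)
  ultimately show False by linarith
qed

lemma holder_of_Taylor:
  assumes P: "\<And>t. \<bar>t\<bar> \<le> 1/8 \<Longrightarrow> norm (qs.fs \<alpha> (of_real (x + t)) - poly P (of_real t)) \<le> C * \<bar>t\<bar> powr s'" and s: "s \<le> s'"
  shows "holder_C s (\<lambda>t. qs.fs \<alpha> (of_real t)) x"
proof (rule holder_C_of_polynomial[where \<delta> = "1/8" and n = "Suc (degree P)" and c = "coeff P" and C = C, OF _ s])
  fix t assume t: "\<bar>t - x\<bar> < 1/8"
  have "poly P (of_real (t - x)) = (\<Sum>k<Suc (degree P). (t - x) ^ k *\<^sub>R coeff P k)"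
    by (simp add: poly_altdef lessThan_Suc_atMost scaleR_conv_of_real mult.commute)
  then show "norm (qs.fs \<alpha> (of_real t) - (\<Sum>k<Suc (degree P). (t - x) ^ k *\<^sub>R coeff P k)) \<le> C * \<bar>t - x\<bar> powr s'"
    using P[of "t - x"] t by simp
qed simp

text \<open>With the growth exponents \<open>2 * q - r\<close> and \<open>- q\<close> the order is
  \<open>q + (\<alpha> - r)\<close>. It exceeds \<open>s\<close> for \<open>q\<close> close enough
  to \<open>\<alpha>\<close>, and a generic \<open>q\<close> makes it non-integral.\<close>

lemma Taylor_cuspidal:
  assumes cu: "cuspidal_at G r f (Some x)" and al: "\<alpha>0 < \<alpha>" and s: "s < 2 * \<alpha> - r"
  obtains P C s' where "s < s'"
    "\<And>t. \<bar>t\<bar> \<le> 1/8 \<Longrightarrow> norm (qs.fs \<alpha> (of_real (of_rat x + t)) - poly P (of_real t)) \<le> C * \<bar>t\<bar> powr s'"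
    "\<And>y. 0 < y \<Longrightarrow> y \<le> 1/8 \<Longrightarrow> norm (\<i> * of_real fr * qs.fs (\<alpha> - 1) (of_real (of_rat x) + \<i> * of_real y) - poly (pderiv P) (\<i> * of_real y)) \<le> C * y powr (s' - 1)"
proof -
  have "max (max \<alpha>0 (\<alpha> - 1)) (s - \<alpha> + r) < \<alpha>" using al s by auto
  then obtain q where q: "max (max \<alpha>0 (\<alpha> - 1)) (s - \<alpha> + r) < q" "q < \<alpha>" "q + (\<alpha> - r) \<notin> \<int>"
    using ex_between_not_Ints by blast
  have q1: "\<alpha>0 \<le> q" "\<alpha> - 1 < q" "s < q + \<alpha> - r" "0 \<le> q" "0 \<le> 2 * q - r" using q(1) alpha0_pos by auto
  have e: "2 * q - r + (\<alpha> - q) = q + (\<alpha> - r)" by simp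
  obtain B where B: "0 \<le> B" "\<And>z. 0 < Im z \<Longrightarrow> norm (f (of_real (of_rat x) + z)) \<le> B * norm z powr (2 * q - r) * Im z powr (- q)"
    using f_bound_cuspidal[OF cu q1(1)] by blast
  have B': "norm (qs.fs 0 (of_real (of_rat x) + z) + A0) \<le> B * norm z powr (2 * q - r) * Im z powr (- q)" if "0 < Im z" "norm z \<le> 1" for z
    using B(2)[of z] f_eq_fs[of "of_real (of_rat x) + z"] that by simp
  have ni: "2 * q - r + (\<alpha> - q) \<notin> \<int>" unfolding e by (rule q(3))
  obtain P C where PC: "\<And>t. \<bar>t\<bar> \<le> 1/8 \<Longrightarrow> norm (qs.fs \<alpha> (of_real (of_rat x + t)) - poly P (of_real t)) \<le> C * \<bar>t\<bar> powr (2 * q - r + (\<alpha> - q))"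
    "\<And>y. 0 < y \<Longrightarrow> y \<le> 1/8 \<Longrightarrow> norm (\<i> * of_real fr * qs.fs (\<alpha> - 1) (of_real (of_rat x) + \<i> * of_real y) - poly (pderiv P) (\<i> * of_real y)) \<le> C * y powr (2 * q - r + (\<alpha> - q) - 1)"
    by (rule qs.Taylor_at_boundary[OF al q1(5,4,2) q(2) ni B(1) B'], assumption, assumption, rule that, assumption+)
  show ?thesis by (rule that[of "2 * q - r + (\<alpha> - q)" P C]) (use PC q1 in auto)
qed

text \<open>Part of the bound \<open>Im z powr (- \<alpha>0)\<close> is traded for a power of the
  distance: it is at most \<open>norm z powr p * Im z powr (- q)\<close> as soon as
  \<open>0 \<le> p \<le> q - \<alpha>0\<close>, because \<open>Im z \<le> norm z \<le> 1\<close>.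
  This allows any order up to \<open>\<alpha> - \<alpha>0\<close>.\<close>

lemma Taylor_general:
  assumes al: "\<alpha>0 < \<alpha>" and s: "s < \<alpha> - \<alpha>0"
  obtains P C s' where "s < s'"
    "\<And>t. \<bar>t\<bar> \<le> 1/8 \<Longrightarrow> norm (qs.fs \<alpha> (of_real (x + t)) - poly P (of_real t)) \<le> C * \<bar>t\<bar> powr s'"
proof -
  have "max s 0 < \<alpha> - \<alpha>0" using al s by auto
  then obtain s' where s': "max s 0 < s'" "s' < \<alpha> - \<alpha>0" "s' + 0 \<notin> \<int>"
    using ex_between_not_Ints by blast
  have "max (max \<alpha>0 (\<alpha> - 1)) (\<alpha> - s') < \<alpha>" using al s' by auto
  then obtain q where q: "max (max \<alpha>0 (\<alpha> - 1)) (\<alpha> - s') < q" "q < \<alpha>" using dense by blast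
  define p where "p = s' - (\<alpha> - q)"
  have p: "0 \<le> p" "p \<le> q - \<alpha>0" "p + (\<alpha> - q) = s'" and q1: "0 \<le> q" "\<alpha> - 1 < q" using q s' alpha0_pos by (auto simp: p_def)
  obtain B where B: "0 \<le> B" "\<And>z. 0 < Im z \<Longrightarrow> Im z \<le> 1 \<Longrightarrow> norm (f z) \<le> B * Im z powr (- \<alpha>0)" using f_bound by blast
  have B': "norm (qs.fs 0 (of_real x + z) + A0) \<le> B * norm z powr p * Im z powr (- q)" if z: "0 < Im z" "norm z \<le> 1" for z
  proof -
    have yz: "Im z \<le> norm z" by (rule complex_Im_le_norm)
    have "norm (f (of_real x + z)) \<le> B * Im z powr (- \<alpha>0)" using B(2)[of "of_real x + z"] z yz by simp
    also have "Im z powr (- \<alpha>0) = Im z powr (q - \<alpha>0) * Im z powr (- q)" by (simp add: powr_add[symmetric])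
    also have "Im z powr (q - \<alpha>0) \<le> Im z powr p" using z yz p by (intro powr_mono') auto
    also have "Im z powr p \<le> norm z powr p" using z yz p by (intro powr_mono2) auto
    finally have "norm (f (of_real x + z)) \<le> B * (norm z powr p * Im z powr (- q))" using B(1) by (simp add: mult_left_mono mult_right_mono)
    then show ?thesis using f_eq_fs[of "of_real x + z"] z by (simp add: mult.assoc)
  qed
  have ni: "p + (\<alpha> - q) \<notin> \<int>" using p s' by simp
  obtain P C where PC: "\<And>t. \<bar>t\<bar> \<le> 1/8 \<Longrightarrow> norm (qs.fs \<alpha> (of_real (x + t)) - poly P (of_real t)) \<le> C * \<bar>t\<bar> powr (p + (\<alpha> - q))"
    by (rule qs.Taylor_at_boundary[OF al p(1) q1 q(2) ni B(1) B'], assumption, assumption, rule that, assumption)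
  show ?thesis by (rule that[of s' P C]) (use PC p s' in auto)
qed

definition beta0 :: "rat \<Rightarrow> real \<Rightarrow> real" where
  "beta0 x \<alpha> = (if cuspidal_at G r f (Some x) then 2 * \<alpha> - r else \<alpha> - r)"

lemma beta0_not_cuspidal: "\<not> cuspidal_at G r f (Some x) \<Longrightarrow> beta0 x \<alpha> = \<alpha> - \<alpha>0"
  using vertical_lower_not_cuspidal(2) by (simp add: beta0_def)

lemma beta0_pos: "\<alpha>0 < \<alpha> \<Longrightarrow> 0 < beta0 x \<alpha>"
  using alpha0_pos beta0_not_cuspidal[of x \<alpha>] by (auto simp: beta0_def split: if_splits)

lemma not_peano_beta0:
  assumes "\<alpha>0 < \<alpha>" "admissible L"
  shows "\<not> peano (beta0 x \<alpha>) (\<lambda>t. L (qs.fs \<alpha> (of_real t))) (of_rat x)"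
proof (cases "cuspidal_at G r f (Some x)")
  case True
  then show ?thesis using not_peano_horocycle[OF assms] by (simp add: beta0_def)
next
  case False
  then show ?thesis using not_peano_vertical[OF vertical_lower_not_cuspidal(1)[OF False] assms] by (simp add: beta0_not_cuspidal)
qed

lemma holder_C_below_beta0:
  assumes al: "\<alpha>0 < \<alpha>" and L: "bounded_linear L" and s: "s < beta0 x \<alpha>"
  shows "holder_C s (\<lambda>t. L (qs.fs \<alpha> (of_real t))) (of_rat x)"
proof (rule holder_C_linear[OF L])
  show "holder_C s (\<lambda>t. qs.fs \<alpha> (of_real t)) (of_rat x)"
  proof (cases "cuspidal_at G r f (Some x)")
    case True
    then have "s < 2 * \<alpha> - r" using s by (simp add: beta0_def)
    then obtain P C s' where "s < s'" "\<And>t. \<bar>t\<bar> \<le> 1/8 \<Longrightarrow> norm (qs.fs \<alpha> (of_real (of_rat x + t)) - poly P (of_real t)) \<le> C * \<bar>t\<bar> powr s'"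
      using Taylor_cuspidal[OF True al] by metis
    then show ?thesis by (intro holder_of_Taylor) auto
  next
    case False
    then have "s < \<alpha> - \<alpha>0" using s by (simp add: beta0_not_cuspidal)
    then obtain P C s' where "s < s'" "\<And>t. \<bar>t\<bar> \<le> 1/8 \<Longrightarrow> norm (qs.fs \<alpha> (of_real (of_rat x + t)) - poly P (of_real t)) \<le> C * \<bar>t\<bar> powr s'"
      using Taylor_general[OF al] by metis
    then show ?thesis by (intro holder_of_Taylor) auto
  qed
qed

lemma holder_C_le_beta0:
  assumes "\<alpha>0 < \<alpha>" "admissible L" "holder_C s (\<lambda>t. L (qs.fs \<alpha> (of_real t))) (of_rat x)"
  shows "s \<le> beta0 x \<alpha>"
  using holder_C_imp_peano[OF assms(3)] not_peano_beta0[OF assms(1,2)] by force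

lemma holder_beta_eq:
  assumes al: "\<alpha>0 < \<alpha>" and L: "admissible L"
  shows "holder_beta (\<lambda>t. L (qs.fs \<alpha> (of_real t))) (of_rat x) = ereal (beta0 x \<alpha>)"
  unfolding holder_beta_def
proof (rule Sup_ereal_eqI)
  show "s \<le> beta0 x \<alpha>" if "s \<in> {s. 0 \<le> s \<and> holder_C s (\<lambda>t. L (qs.fs \<alpha> (of_real t))) (of_rat x)}" for s
    using holder_C_le_beta0[OF al L] that by blast
  fix y assume y: "y < beta0 x \<alpha>"
  have "max y 0 < beta0 x \<alpha>" using y beta0_pos[OF al] by simp
  then have "holder_C (max y 0) (\<lambda>t. L (qs.fs \<alpha> (of_real t))) (of_rat x)"
    using L by (intro holder_C_below_beta0[OF al]) (simp_all add: admissible_def)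
  then show "\<exists>s\<in>{s. 0 \<le> s \<and> holder_C s (\<lambda>t. L (qs.fs \<alpha> (of_real t))) (of_rat x)}. y \<le> s"
    by (intro bexI[of _ "max y 0"]) auto
qed

definition Dseq :: "(complex \<Rightarrow> 'b::real_normed_vector) \<Rightarrow> real \<Rightarrow> nat \<Rightarrow> real \<Rightarrow> 'b" where
  "Dseq L \<alpha> j t = L ((\<i> * of_real fr) ^ j * qs.fs (\<alpha> - real j) (of_real t))"

lemma derivs_on_Dseq:
  assumes L: "bounded_linear L" and k: "\<alpha>0 < \<alpha> - real k"
  shows "derivs_on k (\<lambda>t. L (qs.fs \<alpha> (of_real t))) (Dseq L \<alpha>) I"
  unfolding derivs_on_def
proof (intro conjI allI impI ballI)
  show "Dseq L \<alpha> 0 = (\<lambda>t. L (qs.fs \<alpha> (of_real t)))" by (simp add: Dseq_def[abs_def])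
  fix j t assume j: "j < k"
  have e: "\<alpha> - real j - 1 = \<alpha> - real (Suc j)" by simp
  have "real (Suc j) \<le> real k" using j by simp
  then have "\<alpha>0 < \<alpha> - real j - 1" using k by simp
  from qs.fs_real_deriv[OF this, of t]
  have "((\<lambda>t. (\<i> * of_real fr) ^ j * qs.fs (\<alpha> - real j) (of_real t)) has_vector_derivative
     (\<i> * of_real fr) ^ j * (\<i> * of_real fr * qs.fs (\<alpha> - real j - 1) (of_real t))) (at t)"
    by (rule has_vector_derivative_mult_right)
  then have "((\<lambda>t. (\<i> * of_real fr) ^ j * qs.fs (\<alpha> - real j) (of_real t)) has_vector_derivative
     (\<i> * of_real fr) ^ Suc j * qs.fs (\<alpha> - real (Suc j)) (of_real t)) (at t)"
    unfolding e by (simp add: mult_ac)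
  from bounded_linear.has_vector_derivative[OF L this]
  show "(Dseq L \<alpha> j has_vector_derivative Dseq L \<alpha> (Suc j) t) (at t)" unfolding Dseq_def[abs_def] .
qed

lemma Dseq_admissible: "admissible L \<Longrightarrow> admissible (\<lambda>z. L ((\<i> * of_real fr) ^ j * z))"
  using fr_pos by (intro admissible_mult) auto

text \<open>Derivatives are required on a whole interval, which contains a point of
  \<open>vertical_lower\<close>; there \<open>k\<close> derivatives would give an expansion of order
  \<open>\<alpha> - \<alpha>0\<close>.\<close>

lemma derivs_order_less:
  assumes al: "\<alpha>0 < \<alpha>" and L: "admissible L" and D: "derivs_on k (\<lambda>t. L (qs.fs \<alpha> (of_real t))) D {l<..<u}" and lu: "l < u"
  shows "real k < \<alpha> - \<alpha>0"
proof (rule ccontr)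
  assume "\<not> real k < \<alpha> - \<alpha>0"
  then have k: "\<alpha> - \<alpha>0 \<le> real k" "0 < k" using al by (auto intro!: Nat.gr0I)
  obtain x where x: "l < x" "x < u" "vertical_lower x" using vertical_lower_dense[OF lu] by blast
  show False using derivs_on_peano_order[OF D x(1,2) k] not_peano_vertical[OF x(3) al L] by blast
qed

text \<open>Hardy and Littlewood's argument: a derivative of size \<open>v powr (e - 1)\<close> at
  height \<open>v\<close> makes the boundary values Hoelder continuous of order \<open>e\<close>.
  The exponent \<open>e\<close> is taken strictly between \<open>s\<close> and both
  \<open>\<alpha> - \<alpha>0\<close> and 1; the bound for the derivative is the case
  \<open>p = 0\<close>, \<open>j = 1\<close> of \<open>two_microlocal_bound\<close>, uniform along
  the axis.\<close>

lemma fs_Lambda_on: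
  assumes al: "\<alpha>0 < \<alpha>" and s: "0 \<le> s" "s < \<alpha> - \<alpha>0" "s < 1" and K: "compact K"
  shows "Lambda_on s (\<lambda>t. qs.fs \<alpha> (of_real t)) K"
proof -
  define F where "F t = qs.fs \<alpha> (of_real t)" for t :: real
  have contF: "continuous_on UNIV F"
    unfolding F_def by (intro continuous_on_compose2[OF qs.fs_continuous[OF al]] continuous_intros) auto
  obtain e where e: "s < e" "e < min (\<alpha> - \<alpha>0) 1" using dense[of s "min (\<alpha> - \<alpha>0) 1"] s by auto
  have al0: "0 < \<alpha>" using al alpha0_pos by linarith
  define q where "q = \<alpha> - e"
  have q: "0 \<le> q" "q < \<alpha>" "\<alpha>0 \<le> q" using e s alpha0_pos by (auto simp: q_def)
  obtain B where B: "0 \<le> B" "\<And>z. 0 < Im z \<Longrightarrow> Im z \<le> 1 \<Longrightarrow> norm (f z) \<le> B * Im z powr (- \<alpha>0)" using f_bound by blast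
  have B': "norm (qs.fs 0 (of_real x + z) + A0) \<le> B * norm z powr 0 * Im z powr (- q)" if z: "0 < Im z" "norm z \<le> 1" for x z
  proof -
    have y1: "Im z \<le> 1" using complex_Im_le_norm[of z] z by linarith
    have "norm (f (of_real x + z)) \<le> B * Im z powr (- \<alpha>0)" using B(2)[of "of_real x + z"] z y1 by simp
    also have "\<dots> \<le> B * Im z powr (- q)" using z y1 q B(1) by (intro mult_left_mono powr_mono') auto
    also have "\<dots> = B * norm z powr 0 * Im z powr (- q)" using z(1) by auto
    finally show ?thesis using f_eq_fs[of "of_real x + z"] z by simp
  qed
  have aj: "\<alpha> + 0 - q < real 1" "(0::nat) < 1" using e by (auto simp: q_def)
  obtain C where C: "0 \<le> C" "\<And>x z. (\<And>z. 0 < Im z \<Longrightarrow> norm z \<le> 1 \<Longrightarrow> norm (qs.fs 0 (of_real x + z) + A0) \<le> B * norm z powr 0 * Im z powr (- q)) \<Longrightarrow>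
     0 < Im z \<Longrightarrow> norm z \<le> 1/4 \<Longrightarrow> norm (qs.fs (\<alpha> - real 1) (of_real x + z)) \<le> C * norm z powr 0 * Im z powr (\<alpha> - q - real 1)"
    using qs.two_microlocal_bound[OF al0 order_refl q(1,2) B(1) aj(2,1), of A0] by blast
  define C1 where "C1 = fr * C"
  have C1: "0 \<le> C1" using C fr_pos by (simp add: C1_def)
  have db: "norm (\<i> * of_real fr * qs.fs (\<alpha> - 1) (Complex t v)) \<le> C1 * v powr (e - 1)" if v: "0 < v" "v \<le> 1/4" for t v
  proof -
    have "Complex t v = of_real t + \<i> * of_real v" by (simp add: complex_eq_iff)
    then have "norm (qs.fs (\<alpha> - 1) (Complex t v)) \<le> C * v powr (e - 1)"
      using C(2)[OF B', of "\<i> * of_real v" t] v by (simp add: norm_mult q_def)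
    then show ?thesis using fr_pos by (simp add: norm_mult C1_def mult.assoc)
  qed
  have dd: "(qs.fs \<alpha> has_field_derivative \<i> * of_real fr * qs.fs (\<alpha> - 1) z) (at z)" if "0 < Im z" for z
    by (rule qs.fs_deriv[OF that])
  have e0: "0 < e" using e s by linarith
  have vert: "norm (qs.fs \<alpha> (Complex t d) - F t) \<le> C1 / e * d powr e" if d: "0 < d" "d \<le> 1/4" for t d
  proof (rule tendsto_upperbound)
    have cont: "continuous_on {0..} (\<lambda>v. norm (qs.fs \<alpha> (Complex t d) - qs.fs \<alpha> (of_real t + \<i> * of_real v)))"
      by (intro continuous_intros continuous_on_compose2[OF qs.fs_continuous[OF al]]) auto
    then have "((\<lambda>v. norm (qs.fs \<alpha> (Complex t d) - qs.fs \<alpha> (of_real t + \<i> * of_real v))) \<longlongrightarrow> norm (qs.fs \<alpha> (Complex t d) - qs.fs \<alpha> (of_real t + \<i> * of_real 0))) (at 0 within {0..})"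
      unfolding continuous_on_def by (rule bspec) simp
    then have "((\<lambda>v. norm (qs.fs \<alpha> (Complex t d) - qs.fs \<alpha> (of_real t + \<i> * of_real v))) \<longlongrightarrow> norm (qs.fs \<alpha> (Complex t d) - qs.fs \<alpha> (of_real t + \<i> * of_real 0))) (at_right 0)"
      by (rule tendsto_within_subset) auto
    then show "((\<lambda>v. norm (qs.fs \<alpha> (Complex t d) - qs.fs \<alpha> (of_real t + \<i> * of_real v))) \<longlongrightarrow> norm (qs.fs \<alpha> (Complex t d) - F t)) (at_right 0)"
      by (simp add: F_def)
    have ev: "eventually (\<lambda>v. v \<in> {0<..<d}) (at_right (0::real))" by (rule eventually_at_right_real[OF d(1)])
    show "eventually (\<lambda>v. norm (qs.fs \<alpha> (Complex t d) - qs.fs \<alpha> (of_real t + \<i> * of_real v)) \<le> C1 / e * d powr e) (at_right 0)"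
      using ev
    proof eventually_elim
      case (elim v)
      have "norm (qs.fs \<alpha> (Complex t d) - qs.fs \<alpha> (Complex t v)) \<le> C1 * d powr e / e - C1 * v powr e / e"
        by (rule vertical_bound[OF dd]) (use elim d e0 db in auto)
      also have "\<dots> \<le> C1 / e * d powr e" using C1 e0 by simp
      also have "Complex t v = of_real t + \<i> * of_real v" by (simp add: complex_eq_iff)
      finally show ?case .
    qed
  qed simp
  have horiz: "norm (qs.fs \<alpha> (Complex t d) - qs.fs \<alpha> (Complex t' d)) \<le> C1 * d powr (e - 1) * \<bar>t - t'\<bar>" if d: "0 < d" "d \<le> 1/4" for t t' d
  proof -
    have im: "Im v = d" if "v \<in> closed_segment (Complex t' d) (Complex t d)" for v
      using that unfolding closed_segment_def by (auto simp: left_diff_distrib)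
    have "norm (qs.fs \<alpha> (Complex t d) - qs.fs \<alpha> (Complex t' d)) \<le> C1 * d powr (e - 1) * norm (Complex t d - Complex t' d)"
    proof (rule field_differentiable_bound[of "closed_segment (Complex t' d) (Complex t d)"])
      fix v assume v: "v \<in> closed_segment (Complex t' d) (Complex t d)"
      have vv: "Complex (Re v) d = v" using im[OF v] by (simp add: complex_eq_iff)
      show "(qs.fs \<alpha> has_field_derivative \<i> * of_real fr * qs.fs (\<alpha> - 1) v) (at v within closed_segment (Complex t' d) (Complex t d))"
        by (rule has_field_derivative_at_within[OF dd]) (simp add: im[OF v] d)
      show "norm (\<i> * of_real fr * qs.fs (\<alpha> - 1) v) \<le> C1 * d powr (e - 1)"
        using db[OF d, of "Re v"] unfolding vv .
    qed auto
    also have "norm (Complex t d - Complex t' d) = \<bar>t - t'\<bar>" by (simp add: cmod_def)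
    finally show ?thesis .
  qed
  have small: "norm (F t - F t') \<le> (2 * C1 / e + C1) * \<bar>t - t'\<bar> powr s" if tt: "\<bar>t - t'\<bar> \<le> 1/4" "t \<noteq> t'" for t t'
  proof -
    \<comment> \<open>The path from \<open>t\<close> to \<open>t'\<close> goes up to a height equal
      to the distance of the two points, across, and down again; each piece contributes a multiple
      of \<open>d powr e\<close>.\<close>
    define d where "d = \<bar>t - t'\<bar>"
    have d: "0 < d" "d \<le> 1/4" using tt by (auto simp: d_def)
    have "norm (F t - F t') \<le> norm (qs.fs \<alpha> (Complex t d) - F t) + norm (qs.fs \<alpha> (Complex t d) - qs.fs \<alpha> (Complex t' d)) + norm (qs.fs \<alpha> (Complex t' d) - F t')"
    proof -
      have "F t - F t' = ((qs.fs \<alpha> (Complex t d) - qs.fs \<alpha> (Complex t' d)) - (qs.fs \<alpha> (Complex t d) - F t)) + (qs.fs \<alpha> (Complex t' d) - F t')" by simp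
      then have "norm (F t - F t') \<le> norm ((qs.fs \<alpha> (Complex t d) - qs.fs \<alpha> (Complex t' d)) - (qs.fs \<alpha> (Complex t d) - F t)) + norm (qs.fs \<alpha> (Complex t' d) - F t')"
        by (simp only: norm_triangle_ineq)
      moreover have "norm ((qs.fs \<alpha> (Complex t d) - qs.fs \<alpha> (Complex t' d)) - (qs.fs \<alpha> (Complex t d) - F t)) \<le> norm (qs.fs \<alpha> (Complex t d) - qs.fs \<alpha> (Complex t' d)) + norm (qs.fs \<alpha> (Complex t d) - F t)"
        by (rule norm_triangle_ineq4)
      ultimately show ?thesis by linarith
    qed
    also have "\<dots> \<le> C1 / e * d powr e + C1 * d powr (e - 1) * d + C1 / e * d powr e"
      using vert[OF d, of t] vert[OF d, of t'] horiz[OF d, of t t'] by (simp add: d_def[symmetric])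
    also have "\<dots> = (2 * C1 / e + C1) * d powr e" using d(1) by (simp add: powr_diff distrib_right)
    also have "\<dots> \<le> (2 * C1 / e + C1) * d powr s" using d e C1 e0 by (intro mult_left_mono powr_mono') auto
    finally show ?thesis by (simp add: d_def)
  qed
  have "bounded (F ` K)" by (intro compact_imp_bounded compact_continuous_image continuous_on_subset[OF contF] K) auto
  then obtain S where S: "0 < S" "\<And>t. t \<in> K \<Longrightarrow> norm (F t) \<le> S" by (auto simp: bounded_pos)
  have "norm (F t - F t') \<le> (2 * C1 / e + C1 + 2 * S * 4 powr s) * \<bar>t - t'\<bar> powr s" if t: "t \<in> K" "t' \<in> K" for t t'
  proof (cases "t = t'")
    case True
    then show ?thesis by simp
  next
    case False
    show ?thesis
    proof (cases "\<bar>t - t'\<bar> \<le> 1/4")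
      case True
      have "(2 * C1 / e + C1) * \<bar>t - t'\<bar> powr s \<le> (2 * C1 / e + C1 + 2 * S * 4 powr s) * \<bar>t - t'\<bar> powr s"
        using S(1) by (intro mult_right_mono) auto
      then show ?thesis using small[OF True False] by linarith
    next
      case big: False
      have "norm (F t - F t') \<le> 2 * S" using norm_triangle_ineq4[of "F t" "F t'"] S(2)[OF t(1)] S(2)[OF t(2)] by linarith
      also have "2 * S * 1 \<le> 2 * S * (4 * \<bar>t - t'\<bar>) powr s"
        using big s S(1) by (intro mult_left_mono ge_one_powr_ge_zero) auto
      then have "2 * S \<le> (2 * S * 4 powr s) * \<bar>t - t'\<bar> powr s" by (simp add: powr_mult mult.assoc)
      also have "\<dots> \<le> (2 * C1 / e + C1 + 2 * S * 4 powr s) * \<bar>t - t'\<bar> powr s"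
        using C1 e0 by (intro mult_right_mono) auto
      finally show ?thesis .
    qed
  qed
  then show ?thesis unfolding Lambda_on_def F_def[symmetric]
    using continuous_on_subset[OF contF] by blast
qed

text \<open>The order up to which the fractional integral has derivatives on the real line.\<close>

definition Kord :: "real \<Rightarrow> nat" where "Kord \<alpha> = nat (\<lceil>\<alpha> - \<alpha>0\<rceil> - 1)"

lemma Kord_bounds:
  assumes "\<alpha>0 < \<alpha>"
  shows "real (Kord \<alpha>) < \<alpha> - \<alpha>0" "\<alpha> - \<alpha>0 \<le> real (Kord \<alpha>) + 1"
proof -
  have "0 \<le> \<lceil>\<alpha> - \<alpha>0\<rceil> - 1" using assms by (simp add: le_ceiling_iff) 
  then have "real (Kord \<alpha>) = of_int (\<lceil>\<alpha> - \<alpha>0\<rceil> - 1)" unfolding Kord_def by simp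
  then show "real (Kord \<alpha>) < \<alpha> - \<alpha>0" "\<alpha> - \<alpha>0 \<le> real (Kord \<alpha>) + 1" by linarith+
qed

text \<open>At most \<open>K\<close> derivatives exist near the point. Fewer than \<open>K\<close>
  give at most \<open>K\<close>, since \<open>s \<le> 1\<close>. With exactly \<open>K\<close> the
  last derivative is again an admissible map of a fractional integral, now of order
  \<open>\<alpha> - real K\<close>, whose pointwise exponent is already known.\<close>

lemma holder_beta_star_eq:
  assumes al: "\<alpha>0 < \<alpha>" and L: "admissible L"
  shows "holder_beta_star (\<lambda>t. L (qs.fs \<alpha> (of_real t))) (of_rat x) = ereal (real (Kord \<alpha>) + min 1 (beta0 x (\<alpha> - real (Kord \<alpha>))))"
proof -
  define K where "K = Kord \<alpha>"
  define g where "g t = L (qs.fs \<alpha> (of_real t))" for t :: real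
  have K: "real K < \<alpha> - \<alpha>0" "\<alpha> - \<alpha>0 \<le> real K + 1" unfolding K_def by (rule Kord_bounds[OF al])+
  have bL: "bounded_linear L" using L by (simp add: admissible_def)
  have al': "\<alpha>0 < \<alpha> - real K" using K by simp
  define b' where "b' = beta0 x (\<alpha> - real K)"
  have b': "0 < b'" unfolding b'_def by (rule beta0_pos[OF al'])
  define LK where "LK z = L ((\<i> * of_real fr) ^ K * z)" for z
  have LK: "admissible LK" unfolding LK_def by (rule Dseq_admissible[OF L])
  have DK: "Dseq L \<alpha> K t = LK (qs.fs (\<alpha> - real K) (of_real t))" for t by (simp add: Dseq_def LK_def)
  have "Sup (ereal ` {real k + s | k s. Ck_at k s g (of_rat x)}) = ereal (real K + min 1 b')"
  proof (rule Sup_ereal_eqI)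
    fix v assume "v \<in> {real k + s | k s. Ck_at k s g (of_rat x)}"
    then obtain k s where v: "v = real k + s" and ck: "Ck_at k s g (of_rat x)" by blast
    obtain l u D where s: "0 \<le> s" "s \<le> 1" and lu: "l < of_rat x" "of_rat x < u" and D: "derivs_on k g D {l<..<u}" and h: "holder_C s (D k) (of_rat x)"
      using ck unfolding Ck_at_def by blast
    have "l < u" using lu by linarith
    then have "real k < \<alpha> - \<alpha>0" using derivs_order_less[OF al L D[unfolded g_def]] by blast
    then have "real k < real (Suc K)" using K by simp
    then have kK: "k \<le> K" by simp
    show "v \<le> real K + min 1 b'"
    proof (cases "k = K")
      case True
      have E: "derivs_on K g (Dseq L \<alpha>) {l<..<u}"
        unfolding g_def by (rule derivs_on_Dseq[OF bL al'])
      have "holder_C s (\<lambda>t. LK (qs.fs (\<alpha> - real K) (of_real t))) (of_rat x)"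
      proof (rule holder_C_cong[OF h])
        show "0 < min (of_rat x - l) (u - of_rat x)" using lu by simp
        fix t :: real assume "\<bar>t - of_rat x\<bar> < min (of_rat x - l) (u - of_rat x)"
        then have "t \<in> {l<..<u}" by auto
        then show "D k t = LK (qs.fs (\<alpha> - real K) (of_real t))"
          using derivs_on_unique[OF D[unfolded True] E order_refl] by (simp add: True DK)
      qed
      from holder_C_le_beta0[OF al' LK this] have "s \<le> b'" by (simp add: b'_def)
      then show ?thesis using s by (simp add: v True)
    next
      case False
      then have "Suc k \<le> K" using kK by simp
      then have "real k + 1 \<le> real K" by linarith
      then show ?thesis using s b' by (simp add: v)
    qed
  next
    fix y assume y: "y < real K + min 1 b'"
    have "max 0 (y - real K) < min 1 b'" using y b' by auto
    then obtain s where s: "max 0 (y - real K) < s" "s < min 1 b'" using dense by blast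
    have "Ck_at K s g (of_rat x)"
      unfolding Ck_at_def
    proof (intro conjI exI)
      show "derivs_on K g (Dseq L \<alpha>) {of_rat x - 1<..<of_rat x + 1}"
        unfolding g_def by (rule derivs_on_Dseq[OF bL al'])
      show "holder_C s (Dseq L \<alpha> K) (of_rat x)"
        unfolding DK[abs_def] using LK s by (intro holder_C_below_beta0[OF al']) (auto simp: admissible_def b'_def)
    qed (use s in auto)
    then show "\<exists>v\<in>{real k + s | k s. Ck_at k s g (of_rat x)}. y \<le> v"
      using s by (intro bexI[of _ "real K + s"]) auto
  qed
  moreover have "{ereal (real k + s) | k s. Ck_at k s g (of_rat x)} = ereal ` {real k + s | k s. Ck_at k s g (of_rat x)}" by auto
  ultimately show ?thesis unfolding holder_beta_star_def g_def[symmetric] K_def b'_def by (simp only:)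
qed

text \<open>Above this value a local Hoelder condition on the last derivative would produce an
  expansion of order \<open>\<alpha> - \<alpha>0\<close> at a point of \<open>vertical_lower\<close>
  in the interval; below it \<open>fs_Lambda_on\<close> applies to the derivative of order
  \<open>K\<close>. The value is the same for every interval, so the limit over shrinking intervals
  is that of a constant sequence.\<close>

lemma holder_reg_on_eq:
  assumes al: "\<alpha>0 < \<alpha>" and L: "admissible L" and lu: "l < u"
  shows "holder_reg_on (\<lambda>t. L (qs.fs \<alpha> (of_real t))) {l<..<u} = ereal (\<alpha> - \<alpha>0)"
proof -
  define K where "K = Kord \<alpha>"
  define g where "g t = L (qs.fs \<alpha> (of_real t))" for t :: real
  have K: "real K < \<alpha> - \<alpha>0" "\<alpha> - \<alpha>0 \<le> real K + 1" unfolding K_def by (rule Kord_bounds[OF al])+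
  have bL: "bounded_linear L" using L by (simp add: admissible_def)
  have al': "\<alpha>0 < \<alpha> - real K" using K by simp
  have "Sup (ereal ` {real k + s | k s. Ck_on k s g {l<..<u}}) = ereal (\<alpha> - \<alpha>0)"
  proof (rule Sup_ereal_eqI)
    fix v assume "v \<in> {real k + s | k s. Ck_on k s g {l<..<u}}"
    then obtain k s where v: "v = real k + s" and ck: "Ck_on k s g {l<..<u}" by blast
    obtain D where s: "0 \<le> s" "s \<le> 1" and D: "derivs_on k g D {l<..<u}" and h: "\<And>K. compact K \<Longrightarrow> K \<subseteq> {l<..<u} \<Longrightarrow> Lambda_on s (D k) K"
      using ck unfolding Ck_on_def by blast
    have k: "real k < \<alpha> - \<alpha>0" using derivs_order_less[OF al L D[unfolded g_def] lu] .
    show "v \<le> \<alpha> - \<alpha>0"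
    proof (rule ccontr)
      assume "\<not> v \<le> \<alpha> - \<alpha>0"
      then have gt: "\<alpha> - \<alpha>0 - real k < s" "0 < s" using v k by auto
      obtain z where z: "l < z" "z < u" "vertical_lower z" using vertical_lower_dense[OF lu] by blast
      define l' u' where "l' = (l + z) / 2" and "u' = (z + u) / 2"
      have lu': "l < l'" "l' < z" "z < u'" "u' < u" using z by (auto simp: l'_def u'_def)
      have "Lambda_on s (D k) {l'..u'}" using lu' by (intro h) auto
      then have "holder_C s (D k) z" using lu' gt(2) by (intro Lambda_on_imp_holder_C) auto
      then have "peano (\<alpha> - \<alpha>0 - real k) (D k) z" using gt(1) by (rule holder_C_imp_peano)
      then have "peano (real k + (\<alpha> - \<alpha>0 - real k)) g z"
        using k by (intro derivs_on_peano[OF D z(1,2)]) auto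
      then show False using not_peano_vertical[OF z(3) al L] by (simp add: g_def[abs_def])
    qed
  next
    fix y assume y: "y < \<alpha> - \<alpha>0"
    have "max 0 (y - real K) < \<alpha> - \<alpha>0 - real K" using y K by auto
    then obtain s where s: "max 0 (y - real K) < s" "s < \<alpha> - \<alpha>0 - real K" using dense by blast
    have "Ck_on K s g {l<..<u}"
      unfolding Ck_on_def
    proof (intro conjI exI allI impI)
      show "derivs_on K g (Dseq L \<alpha>) {l<..<u}"
        unfolding g_def by (rule derivs_on_Dseq[OF bL al'])
      fix C assume C: "compact C \<and> C \<subseteq> {l<..<u}"
      have La: "Lambda_on s (\<lambda>t. qs.fs (\<alpha> - real K) (of_real t)) C"
        using s K C by (intro fs_Lambda_on[OF al']) auto
      have blK: "bounded_linear (\<lambda>z. L ((\<i> * of_real fr) ^ K * z))"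
        using bounded_linear_compose[OF bL bounded_linear_mult_right] .
      obtain N where N: "0 < N" "\<And>z. norm (L ((\<i> * of_real fr) ^ K * z)) \<le> norm z * N"
        using bounded_linear.pos_bounded[OF blK] by blast
      obtain B where B: "\<And>t t'. t \<in> C \<Longrightarrow> t' \<in> C \<Longrightarrow> norm (qs.fs (\<alpha> - real K) (of_real t) - qs.fs (\<alpha> - real K) (of_real t')) \<le> B * \<bar>t - t'\<bar> powr s"
        and cont: "continuous_on C (\<lambda>t. qs.fs (\<alpha> - real K) (of_real t))"
        using La unfolding Lambda_on_def by blast
      show "Lambda_on s (Dseq L \<alpha> K) C"
        unfolding Lambda_on_def
      proof (intro conjI exI ballI)
        show "continuous_on C (Dseq L \<alpha> K)" unfolding Dseq_def
          by (rule bounded_linear.continuous_on[OF blK cont])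
        fix t t' assume t: "t \<in> C" "t' \<in> C"
        have "norm (Dseq L \<alpha> K t - Dseq L \<alpha> K t') = norm (L ((\<i> * of_real fr) ^ K * (qs.fs (\<alpha> - real K) (of_real t) - qs.fs (\<alpha> - real K) (of_real t'))))"
          unfolding Dseq_def linear_diff[OF bounded_linear.linear[OF blK]] ..
        also have "\<dots> \<le> B * \<bar>t - t'\<bar> powr s * N"
          by (rule order_trans[OF N(2) mult_right_mono[OF B[OF t]]]) (use N in simp)
        finally show "norm (Dseq L \<alpha> K t - Dseq L \<alpha> K t') \<le> (B * N) * \<bar>t - t'\<bar> powr s" by (simp add: mult_ac)
      qed
    qed (use s K in auto)
    then show "\<exists>v\<in>{real k + s | k s. Ck_on k s g {l<..<u}}. y \<le> v"
      using s by (intro bexI[of _ "real K + s"]) auto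
  qed
  moreover have "{ereal (real k + s) | k s. Ck_on k s g {l<..<u}} = ereal ` {real k + s | k s. Ck_on k s g {l<..<u}}" by auto
  ultimately show ?thesis by (simp only: holder_reg_on_def g_def[abs_def])
qed

lemma has_holder_beta_2star_eq:
  assumes al: "\<alpha>0 < \<alpha>" and L: "admissible L"
  shows "has_holder_beta_2star (\<lambda>t. L (qs.fs \<alpha> (of_real t))) x (ereal (\<alpha> - \<alpha>0))"
  unfolding has_holder_beta_2star_def
proof (intro allI impI)
  fix l u :: "nat \<Rightarrow> real"
  assume a: "(\<forall>n. {l (Suc n)<..<u (Suc n)} \<subseteq> {l n<..<u n}) \<and> (\<Inter>n. {l n<..<u n}) = {x}"
  have "l n < u n" for n
  proof -
    have "x \<in> {l n<..<u n}" using a by blast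
    then show ?thesis by simp
  qed
  then have "holder_reg_on (\<lambda>t. L (qs.fs \<alpha> (of_real t))) {l n<..<u n} = ereal (\<alpha> - \<alpha>0)" for n
    by (rule holder_reg_on_eq[OF al L])
  then show "(\<lambda>n. holder_reg_on (\<lambda>t. L (qs.fs \<alpha> (of_real t))) {l n<..<u n}) \<longlonglongrightarrow> ereal (\<alpha> - \<alpha>0)" by simp
qed

text \<open>The statement uses the floor of \<open>\<alpha> - \<alpha>0\<close>, whereas
  \<open>Kord\<close> is the ceiling minus 1. They differ exactly for integral
  \<open>\<alpha> - \<alpha>0\<close>: then the floor is \<open>Kord \<alpha> + 1\<close> with
  fractional part 0, and on the right the minimum equals 1.\<close>

lemma beta_star_formula:
  assumes al: "\<alpha>0 < \<alpha>"
  shows "(if cusp_form G r f then of_int \<lfloor>\<alpha> - r / 2\<rfloor> + min 1 (2 * frac (\<alpha> - r / 2))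
      else if cuspidal_at G r f (Some x) \<and> \<alpha> - r \<notin> \<int> then of_int \<lfloor>\<alpha> - r\<rfloor> + min 1 (2 * frac (\<alpha> - r) + r)
      else \<alpha> - r) = real (Kord \<alpha>) + min 1 (beta0 x (\<alpha> - real (Kord \<alpha>)))"
proof -
  define E where "E = \<alpha> - \<alpha>0"
  define K where "K = Kord \<alpha>"
  have K: "real K < E" "E \<le> real K + 1" unfolding K_def E_def by (rule Kord_bounds[OF al])+
  have fl: "\<lfloor>E\<rfloor> = (if E \<in> \<int> then int K + 1 else int K)" 
  proof (cases "E \<in> \<int>")
    case True
    then obtain n where n: "E = of_int n" by (auto elim: Ints_cases)
    have "n = int K + 1" using K unfolding n by linarith
    then show ?thesis using True n by simp
  next
    case False
    then have "E \<noteq> real K + 1" by auto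
    then show ?thesis using K False by (auto simp: floor_eq_iff)
  qed
  have EK: "E = real K + 1" if "E \<in> \<int>" using that fl by (metis Ints_cases floor_of_int of_int_add of_int_of_nat_eq of_int_1)
  have fr: "frac E = (if E \<in> \<int> then 0 else E - real K)" using fl by (auto simp: frac_def elim!: Ints_cases)
  have al0: "\<alpha> = E + \<alpha>0" by (simp add: E_def)
  show ?thesis
  proof (cases "cusp_form G r f")
    case True
    then have c: "cuspidal_at G r f (Some x)" "\<alpha>0 = r / 2" by (auto simp: cusp_form_def alpha0_def)
    have e: "\<alpha> - r / 2 = E" using c by (simp add: E_def)
    have b: "beta0 x (\<alpha> - real K) = 2 * (E - real K)" using c by (simp add: beta0_def E_def)
    show ?thesis unfolding e K_def[symmetric] b fl fr using True EK by auto
  next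
    case False
    then have c: "\<alpha>0 = r" by (simp add: alpha0_def)
    have e: "\<alpha> - r = E" using c by (simp add: E_def)
    have b: "beta0 x (\<alpha> - real K) = (if cuspidal_at G r f (Some x) then 2 * (E - real K) + r else E - real K)" using c by (simp add: beta0_def E_def)
    show ?thesis unfolding e K_def[symmetric] b fl fr using False EK K r by (auto simp: min_def)
  qed
qed

lemma holder_exponents_are_fs:
  assumes al: "\<alpha>0 < \<alpha>" and L: "admissible L"
  shows "holder_exponents_are (\<lambda>t. L (qs.fs \<alpha> (of_real t))) (of_rat x) (beta0 x \<alpha>)
     (real (Kord \<alpha>) + min 1 (beta0 x (\<alpha> - real (Kord \<alpha>)))) (\<alpha> - \<alpha>0)"
  unfolding holder_exponents_are_def
  using holder_beta_eq[OF al L] holder_beta_star_eq[OF al L] has_holder_beta_2star_eq[OF al L] by blast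

text \<open>A derivative is an expansion of order 1 with little-o remainder, so the borderline
  \<open>beta0 x \<alpha> = 1\<close> is excluded as well; the value of the Hoelder exponent alone
  would not decide it.\<close>

lemma not_differentiable_fs:
  assumes al: "\<alpha>0 < \<alpha>" and L: "admissible L" and b: "beta0 x \<alpha> \<le> 1"
  shows "\<not> (\<lambda>t. L (qs.fs \<alpha> (of_real t))) differentiable (at (of_rat x))"
proof
  assume "(\<lambda>t. L (qs.fs \<alpha> (of_real t))) differentiable (at (of_rat x))"
  then have "peano 1 (\<lambda>t. L (qs.fs \<alpha> (of_real t))) (of_rat x)"
    by (auto simp: vector_derivative_works intro: peano_of_derivative)
  then show False using peano_mono[OF _ b] not_peano_beta0[OF al L] by blast
qed

text \<open>Here the expansion has order \<open>s' > 1\<close>, so the derivative is the linear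
  coefficient of the polynomial. The same polynomial, differentiated, approximates the series of
  order \<open>\<alpha> - 1\<close> on the vertical ray, which identifies that coefficient as a
  limit even if this series does not extend continuously to the axis.\<close>

lemma fs_derivative_cuspidal:
  assumes cu: "cuspidal_at G r f (Some x)" and al: "\<alpha>0 < \<alpha>" and a: "(r + 1) / 2 < \<alpha>"
  obtains v where "((\<lambda>t. qs.fs \<alpha> (of_real t)) has_vector_derivative v) (at (of_rat x))"
    "((\<lambda>y. \<i> * of_real fr * qs.fs (\<alpha> - 1) (of_real (of_rat x) + \<i> * of_real y)) \<longlongrightarrow> v) (at_right 0)"
proof -
  have a1: "1 < 2 * \<alpha> - r" using a by (simp add: field_simps)
  obtain P C s' where s': "1 < s'" and
    P: "\<And>t. \<bar>t\<bar> \<le> 1/8 \<Longrightarrow> norm (qs.fs \<alpha> (of_real (of_rat x + t)) - poly P (of_real t)) \<le> C * \<bar>t\<bar> powr s'" and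
    P1: "\<And>y. 0 < y \<Longrightarrow> y \<le> 1/8 \<Longrightarrow> norm (\<i> * of_real fr * qs.fs (\<alpha> - 1) (of_real (of_rat x) + \<i> * of_real y) - poly (pderiv P) (\<i> * of_real y)) \<le> C * y powr (s' - 1)"
    by (rule Taylor_cuspidal[OF cu al a1], rule that, assumption+)
  define v where "v = poly (pderiv P) 0"
  define R where "R t = qs.fs \<alpha> (of_real (of_rat x + t)) - poly P (of_real t)" for t :: real
  have R0: "R 0 = 0" using P[of 0] s' by (simp add: R_def)
  have "(R has_vector_derivative 0) (at 0)"
    unfolding has_vector_derivative_def has_derivative_at_alt
  proof (intro conjI allI impI)
    show "bounded_linear (\<lambda>h::real. h *\<^sub>R (0::complex))" by simp
    fix e :: real assume e: "0 < e"
    obtain d where d: "0 < d" "\<And>u. 0 < u \<Longrightarrow> u < d \<Longrightarrow> u powr (s' - 1) \<le> e / (\<bar>C\<bar> + 1)"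
      using powr_less_eps[of "s' - 1" "e / (\<bar>C\<bar> + 1)"] s' e by auto
    have "norm (R y - R 0 - (y - 0) *\<^sub>R 0) \<le> e * norm (y - 0)" if y: "norm (y - 0) < min d (1/8)" for y
    proof (cases "y = 0")
      case False
      have "norm (R y) \<le> C * \<bar>y\<bar> powr s'" unfolding R_def using y by (intro P) auto
      also have "\<dots> \<le> (\<bar>C\<bar> + 1) * \<bar>y\<bar> powr s'" by (intro mult_right_mono) auto
      also have "\<dots> = ((\<bar>C\<bar> + 1) * \<bar>y\<bar> powr (s' - 1)) * \<bar>y\<bar>" using False by (simp add: powr_diff)
      also have "\<dots> \<le> e * \<bar>y\<bar>" using d(2)[of "\<bar>y\<bar>"] y False by (intro mult_right_mono) (auto simp: field_simps)
      finally show ?thesis by (simp add: R0)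
    qed (simp add: R0)
    then show "\<exists>d>0. \<forall>y. norm (y - 0) < d \<longrightarrow> norm (R y - R 0 - (y - 0) *\<^sub>R 0) \<le> e * norm (y - 0)"
      using d(1) by (intro exI[of _ "min d (1/8)"]) auto
  qed
  moreover have "((\<lambda>t. poly P (of_real t)) has_vector_derivative v) (at 0)"
    using has_vector_derivative_real_field[of "poly P" v "0::real"] poly_DERIV[of P 0] by (simp add: v_def)
  ultimately have "((\<lambda>t. R t + poly P (of_real t)) has_vector_derivative (0 + v)) (at 0)"
    by (rule has_vector_derivative_add)
  then have d0: "((\<lambda>t. qs.fs \<alpha> (of_real (of_rat x + t))) has_vector_derivative v) (at 0)"
    by (simp add: R_def)
  have "((\<lambda>t. t - of_rat x) has_real_derivative 1) (at (of_rat x))" by (auto intro!: derivative_eq_intros)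
  then have "((\<lambda>t. t - of_rat x) has_vector_derivative 1) (at (of_rat x :: real))" by (simp add: has_real_derivative_iff_has_vector_derivative)
  from vector_diff_chain_at[OF this, of "\<lambda>t. qs.fs \<alpha> (of_real (of_rat x + t))" v] d0
  have "((\<lambda>t. qs.fs \<alpha> (of_real t)) has_vector_derivative v) (at (of_rat x))" by (simp add: o_def)
  moreover have "((\<lambda>y. \<i> * of_real fr * qs.fs (\<alpha> - 1) (of_real (of_rat x) + \<i> * of_real y)) \<longlongrightarrow> v) (at_right 0)"
  proof -
    have "((\<lambda>y. C * y powr (s' - 1)) \<longlongrightarrow> C * 0) (at_right 0)"
    proof (intro tendsto_mult tendsto_const)
      have "((\<lambda>y::real. y powr (s' - 1)) \<longlongrightarrow> 0 powr (s' - 1)) (at_right 0)"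
        using s' by (intro tendsto_powr' tendsto_ident_at tendsto_const) (auto simp: eventually_at intro!: exI[of _ 1])
      then show "((\<lambda>y::real. y powr (s' - 1)) \<longlongrightarrow> 0) (at_right 0)" by simp
    qed
    moreover have "eventually (\<lambda>y. norm (\<i> * of_real fr * qs.fs (\<alpha> - 1) (of_real (of_rat x) + \<i> * of_real y) - poly (pderiv P) (\<i> * of_real y)) \<le> C * y powr (s' - 1)) (at_right 0)"
      using eventually_at_right_real[of 0 "1/8"] by (auto elim!: eventually_mono intro!: P1)
    ultimately have "((\<lambda>y. \<i> * of_real fr * qs.fs (\<alpha> - 1) (of_real (of_rat x) + \<i> * of_real y) - poly (pderiv P) (\<i> * of_real y)) \<longlongrightarrow> 0) (at_right 0)"
      using Lim_null_comparison by (simp add: Lim_null_comparison)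
    moreover have "((\<lambda>y. poly (pderiv P) (\<i> * of_real y)) \<longlongrightarrow> poly (pderiv P) (\<i> * of_real 0)) (at_right 0)"
      by (intro tendsto_poly tendsto_intros)
    ultimately have "((\<lambda>y. (\<i> * of_real fr * qs.fs (\<alpha> - 1) (of_real (of_rat x) + \<i> * of_real y) - poly (pderiv P) (\<i> * of_real y)) + poly (pderiv P) (\<i> * of_real y)) \<longlongrightarrow> 0 + poly (pderiv P) (\<i> * of_real 0)) (at_right 0)"
      by (rule tendsto_add)
    then show ?thesis by (simp add: v_def)
  qed
  ultimately show ?thesis by (rule that)
qed

end

subsection \<open>The derivative at a cuspidal point\<close>

lemma complex_of_rat: "(of_rat x :: complex) = of_real (of_rat x)"
  by (cases x) (simp add: of_rat_rat)

lemma imag_powr_of_real: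
  assumes "0 < t"
  shows "(\<i> * of_real t) powr (of_real a) = \<i> powr (of_real a) * of_real (t powr a)"
  using powr_times_real_left[of "of_real t" \<i> "of_real a"] powr_of_real[of t a] assms by (simp add: mult.commute)

context modform
begin

lemma deriv_f:
  assumes z: "0 < Im z"
  shows "deriv f z = \<i> * of_real fr * qs.fs (- 1) z"
proof (rule DERIV_imp_deriv)
  have "((\<lambda>z. qs.fs 0 z + A0) has_field_derivative \<i> * of_real fr * qs.fs (0 - 1) z + 0) (at z)"
    by (intro DERIV_add qs.fs_deriv[OF z] DERIV_const)
  then have "((\<lambda>z. qs.fs 0 z + A0) has_field_derivative \<i> * of_real fr * qs.fs (- 1) z) (at z)" by simp
  then show "(f has_field_derivative \<i> * of_real fr * qs.fs (- 1) z) (at z)"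
    by (rule DERIV_cong_ev[THEN iffD1, OF refl _ refl, rotated])
       (rule eventually_mono[OF eventually_nhds_in_open[OF open_halfspace_Im_gt[of 0]]], use z f_eq_fs in auto)
qed

text \<open>Provides the integrable majorant for the integral along the whole ray: at a cuspidal
  point the derivative of \<open>f\<close> stays bounded on the ray near the axis, and high up the
  Fourier series decays exponentially.\<close>

lemma fs_minus_one_decay:
  assumes cu: "cuspidal_at G r f (Some x)"
  obtains M where "\<And>v. 0 < v \<Longrightarrow> norm (qs.fs (- 1) (of_real (of_rat x) + \<i> * of_real v)) \<le> M * exp (- (fr * qs.low * v))"
proof -
  \<comment> \<open>Chosen so that the powers of \<open>v\<close> in the derivative bound,
    \<open>2 * q - r\<close> and \<open>- q - 1\<close>, cancel.\<close>
  define q where "q = r + 1"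
  have q: "\<alpha>0 \<le> q" "0 \<le> q" "0 \<le> 2 * q - r" using r by (auto simp: q_def alpha0_def)
  obtain B where B: "0 \<le> B" "\<And>z. 0 < Im z \<Longrightarrow> norm (f (of_real (of_rat x) + z)) \<le> B * norm z powr (2 * q - r) * Im z powr (- q)"
    using f_bound_cuspidal[OF cu q(1)] by blast
  have B': "norm (qs.fs 0 (of_real (of_rat x) + z) + A0) \<le> B * norm z powr (2 * q - r) * Im z powr (- q)" if "0 < Im z" "norm z \<le> 1" for z
    using B(2)[of z] f_eq_fs[of "of_real (of_rat x) + z"] that by simp
  define D where "D = fact 1 * 2 ^ 1 * B * 2 powr (2 * q - r) * 2 powr q / fr ^ 1"
  define e where "e = fr * qs.low"
  have e: "0 < e" using fr_pos qs.low_pos by (simp add: e_def)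
  have D0: "0 \<le> D" using B fr_pos by (simp add: D_def)
  have near: "norm (qs.fs (- 1) (of_real (of_rat x) + \<i> * of_real v)) \<le> D" if v: "0 < v" "v \<le> 1/2" for v
  proof -
    have "norm (qs.fs (- real 1) (of_real (of_rat x) + \<i> * of_real v)) \<le> D * norm (\<i> * of_real v :: complex) powr (2 * q - r) * Im (\<i> * of_real v) powr (- q - real 1)"
      unfolding D_def by (rule qs.fs_derivative_bound[OF q(3,2) B(1) zero_less_one B']) (use v in \<open>auto simp: norm_mult\<close>)
    also have "\<dots> = D * (v powr (2 * q - r) * v powr (- q - 1))" using v by (simp add: norm_mult)
    also have "v powr (2 * q - r) * v powr (- q - 1) = 1" using v by (simp add: powr_add[symmetric] q_def)
    finally show ?thesis by simp
  qed
  obtain C where C: "0 \<le> C" "\<And>z. 1/2 \<le> Im z \<Longrightarrow> norm (qs.fs (- 1) z) \<le> C * exp (- (fr * qs.low * Im z))"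
    using qs.fs_decay[of "1/2" "- 1"] by auto
  have "norm (qs.fs (- 1) (of_real (of_rat x) + \<i> * of_real v)) \<le> (C + D * exp e) * exp (- (e * v))" if v: "0 < v" for v
  proof (cases "v \<le> 1/2")
    case True
    have "D * 1 \<le> D * (exp e * exp (- (e * v)))"
      using e D0 True by (intro mult_left_mono) (auto simp: exp_add[symmetric])
    also have "\<dots> \<le> (C + D * exp e) * exp (- (e * v))" using C by (simp add: algebra_simps)
    finally show ?thesis using near[OF v True] by simp
  next
    case False
    have "norm (qs.fs (- 1) (of_real (of_rat x) + \<i> * of_real v)) \<le> C * exp (- (e * v))"
      using C(2)[of "of_real (of_rat x) + \<i> * of_real v"] False by (simp add: e_def)
    also have "\<dots> \<le> (C + D * exp e) * exp (- (e * v))" using D0 by (intro mult_right_mono) auto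
    finally show ?thesis .
  qed
  then show ?thesis unfolding e_def by (rule that)
qed

text \<open>The Cauchy-Gamma integral is available from a base point above the axis. The base points
  \<open>y k\<close> descend to the axis: the values converge to \<open>v\<close> by assumption, the
  integrals by dominated convergence.\<close>

lemma fs_vertical_integral:
  assumes cu: "cuspidal_at G r f (Some x)" and al: "0 < \<alpha>"
    and lim: "((\<lambda>y. \<i> * of_real fr * qs.fs (\<alpha> - 1) (of_real (of_rat x) + \<i> * of_real y)) \<longlongrightarrow> v) (at_right 0)"
  shows "((\<lambda>u. of_real (u powr (\<alpha> - 1)) * (\<i> * of_real fr * qs.fs (- 1) (of_real (of_rat x) + \<i> * of_real u))) has_integral
      of_real (Gamma \<alpha> * fr powr (- \<alpha>)) * v) {0<..}"
proof -
  define X :: complex where "X = of_real (of_rat x)"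
  define y where "y k = inverse (real (Suc k))" for k
  define k0 where "k0 = Gamma \<alpha> * fr powr (- \<alpha>)"
  define g where "g u = of_real (u powr (\<alpha> - 1)) * (\<i> * of_real fr * qs.fs (- 1) (X + \<i> * of_real u))" for u :: real
  define gk where "gk k u = of_real (u powr (\<alpha> - 1)) * (\<i> * of_real fr * qs.fs (- 1) (X + \<i> * of_real (y k) + \<i> * of_real u))" for k and u :: real
  define e where "e = fr * qs.low"
  have e: "0 < e" using fr_pos qs.low_pos by (simp add: e_def)
  have y: "0 < y k" for k by (simp add: y_def)
  have y0: "y \<longlonglongrightarrow> 0" unfolding y_def[abs_def] by (rule LIMSEQ_inverse_real_of_nat)
  obtain M where M: "\<And>v. 0 < v \<Longrightarrow> norm (qs.fs (- 1) (X + \<i> * of_real v)) \<le> M * exp (- (e * v))"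
    using fs_minus_one_decay[OF cu] unfolding X_def e_def by blast
  have M0: "0 \<le> M"
  proof -
    have "0 \<le> M * exp (- (e * 1))" using order_trans[OF norm_ge_zero M[of 1]] by simp
    then show ?thesis by (simp add: zero_le_mult_iff)
  qed
  have gki: "(gk k has_integral of_real k0 * (\<i> * of_real fr * qs.fs (\<alpha> - 1) (X + \<i> * of_real (y k)))) {0<..}" for k
  proof -
    have "((\<lambda>u. of_real (u powr (\<alpha> - 1)) * qs.fs (- 1) (X + \<i> * of_real (y k) + \<i> * of_real u)) has_integral
           of_real (Gamma \<alpha> * fr powr (- \<alpha>)) * qs.fs (- 1 + \<alpha>) (X + \<i> * of_real (y k))) {0<..}"
      by (rule qs.fs_Gamma_integral(2)[OF al]) (simp add: X_def y)
    from has_integral_mult_right[OF this, of "\<i> * of_real fr"]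
    show ?thesis unfolding gk_def[abs_def] k0_def by (simp add: mult_ac add.commute)
  qed
  have hi: "(\<lambda>u. fr * M * (u powr (\<alpha> - 1) * exp (- (e * u)))) integrable_on {0<..}"
    using Gamma_integral_scaled[OF al e] by (intro integrable_on_mult_right) blast
  have le: "norm (gk k u) \<le> fr * M * (u powr (\<alpha> - 1) * exp (- (e * u)))" if u: "u \<in> {0<..}" for k u
  proof -
    have "norm (qs.fs (- 1) (X + \<i> * of_real (y k + u))) \<le> M * exp (- (e * (y k + u)))"
      using y[of k] u by (intro M) (auto intro: add_pos_pos)
    also have "\<dots> \<le> M * exp (- (e * u))" using M0 e y[of k] by (intro mult_left_mono) (auto simp: distrib_left)
    finally have b: "norm (qs.fs (- 1) (X + \<i> * of_real (y k) + \<i> * of_real u)) \<le> M * exp (- (e * u))"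
      by (simp add: distrib_left add.assoc)
    have "norm (gk k u) = (u powr (\<alpha> - 1) * fr) * norm (qs.fs (- 1) (X + \<i> * of_real (y k) + \<i> * of_real u))"
      using fr_pos by (simp add: gk_def norm_mult)
    also have "\<dots> \<le> (u powr (\<alpha> - 1) * fr) * (M * exp (- (e * u)))"
      using fr_pos by (intro mult_left_mono[OF b]) auto
    finally show ?thesis by (simp add: mult_ac)
  qed
  have conv: "(\<lambda>k. gk k u) \<longlonglongrightarrow> g u" if u: "u \<in> {0<..}" for u
  proof -
    have "isCont (qs.fs (- 1)) (X + \<i> * of_real u)"
      using qs.fs_deriv[of "X + \<i> * of_real u" "- 1"] u by (intro DERIV_isCont) (auto simp: X_def)
    moreover have "(\<lambda>k. X + \<i> * of_real (y k) + \<i> * of_real u) \<longlonglongrightarrow> X + \<i> * of_real u"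
      using tendsto_add[OF tendsto_add[OF tendsto_const[of X] tendsto_mult[OF tendsto_const[of \<i>] tendsto_of_real[OF y0]]] tendsto_const[of "\<i> * of_real u"]] by simp
    ultimately have "(\<lambda>k. qs.fs (- 1) (X + \<i> * of_real (y k) + \<i> * of_real u)) \<longlonglongrightarrow> qs.fs (- 1) (X + \<i> * of_real u)"
      by (rule isCont_tendsto_compose[of "X + \<i> * of_real u" "qs.fs (- 1)"])
    then show ?thesis unfolding gk_def g_def by (intro tendsto_mult tendsto_const)
  qed
  have dc: "g integrable_on {0<..}" "(\<lambda>k. integral {0<..} (gk k)) \<longlonglongrightarrow> integral {0<..} g"
    using dominated_convergence[of gk "{0<..}" "\<lambda>u. fr * M * (u powr (\<alpha> - 1) * exp (- (e * u)))" g] gki hi le conv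
    by (auto intro: has_integral_integrable)
  have yr: "filterlim y (at_right 0) sequentially"
    using y0 y by (auto simp: filterlim_at less_imp_neq[OF y, symmetric] intro!: always_eventually)
  have "(\<lambda>k. of_real k0 * (\<i> * of_real fr * qs.fs (\<alpha> - 1) (X + \<i> * of_real (y k)))) \<longlonglongrightarrow> of_real k0 * v"
    using filterlim_compose[OF lim yr] by (intro tendsto_mult tendsto_const) (simp add: X_def)
  then have "(\<lambda>k. integral {0<..} (gk k)) \<longlonglongrightarrow> of_real k0 * v"
    using integral_unique[OF gki] by simp
  then have "integral {0<..} g = of_real k0 * v" using dc(2) LIMSEQ_unique by blast
  then show ?thesis using integrable_integral[OF dc(1)] unfolding g_def k0_def X_def by simp
qed

text \<open>The ray is parametrized by \<open>z = of_rat x + \<i> * of_real t\<close>, so the power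
  contributes \<open>\<i> powr (\<alpha> - 1)\<close> and \<open>dz\<close> contributes
  \<open>\<i>\<close>. Together they cancel the power of \<open>\<i>\<close> in the prefactor, while
  \<open>(2 * pi) powr \<alpha>\<close> and the power of the width cancel
  \<open>fr powr (- \<alpha>)\<close> from the Gamma integral.\<close>

lemma fs_derivative_formula:
  assumes cu: "cuspidal_at G r f (Some x)" and al: "\<alpha>0 < \<alpha>" and a: "(r + 1) / 2 < \<alpha>"
  shows "\<exists>J. ((\<lambda>t::real. ((of_rat x + \<i> * of_real t) - of_rat x) powr (of_real (\<alpha> - 1)) *
                deriv f (of_rat x + \<i> * of_real t) * \<i>) has_integral J) {0<..} \<and>
     ((\<lambda>t. qs.fs \<alpha> (of_real t)) has_vector_derivative
        (of_real ((2 * pi) powr \<alpha>) / ((\<i> * of_nat (cusp_width G (1,0,0,1))) powr (of_real \<alpha>) * of_real (Gamma \<alpha>)) * J)) (at (of_rat x))"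
proof -
  obtain v where v: "((\<lambda>t. qs.fs \<alpha> (of_real t)) has_vector_derivative v) (at (of_rat x))"
    "((\<lambda>y. \<i> * of_real fr * qs.fs (\<alpha> - 1) (of_real (of_rat x) + \<i> * of_real y)) \<longlongrightarrow> v) (at_right 0)"
    using fs_derivative_cuspidal[OF cu al a] by blast
  have al0: "0 < \<alpha>" using alpha0_pos al by linarith
  define ia where "ia = \<i> powr (of_real (\<alpha> - 1)) * \<i>"
  define J where "J = ia * (of_real (Gamma \<alpha> * fr powr (- \<alpha>)) * v)"
  have "((\<lambda>t. ia * (of_real (t powr (\<alpha> - 1)) * (\<i> * of_real fr * qs.fs (- 1) (of_real (of_rat x) + \<i> * of_real t)))) has_integral J) {0<..}"
    unfolding J_def by (rule has_integral_mult_right[OF fs_vertical_integral[OF cu al0 v(2)]])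
  then have 1: "((\<lambda>t::real. ((of_rat x + \<i> * of_real t) - of_rat x) powr (of_real (\<alpha> - 1)) *
                deriv f (of_rat x + \<i> * of_real t) * \<i>) has_integral J) {0<..}"
  proof (rule has_integral_eq[rotated])
    fix t :: real assume "t \<in> {0<..}"
    then have t: "0 < t" by simp
    have "(\<i> * of_real t) powr (of_real (\<alpha> - 1)) = \<i> powr (of_real (\<alpha> - 1)) * of_real (t powr (\<alpha> - 1))"
      by (rule imag_powr_of_real[OF t])
    moreover have "deriv f (of_rat x + \<i> * of_real t) = \<i> * of_real fr * qs.fs (- 1) (of_real (of_rat x) + \<i> * of_real t)"
      using t by (subst deriv_f) (simp_all add: complex_of_rat)
    ultimately show "ia * (of_real (t powr (\<alpha> - 1)) * (\<i> * of_real fr * qs.fs (- 1) (of_real (of_rat x) + \<i> * of_real t))) =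
        ((of_rat x + \<i> * of_real t) - of_rat x) powr (of_real (\<alpha> - 1)) * deriv f (of_rat x + \<i> * of_real t) * \<i>"
      by (simp add: ia_def mult_ac)
  qed
  have ia: "\<i> powr of_real \<alpha> = ia"
    using powr_add[of \<i> "of_real (\<alpha> - 1)" 1] by (simp add: ia_def)
  have ia0: "ia \<noteq> 0" by (simp add: ia_def)
  have m: "(\<i> * of_nat (cusp_width G (1,0,0,1))) powr (of_real \<alpha>) = ia * of_real (wid powr \<alpha>)"
    using imag_powr_of_real[OF wid_pos, of \<alpha>] by (simp add: ia wid_def)
  have frp: "fr powr (- \<alpha>) * (2 * pi) powr \<alpha> = wid powr \<alpha>"
    using wid_pos by (simp add: fr_def powr_divide powr_minus field_simps)
  have "Gamma \<alpha> \<noteq> 0" using Gamma_real_pos[OF al0] by simp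
  then have "of_real ((2 * pi) powr \<alpha>) / ((ia * of_real (wid powr \<alpha>)) * of_real (Gamma \<alpha>)) * J =
      of_real ((fr powr (- \<alpha>) * (2 * pi) powr \<alpha>) / wid powr \<alpha>) * v"
    using ia0 wid_pos by (simp add: J_def)
  also have "\<dots> = v" using wid_pos unfolding frp by simp
  finally show ?thesis using 1 v(1) unfolding m by (intro exI[of _ J]) simp
qed

end

theorem theorem2:
  fixes G :: "imat set" and \<mu> :: "imat \<Rightarrow> complex" and r :: real
    and f :: "complex \<Rightarrow> complex" and \<alpha> :: real and x :: rat
    and m :: nat and \<kappa> :: real and a :: "nat \<Rightarrow> complex" and F :: "real \<Rightarrow> complex"
  assumes G: "finite_index_subgroup G"
    and mu: "multiplier_system G \<mu>"
    and r: "0 < r"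
    and mf: "modular_form G \<mu> r f"
    and nonzero: "\<exists>z. 0 < Im z \<and> f z \<noteq> 0"
    and rat: "rational_kappas G r f"
    and m_def: "m = cusp_width G (1,0,0,1)"
    and expansion: "fourier_exp (\<lambda>z. f (of_nat m * z)) \<kappa> a"
    and F_def: "F = frac_integral a \<kappa> m \<alpha>"
    and alpha: "alpha0 G r f < \<alpha>"
  shows
    "(\<forall>b b1 b2.
        b = (if cuspidal_at G r f (Some x) then 2 * \<alpha> - r else \<alpha> - r) \<and>
        b1 = (if cusp_form G r f
              then of_int \<lfloor>\<alpha> - r / 2\<rfloor> + min 1 (2 * frac (\<alpha> - r / 2))
              else if cuspidal_at G r f (Some x) \<and> \<alpha> - r \<notin> \<int>
              then of_int \<lfloor>\<alpha> - r\<rfloor> + min 1 (2 * frac (\<alpha> - r) + r)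
              else \<alpha> - r) \<and>
        b2 = \<alpha> - alpha0 G r f \<longrightarrow>
        holder_exponents_are F (of_rat x) b b1 b2 \<and>
        holder_exponents_are (\<lambda>t. Re (F t)) (of_rat x) b b1 b2 \<and>
        holder_exponents_are (\<lambda>t. Im (F t)) (of_rat x) b b1 b2)
     \<and>
     (0 < \<alpha> - alpha0 G r f \<and> \<alpha> - alpha0 G r f \<le> 1 \<longrightarrow>
        (\<not> cuspidal_at G r f (Some x) \<longrightarrow>
           \<not> F differentiable (at (of_rat x)) \<and>
           \<not> (\<lambda>t. Re (F t)) differentiable (at (of_rat x)) \<and>
           \<not> (\<lambda>t. Im (F t)) differentiable (at (of_rat x))) \<and>
        (cuspidal_at G r f (Some x) \<longrightarrow>
           (F differentiable (at (of_rat x)) \<longleftrightarrow> (r + 1) / 2 < \<alpha>) \<and>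
           ((\<lambda>t. Re (F t)) differentiable (at (of_rat x)) \<longleftrightarrow> (r + 1) / 2 < \<alpha>) \<and>
           ((\<lambda>t. Im (F t)) differentiable (at (of_rat x)) \<longleftrightarrow> (r + 1) / 2 < \<alpha>) \<and>
           ((r + 1) / 2 < \<alpha> \<longrightarrow>
              (\<exists>J. ((\<lambda>t::real. ((of_rat x + \<i> * of_real t) - of_rat x) powr (of_real (\<alpha> - 1)) *
                                deriv f (of_rat x + \<i> * of_real t) * \<i>) has_integral J) {0<..} \<and>
                   (F has_vector_derivative
                      (of_real ((2 * pi) powr \<alpha>) /
                        ((\<i> * of_nat m) powr (of_real \<alpha>) * of_real (Gamma \<alpha>)) * J))
                     (at (of_rat x))))))"
proof -
  interpret mfm: modform G \<mu> r f \<kappa> a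
    using G mu r mf nonzero rat expansion unfolding m_def by unfold_locales
  define g where "g t = mfm.qs.fs \<alpha> (of_real t)" for t :: real
  have Fg: "F = g" unfolding F_def m_def g_def by (intro ext mfm.frac_integral_eq)
  note adm = admissible_id admissible_Re admissible_Im
  have ex: "holder_exponents_are (\<lambda>t. L (g t)) (of_rat x)
      (if cuspidal_at G r f (Some x) then 2 * \<alpha> - r else \<alpha> - r)
      (if cusp_form G r f
              then of_int \<lfloor>\<alpha> - r / 2\<rfloor> + min 1 (2 * frac (\<alpha> - r / 2))
              else if cuspidal_at G r f (Some x) \<and> \<alpha> - r \<notin> \<int>
              then of_int \<lfloor>\<alpha> - r\<rfloor> + min 1 (2 * frac (\<alpha> - r) + r)
              else \<alpha> - r) (\<alpha> - alpha0 G r f)" if "admissible L" for L :: "complex \<Rightarrow> 'b::real_normed_vector"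
    unfolding mfm.beta_star_formula[OF alpha, of x] mfm.beta0_def[symmetric] g_def
    by (rule mfm.holder_exponents_are_fs[OF alpha that])
  have nd: "\<not> (\<lambda>t. L (g t)) differentiable (at (of_rat x))"
    if "admissible L" "mfm.beta0 x \<alpha> \<le> 1" for L :: "complex \<Rightarrow> 'b::real_normed_vector"
    unfolding g_def by (rule mfm.not_differentiable_fs[OF alpha that])
  have dg: "(\<lambda>t. L (g t)) differentiable (at (of_rat x))"
    if L: "admissible L" and cu: "cuspidal_at G r f (Some x)" and a: "(r + 1) / 2 < \<alpha>"
    for L :: "complex \<Rightarrow> 'b::real_normed_vector"
  proof -
    obtain v where "(g has_vector_derivative v) (at (of_rat x))"
      using mfm.fs_derivative_cuspidal[OF cu alpha a] unfolding g_def by blast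
    then have "((\<lambda>t. L (g t)) has_vector_derivative L v) (at (of_rat x))"
      using bounded_linear.has_vector_derivative[of L] L unfolding admissible_def by blast
    then show ?thesis by (rule differentiableI_vector)
  qed
  have iff: "(\<lambda>t. L (g t)) differentiable (at (of_rat x)) \<longleftrightarrow> (r + 1) / 2 < \<alpha>"
    if L: "admissible L" and cu: "cuspidal_at G r f (Some x)" for L :: "complex \<Rightarrow> 'b::real_normed_vector"
  proof (cases "(r + 1) / 2 < \<alpha>")
    case False
    then have "mfm.beta0 x \<alpha> \<le> 1" using cu by (simp add: mfm.beta0_def field_simps)
    then show ?thesis using nd[OF L] False by blast
  qed (use dg[OF that] in blast)
  have nc: "mfm.beta0 x \<alpha> \<le> 1" if "\<not> cuspidal_at G r f (Some x)" "\<alpha> - alpha0 G r f \<le> 1"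
    using that mfm.beta0_not_cuspidal by simp
  show ?thesis
  proof (rule conjI)
    show "\<forall>b b1 b2. b = (if cuspidal_at G r f (Some x) then 2 * \<alpha> - r else \<alpha> - r) \<and>
        b1 = (if cusp_form G r f
              then of_int \<lfloor>\<alpha> - r / 2\<rfloor> + min 1 (2 * frac (\<alpha> - r / 2))
              else if cuspidal_at G r f (Some x) \<and> \<alpha> - r \<notin> \<int>
              then of_int \<lfloor>\<alpha> - r\<rfloor> + min 1 (2 * frac (\<alpha> - r) + r)
              else \<alpha> - r) \<and>
        b2 = \<alpha> - alpha0 G r f \<longrightarrow>
        holder_exponents_are F (of_rat x) b b1 b2 \<and>
        holder_exponents_are (\<lambda>t. Re (F t)) (of_rat x) b b1 b2 \<and>
        holder_exponents_are (\<lambda>t. Im (F t)) (of_rat x) b b1 b2"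
      unfolding Fg using adm[THEN ex] by (intro allI impI) (elim conjE, hypsubst, intro conjI)
  next
    have "F differentiable (at (of_rat x)) \<longleftrightarrow> (r + 1) / 2 < \<alpha>"
      "(\<lambda>t. Re (F t)) differentiable (at (of_rat x)) \<longleftrightarrow> (r + 1) / 2 < \<alpha>"
      "(\<lambda>t. Im (F t)) differentiable (at (of_rat x)) \<longleftrightarrow> (r + 1) / 2 < \<alpha>"
      if "cuspidal_at G r f (Some x)"
      using adm[THEN iff, OF that] by (simp_all add: Fg)
    moreover have "\<not> F differentiable (at (of_rat x))"
      "\<not> (\<lambda>t. Re (F t)) differentiable (at (of_rat x))"
      "\<not> (\<lambda>t. Im (F t)) differentiable (at (of_rat x))"
      if "\<not> cuspidal_at G r f (Some x)" "\<alpha> - alpha0 G r f \<le> 1"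
      using adm[THEN nd, OF nc[OF that]] by (simp_all add: Fg)
    moreover note mfm.fs_derivative_formula[OF _ alpha, of x, folded g_def m_def Fg]
    ultimately show "0 < \<alpha> - alpha0 G r f \<and> \<alpha> - alpha0 G r f \<le> 1 \<longrightarrow>
        (\<not> cuspidal_at G r f (Some x) \<longrightarrow>
           \<not> F differentiable (at (of_rat x)) \<and>
           \<not> (\<lambda>t. Re (F t)) differentiable (at (of_rat x)) \<and>
           \<not> (\<lambda>t. Im (F t)) differentiable (at (of_rat x))) \<and>
        (cuspidal_at G r f (Some x) \<longrightarrow>
           (F differentiable (at (of_rat x)) \<longleftrightarrow> (r + 1) / 2 < \<alpha>) \<and>
           ((\<lambda>t. Re (F t)) differentiable (at (of_rat x)) \<longleftrightarrow> (r + 1) / 2 < \<alpha>) \<and>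
           ((\<lambda>t. Im (F t)) differentiable (at (of_rat x)) \<longleftrightarrow> (r + 1) / 2 < \<alpha>) \<and>
           ((r + 1) / 2 < \<alpha> \<longrightarrow>
              (\<exists>J. ((\<lambda>t::real. ((of_rat x + \<i> * of_real t) - of_rat x) powr (of_real (\<alpha> - 1)) *
                                deriv f (of_rat x + \<i> * of_real t) * \<i>) has_integral J) {0<..} \<and>
                   (F has_vector_derivative
                      (of_real ((2 * pi) powr \<alpha>) /
                        ((\<i> * of_nat m) powr (of_real \<alpha>) * of_real (Gamma \<alpha>)) * J))
                     (at (of_rat x)))))"
      by blast
  qed
qed

end
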